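(* Let $\Omega\subset\mathbb R^2$ be a bounded simply connected domain with $C^2$ boundary, $T>0$, $\varepsilon>0$, $\lambda>0$, $N\in\mathbb N$, let $h_1,\dots,h_N\in C^\infty(\overline\Omega)\cap H_0^1(\Omega)$ be linearly independent, and let $\gamma_0\in W^{2,\infty}([0,1];\overline\Omega)$. For $u\in L^2(0,T;\mathbb R^N)$ and $\psi=\sum_{k=1}^Nu_kh_k$, set $j_{\lambda,\varepsilon}(u):=\mathcal J_{\lambda,\varepsilon}(\psi)$. Then $j_{\lambda,\varepsilon}$ is Fréchet differentiable on $L^2(0,T;\mathbb R^N)$, and for every $\delta u\in L^2(0,T;\mathbb R^N)$, with $\eta:=\sum_{k=1}^N\delta u_kh_k$, $$Dj_{\lambda,\varepsilon}(u)[\delta u]=\lambda\int_0^T(Mu(t))\cdot\delta u(t)\,dt+\int_0^T\!\!\int_0^1\Bigl[p\cdot J\nabla_x\eta(t,X)+q\cdot J\nabla_x^2\eta(t,X)\,a\Bigr]ds\,dt,$$ or, componentwise (as the $L^2(0,T)$-gradient), for $k=1,\dots,N$, $$\frac{\partial j_{\lambda,\varepsilon}}{\partial u_k}(t)=\lambda(Mu(t))_k+\int_0^1\Bigl[p(t,s)\cdot J\nabla h_k(X(t,s))+q(t,s)\cdot J\nabla_x^2h_k(X(t,s))\,a(t,s)\Bigr]ds,$$ where $(X,a)$ is the state and $(p,q)$ the adjoint state associated with $u$.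
   Context: $J=\begin{pmatrix}0&-1\\1&0\end{pmatrix}$; $\nabla_x^2$ is the Hessian and $\nabla_x^3\psi$ the third derivative in $x$; $J\nabla_x^3\psi(t,X)[b,a]$ is $J$ applied to the vector obtained by contracting the symmetric 3-tensor $\nabla_x^3\psi(t,X)$ with $b$ and $a$, and $J\nabla_x^3\psi(t,X)[\,\cdot\,,a]$ is the matrix of the linear map $b\mapsto J\nabla_x^3\psi(t,X)[b,a]$. State: for $u\in L^2(0,T;\mathbb R^N)$, $(X,a)\in C([0,T]\times[0,1];\overline\Omega\times\mathbb R^2)$ is the unique (Carathéodory, for each $s$) solution of $\partial_tX=J\nabla_x\psi(t,X)$, $\partial_ta=J\nabla_x^2\psi(t,X)a$, $X(0,s)=\gamma_0(s)$, $a(0,s)=\gamma_0'(s)$. Cost: $\mathcal J_{\lambda,\varepsilon}(\psi)=-\int_0^1\ell_\varepsilon(a(T,s))\,ds+\frac\lambda2\int_0^T\|\psi(t,\cdot)\|_{L^2(\Omega)}^2dt$ with $\ell_\varepsilon(z)=\sqrt{|z|^2+\varepsilon^2}$. Gram matrix: $M\in\mathbb R^{N\times N}$, $M_{k\ell}=(h_k,h_\ell)_{L^2(\Omega)}$. Adjoint state: $(p,q)\in C([0,T]\times[0,1];\mathbb R^2\times\mathbb R^2)$ is the unique (Carathéodory, for each $s$) solution of the backward linear system $$-\partial_tp=\bigl(J\nabla_x^2\psi(t,X)\bigr)^\top p+\bigl(J\nabla_x^3\psi(t,X)[\,\cdot\,,a]\bigr)^\top q,\qquad -\partial_tq=\bigl(J\nabla_x^2\psi(t,X)\bigr)^\top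 q,$$ $$p(T,s)=0,\qquad q(T,s)=-\frac{a(T,s)}{\sqrt{|a(T,s)|^2+\varepsilon^2}}.$$ *)

theory Defs
  imports "HOL-Analysis.Analysis"
begin

section \<open>Lebesgue spaces and absolutely continuous functions\<close>

text \<open>Elements of $L^2(S)$ are represented by functions; all notions below depend only on
  the almost-everywhere class.\<close>

definition L2 :: "'a::euclidean_space set \<Rightarrow> ('a \<Rightarrow> 'b::euclidean_space) set" where
  "L2 S = {f. f \<in> borel_measurable (lebesgue_on S) \<and>
              integrable (lebesgue_on S) (\<lambda>x. (norm (f x))\<^sup>2)}"

definition L2_norm :: "'a::euclidean_space set \<Rightarrow> ('a \<Rightarrow> 'b::euclidean_space) \<Rightarrow> real" where
  "L2_norm S f = sqrt (\<integral>x. (norm (f x))\<^sup>2 \<partial>lebesgue_on S)"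

definition L2_inner :: "'a::euclidean_space set \<Rightarrow> ('a \<Rightarrow> 'b::euclidean_space) \<Rightarrow> ('a \<Rightarrow> 'b) \<Rightarrow> real" where
  "L2_inner S f g = (\<integral>x. f x \<bullet> g x \<partial>lebesgue_on S)"

text \<open>\<open>x\<close> is absolutely continuous on \<open>[a, b]\<close> and \<open>x' = g\<close> almost everywhere, written in
  integrated form. Applied to \<open>g t = f t (x t)\<close>, this is the notion of a Caratheodory solution
  of \<open>x' = f t x\<close>.\<close>

definition has_ac_derivative_on ::
  "(real \<Rightarrow> 'b::euclidean_space) \<Rightarrow> (real \<Rightarrow> 'b) \<Rightarrow> real \<Rightarrow> real \<Rightarrow> bool" where
  "has_ac_derivative_on x g a b \<longleftrightarrow>
     integrable (lebesgue_on {a..b}) g \<and>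
     (\<forall>t\<in>{a..b}. x t = x a + (\<integral>\<tau>. g \<tau> \<partial>lebesgue_on {a..t}))"

text \<open>Membership in $W^{2,\infty}([a,b])$ for the continuously differentiable representative.\<close>

definition W2_infty_on :: "(real \<Rightarrow> 'b::euclidean_space) \<Rightarrow> real \<Rightarrow> real \<Rightarrow> bool" where
  "W2_infty_on \<gamma> a b \<longleftrightarrow>
     (\<exists>\<gamma>1 \<gamma>2. has_ac_derivative_on \<gamma> \<gamma>1 a b \<and> has_ac_derivative_on \<gamma>1 \<gamma>2 a b \<and>
        (\<exists>C. AE s in lebesgue_on {a..b}. norm (\<gamma>2 s) \<le> C))"

text \<open>Frechet derivative at \<open>u\<close> of a functional on $L^2(S)$: a bounded linear functional
  with remainder $o(\|v\|)$. As \<open>L2_norm\<close> is only a seminorm on representatives, this entails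
  that \<open>D\<close> vanishes on null functions and \<open>j (u + v) = j u\<close> for every null function \<open>v\<close>.\<close>

definition has_L2_frechet_derivative ::
  "'a::euclidean_space set \<Rightarrow> (('a \<Rightarrow> 'b::euclidean_space) \<Rightarrow> real) \<Rightarrow> (('a \<Rightarrow> 'b) \<Rightarrow> real) \<Rightarrow>
   ('a \<Rightarrow> 'b) \<Rightarrow> bool" where
  "has_L2_frechet_derivative S j D u \<longleftrightarrow>
     (\<forall>v\<in>L2 S. \<forall>w\<in>L2 S. D (\<lambda>t. v t + w t) = D v + D w) \<and>
     (\<forall>c. \<forall>v\<in>L2 S. D (\<lambda>t. c *\<^sub>R v t) = c * D v) \<and>
     (\<exists>C. \<forall>v\<in>L2 S. \<bar>D v\<bar> \<le> C * L2_norm S v) \<and>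
     (\<forall>e>0. \<exists>d>0. \<forall>v\<in>L2 S. L2_norm S v < d \<longrightarrow>
        \<bar>j (\<lambda>t. u t + v t) - j u - D v\<bar> \<le> e * L2_norm S v)"

definition has_L2_gradient ::
  "'a::euclidean_space set \<Rightarrow> (('a \<Rightarrow> 'b::euclidean_space) \<Rightarrow> real) \<Rightarrow> ('a \<Rightarrow> 'b) \<Rightarrow>
   ('a \<Rightarrow> 'b) \<Rightarrow> bool" where
  "has_L2_gradient S j G u \<longleftrightarrow> G \<in> L2 S \<and> has_L2_frechet_derivative S j (L2_inner S G) u"

section \<open>Planar domains and smooth functions up to the boundary\<close>

text \<open>Locally, after an orthogonal change of coordinates, the set is the region strictly above
  the graph of a twice continuously differentiable function.\<close>

definition C2_boundary :: "(real^2) set \<Rightarrow> bool" where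
  "C2_boundary \<Omega> \<longleftrightarrow>
     (\<forall>x\<in>frontier \<Omega>. \<exists>r>0. \<exists>(R :: real^2 \<Rightarrow> real^2) \<phi> \<phi>1 \<phi>2.
        orthogonal_transformation R \<and>
        (\<forall>\<tau>::real. (\<phi> has_real_derivative \<phi>1 \<tau>) (at \<tau>)) \<and>
        (\<forall>\<tau>. (\<phi>1 has_real_derivative \<phi>2 \<tau>) (at \<tau>)) \<and>
        continuous_on UNIV \<phi>2 \<and>
        \<Omega> \<inter> ball x r = {y \<in> ball x r. \<phi> (R y $ 1) < R y $ 2})"

primrec iter_partial :: "2 list \<Rightarrow> (real^2 \<Rightarrow> real) \<Rightarrow> real^2 \<Rightarrow> real" where
  "iter_partial [] f = f"
| "iter_partial (i # is) f = (\<lambda>x. frechet_derivative (iter_partial is f) (at x) (axis i 1))"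

text \<open>For open \<open>S\<close>: if all iterated partial derivatives are differentiable, they are all
  continuous, so this is $C^\infty(S)$.\<close>

definition smooth_in :: "(real^2) set \<Rightarrow> (real^2 \<Rightarrow> real) \<Rightarrow> bool" where
  "smooth_in S f \<longleftrightarrow> (\<forall>is. iter_partial is f differentiable_on S)"

text \<open>$C^\infty(\overline\Omega)$: all derivatives in \<open>\<Omega>\<close> extend continuously to the closure.\<close>

definition smooth_upto_boundary :: "(real^2) set \<Rightarrow> (real^2 \<Rightarrow> real) \<Rightarrow> bool" where
  "smooth_upto_boundary \<Omega> f \<longleftrightarrow>
     smooth_in \<Omega> f \<and> continuous_on (closure \<Omega>) f \<and>
     (\<forall>is. \<exists>g. continuous_on (closure \<Omega>) g \<and> (\<forall>x\<in>\<Omega>. g x = iter_partial is f x))"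

text \<open>Derivatives at boundary points are the values of these continuous extensions.\<close>

definition partial_closure :: "(real^2) set \<Rightarrow> 2 list \<Rightarrow> (real^2 \<Rightarrow> real) \<Rightarrow> real^2 \<Rightarrow> real" where
  "partial_closure \<Omega> is f x =
     (if x \<in> \<Omega> then iter_partial is f x else Lim (at x within \<Omega>) (iter_partial is f))"

definition grad :: "(real^2) set \<Rightarrow> (real^2 \<Rightarrow> real) \<Rightarrow> real^2 \<Rightarrow> real^2" where
  "grad \<Omega> f x = (\<chi> i. partial_closure \<Omega> [i] f x)"

definition hessian :: "(real^2) set \<Rightarrow> (real^2 \<Rightarrow> real) \<Rightarrow> real^2 \<Rightarrow> real^2^2" where
  "hessian \<Omega> f x = (\<chi> i j. partial_closure \<Omega> [i, j] f x)"

definition third_deriv :: "(real^2) set \<Rightarrow> (real^2 \<Rightarrow> real) \<Rightarrow> real^2 \<Rightarrow> real^2 \<Rightarrow> real^2 \<Rightarrow> real^2" where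
  "third_deriv \<Omega> f x b a =
     (\<chi> i. \<Sum>j\<in>UNIV. \<Sum>k\<in>UNIV. partial_closure \<Omega> [i, j, k] f x * b $ j * a $ k)"

definition test_function :: "(real^2) set \<Rightarrow> (real^2 \<Rightarrow> real) \<Rightarrow> bool" where
  "test_function \<Omega> \<phi> \<longleftrightarrow> smooth_in UNIV \<phi> \<and> (\<exists>K. compact K \<and> K \<subseteq> \<Omega> \<and> (\<forall>x. x \<notin> K \<longrightarrow> \<phi> x = 0))"

text \<open>$H_0^1(\Omega)$ as the $H^1$-closure of the test functions; the $L^2$-limit \<open>g\<close> of the
  gradients is then the weak gradient of \<open>f\<close>.\<close>

definition H1_0 :: "(real^2) set \<Rightarrow> (real^2 \<Rightarrow> real) set" where
  "H1_0 \<Omega> = {f \<in> L2 \<Omega>. \<exists>g\<in>L2 \<Omega>. \<exists>\<phi>. (\<forall>n::nat. test_function \<Omega> (\<phi> n)) \<and>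
      (\<lambda>n. L2_norm \<Omega> (\<lambda>x. \<phi> n x - f x)) \<longlonglongrightarrow> 0 \<and>
      (\<lambda>n. L2_norm \<Omega> (\<lambda>x. grad \<Omega> (\<phi> n) x - g x)) \<longlonglongrightarrow> 0}"

section \<open>State, cost and adjoint state\<close>

definition J :: "real^2^2" where
  "J = vector [vector [0, -1], vector [1, 0]]"

text \<open>\<open>\<psi> t\<close> is the stream function at time \<open>t\<close>, and \<open>X t s\<close> and \<open>a t s\<close> stand for
  $X(t,s)$ and $a(t,s)$.\<close>

definition is_state ::
  "(real^2) set \<Rightarrow> real \<Rightarrow> (real \<Rightarrow> real^2) \<Rightarrow> (real \<Rightarrow> real^2 \<Rightarrow> real) \<Rightarrow>
   (real \<Rightarrow> real \<Rightarrow> real^2) \<Rightarrow> (real \<Rightarrow> real \<Rightarrow> real^2) \<Rightarrow> bool" where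
  "is_state \<Omega> T \<gamma>0 \<psi> X a \<longleftrightarrow>
     continuous_on ({0..T} \<times> {0..1}) (\<lambda>(t, s). X t s) \<and>
     continuous_on ({0..T} \<times> {0..1}) (\<lambda>(t, s). a t s) \<and>
     (\<forall>t\<in>{0..T}. \<forall>s\<in>{0..1}. X t s \<in> closure \<Omega>) \<and>
     (\<forall>s\<in>{0..1}.
        has_ac_derivative_on (\<lambda>t. X t s) (\<lambda>t. J *v grad \<Omega> (\<psi> t) (X t s)) 0 T \<and>
        has_ac_derivative_on (\<lambda>t. a t s) (\<lambda>t. (J ** hessian \<Omega> (\<psi> t) (X t s)) *v a t s) 0 T \<and>
        X 0 s = \<gamma>0 s \<and>
        a 0 s = vector_derivative \<gamma>0 (at s within {0..1}))"

text \<open>Solutions are unique on \<open>[0, T] \<times> [0, 1]\<close>; the choice operator only fixes the irrelevant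
  values elsewhere. The same applies to the adjoint state.\<close>

definition state ::
  "(real^2) set \<Rightarrow> real \<Rightarrow> (real \<Rightarrow> real^2) \<Rightarrow> (real \<Rightarrow> real^2 \<Rightarrow> real) \<Rightarrow>
   (real \<Rightarrow> real \<Rightarrow> real^2) \<times> (real \<Rightarrow> real \<Rightarrow> real^2)" where
  "state \<Omega> T \<gamma>0 \<psi> = (SOME (X, a). is_state \<Omega> T \<gamma>0 \<psi> X a)"

definition ell :: "real \<Rightarrow> real^2 \<Rightarrow> real" where
  "ell \<epsilon> z = sqrt ((norm z)\<^sup>2 + \<epsilon>\<^sup>2)"

definition cost ::
  "(real^2) set \<Rightarrow> real \<Rightarrow> (real \<Rightarrow> real^2) \<Rightarrow> real \<Rightarrow> real \<Rightarrow> (real \<Rightarrow> real^2 \<Rightarrow> real) \<Rightarrow> real" where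
  "cost \<Omega> T \<gamma>0 lam \<epsilon> \<psi> =
     (let (X, a) = state \<Omega> T \<gamma>0 \<psi> in
      - (\<integral>s. ell \<epsilon> (a T s) \<partial>lebesgue_on {0..1})
      + lam / 2 * (\<integral>t. (L2_norm \<Omega> (\<psi> t))\<^sup>2 \<partial>lebesgue_on {0..T}))"

definition is_adjoint ::
  "(real^2) set \<Rightarrow> real \<Rightarrow> real \<Rightarrow> (real \<Rightarrow> real^2 \<Rightarrow> real) \<Rightarrow>
   (real \<Rightarrow> real \<Rightarrow> real^2) \<Rightarrow> (real \<Rightarrow> real \<Rightarrow> real^2) \<Rightarrow>
   (real \<Rightarrow> real \<Rightarrow> real^2) \<Rightarrow> (real \<Rightarrow> real \<Rightarrow> real^2) \<Rightarrow> bool" where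
  "is_adjoint \<Omega> T \<epsilon> \<psi> X a p q \<longleftrightarrow>
     continuous_on ({0..T} \<times> {0..1}) (\<lambda>(t, s). p t s) \<and>
     continuous_on ({0..T} \<times> {0..1}) (\<lambda>(t, s). q t s) \<and>
     (\<forall>s\<in>{0..1}.
        has_ac_derivative_on (\<lambda>t. p t s)
          (\<lambda>t. - (transpose (J ** hessian \<Omega> (\<psi> t) (X t s)) *v p t s
                + transpose (matrix (\<lambda>b. J *v third_deriv \<Omega> (\<psi> t) (X t s) b (a t s))) *v q t s)) 0 T \<and>
        has_ac_derivative_on (\<lambda>t. q t s)
          (\<lambda>t. - (transpose (J ** hessian \<Omega> (\<psi> t) (X t s)) *v q t s)) 0 T \<and>
        p T s = 0 \<and>
        q T s = - (a T s /\<^sub>R sqrt ((norm (a T s))\<^sup>2 + \<epsilon>\<^sup>2)))"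

definition adjoint_state ::
  "(real^2) set \<Rightarrow> real \<Rightarrow> real \<Rightarrow> (real \<Rightarrow> real^2 \<Rightarrow> real) \<Rightarrow>
   (real \<Rightarrow> real \<Rightarrow> real^2) \<Rightarrow> (real \<Rightarrow> real \<Rightarrow> real^2) \<Rightarrow>
   (real \<Rightarrow> real \<Rightarrow> real^2) \<times> (real \<Rightarrow> real \<Rightarrow> real^2)" where
  "adjoint_state \<Omega> T \<epsilon> \<psi> X a = (SOME (p, q). is_adjoint \<Omega> T \<epsilon> \<psi> X a p q)"

definition stream :: "('n::finite \<Rightarrow> real^2 \<Rightarrow> real) \<Rightarrow> (real \<Rightarrow> real^'n) \<Rightarrow> real \<Rightarrow> real^2 \<Rightarrow> real" where
  "stream h u t x = (\<Sum>k\<in>UNIV. u t $ k * h k x)"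

definition gram :: "(real^2) set \<Rightarrow> ('n::finite \<Rightarrow> real^2 \<Rightarrow> real) \<Rightarrow> real^'n^'n" where
  "gram \<Omega> h = (\<chi> k l. L2_inner \<Omega> (h k) (h l))"

definition reduced_cost ::
  "(real^2) set \<Rightarrow> real \<Rightarrow> (real \<Rightarrow> real^2) \<Rightarrow> real \<Rightarrow> real \<Rightarrow> ('n::finite \<Rightarrow> real^2 \<Rightarrow> real) \<Rightarrow>
   (real \<Rightarrow> real^'n) \<Rightarrow> real" where
  "reduced_cost \<Omega> T \<gamma>0 lam \<epsilon> h u = cost \<Omega> T \<gamma>0 lam \<epsilon> (stream h u)"

end

theory Submission
  imports Defs
begin

text \<open>
  The state \<open>z = (X, a)\<close> solves \<open>z' = (\<Sum>k. u\<^sub>k F\<^sub>k(z))\<close> with the fields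
  \<open>F\<^sub>k(x, a) = (J \<nabla>h\<^sub>k(x), J \<nabla>\<^sup>2h\<^sub>k(x) a)\<close>, and the adjoint state \<open>r = (p, q)\<close> solves the equation
  that is dual to the linearization. If \<open>zv\<close> is the state for \<open>u + v\<close>, then a Gronwall estimate
  gives \<open>zv - z = O(\<parallel>v\<parallel>)\<close>, and integrating the derivative of \<open>r \<bullet> (zv - z)\<close> gives
  \<open>r(T) \<bullet> (zv - z)(T) = \<integral> (\<Sum>k. v\<^sub>k r \<bullet> F\<^sub>k(z)) dt + O(\<parallel>v\<parallel>\<^sup>2)\<close>, because the adjoint equation cancels
  the first-order terms in \<open>zv - z\<close> (\<open>adjoint_duality\<close>). By the terminal condition, the left-hand
  side is the first-order change of \<open>- ell \<epsilon>\<close> at the terminal tangent. Integration over the curve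
  parameter and Fubini's theorem give the derivative, and the quadratic cost is expanded directly.
  The linearized state equation is not needed, and the remainder is of second order. The estimates
  hold for any state of \<open>u\<close> and any state of \<open>u + v\<close>, so only existence of states and of adjoint
  states has to be proved, not uniqueness.

  The Taylor expansions must hold between any two points of the closed domain, which need not be
  convex. Near the boundary, two points are joined by three segments inside the domain whose
  lengths are at most a multiple of the distance. Together with the mean value theorem and
  compactness, this yields Lipschitz and second-order Taylor estimates for all continuous
  extensions of partial derivatives (\<open>lipschitz_on_closure\<close>, \<open>taylor_on_closure\<close>).

  For existence of the state, the fields \<open>J \<nabla>h\<^sub>k\<close> are extended to Lipschitz fields on the plane, the
  Caratheodory equation is solved by a contraction (\<open>caratheodory_existence\<close>), and the solution is
  shown to stay in the closed domain (\<open>invariant_set\<close>). The latter uses that \<open>J \<nabla>h\<^sub>k\<close> is tangent to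
  the boundary (\<open>rotated_gradient_tangent\<close>), which follows from \<open>h\<^sub>k = 0\<close> there. This boundary value
  is deduced from membership in \<open>H1_0 \<Omega>\<close> by comparing the extension of \<open>h\<^sub>k\<close> by zero with its
  translates (\<open>H1_0_zero_on_frontier\<close>). The tangents and the adjoint state then solve linear equations
  with continuous coefficients.

  The controls are merely square integrable, so solutions are only absolutely continuous in time.
  Gronwall's inequality, integration by parts and invariance are all proved by one device: a
  function that does not increase over short intervals does not increase at all
  (\<open>locally_nonincreasing_imp_le\<close>). Differentiation almost everywhere is never used.
\<close>

section \<open>Absolutely continuous functions of one variable\<close>

text \<open>The bound \<open>\<delta>\<close> on the length of the intervals is uniform, so finitely many steps reach \<open>t\<close>.\<close>

lemma locally_nonincreasing_imp_le:
  fixes f :: "real \<Rightarrow> real"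
  assumes "\<delta> > 0"
    and step: "\<And>s t. a \<le> s \<Longrightarrow> s \<le> t \<Longrightarrow> t \<le> b \<Longrightarrow> t - s \<le> \<delta> \<Longrightarrow> f t \<le> f s"
    and "a \<le> t" "t \<le> b"
  shows "f t \<le> f a"
proof -
  obtain n :: nat where n: "(t - a) / \<delta> < real n"
    using reals_Archimedean2 by blast
  have n0: "n > 0"
    using n \<open>\<delta> > 0\<close> \<open>a \<le> t\<close> by (metis diff_ge_0_iff_ge divide_nonneg_pos gr0I not_le of_nat_0)
  define \<sigma> where "\<sigma> i = a + real i * ((t - a) / real n)" for i
  have d0: "(t - a) / real n \<ge> 0"
    using \<open>a \<le> t\<close> by simp
  have d1: "(t - a) / real n \<le> \<delta>"
    using n n0 \<open>\<delta> > 0\<close> by (simp add: field_simps)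
  have "i \<le> n \<Longrightarrow> f (\<sigma> i) \<le> f a" for i
  proof (induction i)
    case 0
    then show ?case by (simp add: \<sigma>_def)
  next
    case (Suc i)
    have "\<sigma> (Suc i) = \<sigma> i + (t - a) / real n"
      unfolding \<sigma>_def of_nat_Suc by (simp only: distrib_right)
    moreover have "\<sigma> (Suc i) \<le> b"
    proof -
      have "real (Suc i) * ((t - a) / real n) \<le> real n * ((t - a) / real n)"
        using Suc.prems d0 by (intro mult_right_mono) auto
      then show ?thesis
        using n0 \<open>t \<le> b\<close> by (simp add: \<sigma>_def)
    qed
    moreover have "a \<le> \<sigma> i"
      using mult_nonneg_nonneg[OF of_nat_0_le_iff d0, of i] unfolding \<sigma>_def by linarith
    ultimately have "f (\<sigma> (Suc i)) \<le> f (\<sigma> i)"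
      using d0 d1 by (intro step) auto
    then show ?case
      using Suc by simp
  qed
  from this[of n] show ?thesis
    using n0 by (simp add: \<sigma>_def)
qed

lemma integral_lebesgue_on_Icc_diff:
  fixes g :: "real \<Rightarrow> 'b::euclidean_space"
  assumes g: "integrable (lebesgue_on {a..b}) g" and "a \<le> s" "s \<le> t" "t \<le> b"
  shows "(\<integral>\<tau>. g \<tau> \<partial>lebesgue_on {a..t}) - (\<integral>\<tau>. g \<tau> \<partial>lebesgue_on {a..s})
    = (\<integral>\<tau>. g \<tau> \<partial>lebesgue_on {s..t})"
proof -
  have "integrable (lebesgue_on {a..t}) g"
    using integrable_subinterval[OF g, of a t] assms by auto
  from integral_combine[OF this, of s] show ?thesis
    using assms by simp
qed

lemma integrable_lebesgue_on_Icc_subset: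
  fixes g :: "real \<Rightarrow> 'b::euclidean_space"
  assumes g: "integrable (lebesgue_on {a..b}) g" and "a \<le> s" "t \<le> b"
  shows "integrable (lebesgue_on {s..t}) g"
  using integrable_subinterval[OF g, of s t] assms by auto

lemma indefinite_lebesgue_integral_continuous:
  fixes g :: "real \<Rightarrow> 'b::euclidean_space"
  assumes g: "integrable (lebesgue_on {a..b}) g"
  shows "continuous_on {a..b} (\<lambda>t. \<integral>\<tau>. g \<tau> \<partial>lebesgue_on {a..t})"
proof -
  have "continuous_on {a..b} (\<lambda>t. integral {a..t} g)"
    using integrable_on_lebesgue_on[OF g] by (simp add: indefinite_integral_continuous_1)
  moreover have "(\<integral>\<tau>. g \<tau> \<partial>lebesgue_on {a..t}) = integral {a..t} g" if "t \<in> {a..b}" for t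
    using that by (intro lebesgue_integral_eq_integral integrable_lebesgue_on_Icc_subset[OF g]) auto
  ultimately show ?thesis
    by (metis (no_types, lifting) continuous_on_cong)
qed

lemma integral_short_interval_small:
  fixes w :: "real \<Rightarrow> real"
  assumes w: "integrable (lebesgue_on {a..b}) w" and "e > 0"
  obtains \<delta> where "\<delta> > 0"
    and "\<And>s t. a \<le> s \<Longrightarrow> s \<le> t \<Longrightarrow> t \<le> b \<Longrightarrow> t - s \<le> \<delta> \<Longrightarrow> (\<integral>\<tau>. w \<tau> \<partial>lebesgue_on {s..t}) \<le> e"
proof -
  let ?U = "\<lambda>t. \<integral>\<tau>. w \<tau> \<partial>lebesgue_on {a..t}"
  have "uniformly_continuous_on {a..b} ?U"
    by (intro compact_uniformly_continuous indefinite_lebesgue_integral_continuous w) auto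
  then obtain d where d: "d > 0" "\<And>x y. x \<in> {a..b} \<Longrightarrow> y \<in> {a..b} \<Longrightarrow> dist y x < d \<Longrightarrow> dist (?U y) (?U x) < e"
    using \<open>e > 0\<close> unfolding uniformly_continuous_on_def by meson
  show thesis
  proof
    show "d / 2 > 0" using d by simp
    fix s t assume st: "a \<le> s" "s \<le> t" "t \<le> b" "t - s \<le> d / 2"
    have "dist (?U t) (?U s) < e"
      using st d(1) by (intro d(2)) (auto simp: dist_real_def)
    then show "(\<integral>\<tau>. w \<tau> \<partial>lebesgue_on {s..t}) \<le> e"
      using integral_lebesgue_on_Icc_diff[OF w, of s t] st by (auto simp: dist_real_def)
  qed
qed

lemma ac_derivative_diff:
  assumes "has_ac_derivative_on x g a b" "a \<le> s" "s \<le> t" "t \<le> b"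
  shows "x t - x s = (\<integral>\<tau>. g \<tau> \<partial>lebesgue_on {s..t})"
proof -
  have "t \<in> {a..b}" "s \<in> {a..b}"
    using assms by auto
  then have "x t = x a + (\<integral>\<tau>. g \<tau> \<partial>lebesgue_on {a..t})" "x s = x a + (\<integral>\<tau>. g \<tau> \<partial>lebesgue_on {a..s})"
    using assms(1) unfolding has_ac_derivative_on_def by blast+
  moreover have "integrable (lebesgue_on {a..b}) g"
    using assms(1) unfolding has_ac_derivative_on_def by blast
  ultimately show ?thesis
    using integral_lebesgue_on_Icc_diff[of a b g s t] assms(2-) by simp
qed

lemma ac_derivative_continuous:
  assumes "has_ac_derivative_on x g a b"
  shows "continuous_on {a..b} x"
proof -
  have i: "integrable (lebesgue_on {a..b}) g"
    and eq: "\<And>t. t \<in> {a..b} \<Longrightarrow> x t = x a + (\<integral>\<tau>. g \<tau> \<partial>lebesgue_on {a..t})"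
    using assms unfolding has_ac_derivative_on_def by blast+
  have "continuous_on {a..b} (\<lambda>t. x a + (\<integral>\<tau>. g \<tau> \<partial>lebesgue_on {a..t}))"
    by (intro continuous_intros indefinite_lebesgue_integral_continuous i)
  then show ?thesis
    by (rule continuous_on_eq) (rule eq[symmetric])
qed

lemma ac_derivative_integrable:
  assumes "has_ac_derivative_on x g a b" "a \<le> s" "t \<le> b"
  shows "integrable (lebesgue_on {s..t}) g"
  using assms integrable_lebesgue_on_Icc_subset unfolding has_ac_derivative_on_def by blast

lemma ac_derivative_cong:
  assumes "has_ac_derivative_on x g a b"
    and "\<And>t. t \<in> {a..b} \<Longrightarrow> x t = y t" "\<And>t. t \<in> {a..b} \<Longrightarrow> g t = g' t"
  shows "has_ac_derivative_on y g' a b"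
proof -
  have int: "integrable (lebesgue_on {a..b}) g = integrable (lebesgue_on {a..b}) g'"
    by (rule Bochner_Integration.integrable_cong) (use assms in auto)
  have "(\<integral>\<tau>. g \<tau> \<partial>lebesgue_on {a..t}) = (\<integral>\<tau>. g' \<tau> \<partial>lebesgue_on {a..t})" if "t \<le> b" for t
    by (rule Bochner_Integration.integral_cong) (use assms that in auto)
  moreover have eq: "\<And>t. t \<in> {a..b} \<Longrightarrow> x t = x a + (\<integral>\<tau>. g \<tau> \<partial>lebesgue_on {a..t})"
    and i: "integrable (lebesgue_on {a..b}) g"
    using assms(1) unfolding has_ac_derivative_on_def by blast+
  ultimately have "y t = y a + (\<integral>\<tau>. g' \<tau> \<partial>lebesgue_on {a..t})" if "t \<in> {a..b}" for t
  proof -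
    have "a \<in> {a..b}" "t \<le> b" using that by auto
    then show ?thesis
      using \<open>\<And>t. t \<le> b \<Longrightarrow> (\<integral>\<tau>. g \<tau> \<partial>lebesgue_on {a..t}) = (\<integral>\<tau>. g' \<tau> \<partial>lebesgue_on {a..t})\<close>[of t]
        assms(2)[OF that] assms(2)[of a] eq[OF that] by metis
  qed
  then show ?thesis
    unfolding has_ac_derivative_on_def using int i by blast
qed

lemma ac_derivative_diff_fun:
  assumes "has_ac_derivative_on x g a b" "has_ac_derivative_on y h a b"
  shows "has_ac_derivative_on (\<lambda>t. x t - y t) (\<lambda>t. g t - h t) a b"
proof -
  have "(\<integral>\<tau>. g \<tau> - h \<tau> \<partial>lebesgue_on {a..t}) = (\<integral>\<tau>. g \<tau> \<partial>lebesgue_on {a..t}) - (\<integral>\<tau>. h \<tau> \<partial>lebesgue_on {a..t})"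
    if "t \<le> b" for t
    using that by (intro Bochner_Integration.integral_diff ac_derivative_integrable[OF assms(1)]
        ac_derivative_integrable[OF assms(2)]) auto
  note int = this
  show ?thesis
    unfolding has_ac_derivative_on_def
  proof (intro conjI ballI)
    show "integrable (lebesgue_on {a..b}) (\<lambda>t. g t - h t)"
      using assms unfolding has_ac_derivative_on_def by blast
    fix t assume t: "t \<in> {a..b}"
    have "x t - x a = (\<integral>\<tau>. g \<tau> \<partial>lebesgue_on {a..t})" "y t - y a = (\<integral>\<tau>. h \<tau> \<partial>lebesgue_on {a..t})"
      using t by (auto intro!: ac_derivative_diff assms)
    then show "x t - y t = x a - y a + (\<integral>\<tau>. g \<tau> - h \<tau> \<partial>lebesgue_on {a..t})"
      using int[of t] t by (simp add: algebra_simps)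
  qed
qed

lemma ac_derivative_Pair:
  fixes x g :: "real \<Rightarrow> 'b::euclidean_space" and y h :: "real \<Rightarrow> 'c::euclidean_space"
  assumes "has_ac_derivative_on x g a b" "has_ac_derivative_on y h a b"
  shows "has_ac_derivative_on (\<lambda>t. (x t, y t)) (\<lambda>t. (g t, h t)) a b"
proof -
  have l1: "bounded_linear (\<lambda>p::'b. (p, 0::'c))" and l2: "bounded_linear (\<lambda>q::'c. (0::'b, q))"
    by (auto intro!: bounded_linear_Pair bounded_linear_ident bounded_linear_zero)
  have hb: "has_bochner_integral (lebesgue_on {a..t}) (\<lambda>\<tau>. (g \<tau>, h \<tau>))
      ((\<integral>\<tau>. g \<tau> \<partial>lebesgue_on {a..t}), (\<integral>\<tau>. h \<tau> \<partial>lebesgue_on {a..t}))" if "t \<le> b" for t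
  proof -
    have 1: "has_bochner_integral (lebesgue_on {a..t}) g (\<integral>\<tau>. g \<tau> \<partial>lebesgue_on {a..t})"
      "has_bochner_integral (lebesgue_on {a..t}) h (\<integral>\<tau>. h \<tau> \<partial>lebesgue_on {a..t})"
      using assms that by (auto simp: has_bochner_integral_iff intro: ac_derivative_integrable)
    have 2: "has_bochner_integral (lebesgue_on {a..t}) (\<lambda>\<tau>. (g \<tau>, 0) + (0, h \<tau>))
      ((\<integral>\<tau>. g \<tau> \<partial>lebesgue_on {a..t}, 0) + (0, \<integral>\<tau>. h \<tau> \<partial>lebesgue_on {a..t}))"
      by (intro has_bochner_integral_add has_bochner_integral_bounded_linear[OF l1 1(1)]
          has_bochner_integral_bounded_linear[OF l2 1(2)])
    then show ?thesis by simp
  qed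
  then have 1: "integrable (lebesgue_on {a..b}) (\<lambda>\<tau>. (g \<tau>, h \<tau>))"
    by (auto simp: has_bochner_integral_iff)
  have 2: "(x t, y t) = (x a, y a) + (\<integral>\<tau>. (g \<tau>, h \<tau>) \<partial>lebesgue_on {a..t})"
    if "t \<in> {a..b}" for t
  proof -
    have "x t = x a + (\<integral>\<tau>. g \<tau> \<partial>lebesgue_on {a..t})" "y t = y a + (\<integral>\<tau>. h \<tau> \<partial>lebesgue_on {a..t})"
      using assms that unfolding has_ac_derivative_on_def by blast+
    moreover have "(\<integral>\<tau>. (g \<tau>, h \<tau>) \<partial>lebesgue_on {a..t})
      = ((\<integral>\<tau>. g \<tau> \<partial>lebesgue_on {a..t}), (\<integral>\<tau>. h \<tau> \<partial>lebesgue_on {a..t}))"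
      using hb[of t] that by (simp add: has_bochner_integral_iff)
    ultimately show ?thesis
      by (simp only: add_Pair)
  qed
  show ?thesis
    unfolding has_ac_derivative_on_def using 1 2 by blast
qed

lemma ac_derivative_fst_snd:
  fixes x g :: "real \<Rightarrow> 'b::euclidean_space" and y h :: "real \<Rightarrow> 'c::euclidean_space"
  assumes "has_ac_derivative_on (\<lambda>t. (x t, y t)) (\<lambda>t. (g t, h t)) a b"
  shows "has_ac_derivative_on x g a b" "has_ac_derivative_on y h a b"
proof -
  have i: "integrable (lebesgue_on {a..t}) (\<lambda>t. (g t, h t))" if "t \<le> b" for t
    using assms that by (intro ac_derivative_integrable[OF assms]) auto
  have 1: "integrable (lebesgue_on {a..t}) g" "(\<integral>\<tau>. g \<tau> \<partial>lebesgue_on {a..t}) = fst (\<integral>\<tau>. (g \<tau>, h \<tau>) \<partial>lebesgue_on {a..t})"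
   if "t \<le> b" for t
    using integrable_bounded_linear[OF bounded_linear_fst i[OF that]]
      integral_bounded_linear[OF bounded_linear_fst i[OF that]] by auto
  have 2: "integrable (lebesgue_on {a..t}) h" "(\<integral>\<tau>. h \<tau> \<partial>lebesgue_on {a..t}) = snd (\<integral>\<tau>. (g \<tau>, h \<tau>) \<partial>lebesgue_on {a..t})"
   if "t \<le> b" for t
    using integrable_bounded_linear[OF bounded_linear_snd i[OF that]]
      integral_bounded_linear[OF bounded_linear_snd i[OF that]] by auto
  have "x t = x a + (\<integral>\<tau>. g \<tau> \<partial>lebesgue_on {a..t})" "y t = y a + (\<integral>\<tau>. h \<tau> \<partial>lebesgue_on {a..t})"
    if t: "t \<in> {a..b}" for t
  proof -
    have "(x t, y t) = (x a, y a) + (\<integral>\<tau>. (g \<tau>, h \<tau>) \<partial>lebesgue_on {a..t})"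
      using assms t unfolding has_ac_derivative_on_def by blast
    then have "x t = x a + fst (\<integral>\<tau>. (g \<tau>, h \<tau>) \<partial>lebesgue_on {a..t})"
      "y t = y a + snd (\<integral>\<tau>. (g \<tau>, h \<tau>) \<partial>lebesgue_on {a..t})"
      by (metis fst_add fst_conv, metis snd_add snd_conv)
    moreover have "t \<le> b" using t by simp
    ultimately show "x t = x a + (\<integral>\<tau>. g \<tau> \<partial>lebesgue_on {a..t})" "y t = y a + (\<integral>\<tau>. h \<tau> \<partial>lebesgue_on {a..t})"
      using 1(2)[of t] 2(2)[of t] by metis+
  qed
  then show "has_ac_derivative_on x g a b" "has_ac_derivative_on y h a b"
    unfolding has_ac_derivative_on_def using 1(1) 2(1) by blast+
qed

lemma ac_derivative_reflect:
  assumes x: "has_ac_derivative_on x g 0 T"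
  shows "has_ac_derivative_on (\<lambda>t. x (T - t)) (\<lambda>t. - g (T - t)) 0 T"
proof -
  have refl: "integrable (lebesgue_on {0..t}) (\<lambda>\<tau>. g (T - \<tau>)) \<and>
      (\<integral>\<tau>. g (T - \<tau>) \<partial>lebesgue_on {0..t}) = (\<integral>\<tau>. g \<tau> \<partial>lebesgue_on {T-t..T})" if t: "t \<in> {0..T}" for t
  proof -
    have int: "integrable (lebesgue_on {T-t..T}) g"
      using t by (intro ac_derivative_integrable[OF x]) auto
    have i: "has_bochner_integral lebesgue (\<lambda>\<tau>. indicator {T-t..T} \<tau> *\<^sub>R g \<tau>) (\<integral>\<tau>. g \<tau> \<partial>lebesgue_on {T-t..T})"
      using int has_bochner_integral_integrable
      by (subst has_bochner_integral_restrict_space[symmetric]) auto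
    have eq: "indicat_real {T-t..T} (T - \<tau>) = indicat_real {0..t} \<tau>" for \<tau>
      by (auto simp: indicator_def)
    from i have "has_bochner_integral lebesgue (\<lambda>\<tau>. indicator {0..t} \<tau> *\<^sub>R g (T - \<tau>)) (\<integral>\<tau>. g \<tau> \<partial>lebesgue_on {T-t..T})"
      using has_bochner_integral_lebesgue_real_affine_iff[of "-1" "\<lambda>\<tau>. indicator {T-t..T} \<tau> *\<^sub>R g \<tau>" _ T]
      by (simp add: eq)
    then have "has_bochner_integral (lebesgue_on {0..t}) (\<lambda>\<tau>. g (T - \<tau>)) (\<integral>\<tau>. g \<tau> \<partial>lebesgue_on {T-t..T})"
      by (simp add: has_bochner_integral_restrict_space)
    then show ?thesis
      by (simp add: has_bochner_integral_iff)
  qed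
  show ?thesis
    unfolding has_ac_derivative_on_def
  proof (intro conjI ballI)
    show "integrable (lebesgue_on {0..T}) (\<lambda>t. - g (T - t))"
    proof (cases "T \<ge> 0")
      case True
      then show ?thesis using refl[of T] by simp
    qed (auto intro: has_bochner_integral_null simp: integrable.simps)
  next
    fix t assume t: "t \<in> {0..T}"
    have "x T - x (T - t) = (\<integral>\<tau>. g \<tau> \<partial>lebesgue_on {T-t..T})"
      using t by (intro ac_derivative_diff[OF x]) auto
    then show "x (T - t) = x (T - 0) + (\<integral>\<tau>. - g (T - \<tau>) \<partial>lebesgue_on {0..t})"
      using refl[OF t] by (simp add: algebra_simps)
  qed
qed

text \<open>The increment over \<open>[s, t]\<close> of the difference of the two sides is at most the oscillation
  of \<open>x\<close> and \<open>y\<close> times the integral of \<open>|g| + |h|\<close>, which makes it locally, hence globally,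
  smaller than any multiple of that integral. No differentiation almost everywhere is needed.\<close>

lemma ac_derivative_integration_by_parts:
  fixes x y :: "real \<Rightarrow> 'b::euclidean_space"
  assumes x: "has_ac_derivative_on x g a b" and y: "has_ac_derivative_on y h a b" and "a \<le> b"
  shows "integrable (lebesgue_on {a..b}) (\<lambda>t. g t \<bullet> y t + x t \<bullet> h t)"
    and "x b \<bullet> y b - x a \<bullet> y a = (\<integral>t. g t \<bullet> y t + x t \<bullet> h t \<partial>lebesgue_on {a..b})"
proof -
  have cx: "continuous_on {a..b} x" and cy: "continuous_on {a..b} y"
    using x y by (auto intro: ac_derivative_continuous)
  have mx: "x \<in> borel_measurable (lebesgue_on {a..b})" "y \<in> borel_measurable (lebesgue_on {a..b})"
    using cx cy by (auto intro!: continuous_imp_measurable_on_sets_lebesgue)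
  have gi: "integrable (lebesgue_on {a..b}) g" "integrable (lebesgue_on {a..b}) h"
    using x y by (auto intro: ac_derivative_integrable)
  obtain C where C: "\<And>t. t \<in> {a..b} \<Longrightarrow> norm (x t) \<le> C" "\<And>t. t \<in> {a..b} \<Longrightarrow> norm (y t) \<le> C"
  proof -
    have "bounded (x ` {a..b})" "bounded (y ` {a..b})"
      using cx cy by (auto intro!: compact_imp_bounded compact_continuous_image)
    then obtain C1 C2 where "\<And>t. t \<in> {a..b} \<Longrightarrow> norm (x t) \<le> C1" "\<And>t. t \<in> {a..b} \<Longrightarrow> norm (y t) \<le> C2"
      unfolding bounded_iff by blast
    then show thesis
      by (intro that[of "max C1 C2"]) (auto simp: le_max_iff_disj)
  qed
  define w where "w t = norm (g t) + norm (h t)" for t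
  have wi: "integrable (lebesgue_on {a..b}) w"
    unfolding w_def using gi by auto
  define k where "k t = g t \<bullet> y t + x t \<bullet> h t" for t
  have kb: "norm (k t) \<le> C * w t" if "t \<in> {a..b}" for t
  proof -
    have "norm (k t) \<le> norm (g t) * norm (y t) + norm (x t) * norm (h t)"
      unfolding k_def using Cauchy_Schwarz_ineq2[of "g t" "y t"] Cauchy_Schwarz_ineq2[of "x t" "h t"]
      by (simp add: abs_if split: if_splits)
    also have "\<dots> \<le> norm (g t) * C + C * norm (h t)"
      using C[OF that] by (intro add_mono mult_left_mono mult_right_mono) auto
    finally show ?thesis by (simp add: w_def algebra_simps)
  qed
  show ki: "integrable (lebesgue_on {a..b}) (\<lambda>t. g t \<bullet> y t + x t \<bullet> h t)"
    unfolding k_def[symmetric]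
  proof (rule measurable_bounded_by_integrable_imp_lebesgue_integrable[OF _ _ kb])
    show "k \<in> borel_measurable (lebesgue_on {a..b})"
      unfolding k_def using mx borel_measurable_integrable[OF gi(1)] borel_measurable_integrable[OF gi(2)]
      by measurable
    show "integrable (lebesgue_on {a..b}) (\<lambda>t. C * w t)"
      using wi by simp
  qed auto
  then have ki: "integrable (lebesgue_on {a..b}) k" unfolding k_def .
  define H where "H t = x t \<bullet> y t - x a \<bullet> y a - (\<integral>\<tau>. k \<tau> \<partial>lebesgue_on {a..t})" for t
  define W where "W t = (\<integral>\<tau>. w \<tau> \<partial>lebesgue_on {a..t})" for t
  have small: "\<bar>H b\<bar> \<le> e * W b" if "e > 0" for e
  proof -
    have u: "uniformly_continuous_on {a..b} x" "uniformly_continuous_on {a..b} y"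
      using cx cy by (auto intro: compact_uniformly_continuous)
    obtain d1 where d1: "d1 > 0" "\<And>s t. s \<in> {a..b} \<Longrightarrow> t \<in> {a..b} \<Longrightarrow> dist t s < d1 \<Longrightarrow> dist (x t) (x s) < e"
      using u(1) \<open>e > 0\<close> unfolding uniformly_continuous_on_def by meson
    obtain d2 where d2: "d2 > 0" "\<And>s t. s \<in> {a..b} \<Longrightarrow> t \<in> {a..b} \<Longrightarrow> dist t s < d2 \<Longrightarrow> dist (y t) (y s) < e"
      using u(2) \<open>e > 0\<close> unfolding uniformly_continuous_on_def by meson
    note d = d1 d2
    define \<delta> where "\<delta> = min d1 d2 / 2"
    have \<delta>: "\<delta> > 0" "\<delta> < d1" "\<delta> < d2"
      using d by (auto simp: \<delta>_def)
    have inc: "\<bar>H t - H s\<bar> \<le> e * (W t - W s)" if st: "a \<le> s" "s \<le> t" "t \<le> b" "t - s \<le> \<delta>" for s t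
    proof -
      have gi': "integrable (lebesgue_on {s..t}) g" "integrable (lebesgue_on {s..t}) h" 
         "integrable (lebesgue_on {s..t}) w" "integrable (lebesgue_on {s..t}) k"
        using st gi wi ki by (auto intro: integrable_lebesgue_on_Icc_subset)
      have "x t \<bullet> y t - x s \<bullet> y s = (x t - x s) \<bullet> y t + x s \<bullet> (y t - y s)"
        by (simp add: inner_diff_left inner_diff_right)
      also have "\<dots> = (\<integral>\<tau>. g \<tau> \<bullet> y t \<partial>lebesgue_on {s..t}) + (\<integral>\<tau>. x s \<bullet> h \<tau> \<partial>lebesgue_on {s..t})"
        using ac_derivative_diff[OF x st(1-3)] ac_derivative_diff[OF y st(1-3)] gi' by simp
      finally have "H t - H s = (\<integral>\<tau>. g \<tau> \<bullet> y t \<partial>lebesgue_on {s..t}) + (\<integral>\<tau>. x s \<bullet> h \<tau> \<partial>lebesgue_on {s..t})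
          - (\<integral>\<tau>. k \<tau> \<partial>lebesgue_on {s..t})"
        using integral_lebesgue_on_Icc_diff[OF ki st(1-3)] by (simp add: H_def)
      also have "\<dots> = (\<integral>\<tau>. g \<tau> \<bullet> y t + x s \<bullet> h \<tau> - k \<tau> \<partial>lebesgue_on {s..t})"
        using gi' by simp
      finally have eq: "H t - H s = (\<integral>\<tau>. g \<tau> \<bullet> y t + x s \<bullet> h \<tau> - k \<tau> \<partial>lebesgue_on {s..t})" .
      have "\<bar>H t - H s\<bar> \<le> (\<integral>\<tau>. \<bar>g \<tau> \<bullet> y t + x s \<bullet> h \<tau> - k \<tau>\<bar> \<partial>lebesgue_on {s..t})"
        unfolding eq using integral_norm_bound[of "lebesgue_on {s..t}"] by fastforce
      also have "\<dots> \<le> (\<integral>\<tau>. e * w \<tau> \<partial>lebesgue_on {s..t})"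
      proof (rule integral_mono)
        fix \<tau> assume "\<tau> \<in> space (lebesgue_on {s..t})"
        then have \<tau>: "\<tau> \<in> {s..t}" by simp
        have "dist (y t) (y \<tau>) < e" "dist (x s) (x \<tau>) < e"
          using \<tau> st \<delta> by (auto intro!: d simp: dist_real_def)
        then have nb: "norm (y t - y \<tau>) \<le> e" "norm (x s - x \<tau>) \<le> e"
          by (auto simp: dist_norm)
        have "g \<tau> \<bullet> y t + x s \<bullet> h \<tau> - k \<tau> = g \<tau> \<bullet> (y t - y \<tau>) + (x s - x \<tau>) \<bullet> h \<tau>"
          by (simp add: k_def inner_diff_left inner_diff_right)
        also have "\<bar>\<dots>\<bar> \<le> norm (g \<tau>) * norm (y t - y \<tau>) + norm (x s - x \<tau>) * norm (h \<tau>)"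
          using Cauchy_Schwarz_ineq2[of "g \<tau>" "y t - y \<tau>"] Cauchy_Schwarz_ineq2[of "x s - x \<tau>" "h \<tau>"]
          by linarith
        also have "\<dots> \<le> norm (g \<tau>) * e + e * norm (h \<tau>)"
          using nb by (intro add_mono mult_left_mono mult_right_mono) auto
        finally show "\<bar>g \<tau> \<bullet> y t + x s \<bullet> h \<tau> - k \<tau>\<bar> \<le> e * w \<tau>"
          by (simp add: w_def algebra_simps)
      qed (use gi' in auto)
      also have "\<dots> = e * (W t - W s)"
        unfolding W_def using integral_lebesgue_on_Icc_diff[OF wi st(1-3)] gi' by simp
      finally show ?thesis .
    qed
    have inc': "H t - e * W t \<le> H s - e * W s" "- H t - e * W t \<le> - H s - e * W s"
      if "a \<le> s" "s \<le> t" "t \<le> b" "t - s \<le> \<delta>" for s t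
      using inc[OF that] by (auto simp: right_diff_distrib)
    have "H b - e * W b \<le> H a - e * W a"
      by (rule locally_nonincreasing_imp_le[OF \<delta>(1), where f = "\<lambda>t. H t - e * W t"])
        (use \<open>a \<le> b\<close> inc' in auto)
    moreover have "- H b - e * W b \<le> - H a - e * W a"
      by (rule locally_nonincreasing_imp_le[OF \<delta>(1), where f = "\<lambda>t. - H t - e * W t"])
        (use \<open>a \<le> b\<close> inc' in auto)
    moreover have "H a = 0" "W a = 0"
      by (simp_all add: H_def W_def integral_eq_zero_null_sets)
    ultimately show ?thesis by auto
  qed
  have "\<bar>H b\<bar> \<le> 0"
  proof -
    have W0: "W b \<ge> 0" using small[of 1] by simp
    show ?thesis
    proof (rule field_le_epsilon)
      fix e :: real assume e: "e > 0"
      have "\<bar>H b\<bar> \<le> e / (1 + W b) * W b"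
        using W0 e by (intro small) auto
      also have "\<dots> \<le> e"
        using W0 e by (simp add: field_simps)
      finally show "\<bar>H b\<bar> \<le> 0 + e" by simp
    qed
  qed
  then show "x b \<bullet> y b - x a \<bullet> y a = (\<integral>t. g t \<bullet> y t + x t \<bullet> h t \<partial>lebesgue_on {a..b})"
    by (simp add: H_def k_def)
qed

text \<open>The factor \<open>2\<close> in the exponent comes from \<open>exp (- 2 D) \<le> 1 - D\<close> for \<open>0 \<le> D \<le> 1/2\<close>, which suffices
  on intervals where the integral \<open>D\<close> of \<open>w\<close> is small. The constant depends on \<open>w\<close> only through
  its integral.\<close>

lemma gronwall:
  fixes y w :: "real \<Rightarrow> real"
  assumes w: "integrable (lebesgue_on {a..b}) w" and w0: "\<And>t. t \<in> {a..b} \<Longrightarrow> w t \<ge> 0"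
    and wy: "integrable (lebesgue_on {a..b}) (\<lambda>t. w t * y t)" and y0: "\<And>t. t \<in> {a..b} \<Longrightarrow> y t \<ge> 0"
    and le: "\<And>t. t \<in> {a..b} \<Longrightarrow> y t \<le> c + (\<integral>\<tau>. w \<tau> * y \<tau> \<partial>lebesgue_on {a..t})"
    and c: "c \<ge> 0" and t: "t \<in> {a..b}"
  shows "y t \<le> c * exp (2 * (\<integral>\<tau>. w \<tau> \<partial>lebesgue_on {a..b}))"
proof -
  define U where "U t = (\<integral>\<tau>. w \<tau> \<partial>lebesgue_on {a..t})" for t
  define Y where "Y t = c + (\<integral>\<tau>. w \<tau> * y \<tau> \<partial>lebesgue_on {a..t})" for t
  have Udiff: "U t - U s = (\<integral>\<tau>. w \<tau> \<partial>lebesgue_on {s..t})" 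
    and Ydiff: "Y t - Y s = (\<integral>\<tau>. w \<tau> * y \<tau> \<partial>lebesgue_on {s..t})" if "a \<le> s" "s \<le> t" "t \<le> b" for s t
    using integral_lebesgue_on_Icc_diff[OF w that] integral_lebesgue_on_Icc_diff[OF wy that] 
    by (auto simp: U_def Y_def)
  have Umono: "U s \<le> U t" and Ymono: "Y s \<le> Y t" if "a \<le> s" "s \<le> t" "t \<le> b" for s t
  proof -
    have "0 \<le> (\<integral>\<tau>. w \<tau> \<partial>lebesgue_on {s..t})" "0 \<le> (\<integral>\<tau>. w \<tau> * y \<tau> \<partial>lebesgue_on {s..t})"
      using that w0 y0 by (auto intro!: Bochner_Integration.integral_nonneg)
    then show "U s \<le> U t" "Y s \<le> Y t"
      using Udiff[OF that] Ydiff[OF that] by linarith+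
  qed
  have a0: "U a = 0" "Y a = c"
    by (simp_all add: U_def Y_def integral_eq_zero_null_sets)
  have Ynn: "Y t \<ge> 0" if "t \<in> {a..b}" for t
    using le[OF that] y0[OF that] by (simp add: Y_def)
  obtain \<delta> where \<delta>: "\<delta> > 0"
    and sm: "\<And>s t. a \<le> s \<Longrightarrow> s \<le> t \<Longrightarrow> t \<le> b \<Longrightarrow> t - s \<le> \<delta> \<Longrightarrow> (\<integral>\<tau>. w \<tau> \<partial>lebesgue_on {s..t}) \<le> 1/2"
    using integral_short_interval_small[OF w, of "1/2"] by auto
  have "Y t * exp (- 2 * U t) \<le> Y a * exp (- 2 * U a)"
  proof (rule locally_nonincreasing_imp_le[OF \<delta>, where b = b and f = "\<lambda>t. Y t * exp (- 2 * U t)"])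
    fix s t assume st: "a \<le> s" "s \<le> t" "t \<le> b" "t - s \<le> \<delta>"
    define D where "D = U t - U s"
    have D: "0 \<le> D" "D \<le> 1/2"
      using Umono[OF st(1-3)] sm[OF st] Udiff[OF st(1-3)] by (auto simp: D_def)
    have int: "integrable (lebesgue_on {s..t}) w" "integrable (lebesgue_on {s..t}) (\<lambda>\<tau>. w \<tau> * y \<tau>)"
      using w wy st by (auto intro: integrable_lebesgue_on_Icc_subset)
    have "Y t - Y s \<le> (\<integral>\<tau>. w \<tau> * Y t \<partial>lebesgue_on {s..t})"
      unfolding Ydiff[OF st(1-3)]
    proof (rule integral_mono)
      fix \<tau> assume "\<tau> \<in> space (lebesgue_on {s..t})"
      then have \<tau>: "\<tau> \<in> {s..t}" by simp
      have "y \<tau> \<le> Y \<tau>" using le[of \<tau>] \<tau> st by (simp add: Y_def)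
      also have "Y \<tau> \<le> Y t" using \<tau> st by (intro Ymono) auto
      finally show "w \<tau> * y \<tau> \<le> w \<tau> * Y t"
        using w0[of \<tau>] \<tau> st by (intro mult_left_mono) auto
    qed (use int in auto)
    also have "\<dots> = D * Y t"
      using int by (simp add: D_def Udiff[OF st(1-3)])
    finally have 1: "Y t * (1 - D) \<le> Y s" by (simp add: algebra_simps)
    have "exp (- 2 * D) \<le> 1 - D"
    proof -
      have "1 \<le> (1 - D) * (1 + 2 * D)"
        using D mult_nonneg_nonneg[of D "1 - 2 * D"] by (simp add: algebra_simps)
      also have "\<dots> \<le> (1 - D) * exp (2 * D)"
        using D exp_ge_add_one_self[of "2 * D"] by (intro mult_left_mono) auto
      finally show ?thesis
        by (simp add: exp_minus field_simps)
    qed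
    then have "Y t * exp (- 2 * D) \<le> Y s"
      using 1 Ynn[of t] st mult_left_mono[of "exp (- 2 * D)" "1 - D" "Y t"] by auto
    moreover have "exp (- 2 * U t) = exp (- 2 * D) * exp (- 2 * U s)"
      by (simp add: D_def flip: exp_add)
    ultimately show "Y t * exp (- 2 * U t) \<le> Y s * exp (- 2 * U s)"
      by (simp add: mult.assoc[symmetric] mult_right_mono)
  qed (use t in auto)
  then have "Y t \<le> c * exp (2 * U t)"
    using a0 by (simp add: exp_minus field_simps)
  also have "\<dots> \<le> c * exp (2 * U b)"
    using Umono[of t b] t c by (intro mult_left_mono) auto
  finally show ?thesis
    using le[OF t] by (simp add: Y_def U_def)
qed

section \<open>Paths and mean values in a planar domain with twice differentiable boundary\<close>

text \<open>The orthogonal change of coordinates is replaced by the orthonormal vectors \<open>e1\<close> and \<open>e2\<close> that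
  it maps to the coordinate axes.\<close>

lemma C2_boundary_coordinates:
  assumes "C2_boundary \<Omega>" "x \<in> frontier \<Omega>"
  obtains r e1 e2 \<phi> \<phi>' where "r > 0" "norm e1 = 1" "norm e2 = 1" "e1 \<bullet> e2 = 0"
    "\<And>\<tau>::real. (\<phi> has_real_derivative \<phi>' \<tau>) (at \<tau>)" "continuous_on UNIV \<phi>'"
    "\<Omega> \<inter> ball x r = {y \<in> ball x r. \<phi> (e1 \<bullet> y) < e2 \<bullet> y}"
proof -
  obtain r and R :: "real^2 \<Rightarrow> real^2" and \<phi> \<phi>1 \<phi>2 where r: "r > 0" and R: "orthogonal_transformation R"
    and d1: "\<forall>\<tau>::real. (\<phi> has_real_derivative \<phi>1 \<tau>) (at \<tau>)"
    and d2: "\<forall>\<tau>. (\<phi>1 has_real_derivative \<phi>2 \<tau>) (at \<tau>)"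
    and eq: "\<Omega> \<inter> ball x r = {y \<in> ball x r. \<phi> (R y $ 1) < R y $ 2}"
    using assms(1)[unfolded C2_boundary_def, rule_format, OF assms(2)] by (elim exE conjE) (rule that; assumption)
  obtain e1 e2 where e: "R e1 = axis 1 1" "R e2 = axis 2 1"
    using orthogonal_transformation_surj[OF R] by (metis surjD)
  have inn: "R u \<bullet> R v = u \<bullet> v" for u v
    using R by (simp add: orthogonal_transformation_def)
  have "R y $ 1 = e1 \<bullet> y" "R y $ 2 = e2 \<bullet> y" for y
    using inn[of e1 y] inn[of e2 y] by (simp_all add: e inner_axis' )
  moreover have "e1 \<bullet> e1 = 1" "e2 \<bullet> e2 = 1" "e1 \<bullet> e2 = 0"
    using inn[of e1 e1] inn[of e2 e2] inn[of e1 e2] by (simp_all add: e inner_axis_axis)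
  moreover have "continuous_on UNIV \<phi>1"
    using d2 by (meson DERIV_continuous_on has_field_derivative_at_within)
  ultimately show thesis
    using r d1 eq by (intro that[of r e1 e2 \<phi> \<phi>1]) (auto simp: norm_eq_sqrt_inner)
qed

lemma closure_above_graph:
  fixes \<phi> :: "real \<Rightarrow> real"
  assumes eq: "\<Omega> \<inter> ball x r = {y \<in> ball x r. \<phi> (e1 \<bullet> y) < e2 \<bullet> y}"
    and \<phi>: "continuous_on UNIV \<phi>" and y: "y \<in> closure \<Omega>" "y \<in> ball x r"
  shows "\<phi> (e1 \<bullet> y) \<le> e2 \<bullet> y"
proof (rule ccontr)
  assume neg: "\<not> \<phi> (e1 \<bullet> y) \<le> e2 \<bullet> y"
  define N where "N = ball x r \<inter> {y. e2 \<bullet> y < \<phi> (e1 \<bullet> y)}"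
  have "open N"
    unfolding N_def
    by (intro open_Int open_ball open_Collect_less continuous_intros continuous_on_compose2[OF \<phi>]) auto
  moreover have "N \<inter> \<Omega> = {}"
  proof -
    have "q \<notin> \<Omega>" if "q \<in> N" for q
    proof
      assume "q \<in> \<Omega>"
      then have "q \<in> {y \<in> ball x r. \<phi> (e1 \<bullet> y) < e2 \<bullet> y}"
        using that unfolding eq[symmetric] N_def by simp
      then show False using that by (simp add: N_def)
    qed
    then show ?thesis by blast
  qed
  ultimately have "N \<inter> closure \<Omega> = {}"
    by (simp add: open_Int_closure_eq_empty)
  moreover have "y \<in> N"
    using neg y by (auto simp: N_def)
  ultimately show False using y by auto
qed

text \<open>The points \<open>y\<close> and \<open>z\<close> are joined by three consecutive segments that, apart from \<open>y\<close> and \<open>z\<close>, lie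
  in \<open>\<Omega>\<close> and are not longer than \<open>c\<close> times the distance. The corners \<open>w1\<close> and \<open>w2\<close> may coincide with
  an end point, which covers a single segment.\<close>

definition three_segment_path :: "'a::real_normed_vector set \<Rightarrow> real \<Rightarrow> 'a \<Rightarrow> 'a \<Rightarrow> bool" where
  "three_segment_path \<Omega> c y z \<longleftrightarrow> (\<exists>w1 w2.
     open_segment y w1 \<subseteq> \<Omega> \<and> closed_segment w1 w2 \<subseteq> \<Omega> \<union> {y, z} \<and> open_segment w1 w2 \<subseteq> \<Omega> \<and> open_segment z w2 \<subseteq> \<Omega> \<and>
     dist y w1 \<le> c * dist y z \<and> dist w1 w2 \<le> c * dist y z \<and> dist z w2 \<le> c * dist y z)"

lemma three_segment_path_mono:
  assumes "three_segment_path \<Omega> c y z" "c \<le> c'"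
  shows "three_segment_path \<Omega> c' y z"
proof -
  have "c * dist y z \<le> c' * dist y z" using assms by (intro mult_right_mono) auto
  then show ?thesis
    using assms(1) unfolding three_segment_path_def by (meson order.trans)
qed

text \<open>At a boundary point, the path goes up from the graph in the direction \<open>e2\<close>, then straight across,
  and down again.\<close>

lemma local_three_segment_path:
  assumes "open \<Omega>" "C2_boundary \<Omega>" "x \<in> closure \<Omega>"
  shows "\<exists>\<rho>>0. \<exists>c. \<forall>y\<in>closure \<Omega> \<inter> ball x \<rho>. \<forall>z\<in>closure \<Omega> \<inter> ball x \<rho>. y \<noteq> z \<longrightarrow> three_segment_path \<Omega> c y z"
proof (cases "x \<in> \<Omega>")
  case True
  then obtain r where r: "r > 0" "ball x r \<subseteq> \<Omega>"
    using \<open>open \<Omega>\<close> openE by blast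
  have "three_segment_path \<Omega> 1 y z" if "y \<in> ball x r" "z \<in> ball x r" for y z
  proof -
    have "closed_segment y z \<subseteq> ball x r"
      using that by (simp add: closed_segment_subset convex_ball)
    then have "open_segment y z \<subseteq> \<Omega>"
      using r segment_open_subset_closed by blast
    then show ?thesis
      unfolding three_segment_path_def by (intro exI[of _ z]) auto
  qed
  then show ?thesis using r by (intro exI[of _ r] conjI exI[of _ 1]) auto
next
  case False
  then have "x \<in> frontier \<Omega>"
    using assms by (simp add: frontier_def interior_open)
  then obtain r e1 e2 \<phi> \<phi>' where r: "r > 0" and e: "norm e1 = 1" "norm e2 = 1" "e1 \<bullet> e2 = 0"
    and \<phi>: "\<And>\<tau>::real. (\<phi> has_real_derivative \<phi>' \<tau>) (at \<tau>)" "continuous_on UNIV \<phi>'"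
    and eq: "\<Omega> \<inter> ball x r = {y \<in> ball x r. \<phi> (e1 \<bullet> y) < e2 \<bullet> y}"
    by (rule C2_boundary_coordinates[OF assms(2)]) blast
  have c\<phi>: "continuous_on UNIV \<phi>"
    using \<phi>(1) by (meson DERIV_continuous_on has_field_derivative_at_within)
  define I where "I = {e1 \<bullet> x - r..e1 \<bullet> x + r}"
  obtain L where L: "L \<ge> 0" "\<And>\<tau>. \<tau> \<in> I \<Longrightarrow> \<bar>\<phi>' \<tau>\<bar> \<le> L"
  proof -
    have "bounded (\<phi>' ` I)"
      unfolding I_def by (intro compact_imp_bounded compact_continuous_image continuous_on_subset[OF \<phi>(2)]) auto
    then obtain L where "\<And>\<tau>. \<tau> \<in> I \<Longrightarrow> \<bar>\<phi>' \<tau>\<bar> \<le> L"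
      unfolding bounded_iff by auto
    then show thesis by (intro that[of "max 0 L"]) (auto simp: le_max_iff_disj)
  qed
  have lip: "\<bar>\<phi> \<sigma> - \<phi> \<tau>\<bar> \<le> L * \<bar>\<sigma> - \<tau>\<bar>" if "\<sigma> \<in> I" "\<tau> \<in> I" for \<sigma> \<tau>
    using field_differentiable_bound[of I \<phi> \<phi>' L \<sigma> \<tau>] that L(2) \<phi>(1) 
    by (auto simp: I_def intro: has_field_derivative_at_within)
  have inI: "e1 \<bullet> p \<in> I" if "p \<in> ball x r" for p
    using Cauchy_Schwarz_ineq2[of e1 "p - x"] e that 
    by (auto simp: I_def inner_diff_right dist_norm norm_minus_commute abs_le_iff)
  \<comment> \<open>so small that the paths below, which rise by at most \<open>(L + 1) 2\<rho>\<close>, stay in the ball of radius \<open>r\<close>\<close>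
  define \<rho> where "\<rho> = r / (2 * L + 3)"
  have \<rho>: "\<rho> > 0" "\<rho> * (2 * L + 3) = r" "\<rho> \<le> r"
    using r L by (auto simp: \<rho>_def field_simps)
  have "three_segment_path \<Omega> (L + 1) y z"
    if y: "y \<in> closure \<Omega> \<inter> ball x \<rho>" and z: "z \<in> closure \<Omega> \<inter> ball x \<rho>" and "y \<noteq> z" for y z
  proof -
    define d where "d = dist y z"
    have d0: "d > 0" using \<open>y \<noteq> z\<close> by (simp add: d_def)
    have d1: "d \<le> 2 * \<rho>"
      using y z dist_triangle[of y z x] by (simp add: d_def dist_commute)
    \<comment> \<open>on the segment across, the graph rises by at most \<open>L d < h\<close>\<close>
    define h where "h = (L + 1) * d"
    have h0: "h > 0" using d0 L by (simp add: h_def)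
    have h1: "h \<le> (L + 1) * (2 * \<rho>)"
      unfolding h_def using d1 L by (intro mult_left_mono) auto
    have h2: "\<rho> + h \<le> r" using h1 \<rho>(2) by (simp add: algebra_simps)
    have yz: "y \<in> ball x r" "z \<in> ball x r"
      using y z \<rho> by auto
    have g: "\<phi> (e1 \<bullet> y) \<le> e2 \<bullet> y" "\<phi> (e1 \<bullet> z) \<le> e2 \<bullet> z"
      using closure_above_graph[OF eq c\<phi>] y z yz by auto
    have e2e2: "e2 \<bullet> e2 = 1" using e by (simp add: dot_square_norm)
    have inball: "p + t *\<^sub>R e2 \<in> ball x r" if "p \<in> ball x \<rho>" "0 \<le> t" "t \<le> h" for p t
    proof -
      have "dist x (p + t *\<^sub>R e2) \<le> dist x p + norm (t *\<^sub>R e2)"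
        using norm_triangle_ineq4[of "x - p" "t *\<^sub>R e2"] by (simp add: dist_norm algebra_simps)
      then show ?thesis using that e h2 by simp
    qed
    have up: "p + t *\<^sub>R e2 \<in> \<Omega>" if "p \<in> ball x \<rho>" "\<phi> (e1 \<bullet> p) \<le> e2 \<bullet> p" "0 < t" "t \<le> h" for p t
    proof -
      have "p + t *\<^sub>R e2 \<in> {y \<in> ball x r. \<phi> (e1 \<bullet> y) < e2 \<bullet> y}"
        using that inball[of p t] e e2e2 by (simp add: inner_add_right)
      then show ?thesis using eq by blast
    qed
    have updown: "open_segment p (p + h *\<^sub>R e2) \<subseteq> \<Omega>" if "p \<in> ball x \<rho>" "\<phi> (e1 \<bullet> p) \<le> e2 \<bullet> p" for p
    proof
      fix q assume "q \<in> open_segment p (p + h *\<^sub>R e2)"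
      then obtain u where u: "0 < u" "u < 1" "q = (1 - u) *\<^sub>R p + u *\<^sub>R (p + h *\<^sub>R e2)"
        by (auto simp: in_segment)
      then have "q = p + (u * h) *\<^sub>R e2"
        by (simp add: algebra_simps)
      moreover have "u * h \<le> h" using u h0 by simp
      ultimately show "q \<in> \<Omega>"
        using up[OF that, of "u * h"] u h0 by simp
    qed
    have across: "closed_segment (y + h *\<^sub>R e2) (z + h *\<^sub>R e2) \<subseteq> \<Omega>"
    proof
      fix q assume "q \<in> closed_segment (y + h *\<^sub>R e2) (z + h *\<^sub>R e2)"
      then obtain u where u: "0 \<le> u" "u \<le> 1" "q = (1 - u) *\<^sub>R (y + h *\<^sub>R e2) + u *\<^sub>R (z + h *\<^sub>R e2)"
        by (auto simp: in_segment)
      define p where "p = (1 - u) *\<^sub>R y + u *\<^sub>R z"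
      have q: "q = p + h *\<^sub>R e2"
        unfolding u(3) p_def by (simp add: algebra_simps)
      have pb: "p \<in> ball x \<rho>"
        unfolding p_def using y z u by (intro convexD_alt[OF convex_ball, of y x \<rho> z u]) auto
      then have pr: "p \<in> ball x r" using \<rho> by auto
      have py: "\<bar>e1 \<bullet> p - e1 \<bullet> y\<bar> \<le> d" "\<bar>e1 \<bullet> p - e1 \<bullet> z\<bar> \<le> d"
      proof -
        have eqs: "p - y = u *\<^sub>R (z - y)" "p - z = (1 - u) *\<^sub>R (y - z)"
          by (simp_all add: p_def algebra_simps)
        have "norm (p - y) \<le> d" "norm (p - z) \<le> d"
          unfolding eqs d_def using u mult_left_le_one_le[of "norm (z - y)" u] mult_left_le_one_le[of "norm (z - y)" "1 - u"]
          by (simp_all add: dist_norm norm_minus_commute)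
        then show "\<bar>e1 \<bullet> p - e1 \<bullet> y\<bar> \<le> d" "\<bar>e1 \<bullet> p - e1 \<bullet> z\<bar> \<le> d"
          using Cauchy_Schwarz_ineq2[of e1 "p - y"] Cauchy_Schwarz_ineq2[of e1 "p - z"] e
          by (simp_all add: inner_diff_right)
      qed
      have "\<phi> (e1 \<bullet> p) - \<phi> (e1 \<bullet> y) \<le> L * d" "\<phi> (e1 \<bullet> p) - \<phi> (e1 \<bullet> z) \<le> L * d"
        using lip[OF inI[OF pr] inI[OF yz(1)]] lip[OF inI[OF pr] inI[OF yz(2)]] 
          mult_left_mono[OF py(1) L(1)] mult_left_mono[OF py(2) L(1)] by linarith+
      then have "\<phi> (e1 \<bullet> p) - L * d \<le> e2 \<bullet> y" "\<phi> (e1 \<bullet> p) - L * d \<le> e2 \<bullet> z"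
        using g by linarith+
      then have "(1 - u) * (\<phi> (e1 \<bullet> p) - L * d) + u * (\<phi> (e1 \<bullet> p) - L * d) \<le> (1 - u) * (e2 \<bullet> y) + u * (e2 \<bullet> z)"
        using u by (intro add_mono mult_left_mono) auto
      then have "\<phi> (e1 \<bullet> p) - L * d \<le> e2 \<bullet> p"
        by (simp add: p_def inner_add_right algebra_simps)
      then have "\<phi> (e1 \<bullet> q) < e2 \<bullet> q"
        using d0 e e2e2 by (simp add: q inner_add_right h_def algebra_simps)
      then show "q \<in> \<Omega>"
        using inball[OF pb, of h] h0 eq q by auto
    qed
    show ?thesis
      unfolding three_segment_path_def
    proof (rule exI[of _ "y + h *\<^sub>R e2"], rule exI[of _ "z + h *\<^sub>R e2"], intro conjI)
      show "open_segment y (y + h *\<^sub>R e2) \<subseteq> \<Omega>" "open_segment z (z + h *\<^sub>R e2) \<subseteq> \<Omega>"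
        using updown y z g by auto
      show "closed_segment (y + h *\<^sub>R e2) (z + h *\<^sub>R e2) \<subseteq> \<Omega> \<union> {y, z}"
        using across by auto
      show "open_segment (y + h *\<^sub>R e2) (z + h *\<^sub>R e2) \<subseteq> \<Omega>"
        using across segment_open_subset_closed by blast
      show "dist y (y + h *\<^sub>R e2) \<le> (L + 1) * dist y z" "dist z (z + h *\<^sub>R e2) \<le> (L + 1) * dist y z"
        using h0 e by (simp_all add: dist_norm h_def d_def)
      show "dist (y + h *\<^sub>R e2) (z + h *\<^sub>R e2) \<le> (L + 1) * dist y z"
        using L d0 by (simp add: d_def algebra_simps)
    qed
  qed
  then show ?thesis using \<rho>(1) by blast
qed

lemma segment_mean_value:
  fixes f :: "'a::real_normed_vector \<Rightarrow> real"
  assumes "continuous_on (closed_segment a b) f"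
    and f': "\<And>p. p \<in> open_segment a b \<Longrightarrow> (f has_derivative f' p) (at p)"
    and M: "\<And>p v. p \<in> open_segment a b \<Longrightarrow> \<bar>f' p v\<bar> \<le> M * norm v"
  shows "\<bar>f b - f a\<bar> \<le> M * dist a b"
proof (cases "a = b")
  case False
  define \<gamma> where "\<gamma> t = (1 - t) *\<^sub>R a + t *\<^sub>R b" for t
  have \<gamma>': "(\<gamma> has_derivative (\<lambda>s. s *\<^sub>R (b - a))) (at t)" for t
    unfolding \<gamma>_def by (auto intro!: derivative_eq_intros simp: algebra_simps)
  have seg: "\<gamma> t \<in> open_segment a b" if "0 < t" "t < 1" for t
    using that False by (auto simp: \<gamma>_def in_segment)
  have "continuous_on {0..1} (\<lambda>t. f (\<gamma> t))"
  proof (rule continuous_on_compose2[OF assms(1)])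
    show "continuous_on {0..1} \<gamma>"
      unfolding \<gamma>_def by (intro continuous_intros)
    show "\<gamma> ` {0..1} \<subseteq> closed_segment a b"
      by (auto simp: \<gamma>_def closed_segment_def)
  qed
  moreover have "((\<lambda>t. f (\<gamma> t)) has_derivative (\<lambda>s. f' (\<gamma> t) (s *\<^sub>R (b - a)))) (at t)" if "0 < t" "t < 1" for t
    using diff_chain_at[OF \<gamma>' f'[OF seg[OF that]]] by (simp add: o_def)
  ultimately obtain t where t: "0 < t" "t < 1" "f (\<gamma> 1) - f (\<gamma> 0) = f' (\<gamma> t) ((1 - 0) *\<^sub>R (b - a))"
    using mvt[of 0 1 "\<lambda>t. f (\<gamma> t)" "\<lambda>t s. f' (\<gamma> t) (s *\<^sub>R (b - a))"] by auto
  then show ?thesis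
    using M[OF seg[OF t(1,2)], of "b - a"] by (simp add: \<gamma>_def dist_norm norm_minus_commute)
qed simp

text \<open>A mean value inequality with constants \<open>\<delta>\<close> and \<open>c\<close> that depend on the domain only. The derivative
  needs to be bounded only at distance at most \<open>c * dist y z\<close> from \<open>y\<close>, which makes the second-order
  estimate below possible.\<close>

proposition C2_domain_mean_value:
  fixes \<Omega> :: "(real^2) set"
  assumes "open \<Omega>" "bounded \<Omega>" "C2_boundary \<Omega>"
  obtains \<delta> c where "\<delta> > 0" "c \<ge> 1"
    "\<And>f f' M y z. y \<in> closure \<Omega> \<Longrightarrow> z \<in> closure \<Omega> \<Longrightarrow> dist y z < \<delta> \<Longrightarrow> 0 \<le> M \<Longrightarrow>
       continuous_on (closure \<Omega>) f \<Longrightarrow> (\<And>p. p \<in> \<Omega> \<Longrightarrow> (f has_derivative f' p) (at p)) \<Longrightarrow>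
       (\<And>p v. p \<in> \<Omega> \<Longrightarrow> dist y p \<le> c * dist y z \<Longrightarrow> \<bar>f' p v\<bar> \<le> M * norm v) \<Longrightarrow>
       \<bar>f z - f y\<bar> \<le> M * c * dist y (z :: real^2)"
proof -
  have "\<forall>x\<in>closure \<Omega>. \<exists>\<rho> c. \<rho> > 0 \<and> (\<forall>y\<in>closure \<Omega> \<inter> ball x \<rho>. \<forall>z\<in>closure \<Omega> \<inter> ball x \<rho>. y \<noteq> z \<longrightarrow> three_segment_path \<Omega> c y z)"
    using local_three_segment_path[OF assms(1,3)] by blast
  then obtain \<rho> c where \<rho>: "\<And>x. x \<in> closure \<Omega> \<Longrightarrow> \<rho> x > (0::real)"
    and c: "\<And>x y z. x \<in> closure \<Omega> \<Longrightarrow> y\<in>closure \<Omega> \<inter> ball x (\<rho> x) \<Longrightarrow> z\<in>closure \<Omega> \<inter> ball x (\<rho> x) \<Longrightarrow> y \<noteq> z \<Longrightarrow> three_segment_path \<Omega> (c x) y z"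
    by metis
  have comp: "compact (closure \<Omega>)" using assms by (simp add: compact_closure)
  have cover: "closure \<Omega> \<subseteq> (\<Union>x\<in>closure \<Omega>. ball x (\<rho> x / 2))"
    using \<rho> by (force simp: )
  obtain D where D: "D \<subseteq> closure \<Omega>" "finite D" "closure \<Omega> \<subseteq> (\<Union>x\<in>D. ball x (\<rho> x / 2))"
    by (rule compactE_image[OF comp _ cover]) auto
  define \<delta> where "\<delta> = Min (insert 1 ((\<lambda>x. \<rho> x / 2) ` D))"
  define c0 where "c0 = Max (insert 1 (c ` D))"
  have \<delta>: "\<delta> > 0"
    unfolding \<delta>_def using D \<rho> by (auto simp: Min_gr_iff)
  have \<delta>': "\<delta> \<le> \<rho> x / 2" if "x \<in> D" for x
    unfolding \<delta>_def using D that by (intro Min_le) auto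
  note \<delta> = \<delta> \<delta>'
  have c0: "c0 \<ge> 1" "\<And>x. x \<in> D \<Longrightarrow> c x \<le> c0"
    unfolding c0_def using D by auto
  have path: "three_segment_path \<Omega> c0 y z" if yz: "y \<in> closure \<Omega>" "z \<in> closure \<Omega>" "dist y z < \<delta>" "y \<noteq> z" for y z
  proof -
    obtain x where x: "x \<in> D" "dist x y < \<rho> x / 2"
      using D(3) yz(1) by auto
    have "dist x z < \<rho> x"
      using dist_triangle[of x z y] x \<delta>(2)[OF x(1)] yz(3) by linarith
    moreover have "dist x y < \<rho> x"
      using x \<rho>[of x] D by (auto simp: subset_iff)
    ultimately have "three_segment_path \<Omega> (c x) y z"
      using yz x D by (intro c) auto
    then show ?thesis
      using c0(2)[OF x(1)] by (rule three_segment_path_mono)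
  qed
  show thesis
  proof (rule that[OF \<delta>(1), of "3 * c0"])
    show "1 \<le> 3 * c0" using c0 by simp
    fix f :: "real^2 \<Rightarrow> real" and f' M y z
    assume y: "y \<in> closure \<Omega>" and z: "z \<in> closure \<Omega>" and d: "dist y z < \<delta>" and M: "0 \<le> M"
      and cf: "continuous_on (closure \<Omega>) f" and f': "\<And>p. p \<in> \<Omega> \<Longrightarrow> (f has_derivative f' p) (at p)"
      and b: "\<And>p v. p \<in> \<Omega> \<Longrightarrow> dist y p \<le> 3 * c0 * dist y z \<Longrightarrow> \<bar>f' p v\<bar> \<le> M * norm v"
    show "\<bar>f z - f y\<bar> \<le> M * (3 * c0) * dist y z"
    proof (cases "y = z")
      case False
      obtain w1 w2 where s: "open_segment y w1 \<subseteq> \<Omega>" "closed_segment w1 w2 \<subseteq> \<Omega> \<union> {y, z}" "open_segment w1 w2 \<subseteq> \<Omega>" "open_segment z w2 \<subseteq> \<Omega>"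
        and n: "dist y w1 \<le> c0 * dist y z" "dist w1 w2 \<le> c0 * dist y z" "dist z w2 \<le> c0 * dist y z"
        using path[OF y z d False] unfolding three_segment_path_def by blast
      have "w1 \<in> closure \<Omega>" "w2 \<in> closure \<Omega>"
        using s(2) y z closure_subset[of \<Omega>] by auto
      have seg: "\<bar>f b - f a\<bar> \<le> M * dist a b"
        if ab: "open_segment a b \<subseteq> \<Omega>" "a \<in> closure \<Omega>" "b \<in> closure \<Omega>" "dist y a + dist a b \<le> 3 * c0 * dist y z" for a b
      proof (rule segment_mean_value)
        have "closed_segment a b \<subseteq> closure \<Omega>"
          using ab closure_subset[of \<Omega>] by (auto simp: closed_segment_eq_open)
        then show "continuous_on (closed_segment a b) f"
          by (rule continuous_on_subset[OF cf])
        show "(f has_derivative f' p) (at p)" if "p \<in> open_segment a b" for p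
          using that ab f' by auto
        show "\<bar>f' p v\<bar> \<le> M * norm v" if p: "p \<in> open_segment a b" for p v
        proof (rule b)
          show "p \<in> \<Omega>" using p ab by auto
          have "dist a p \<le> dist a b"
            using p segment_open_subset_closed[of a b] dist_in_closed_segment[of p a b] by (auto simp: dist_commute)
          then show "dist y p \<le> 3 * c0 * dist y z"
            using dist_triangle[of y p a] ab(4) by linarith
        qed
      qed
      have dyz: "dist y z \<le> c0 * dist y z"
        using c0(1) mult_right_mono[of 1 c0 "dist y z"] by simp
      have c0d: "0 \<le> c0 * dist y z" "3 * c0 * dist y z = 3 * (c0 * dist y z)"
        using c0(1) by simp_all
      have "\<bar>f w1 - f y\<bar> \<le> M * dist y w1"
        using s y \<open>w1 \<in> closure \<Omega>\<close> n dyz c0d by (intro seg) auto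
      moreover have "\<bar>f w2 - f w1\<bar> \<le> M * dist w1 w2"
        using s \<open>w1 \<in> closure \<Omega>\<close> \<open>w2 \<in> closure \<Omega>\<close> n dyz c0d by (intro seg) auto
      moreover have "\<bar>f w2 - f z\<bar> \<le> M * dist z w2"
        using s z \<open>w2 \<in> closure \<Omega>\<close> n dyz c0d by (intro seg) auto
      moreover have "M * dist y w1 \<le> M * (c0 * dist y z)" "M * dist w1 w2 \<le> M * (c0 * dist y z)" "M * dist z w2 \<le> M * (c0 * dist y z)"
        using n M by (auto intro: mult_left_mono)
      ultimately have "\<bar>f z - f y\<bar> \<le> 3 * (M * (c0 * dist y z))"
        by linarith
      then show ?thesis by (simp add: mult_ac)
    qed auto
  qed
qed

lemma lipschitz_on_closure:
  fixes \<Omega> :: "(real^2) set" and G :: "real^2 \<Rightarrow> real^2"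
  assumes \<Omega>: "open \<Omega>" "bounded \<Omega>" "C2_boundary \<Omega>"
    and cf: "continuous_on (closure \<Omega>) f" and f': "\<And>p. p \<in> \<Omega> \<Longrightarrow> (f has_derivative (\<lambda>v. G p \<bullet> v)) (at p)"
    and G: "continuous_on (closure \<Omega>) G"
  obtains L where "\<And>y z. y \<in> closure \<Omega> \<Longrightarrow> z \<in> closure \<Omega> \<Longrightarrow> \<bar>f z - f y\<bar> \<le> L * dist y z"
proof -
  obtain \<delta> c where \<delta>: "\<delta> > 0" "c \<ge> 1" and mv:
    "\<And>f f' M y z. y \<in> closure \<Omega> \<Longrightarrow> z \<in> closure \<Omega> \<Longrightarrow> dist y z < \<delta> \<Longrightarrow> 0 \<le> M \<Longrightarrow>
       continuous_on (closure \<Omega>) f \<Longrightarrow> (\<And>p. p \<in> \<Omega> \<Longrightarrow> (f has_derivative f' p) (at p)) \<Longrightarrow>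
       (\<And>p v. p \<in> \<Omega> \<Longrightarrow> dist y p \<le> c * dist y z \<Longrightarrow> \<bar>f' p v\<bar> \<le> M * norm v) \<Longrightarrow>
       \<bar>f z - f y\<bar> \<le> M * c * dist y z"
    using C2_domain_mean_value[OF \<Omega>] by metis
  have comp: "compact (closure \<Omega>)" using \<Omega> by (simp add: compact_closure)
  have "bounded (f ` closure \<Omega>)" "bounded (G ` closure \<Omega>)"
    using comp cf G by (auto intro!: compact_imp_bounded compact_continuous_image)
  then obtain F B where "\<And>p. p \<in> closure \<Omega> \<Longrightarrow> \<bar>f p\<bar> \<le> F" and B0: "\<And>p. p \<in> closure \<Omega> \<Longrightarrow> norm (G p) \<le> B"
    unfolding bounded_iff by (metis imageI real_norm_def)
  then have F: "\<And>p. p \<in> closure \<Omega> \<Longrightarrow> \<bar>f p\<bar> \<le> max 0 F" and B: "\<And>p. p \<in> closure \<Omega> \<Longrightarrow> norm (G p) \<le> max 0 B"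
    by (auto simp: le_max_iff_disj)
  show thesis
  proof (rule that[of "max (max 0 B * c) (2 * max 0 F / \<delta>)"])
    fix y z assume y: "y \<in> closure \<Omega>" and z: "z \<in> closure \<Omega>"
    show "\<bar>f z - f y\<bar> \<le> max (max 0 B * c) (2 * max 0 F / \<delta>) * dist y z"
    proof (cases "dist y z < \<delta>")
      case True
      have "\<bar>f z - f y\<bar> \<le> max 0 B * c * dist y z"
      proof (rule mv[OF y z True _ cf f'])
        fix p v assume "p \<in> \<Omega>"
        then have "norm (G p) \<le> max 0 B" using B closure_subset by blast
        then show "\<bar>G p \<bullet> v\<bar> \<le> max 0 B * norm v"
          using Cauchy_Schwarz_ineq2[of "G p" v] mult_right_mono[of "norm (G p)" "max 0 B" "norm v"]
          by (meson norm_ge_zero order_trans)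
      qed auto
      also have "\<dots> \<le> max (max 0 B * c) (2 * max 0 F / \<delta>) * dist y z"
        by (intro mult_right_mono) auto
      finally show ?thesis .
    next
      case False
      have "\<bar>f z - f y\<bar> \<le> 2 * max 0 F"
        using F[OF y] F[OF z] by linarith
      also have "\<dots> \<le> 2 * max 0 F / \<delta> * dist y z"
        using mult_left_mono[of \<delta> "dist y z" "2 * max 0 F"] False \<delta> by (simp add: field_simps)
      also have "\<dots> \<le> max (max 0 B * c) (2 * max 0 F / \<delta>) * dist y z"
        by (intro mult_right_mono) auto
      finally show ?thesis .
    qed
  qed
qed

text \<open>The mean value inequality is applied to \<open>f\<close> minus its linear part at \<open>y\<close>; distant points are
  handled by the boundedness of \<open>f\<close> and \<open>G\<close>.\<close>

lemma taylor_on_closure: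
  fixes \<Omega> :: "(real^2) set" and G :: "real^2 \<Rightarrow> real^2"
  assumes \<Omega>: "open \<Omega>" "bounded \<Omega>" "C2_boundary \<Omega>"
    and cf: "continuous_on (closure \<Omega>) f" and f': "\<And>p. p \<in> \<Omega> \<Longrightarrow> (f has_derivative (\<lambda>v. G p \<bullet> v)) (at p)"
    and G: "\<And>y z. y \<in> closure \<Omega> \<Longrightarrow> z \<in> closure \<Omega> \<Longrightarrow> norm (G z - G y) \<le> L * dist y z" "L \<ge> 0"
  obtains C where "\<And>y z. y \<in> closure \<Omega> \<Longrightarrow> z \<in> closure \<Omega> \<Longrightarrow> \<bar>f z - f y - G y \<bullet> (z - y)\<bar> \<le> C * (dist y z)\<^sup>2"
proof -
  obtain \<delta> c where \<delta>: "\<delta> > 0" "c \<ge> 1" and mv: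
    "\<And>f f' M y z. y \<in> closure \<Omega> \<Longrightarrow> z \<in> closure \<Omega> \<Longrightarrow> dist y z < \<delta> \<Longrightarrow> 0 \<le> M \<Longrightarrow>
       continuous_on (closure \<Omega>) f \<Longrightarrow> (\<And>p. p \<in> \<Omega> \<Longrightarrow> (f has_derivative f' p) (at p)) \<Longrightarrow>
       (\<And>p v. p \<in> \<Omega> \<Longrightarrow> dist y p \<le> c * dist y z \<Longrightarrow> \<bar>f' p v\<bar> \<le> M * norm v) \<Longrightarrow>
       \<bar>f z - f y\<bar> \<le> M * c * dist y z"
    using C2_domain_mean_value[OF \<Omega>] by metis
  have comp: "compact (closure \<Omega>)" using \<Omega> by (simp add: compact_closure)
  have contG: "continuous_on (closure \<Omega>) G"
    using G by (intro lipschitz_on_continuous_on[where L = L]) (auto simp: lipschitz_on_def dist_norm norm_minus_commute)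
  have "bounded (f ` closure \<Omega>)" "bounded (G ` closure \<Omega>)"
    using comp cf contG by (auto intro!: compact_imp_bounded compact_continuous_image)
  then obtain F B where "\<And>p. p \<in> closure \<Omega> \<Longrightarrow> \<bar>f p\<bar> \<le> F" and B0: "\<And>p. p \<in> closure \<Omega> \<Longrightarrow> norm (G p) \<le> B"
    unfolding bounded_iff by (metis imageI real_norm_def)
  then have F: "\<And>p. p \<in> closure \<Omega> \<Longrightarrow> \<bar>f p\<bar> \<le> max 0 F" and B: "\<And>p. p \<in> closure \<Omega> \<Longrightarrow> norm (G p) \<le> max 0 B"
    by (auto simp: le_max_iff_disj)
  define C where "C = max (L * c * c) (2 * max 0 F / \<delta>\<^sup>2 + max 0 B / \<delta>)"
  show thesis
  proof (rule that[of C])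
    fix y z assume y: "y \<in> closure \<Omega>" and z: "z \<in> closure \<Omega>"
    show "\<bar>f z - f y - G y \<bullet> (z - y)\<bar> \<le> C * (dist y z)\<^sup>2"
    proof (cases "dist y z < \<delta>")
      case True
      define g where "g x = f x - G y \<bullet> x" for x
      have "\<bar>g z - g y\<bar> \<le> (L * (c * dist y z)) * c * dist y z"
      proof (rule mv[OF y z True])
        show "0 \<le> L * (c * dist y z)" using G(2) \<delta> by simp
        show "continuous_on (closure \<Omega>) g" unfolding g_def by (intro continuous_intros cf)
        show "(g has_derivative (\<lambda>v. (G p - G y) \<bullet> v)) (at p)" if "p \<in> \<Omega>" for p
          unfolding g_def inner_diff_left by (intro derivative_intros f'[OF that])
        fix p v assume p: "p \<in> \<Omega>" "dist y p \<le> c * dist y z"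
        have "norm (G p - G y) \<le> L * dist y p" using G(1)[OF y, of p] p closure_subset by blast
        also have "\<dots> \<le> L * (c * dist y z)" using p G(2) by (intro mult_left_mono)
        finally show "\<bar>(G p - G y) \<bullet> v\<bar> \<le> L * (c * dist y z) * norm v"
          using Cauchy_Schwarz_ineq2[of "G p - G y" v] mult_right_mono[of "norm (G p - G y)" "L * (c * dist y z)" "norm v"]
          by (meson norm_ge_zero order_trans)
      qed
      also have "\<dots> = L * c * c * (dist y z)\<^sup>2" by (simp add: power2_eq_square mult_ac)
      also have "\<dots> \<le> C * (dist y z)\<^sup>2"
        unfolding C_def by (intro mult_right_mono) auto
      finally show ?thesis by (simp add: g_def inner_diff_right algebra_simps)
    next
      case False
      define t where "t = dist y z / \<delta>"
      have t: "t \<ge> 1" using False \<delta> by (simp add: t_def)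
      have "\<bar>G y \<bullet> (z - y)\<bar> \<le> max 0 B * dist y z"
        using Cauchy_Schwarz_ineq2[of "G y" "z - y"] mult_right_mono[OF B[OF y], of "norm (z - y)"]
        by (simp add: dist_norm norm_minus_commute)
      then have "\<bar>f z - f y - G y \<bullet> (z - y)\<bar> \<le> 2 * max 0 F + max 0 B * dist y z"
        using F[OF y] F[OF z] by linarith
      also have "\<dots> \<le> 2 * max 0 F * t\<^sup>2 + max 0 B * dist y z * t"
        using t mult_left_mono[of 1 "t\<^sup>2" "2 * max 0 F"] mult_left_mono[of 1 t "max 0 B * dist y z"]
        by (intro add_mono) (auto simp: one_le_power)
      also have "\<dots> = (2 * max 0 F / \<delta>\<^sup>2 + max 0 B / \<delta>) * (dist y z)\<^sup>2"
        by (simp add: t_def power_divide power2_eq_square algebra_simps)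
      also have "\<dots> \<le> C * (dist y z)\<^sup>2"
        unfolding C_def by (intro mult_right_mono) auto
      finally show ?thesis .
    qed
  qed
qed

section \<open>Derivatives up to the boundary\<close>

text \<open>Both mixed derivatives are the limit of the symmetric second difference \<open>\<Delta> a b t / t\<^sup>2\<close>.\<close>

lemma schwarz_mixed_partials:
  fixes F :: "'a::real_normed_vector \<Rightarrow> real"
  assumes "open \<Omega>" "x \<in> \<Omega>" and F: "\<And>p. p \<in> \<Omega> \<Longrightarrow> F differentiable (at p)"
    and A: "(\<lambda>p. frechet_derivative F (at p) a) differentiable (at x)"
    and B: "(\<lambda>p. frechet_derivative F (at p) b) differentiable (at x)"
  shows "frechet_derivative (\<lambda>p. frechet_derivative F (at p) a) (at x) b
       = frechet_derivative (\<lambda>p. frechet_derivative F (at p) b) (at x) a"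
proof -
  define \<Delta> where "\<Delta> a b t = F (x + t *\<^sub>R a + t *\<^sub>R b) - F (x + t *\<^sub>R a) - F (x + t *\<^sub>R b) + F x" for a b t
  have key: "\<exists>d>0. \<forall>t. 0 < t \<longrightarrow> t < d \<longrightarrow>
      \<bar>\<Delta> a b t - t\<^sup>2 * frechet_derivative (\<lambda>p. frechet_derivative F (at p) a) (at x) b\<bar> \<le> e * t\<^sup>2"
    if A: "(\<lambda>p. frechet_derivative F (at p) a) differentiable (at x)" and "e > 0" for a b e
  proof -
    define f where "f p = frechet_derivative F (at p) a" for p
    define f' where "f' = frechet_derivative f (at x)"
    have f': "(f has_derivative f') (at x)"
      using A frechet_derivative_works unfolding f_def[abs_def] f'_def by blast
    have lin: "linear f'" using f' has_derivative_linear by blast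
    define N where "N = norm a + norm b + 1"
    have N: "N > 0" by (simp add: N_def add_nonneg_pos)
    have "\<forall>e>0. \<exists>d>0. \<forall>y. norm (y - x) < d \<longrightarrow> norm (f y - f x - f' (y - x)) \<le> e * norm (y - x)"
      using f' unfolding has_derivative_at_alt by blast
    then obtain d1 where d1: "d1 > 0" "\<And>y. norm (y - x) < d1 \<Longrightarrow> norm (f y - f x - f' (y - x)) \<le> e / (2 * N) * norm (y - x)"
    proof -
      have "e / (2 * N) > 0" using \<open>e > 0\<close> N by simp
      with \<open>\<forall>e>0. _\<close> show thesis using that by blast
    qed
    obtain d2 where d2: "d2 > 0" "ball x d2 \<subseteq> \<Omega>"
      using assms(1,2) openE by blast
    define d where "d = min d1 d2 / N"
    have "d > 0" using d1 d2 N by (simp add: d_def)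
    moreover have "\<bar>\<Delta> a b t - t\<^sup>2 * f' b\<bar> \<le> e * t\<^sup>2" if t: "0 < t" "t < d" for t
    proof -
      have tN: "t * N < d1" "t * N < d2"
        using t N by (simp_all add: d_def pos_less_divide_eq)
      have nrm: "norm (s *\<^sub>R a + r *\<^sub>R b) \<le> t * N" if "0 \<le> s" "s \<le> t" "0 \<le> r" "r \<le> t" for s r
      proof -
        have "norm (s *\<^sub>R a + r *\<^sub>R b) \<le> s * norm a + r * norm b"
          using norm_triangle_ineq[of "s *\<^sub>R a" "r *\<^sub>R b"] that by simp
        also have "\<dots> \<le> t * norm a + t * norm b"
          using that by (intro add_mono mult_right_mono) auto
        also have "\<dots> \<le> t * N" using t by (simp add: N_def algebra_simps)
        finally show ?thesis .
      qed
      have inO: "x + (s *\<^sub>R a + r *\<^sub>R b) \<in> \<Omega>" if "0 \<le> s" "s \<le> t" "0 \<le> r" "r \<le> t" for s r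
      proof -
        have "x + (s *\<^sub>R a + r *\<^sub>R b) \<in> ball x d2"
          using nrm[OF that] tN dist_commute[of x "x + (s *\<^sub>R a + r *\<^sub>R b)"] by (simp add: dist_norm)
        then show ?thesis using d2 by blast
      qed
      define \<phi> where "\<phi> s = F (x + (s *\<^sub>R a + t *\<^sub>R b)) - F (x + (s *\<^sub>R a + 0 *\<^sub>R b))" for s
      have Fd: "((\<lambda>s. F (x + (s *\<^sub>R a + r *\<^sub>R b))) has_derivative (\<lambda>u. u * f (x + (s *\<^sub>R a + r *\<^sub>R b)))) (at s)"
        if "0 \<le> s" "s \<le> t" "0 \<le> r" "r \<le> t" for s r
      proof -
        have D: "(F has_derivative frechet_derivative F (at (x + (s *\<^sub>R a + r *\<^sub>R b)))) (at (x + (s *\<^sub>R a + r *\<^sub>R b)))"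
          using F[OF inO[OF that]] frechet_derivative_works by blast
        have "((\<lambda>s. x + (s *\<^sub>R a + r *\<^sub>R b)) has_derivative (\<lambda>u. u *\<^sub>R a)) (at s)"
          by (auto intro!: derivative_eq_intros)
        from diff_chain_at[OF this D] show ?thesis
          using linear_scale[OF has_derivative_linear[OF D]] by (simp add: o_def f_def)
      qed
      have \<phi>': "(\<phi> has_derivative (\<lambda>u. u * f (x + (s *\<^sub>R a + t *\<^sub>R b)) - u * f (x + (s *\<^sub>R a + 0 *\<^sub>R b)))) (at s)"
        if "0 \<le> s" "s \<le> t" for s
        unfolding \<phi>_def using that t by (intro has_derivative_diff Fd) auto
      have "continuous_on {0..t} \<phi>"
        by (intro continuous_at_imp_continuous_on ballI has_derivative_continuous[OF \<phi>']) auto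
      then obtain s where s: "0 < s" "s < t" 
        "\<phi> t - \<phi> 0 = (t - 0) * f (x + (s *\<^sub>R a + t *\<^sub>R b)) - (t - 0) * f (x + (s *\<^sub>R a + 0 *\<^sub>R b))"
        using mvt[OF t(1), of \<phi> "\<lambda>s u. u * f (x + (s *\<^sub>R a + t *\<^sub>R b)) - u * f (x + (s *\<^sub>R a + 0 *\<^sub>R b))"] \<phi>' by auto
      define w where "w r = s *\<^sub>R a + r *\<^sub>R b" for r
      have \<Delta>: "\<Delta> a b t = t * (f (x + w t) - f (x + w 0))"
        using s(3) by (simp add: \<Delta>_def \<phi>_def w_def algebra_simps)
      have rem: "\<bar>f (x + w r) - f x - f' (w r)\<bar> \<le> e / 2 * t" if "0 \<le> r" "r \<le> t" for r
      proof -
        have nw: "norm (w r) \<le> t * N" using nrm[of s r] s that by (simp add: w_def)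
        then have "norm (f (x + w r) - f x - f' (w r)) \<le> e / (2 * N) * norm (w r)"
          using d1(2)[of "x + w r"] tN by simp
        also have "\<dots> \<le> e / (2 * N) * (t * N)"
          using nw N \<open>e > 0\<close> by (intro mult_left_mono) auto
        also have "\<dots> = e / 2 * t" using N by simp
        finally show ?thesis by simp
      qed
      have fw: "f' (w t) - f' (w 0) = t * f' b"
        by (simp add: w_def linear_add[OF lin] linear_scale[OF lin] flip: linear_diff[OF lin])
      have "\<Delta> a b t - t\<^sup>2 * f' b = t * ((f (x + w t) - f x - f' (w t)) - (f (x + w 0) - f x - f' (w 0)))"
        using fw unfolding \<Delta> by (simp add: power2_eq_square algebra_simps)
      also have "\<bar>\<dots>\<bar> \<le> t * (e * t)"
      proof -
        have "\<bar>(f (x + w t) - f x - f' (w t)) - (f (x + w 0) - f x - f' (w 0))\<bar> \<le> e / 2 * t + e / 2 * t"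
          using rem[of t] rem[of 0] t by linarith
        then show ?thesis
          unfolding abs_mult using t by (intro mult_mono) auto
      qed
      finally show ?thesis by (simp add: power2_eq_square mult_ac)
    qed
    ultimately show ?thesis
      unfolding f'_def f_def by blast
  qed
  have sym: "\<Delta> a b t = \<Delta> b a t" for t
    by (simp add: \<Delta>_def algebra_simps)
  let ?p = "frechet_derivative (\<lambda>p. frechet_derivative F (at p) a) (at x) b"
  let ?q = "frechet_derivative (\<lambda>p. frechet_derivative F (at p) b) (at x) a"
  have "\<bar>?p - ?q\<bar> \<le> 0 + e" if "e > 0" for e
  proof -
    have "e / 2 > 0" using that by simp
    from key[OF A this, of b] key[OF B this, of a] obtain d1 d2 where d: "d1 > 0" "d2 > 0"
      "\<And>t. 0 < t \<Longrightarrow> t < d1 \<Longrightarrow> \<bar>\<Delta> a b t - t\<^sup>2 * ?p\<bar> \<le> e / 2 * t\<^sup>2"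
      "\<And>t. 0 < t \<Longrightarrow> t < d2 \<Longrightarrow> \<bar>\<Delta> b a t - t\<^sup>2 * ?q\<bar> \<le> e / 2 * t\<^sup>2"
      by blast
    define t where "t = min d1 d2 / 2"
    have t: "0 < t" "t < d1" "t < d2" using d by (auto simp: t_def)
    have "\<bar>t\<^sup>2 * ?p - t\<^sup>2 * ?q\<bar> \<le> e / 2 * t\<^sup>2 + e / 2 * t\<^sup>2"
      using d(3)[OF t(1,2)] d(4)[OF t(1,3)] sym[of t] by linarith
    then have "t\<^sup>2 * \<bar>?p - ?q\<bar> \<le> t\<^sup>2 * e"
      by (simp add: abs_mult flip: right_diff_distrib) (simp add: algebra_simps)
    then show ?thesis using t by simp
  qed
  then have "\<bar>?p - ?q\<bar> \<le> 0" by (rule field_le_epsilon)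
  then show ?thesis by simp
qed


lemma linear_eq_inner_partials:
  fixes f' :: "real^2 \<Rightarrow> real"
  assumes "linear f'"
  shows "f' v = (\<chi> i. f' (axis i 1)) \<bullet> v"
proof -
  have "f' v = f' (\<Sum>i\<in>UNIV. (v $ i) *\<^sub>R axis i 1)"
    using basis_expansion[of v] by (simp add: scalar_mult_eq_scaleR)
  also have "\<dots> = (\<Sum>i\<in>UNIV. v $ i * f' (axis i 1))"
    by (simp add: linear_sum[OF assms] linear_scale[OF assms])
  finally show ?thesis by (simp add: inner_vec_def mult.commute)
qed

text \<open>For \<open>f\<close> smooth up to the boundary, \<open>partial_closure \<Omega> is f\<close> is the continuous extension of an
  iterated partial derivative to the closure of \<open>\<Omega>\<close>.\<close>

locale smooth_closure =
  fixes \<Omega> :: "(real^2) set" and f :: "real^2 \<Rightarrow> real"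
  assumes op: "open \<Omega>" and smooth: "smooth_upto_boundary \<Omega> f"
begin

abbreviation P :: "2 list \<Rightarrow> real^2 \<Rightarrow> real" where
  "P is \<equiv> partial_closure \<Omega> is f"

lemma iter_differentiable: "p \<in> \<Omega> \<Longrightarrow> iter_partial is f differentiable (at p)"
  using smooth op unfolding smooth_upto_boundary_def smooth_in_def differentiable_on_def
  by (metis at_within_open)

lemma P_interior: "p \<in> \<Omega> \<Longrightarrow> P is p = iter_partial is f p"
  by (simp add: partial_closure_def)

lemma P_eq_extension:
  assumes "continuous_on (closure \<Omega>) g" "\<And>x. x \<in> \<Omega> \<Longrightarrow> g x = iter_partial is f x" "x \<in> closure \<Omega>"
  shows "P is x = g x"
proof (cases "x \<in> \<Omega>")
  case False
  then have "x islimpt \<Omega>" using assms(3) by (auto simp: closure_def)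
  then have nt: "at x within \<Omega> \<noteq> bot" by (simp add: trivial_limit_within)
  have "(g \<longlongrightarrow> g x) (at x within \<Omega>)"
    using assms(1,3) closure_subset by (meson continuous_on_def tendsto_within_subset)
  moreover have "\<forall>\<^sub>F y in at x within \<Omega>. g y = iter_partial is f y"
    using assms(2) by (simp add: eventually_at_filter)
  ultimately have "(iter_partial is f \<longlongrightarrow> g x) (at x within \<Omega>)"
    by (rule Lim_transform_eventually)
  then show ?thesis
    using False nt by (simp add: partial_closure_def tendsto_Lim)
qed (use assms in \<open>simp add: P_interior\<close>)

lemma P_continuous: "continuous_on (closure \<Omega>) (P is)"
proof -
  obtain g where g: "continuous_on (closure \<Omega>) g" "\<And>x. x \<in> \<Omega> \<Longrightarrow> g x = iter_partial is f x"
    using smooth unfolding smooth_upto_boundary_def by metis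
  show ?thesis
    by (rule continuous_on_eq[OF g(1)]) (rule P_eq_extension[OF g, symmetric])
qed

lemma P_Nil: "x \<in> closure \<Omega> \<Longrightarrow> P [] x = f x"
  using smooth unfolding smooth_upto_boundary_def by (intro P_eq_extension) auto

lemma P_tendsto:
  assumes "x \<in> closure \<Omega>"
  shows "(iter_partial is f \<longlongrightarrow> P is x) (at x within \<Omega>)"
proof -
  have "(P is \<longlongrightarrow> P is x) (at x within \<Omega>)"
    using P_continuous assms closure_subset by (meson continuous_on_def tendsto_within_subset)
  moreover have "\<forall>\<^sub>F y in at x within \<Omega>. P is y = iter_partial is f y"
    by (simp add: eventually_at_filter P_interior)
  ultimately show ?thesis by (rule Lim_transform_eventually)
qed

lemma iter_has_derivative:
  assumes "p \<in> \<Omega>"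
  shows "(iter_partial is f has_derivative (\<lambda>v. (\<chi> i. P (i # is) p) \<bullet> v)) (at p)"
proof -
  have D: "(iter_partial is f has_derivative frechet_derivative (iter_partial is f) (at p)) (at p)"
    using iter_differentiable[OF assms] frechet_derivative_works by blast
  have "(\<chi> i. P (i # is) p) = (\<chi> i. frechet_derivative (iter_partial is f) (at p) (axis i 1))"
    using assms by (simp add: P_interior)
  then have "frechet_derivative (iter_partial is f) (at p) = (\<lambda>v. (\<chi> i. P (i # is) p) \<bullet> v)"
    using linear_eq_inner_partials[OF has_derivative_linear[OF D]] by (intro ext) metis
  with D show ?thesis by metis
qed

lemma P_has_derivative:
  assumes "p \<in> \<Omega>"
  shows "(P is has_derivative (\<lambda>v. (\<chi> i. P (i # is) p) \<bullet> v)) (at p)"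
  by (rule has_derivative_transform_within_open[OF iter_has_derivative[OF assms] op assms])
    (simp add: P_interior)

lemma P_symmetric:
  assumes "x \<in> closure \<Omega>"
  shows "P (i # j # is) x = P (j # i # is) x"
proof -
  have "P (i # j # is) x = P (j # i # is) x" if x: "x \<in> \<Omega>" for x
  proof -
    have d: "iter_partial (k # is) f differentiable (at x)" for k
      by (rule iter_differentiable[OF x])
    show ?thesis
      using schwarz_mixed_partials[OF op x iter_differentiable, of "is" "axis j 1" "axis i 1"] d[of i] d[of j] x
      by (simp add: P_interior)
  qed
  then have "P (i # j # is) x - P (j # i # is) x = 0"
    by (intro continuous_constant_on_closure[OF _ _ assms, where f = "\<lambda>x. P (i # j # is) x - P (j # i # is) x"]
        continuous_on_diff P_continuous) simp
  then show ?thesis by simp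
qed

lemma P_bounded:
  assumes "bounded \<Omega>"
  obtains C where "\<And>x. x \<in> closure \<Omega> \<Longrightarrow> \<bar>P is x\<bar> \<le> C"
proof -
  have "bounded (P is ` closure \<Omega>)"
    using assms by (intro compact_imp_bounded compact_continuous_image P_continuous) (simp add: compact_closure)
  then show thesis using that unfolding bounded_iff by auto
qed

lemma gradient_continuous: "continuous_on (closure \<Omega>) (\<lambda>p. \<chi> i. P (i # is) p)"
  by (intro continuous_on_vec_lambda P_continuous)

lemma P_lipschitz:
  assumes "bounded \<Omega>" "C2_boundary \<Omega>"
  obtains L where "L \<ge> 0" "\<And>y z. y \<in> closure \<Omega> \<Longrightarrow> z \<in> closure \<Omega> \<Longrightarrow> \<bar>P is z - P is y\<bar> \<le> L * dist y z"
proof -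
  obtain L where L: "\<And>y z. y \<in> closure \<Omega> \<Longrightarrow> z \<in> closure \<Omega> \<Longrightarrow> \<bar>P is z - P is y\<bar> \<le> L * dist y z"
    using lipschitz_on_closure[OF op assms P_continuous P_has_derivative gradient_continuous] by blast
  show thesis
  proof (rule that[of "max 0 L"])
    fix y z assume yz: "y \<in> closure \<Omega>" "z \<in> closure \<Omega>"
    have "L * dist y z \<le> max 0 L * dist y z" by (intro mult_right_mono) auto
    then show "\<bar>P is z - P is y\<bar> \<le> max 0 L * dist y z" using L[OF yz] by linarith
  qed simp
qed

lemma P_taylor:
  assumes "bounded \<Omega>" "C2_boundary \<Omega>"
  obtains C where "C \<ge> 0" "\<And>y z. y \<in> closure \<Omega> \<Longrightarrow> z \<in> closure \<Omega> \<Longrightarrow>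
    \<bar>P is z - P is y - (\<Sum>i\<in>UNIV. P (i # is) y * (z - y) $ i)\<bar> \<le> C * (dist y z)\<^sup>2"
proof -
  obtain L1 L2 where L: "L1 \<ge> 0" "L2 \<ge> 0"
    "\<And>y z. y \<in> closure \<Omega> \<Longrightarrow> z \<in> closure \<Omega> \<Longrightarrow> \<bar>P (1 # is) z - P (1 # is) y\<bar> \<le> L1 * dist y z"
    "\<And>y z. y \<in> closure \<Omega> \<Longrightarrow> z \<in> closure \<Omega> \<Longrightarrow> \<bar>P (2 # is) z - P (2 # is) y\<bar> \<le> L2 * dist y z"
    by (rule P_lipschitz[OF assms, of "1 # is"], rule P_lipschitz[OF assms, of "2 # is"]) blast
  have G: "norm ((\<chi> i. P (i # is) z) - (\<chi> i. P (i # is) y)) \<le> (L1 + L2) * dist y z"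
    if "y \<in> closure \<Omega>" "z \<in> closure \<Omega>" for y z
  proof -
    have "norm ((\<chi> i. P (i # is) z) - (\<chi> i. P (i # is) y)) \<le> \<bar>P (1 # is) z - P (1 # is) y\<bar> + \<bar>P (2 # is) z - P (2 # is) y\<bar>"
      using norm_le_l1_cart[of "(\<chi> i. P (i # is) z) - (\<chi> i. P (i # is) y)"] by (simp add: sum_2)
    then show ?thesis using L(3,4)[OF that] by (simp add: algebra_simps)
  qed
  have "L1 + L2 \<ge> 0" using L by simp
  obtain C where C: "\<And>y z. y \<in> closure \<Omega> \<Longrightarrow> z \<in> closure \<Omega> \<Longrightarrow>
      \<bar>P is z - P is y - (\<chi> i. P (i # is) y) \<bullet> (z - y)\<bar> \<le> C * (dist y z)\<^sup>2"
    using taylor_on_closure[OF op assms P_continuous P_has_derivative G \<open>L1 + L2 \<ge> 0\<close>] by blast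
  show thesis
  proof (rule that[of "max 0 C"])
    fix y z assume yz: "y \<in> closure \<Omega>" "z \<in> closure \<Omega>"
    have "C * (dist y z)\<^sup>2 \<le> max 0 C * (dist y z)\<^sup>2" by (intro mult_right_mono) auto
    then show "\<bar>P is z - P is y - (\<Sum>i\<in>UNIV. P (i # is) y * (z - y) $ i)\<bar> \<le> max 0 C * (dist y z)\<^sup>2"
      using C[OF yz] by (simp add: inner_vec_def)
  qed simp
qed

end

lemma partial_closure_stream:
  fixes h :: "'n::finite \<Rightarrow> real^2 \<Rightarrow> real"
  assumes op: "open \<Omega>" and h: "\<And>k. smooth_upto_boundary \<Omega> (h k)" and x: "x \<in> closure \<Omega>"
  shows "partial_closure \<Omega> is (stream h u t) x = (\<Sum>k\<in>UNIV. u t $ k * partial_closure \<Omega> is (h k) x)"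
proof -
  interpret smooth_closure \<Omega> "h k" for k
    using op h by unfold_locales
  have iter: "iter_partial is (stream h u t) p = (\<Sum>k\<in>UNIV. u t $ k * iter_partial is (h k) p)" if "p \<in> \<Omega>" for p
    using that
  proof (induction "is" arbitrary: p)
    case Nil
    then show ?case by (simp add: stream_def)
  next
    case (Cons i js)
    have D: "((\<lambda>p. \<Sum>k\<in>UNIV. u t $ k * iter_partial js (h k) p) has_derivative
        (\<lambda>v. \<Sum>k\<in>UNIV. u t $ k * frechet_derivative (iter_partial js (h k)) (at p) v)) (at p)"
      by (intro has_derivative_sum has_derivative_mult_right)
        (use iter_differentiable[OF Cons.prems] frechet_derivative_works in blast)
    have "(iter_partial js (stream h u t) has_derivative
        (\<lambda>v. \<Sum>k\<in>UNIV. u t $ k * frechet_derivative (iter_partial js (h k)) (at p) v)) (at p)"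
      by (rule has_derivative_transform_within_open[OF D op Cons.prems]) (simp add: Cons.IH)
    from frechet_derivative_at[OF this] show ?case
      by (simp add: fun_eq_iff)
  qed
  show ?thesis
  proof (cases "x \<in> \<Omega>")
    case True
    then show ?thesis by (simp add: partial_closure_def iter)
  next
    case False
    then have "x islimpt \<Omega>" using x by (auto simp: closure_def)
    then have nt: "at x within \<Omega> \<noteq> bot" by (simp add: trivial_limit_within)
    have "((\<lambda>p. \<Sum>k\<in>UNIV. u t $ k * iter_partial is (h k) p) \<longlongrightarrow>
        (\<Sum>k\<in>UNIV. u t $ k * partial_closure \<Omega> is (h k) x)) (at x within \<Omega>)"
      by (intro tendsto_intros P_tendsto x)
    then have "(iter_partial is (stream h u t) \<longlongrightarrow>
        (\<Sum>k\<in>UNIV. u t $ k * partial_closure \<Omega> is (h k) x)) (at x within \<Omega>)"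
      by (rule Lim_transform_eventually) (simp add: eventually_at_filter iter)
    then show ?thesis
      using False nt by (simp add: partial_closure_def tendsto_Lim)
  qed
qed

section \<open>Vanishing boundary values\<close>

lemma integrable_continuous_compact_support:
  fixes F :: "'a::euclidean_space \<Rightarrow> 'b::{banach, second_countable_topology}"
  assumes "continuous_on UNIV F" "compact S" "\<And>x. x \<notin> S \<Longrightarrow> F x = 0"
  shows "integrable lborel F"
proof -
  have "integrable lborel (\<lambda>x. indicator S x *\<^sub>R F x)"
    using assms by (intro borel_integrable_compact) (auto intro: continuous_on_subset)
  moreover have "(\<lambda>x. indicator S x *\<^sub>R F x) = F"
    using assms(3) by (auto simp: indicator_def)
  ultimately show ?thesis by simp
qed

lemma lborel_translate:
  fixes F :: "'a::euclidean_space \<Rightarrow> real"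
  assumes "integrable lborel F"
  shows "integrable lborel (\<lambda>x. F (x - c))" "(\<integral>x. F (x - c) \<partial>lborel) = (\<integral>x. F x \<partial>lborel)"
proof -
  have F: "F \<in> borel_measurable borel" using assms by auto
  have "integrable (distr lborel borel ((+) (- c))) F"
    using assms by (simp add: lborel_distr_plus)
  then show "integrable lborel (\<lambda>x. F (x - c))"
    by (subst (asm) integrable_distr_eq) (use F in auto)
  have "(\<integral>x. F x \<partial>lborel) = (\<integral>x. F x \<partial>distr lborel borel ((+) (- c)))"
    by (simp add: lborel_distr_plus)
  also have "\<dots> = (\<integral>x. F (x - c) \<partial>lborel)"
    by (subst integral_distr) (use F in auto)
  finally show "(\<integral>x. F (x - c) \<partial>lborel) = (\<integral>x. F x \<partial>lborel)" by simp
qed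

lemma square_add_le: "((a::real) + b)\<^sup>2 \<le> 2 * a\<^sup>2 + 2 * b\<^sup>2"
  using zero_le_power2[of "a - b"] by (simp add: power2_sum power2_diff)

text \<open>Halving the increment repeatedly reduces the estimate to difference quotients with
  arbitrarily small increments.\<close>

lemma translation_estimate:
  fixes \<phi> :: "'a::euclidean_space \<Rightarrow> real"
  assumes deriv: "\<And>x. (\<phi> has_derivative (\<lambda>v. G x \<bullet> v)) (at x)" and G: "continuous_on UNIV G"
    and K: "compact K" "\<And>x. x \<notin> K \<Longrightarrow> \<phi> x = 0" "\<And>x. x \<notin> K \<Longrightarrow> G x = 0"
    and e: "norm e = 1" and \<delta>: "\<delta> > 0"
  shows "integrable lborel (\<lambda>x. (\<phi> x - \<phi> (x - \<delta> *\<^sub>R e))\<^sup>2)"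
    and "(\<integral>x. (\<phi> x - \<phi> (x - \<delta> *\<^sub>R e))\<^sup>2 \<partial>lborel) \<le> \<delta>\<^sup>2 * (\<integral>x. (norm (G x))\<^sup>2 \<partial>lborel)"
proof -
  have c\<phi>: "continuous_on UNIV \<phi>"
    by (intro continuous_at_imp_continuous_on ballI has_derivative_continuous[OF deriv])
  have intd: "integrable lborel (\<lambda>x. (\<phi> x - \<phi> (x - c))\<^sup>2)" for c
  proof (rule integrable_continuous_compact_support)
    show "continuous_on UNIV (\<lambda>x. (\<phi> x - \<phi> (x - c))\<^sup>2)"
      by (intro continuous_intros c\<phi> continuous_on_compose2[OF c\<phi>]) auto
    show "compact (K \<union> (+) c ` K)"
      using K(1) by (intro compact_Un compact_translation)
    show "(\<phi> x - \<phi> (x - c))\<^sup>2 = 0" if "x \<notin> K \<union> (+) c ` K" for x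
    proof -
      have "x - c \<notin> K"
        using that by (metis UnCI add.commute diff_add_cancel image_eqI)
      then show ?thesis using that K(2) by auto
    qed
  qed
  then show "integrable lborel (\<lambda>x. (\<phi> x - \<phi> (x - \<delta> *\<^sub>R e))\<^sup>2)" .
  define g where "g t = (\<integral>x. (\<phi> x - \<phi> (x - t *\<^sub>R e))\<^sup>2 \<partial>lborel)" for t
  have double: "g (2 * t) \<le> 4 * g t" for t
  proof -
    have "g (2 * t) \<le> (\<integral>x. 2 * (\<phi> x - \<phi> (x - t *\<^sub>R e))\<^sup>2 + 2 * (\<phi> (x - t *\<^sub>R e) - \<phi> (x - t *\<^sub>R e - t *\<^sub>R e))\<^sup>2 \<partial>lborel)"
      unfolding g_def
    proof (rule integral_mono)
      show "integrable lborel (\<lambda>x. 2 * (\<phi> x - \<phi> (x - t *\<^sub>R e))\<^sup>2 + 2 * (\<phi> (x - t *\<^sub>R e) - \<phi> (x - t *\<^sub>R e - t *\<^sub>R e))\<^sup>2)"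
        using intd lborel_translate(1)[OF intd[of "t *\<^sub>R e"], of "t *\<^sub>R e"] by auto
      fix x
      have eq: "x - (2 * t) *\<^sub>R e = x - t *\<^sub>R e - t *\<^sub>R e" by (simp add: scaleR_2 flip: scaleR_scaleR)
      show "(\<phi> x - \<phi> (x - (2 * t) *\<^sub>R e))\<^sup>2 \<le> 2 * (\<phi> x - \<phi> (x - t *\<^sub>R e))\<^sup>2 + 2 * (\<phi> (x - t *\<^sub>R e) - \<phi> (x - t *\<^sub>R e - t *\<^sub>R e))\<^sup>2"
        unfolding eq
        using square_add_le[of "\<phi> x - \<phi> (x - t *\<^sub>R e)" "\<phi> (x - t *\<^sub>R e) - \<phi> (x - t *\<^sub>R e - t *\<^sub>R e)"] by simp
    qed (rule intd)
    also have "\<dots> = 2 * g t + 2 * g t"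
      using intd lborel_translate[OF intd[of "t *\<^sub>R e"], of "t *\<^sub>R e"] by (simp add: g_def)
    finally show ?thesis by simp
  qed
  define d where "d n = \<delta> / 2 ^ n" for n :: nat
  have d0: "d n > 0" for n using \<delta> by (simp add: d_def)
  have iter: "g \<delta> \<le> 4 ^ n * g (d n)" for n
  proof (induction n)
    case (Suc n)
    have "g (d n) \<le> 4 * g (d (Suc n))"
      using double[of "d (Suc n)"] by (simp add: d_def)
    then have "4 ^ n * g (d n) \<le> 4 ^ n * (4 * g (d (Suc n)))"
      by (intro mult_left_mono) auto
    moreover have "4 ^ n * (4 * g (d (Suc n))) = 4 ^ Suc n * g (d (Suc n))" by simp
    ultimately show ?case using Suc by linarith
  qed (simp add: d_def)
  have "compact (G ` K)" using K(1) G by (intro compact_continuous_image) (auto intro: continuous_on_subset)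
  then have "bounded (G ` K)" by (rule compact_imp_bounded)
  then obtain B0 where B0: "\<And>x. x \<in> K \<Longrightarrow> norm (G x) \<le> B0"
    unfolding bounded_iff by auto
  define B where "B = max 0 B0"
  have B: "norm (G x) \<le> B" "B \<ge> 0" for x
    using B0[of x] K(3)[of x] by (cases "x \<in> K") (auto simp: B_def)
  obtain R where R: "\<And>x. x \<in> K \<Longrightarrow> norm x \<le> R"
    using compact_imp_bounded[OF K(1)] unfolding bounded_iff by auto
  define Q where "Q n x = ((\<phi> x - \<phi> (x - d n *\<^sub>R e)) / d n)\<^sup>2" for n x
  have lim: "(\<lambda>n. \<integral>x. Q n x \<partial>lborel) \<longlonglongrightarrow> (\<integral>x. (G x \<bullet> e)\<^sup>2 \<partial>lborel)"
  proof (rule integral_dominated_convergence)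
    show "(\<lambda>x. (G x \<bullet> e)\<^sup>2) \<in> borel_measurable lborel"
      using borel_measurable_continuous_onI[OF G] by simp
    show "Q n \<in> borel_measurable lborel" for n
      unfolding Q_def using borel_measurable_continuous_onI[OF c\<phi>] by simp
    show "integrable lborel (\<lambda>x::'a. B\<^sup>2 * indicator (cball 0 (R + \<delta>)) x)"
      by (intro integrable_mult_right integrable_real_indicator) (use emeasure_lborel_cball_finite[of "0::'a" "R + \<delta>"] in auto)
    show "AE x in lborel. (\<lambda>n. Q n x) \<longlonglongrightarrow> (G x \<bullet> e)\<^sup>2"
    proof (rule AE_I2)
      fix x
      have "((\<lambda>t. x - t *\<^sub>R e) has_derivative (\<lambda>s. - (s *\<^sub>R e))) (at 0)"
        by (auto intro!: derivative_eq_intros)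
      from diff_chain_at[OF this, of \<phi> "\<lambda>v. G x \<bullet> v"] deriv[of x]
      have "((\<lambda>t. \<phi> (x - t *\<^sub>R e)) has_derivative (\<lambda>s. G x \<bullet> - (s *\<^sub>R e))) (at 0)"
        by (simp add: o_def)
      moreover have "(\<lambda>s. G x \<bullet> - (s *\<^sub>R e)) = (*) (- (G x \<bullet> e))"
        by (auto simp: fun_eq_iff)
      ultimately have "((\<lambda>t. \<phi> (x - t *\<^sub>R e)) has_real_derivative - (G x \<bullet> e)) (at 0)"
        by (simp only: has_field_derivative_def)
      then have "((\<lambda>h. (\<phi> (x - h *\<^sub>R e) - \<phi> x) / h) \<longlongrightarrow> - (G x \<bullet> e)) (at 0)"
        by (simp add: DERIV_def)
      moreover have "filterlim d (at 0) sequentially"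
      proof -
        have "d \<longlonglongrightarrow> 0"
          unfolding d_def using tendsto_mult_right_zero[OF LIMSEQ_inverse_realpow_zero[of 2], of \<delta>]
          by (simp add: divide_inverse power_inverse)
        then show ?thesis using d0 by (intro filterlim_atI) (auto simp: less_imp_neq[THEN not_sym])
      qed
      ultimately have "(\<lambda>n. (\<phi> (x - d n *\<^sub>R e) - \<phi> x) / d n) \<longlonglongrightarrow> - (G x \<bullet> e)"
        by (rule filterlim_compose)
      then have "(\<lambda>n. ((\<phi> (x - d n *\<^sub>R e) - \<phi> x) / d n)\<^sup>2) \<longlonglongrightarrow> (- (G x \<bullet> e))\<^sup>2"
        by (rule tendsto_power)
      moreover have "((\<phi> (x - d n *\<^sub>R e) - \<phi> x) / d n)\<^sup>2 = Q n x" for n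
        by (simp add: Q_def power_divide power2_commute)
      ultimately show "(\<lambda>n. Q n x) \<longlonglongrightarrow> (G x \<bullet> e)\<^sup>2"
        by simp
    qed
    show "AE x in lborel. norm (Q n x) \<le> B\<^sup>2 * indicator (cball 0 (R + \<delta>)) x" for n
    proof (rule AE_I2)
      fix x
      have dn: "d n \<le> \<delta>" using \<delta> by (simp add: d_def divide_le_eq mult_le_cancel_left1)
      have "\<bar>\<phi> x - \<phi> (x - d n *\<^sub>R e)\<bar> \<le> B * dist (x - d n *\<^sub>R e) x"
      proof (rule segment_mean_value[where f' = "\<lambda>p v. G p \<bullet> v"])
        fix p v show "\<bar>G p \<bullet> v\<bar> \<le> B * norm v"
          using Cauchy_Schwarz_ineq2[of "G p" v] mult_right_mono[OF B(1)[of p], of "norm v"] by simp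
      qed (use continuous_on_subset[OF c\<phi> subset_UNIV] deriv in auto)
      then have q: "\<bar>(\<phi> x - \<phi> (x - d n *\<^sub>R e)) / d n\<bar> \<le> B"
        using d0[of n] e by (simp add: dist_norm abs_divide pos_divide_le_eq)
      show "norm (Q n x) \<le> B\<^sup>2 * indicator (cball 0 (R + \<delta>)) x"
      proof (cases "x \<in> cball 0 (R + \<delta>)")
        case True
        then show ?thesis using q B(2) by (simp add: Q_def abs_le_square_iff[symmetric])
      next
        case False
        then have nx: "norm x > R + \<delta>" by simp
        then have "x \<notin> K" using R[of x] \<delta> by auto
        moreover have "x - d n *\<^sub>R e \<notin> K"
          using R[of "x - d n *\<^sub>R e"] norm_triangle_sub[of x "d n *\<^sub>R e"] nx dn e d0[of n] by auto
        ultimately show ?thesis by (simp add: Q_def K(2))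
      qed
    qed
  qed
  have "g \<delta> \<le> \<delta>\<^sup>2 * (\<integral>x. Q n x \<partial>lborel)" for n
  proof -
    have "\<delta>\<^sup>2 * (\<integral>x. Q n x \<partial>lborel) = \<delta>\<^sup>2 * (g (d n) / (d n)\<^sup>2)"
      by (simp add: Q_def g_def power_divide)
    also have "\<dots> = 4 ^ n * g (d n)"
    proof -
      have "(2 ^ n)\<^sup>2 = (4::real) ^ n"
        by (simp add: power2_eq_square flip: power_mult_distrib)
      then show ?thesis using \<delta> by (simp add: d_def power_divide)
    qed
    finally show ?thesis using iter[of n] by simp
  qed
  then have "g \<delta> \<le> \<delta>\<^sup>2 * (\<integral>x. (G x \<bullet> e)\<^sup>2 \<partial>lborel)"
    by (intro tendsto_lowerbound[OF tendsto_mult_left[OF lim]]) auto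
  also have "\<dots> \<le> \<delta>\<^sup>2 * (\<integral>x. (norm (G x))\<^sup>2 \<partial>lborel)"
  proof (intro mult_left_mono integral_mono)
    show "integrable lborel (\<lambda>x. (G x \<bullet> e)\<^sup>2)" "integrable lborel (\<lambda>x. (norm (G x))\<^sup>2)"
      using K by (intro integrable_continuous_compact_support[where S = K] continuous_intros G; simp)+
    show "(G x \<bullet> e)\<^sup>2 \<le> (norm (G x))\<^sup>2" for x
      using Cauchy_Schwarz_ineq2[of "G x" e] e by (simp add: abs_le_square_iff[symmetric])
  qed simp
  finally show "(\<integral>x. (\<phi> x - \<phi> (x - \<delta> *\<^sub>R e))\<^sup>2 \<partial>lborel) \<le> \<delta>\<^sup>2 * (\<integral>x. (norm (G x))\<^sup>2 \<partial>lborel)"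
    by (simp add: g_def)
qed

lemma test_function_gradient:
  assumes "test_function \<Omega> \<phi>" "open \<Omega>"
  obtains G K where "\<And>x. (\<phi> has_derivative (\<lambda>v. G x \<bullet> v)) (at x)" "continuous_on UNIV G"
    "compact K" "K \<subseteq> \<Omega>" "\<And>x. x \<notin> K \<Longrightarrow> \<phi> x = 0" "\<And>x. x \<notin> K \<Longrightarrow> G x = 0" "\<And>x. x \<in> \<Omega> \<Longrightarrow> grad \<Omega> \<phi> x = G x"
proof -
  obtain K where K: "compact K" "K \<subseteq> \<Omega>" "\<And>x. x \<notin> K \<Longrightarrow> \<phi> x = 0" and sm: "smooth_in UNIV \<phi>"
    using assms(1) unfolding test_function_def by auto
  have df: "iter_partial is \<phi> differentiable (at x)" for "is" x
    using sm unfolding smooth_in_def differentiable_on_def by auto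
  define G where "G x = (\<chi> i. iter_partial [i] \<phi> x)" for x
  have D: "(\<phi> has_derivative frechet_derivative \<phi> (at x)) (at x)" for x
    using df[of "[]" x] frechet_derivative_works by auto
  have G: "(\<phi> has_derivative (\<lambda>v. G x \<bullet> v)) (at x)" for x
  proof -
    have gx: "G x = (\<chi> i. frechet_derivative \<phi> (at x) (axis i 1))" by (simp add: G_def)
    have "frechet_derivative \<phi> (at x) = (\<lambda>v. G x \<bullet> v)"
      unfolding gx by (intro ext linear_eq_inner_partials has_derivative_linear[OF D])
    then show ?thesis using D[of x] by metis
  qed
  show thesis
  proof (rule that[OF G _ K])
    show "continuous_on UNIV G"
      unfolding G_def
      by (intro continuous_on_vec_lambda continuous_at_imp_continuous_on ballI differentiable_imp_continuous_within df)
    show "G x = 0" if "x \<notin> K" for x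
    proof -
      have "(\<phi> has_derivative (\<lambda>v. 0)) (at x)"
        by (rule has_derivative_transform_within_open[of "\<lambda>_. 0" _ _ _ "- K"])
          (use K that in \<open>auto simp: compact_imp_closed open_Compl\<close>)
      then have "(\<lambda>v. G x \<bullet> v) = (\<lambda>v. 0)"
        using G has_derivative_unique by blast
      then show ?thesis by (metis inner_eq_zero_iff)
    qed
    show "grad \<Omega> \<phi> x = G x" if "x \<in> \<Omega>" for x
      using that by (simp add: grad_def G_def partial_closure_def)
  qed
qed

lemma lebesgue_on_eq_lborel:
  fixes F :: "'a::euclidean_space \<Rightarrow> real"
  assumes "S \<in> sets borel" "(\<lambda>x. indicator S x * F x) \<in> borel_measurable borel"
  shows "integrable (lebesgue_on S) F \<longleftrightarrow> integrable lborel (\<lambda>x. indicator S x * F x)"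
    "(\<integral>x. F x \<partial>lebesgue_on S) = (\<integral>x. indicator S x * F x \<partial>lborel)"
proof -
  have S: "S \<inter> space lebesgue \<in> sets lebesgue" using assms(1) by simp
  have m: "(\<lambda>x. indicator S x * F x) \<in> borel_measurable lborel" using assms(2) by simp
  show "integrable (lebesgue_on S) F \<longleftrightarrow> integrable lborel (\<lambda>x. indicator S x * F x)"
    using integrable_restrict_space[OF S, of F] integrable_completion[OF m] by simp
  show "(\<integral>x. F x \<partial>lebesgue_on S) = (\<integral>x. indicator S x * F x \<partial>lborel)"
    using integral_restrict_space[OF S, of F] integral_completion[OF m] by simp
qed

text \<open>The extension \<open>f0\<close> of \<open>f\<close> by zero inherits the translation estimate of the approximating test
  functions, whose gradients are bounded in \<open>L\<^sup>2\<close>. That the limit of these gradients is the gradient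
  of \<open>f\<close> plays no role.\<close>

lemma H1_0_translation:
  fixes f :: "real^2 \<Rightarrow> real"
  assumes op: "open \<Omega>" and cf: "continuous_on (closure \<Omega>) f" and H: "f \<in> H1_0 \<Omega>"
  defines "f0 \<equiv> \<lambda>x. indicator \<Omega> x * f x"
  obtains C where "\<And>e \<delta>. norm e = 1 \<Longrightarrow> \<delta> > 0 \<Longrightarrow> integrable lborel (\<lambda>x. (f0 x - f0 (x - \<delta> *\<^sub>R e))\<^sup>2)"
    "\<And>e \<delta>. norm e = 1 \<Longrightarrow> \<delta> > 0 \<Longrightarrow> (\<integral>x. (f0 x - f0 (x - \<delta> *\<^sub>R e))\<^sup>2 \<partial>lborel) \<le> C * \<delta>\<^sup>2"
proof -
  obtain g \<phi> where fL: "f \<in> L2 \<Omega>" and gL: "g \<in> L2 \<Omega>" and test: "\<And>n::nat. test_function \<Omega> (\<phi> n)"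
    and lim1: "(\<lambda>n. L2_norm \<Omega> (\<lambda>x. \<phi> n x - f x)) \<longlonglongrightarrow> 0"
    and lim2: "(\<lambda>n. L2_norm \<Omega> (\<lambda>x. grad \<Omega> (\<phi> n) x - g x)) \<longlonglongrightarrow> 0"
    using H unfolding H1_0_def by blast
  have "\<forall>n. \<exists>G K. (\<forall>x. (\<phi> n has_derivative (\<lambda>v. G x \<bullet> v)) (at x)) \<and> continuous_on UNIV G \<and>
    compact K \<and> K \<subseteq> \<Omega> \<and> (\<forall>x. x \<notin> K \<longrightarrow> \<phi> n x = 0) \<and> (\<forall>x. x \<notin> K \<longrightarrow> G x = 0) \<and> (\<forall>x\<in>\<Omega>. grad \<Omega> (\<phi> n) x = G x)"
  proof
    fix n
    obtain G K where *: "\<And>x. (\<phi> n has_derivative (\<lambda>v. G x \<bullet> v)) (at x)" "continuous_on UNIV G"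
      "compact K" "K \<subseteq> \<Omega>" "\<And>x. x \<notin> K \<Longrightarrow> \<phi> n x = 0" "\<And>x. x \<notin> K \<Longrightarrow> G x = 0"
      "\<And>x. x \<in> \<Omega> \<Longrightarrow> grad \<Omega> (\<phi> n) x = G x"
      by (rule test_function_gradient[OF test[of n] op]) (rule that; assumption)
    show "\<exists>G K. (\<forall>x. (\<phi> n has_derivative (\<lambda>v. G x \<bullet> v)) (at x)) \<and> continuous_on UNIV G \<and>
      compact K \<and> K \<subseteq> \<Omega> \<and> (\<forall>x. x \<notin> K \<longrightarrow> \<phi> n x = 0) \<and> (\<forall>x. x \<notin> K \<longrightarrow> G x = 0) \<and> (\<forall>x\<in>\<Omega>. grad \<Omega> (\<phi> n) x = G x)"
      by (intro exI[of _ G] exI[of _ K]) (simp add: *)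
  qed
  then obtain G K where G: "\<And>n x. (\<phi> n has_derivative (\<lambda>v. G n x \<bullet> v)) (at x)" "\<And>n. continuous_on UNIV (G n)"
    and K: "\<And>n. compact (K n)" "\<And>n. K n \<subseteq> \<Omega>" "\<And>n x. x \<notin> K n \<Longrightarrow> \<phi> n x = 0" "\<And>n x. x \<notin> K n \<Longrightarrow> G n x = 0"
    and gradG: "\<And>n x. x \<in> \<Omega> \<Longrightarrow> grad \<Omega> (\<phi> n) x = G n x"
    by metis
  have c\<phi>: "continuous_on UNIV (\<phi> n)" for n
    by (intro continuous_at_imp_continuous_on ballI has_derivative_continuous[OF G(1)])
  have \<phi>out: "\<phi> n x = 0" if "x \<notin> \<Omega>" for n x
    using that K(2)[of n] K(3)[of x n] by auto
  have Gout: "G n x = 0" if "x \<notin> \<Omega>" for n x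
    using that K(2)[of n] K(4)[of x n] by auto
  have \<Omega>b: "\<Omega> \<in> sets borel" using op by simp
  have f0m: "f0 \<in> borel_measurable borel"
    unfolding f0_def using borel_measurable_continuous_on_indicator[OF \<Omega>b continuous_on_subset[OF cf closure_subset]]
    by simp
  have f0i: "integrable lborel (\<lambda>x. (f0 x)\<^sup>2)"
  proof -
    have "integrable (lebesgue_on \<Omega>) (\<lambda>x. (norm (f x))\<^sup>2)" using fL by (simp add: L2_def)
    moreover have eq: "(\<lambda>x. indicator \<Omega> x * (norm (f x))\<^sup>2) = (\<lambda>x. (f0 x)\<^sup>2)"
      by (auto simp: f0_def indicator_def)
    moreover have "(\<lambda>x. (f0 x)\<^sup>2) \<in> borel_measurable borel" using f0m by simp
    ultimately show ?thesis
      using lebesgue_on_eq_lborel(1)[OF \<Omega>b, of "\<lambda>x. (norm (f x))\<^sup>2"] by simp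
  qed
  have \<phi>m: "\<phi> n \<in> borel_measurable borel" for n
    using borel_measurable_continuous_onI[OF c\<phi>] .
  have \<phi>i: "integrable lborel (\<lambda>x. (\<phi> n x)\<^sup>2)" for n
    by (rule integrable_continuous_compact_support[OF _ K(1)[of n]]) (auto intro!: continuous_intros c\<phi> simp: K(3))
  define D where "D n x = \<phi> n x - f0 x" for n x
  have Dm: "D n \<in> borel_measurable borel" for n
    unfolding D_def using \<phi>m f0m by simp
  have Di: "integrable lborel (\<lambda>x. (D n x)\<^sup>2)" for n
  proof (rule Bochner_Integration.integrable_bound)
    show "integrable lborel (\<lambda>x. 2 * (\<phi> n x)\<^sup>2 + 2 * (f0 x)\<^sup>2)" using \<phi>i f0i by simp
    show "(\<lambda>x. (D n x)\<^sup>2) \<in> borel_measurable lborel" using Dm by simp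
    show "AE x in lborel. norm ((D n x)\<^sup>2) \<le> norm (2 * (\<phi> n x)\<^sup>2 + 2 * (f0 x)\<^sup>2)"
      using square_add_le[of "\<phi> n _" "- f0 _"] by (intro AE_I2) (simp add: D_def)
  qed
  have Dnorm: "(\<integral>x. (D n x)\<^sup>2 \<partial>lborel) = (L2_norm \<Omega> (\<lambda>x. \<phi> n x - f x))\<^sup>2" for n
  proof -
    have eq: "(\<lambda>x. indicator \<Omega> x * (norm (\<phi> n x - f x))\<^sup>2) = (\<lambda>x. (D n x)\<^sup>2)"
      using \<phi>out by (auto simp: D_def f0_def indicator_def)
    have "(L2_norm \<Omega> (\<lambda>x. \<phi> n x - f x))\<^sup>2 = (\<integral>x. (norm (\<phi> n x - f x))\<^sup>2 \<partial>lebesgue_on \<Omega>)"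
      unfolding L2_norm_def by (intro real_sqrt_pow2 Bochner_Integration.integral_nonneg) simp
    also have "\<dots> = (\<integral>x. (D n x)\<^sup>2 \<partial>lborel)"
      unfolding eq[symmetric] by (rule lebesgue_on_eq_lborel(2)[OF \<Omega>b]) (use Dm in \<open>simp only: eq; simp\<close>)
    finally show ?thesis by simp
  qed
  define C0 where "C0 = 2 * (\<integral>x. (norm (g x))\<^sup>2 \<partial>lebesgue_on \<Omega>) + 2"
  have Gb: "\<forall>\<^sub>F n in sequentially. (\<integral>x. (norm (G n x))\<^sup>2 \<partial>lborel) \<le> C0"
  proof -
    have "\<forall>\<^sub>F n in sequentially. L2_norm \<Omega> (\<lambda>x. grad \<Omega> (\<phi> n) x - g x) < 1"
      using lim2 by (rule order_tendstoD) simp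
    then show ?thesis
    proof eventually_elim
      case (elim n)
      have Gi: "integrable lborel (\<lambda>x. (norm (G n x))\<^sup>2)"
        by (rule integrable_continuous_compact_support[OF _ K(1)[of n]]) (auto intro!: continuous_intros G simp: K(4))
      have eq: "(\<lambda>x. indicator \<Omega> x * (norm (G n x))\<^sup>2) = (\<lambda>x. (norm (G n x))\<^sup>2)"
      proof
        fix x show "indicator \<Omega> x * (norm (G n x))\<^sup>2 = (norm (G n x))\<^sup>2"
          using Gout[of x n] by (cases "x \<in> \<Omega>") auto
      qed
      have Gm: "G n \<in> borel_measurable borel" using borel_measurable_continuous_onI[OF G(2)] .
      have m1: "G n \<in> borel_measurable (lebesgue_on \<Omega>)"
        using op by (intro continuous_imp_measurable_on_sets_lebesgue continuous_on_subset[OF G(2)]) auto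
      have m2: "g \<in> borel_measurable (lebesgue_on \<Omega>)" and gi: "integrable (lebesgue_on \<Omega>) (\<lambda>x. (norm (g x))\<^sup>2)"
        using gL by (auto simp: L2_def)
      have Gi': "integrable (lebesgue_on \<Omega>) (\<lambda>x. (norm (G n x))\<^sup>2)"
        using lebesgue_on_eq_lborel(1)[OF \<Omega>b, of "\<lambda>x. (norm (G n x))\<^sup>2"] Gi Gm by (simp add: eq)
      have nsq: "(norm (a + b))\<^sup>2 \<le> 2 * (norm a)\<^sup>2 + 2 * (norm b)\<^sup>2" for a b :: "real^2"
      proof -
        have "(norm (a + b))\<^sup>2 \<le> (norm a + norm b)\<^sup>2" by (intro power_mono norm_triangle_ineq) simp
        then show ?thesis using square_add_le[of "norm a" "norm b"] by linarith
      qed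
      have di: "integrable (lebesgue_on \<Omega>) (\<lambda>x. (norm (G n x - g x))\<^sup>2)"
      proof (rule Bochner_Integration.integrable_bound)
        show "integrable (lebesgue_on \<Omega>) (\<lambda>x. 2 * (norm (G n x))\<^sup>2 + 2 * (norm (g x))\<^sup>2)"
          using Gi' gi by simp
        show "(\<lambda>x. (norm (G n x - g x))\<^sup>2) \<in> borel_measurable (lebesgue_on \<Omega>)"
          using m1 m2 by measurable
        show "AE x in lebesgue_on \<Omega>. norm ((norm (G n x - g x))\<^sup>2) \<le> norm (2 * (norm (G n x))\<^sup>2 + 2 * (norm (g x))\<^sup>2)"
          using nsq[of "G n _" "- g _"] by (intro AE_I2) simp
      qed
      have "(\<integral>x. (norm (G n x))\<^sup>2 \<partial>lborel) = (\<integral>x. (norm (G n x))\<^sup>2 \<partial>lebesgue_on \<Omega>)"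
        using lebesgue_on_eq_lborel(2)[OF \<Omega>b, of "\<lambda>x. (norm (G n x))\<^sup>2"] Gm by (simp add: eq)
      also have "\<dots> \<le> (\<integral>x. 2 * (norm (g x))\<^sup>2 + 2 * (norm (G n x - g x))\<^sup>2 \<partial>lebesgue_on \<Omega>)"
      proof (intro integral_mono)
        fix x show "(norm (G n x))\<^sup>2 \<le> 2 * (norm (g x))\<^sup>2 + 2 * (norm (G n x - g x))\<^sup>2"
          using nsq[of "g x" "G n x - g x"] by simp
      qed (use gi di Gi' in auto)
      also have "\<dots> = 2 * (\<integral>x. (norm (g x))\<^sup>2 \<partial>lebesgue_on \<Omega>) + 2 * (\<integral>x. (norm (G n x - g x))\<^sup>2 \<partial>lebesgue_on \<Omega>)"
        using gi di by simp
      also have "(\<integral>x. (norm (G n x - g x))\<^sup>2 \<partial>lebesgue_on \<Omega>) = (L2_norm \<Omega> (\<lambda>x. grad \<Omega> (\<phi> n) x - g x))\<^sup>2"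
      proof -
        have "(\<integral>x. (norm (G n x - g x))\<^sup>2 \<partial>lebesgue_on \<Omega>) = (\<integral>x. (norm (grad \<Omega> (\<phi> n) x - g x))\<^sup>2 \<partial>lebesgue_on \<Omega>)"
          by (rule Bochner_Integration.integral_cong) (use gradG in auto)
        then show ?thesis
          unfolding L2_norm_def by (subst real_sqrt_pow2) (auto intro: Bochner_Integration.integral_nonneg)
      qed
      also have "(L2_norm \<Omega> (\<lambda>x. grad \<Omega> (\<phi> n) x - g x))\<^sup>2 \<le> 1"
        using elim by (intro power_le_one) (auto simp: L2_norm_def intro: Bochner_Integration.integral_nonneg)
      finally show ?case by (simp add: C0_def)
    qed
  qed
  have D0: "(\<lambda>n. \<integral>x. (D n x)\<^sup>2 \<partial>lborel) \<longlonglongrightarrow> 0"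
    unfolding Dnorm using tendsto_power[OF lim1, of 2] by simp
  have int: "integrable lborel (\<lambda>x. (f0 x - f0 (x - c))\<^sup>2)" for c
  proof (rule Bochner_Integration.integrable_bound)
    show "integrable lborel (\<lambda>x. 2 * (f0 x)\<^sup>2 + 2 * (f0 (x - c))\<^sup>2)"
      using f0i lborel_translate(1)[OF f0i, of c] by simp
    show "(\<lambda>x. (f0 x - f0 (x - c))\<^sup>2) \<in> borel_measurable lborel" using f0m by simp
    show "AE x in lborel. norm ((f0 x - f0 (x - c))\<^sup>2) \<le> norm (2 * (f0 x)\<^sup>2 + 2 * (f0 (x - c))\<^sup>2)"
      using square_add_le[of "f0 _" "- f0 _"] by (intro AE_I2) simp
  qed
  show thesis
  proof (rule that[of "2 * C0"])
    fix e :: "real^2" and \<delta> :: real assume e: "norm e = 1" and \<delta>: "\<delta> > 0"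
    show "integrable lborel (\<lambda>x. (f0 x - f0 (x - \<delta> *\<^sub>R e))\<^sup>2)" by (rule int)
    let ?c = "\<delta> *\<^sub>R e"
    have "(\<integral>x. (f0 x - f0 (x - ?c))\<^sup>2 \<partial>lborel) \<le> 2 * C0 * \<delta>\<^sup>2 + 8 * (\<integral>x. (D n x)\<^sup>2 \<partial>lborel)"
      if n: "(\<integral>x. (norm (G n x))\<^sup>2 \<partial>lborel) \<le> C0" for n
    proof -
      note te = translation_estimate[OF G(1)[of n] G(2)[of n] K(1)[of n] K(3)[of _ n] K(4)[of _ n] e \<delta>]
      have "(\<integral>x. (f0 x - f0 (x - ?c))\<^sup>2 \<partial>lborel) \<le>
          (\<integral>x. 2 * (\<phi> n x - \<phi> n (x - ?c))\<^sup>2 + (4 * (D n x)\<^sup>2 + 4 * (D n (x - ?c))\<^sup>2) \<partial>lborel)"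
      proof (rule integral_mono[OF int])
        show "integrable lborel (\<lambda>x. 2 * (\<phi> n x - \<phi> n (x - ?c))\<^sup>2 + (4 * (D n x)\<^sup>2 + 4 * (D n (x - ?c))\<^sup>2))"
          using te(1) Di lborel_translate(1)[OF Di[of n], of ?c] by simp
        fix x
        have "f0 x - f0 (x - ?c) = (\<phi> n x - \<phi> n (x - ?c)) + (D n (x - ?c) - D n x)"
          by (simp add: D_def)
        then show "(f0 x - f0 (x - ?c))\<^sup>2 \<le> 2 * (\<phi> n x - \<phi> n (x - ?c))\<^sup>2 + (4 * (D n x)\<^sup>2 + 4 * (D n (x - ?c))\<^sup>2)"
          using square_add_le[of "\<phi> n x - \<phi> n (x - ?c)" "D n (x - ?c) - D n x"] 
            square_add_le[of "D n (x - ?c)" "- D n x"] by simp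
      qed
      also have "\<dots> = 2 * (\<integral>x. (\<phi> n x - \<phi> n (x - ?c))\<^sup>2 \<partial>lborel) + 8 * (\<integral>x. (D n x)\<^sup>2 \<partial>lborel)"
        using te(1) Di lborel_translate[OF Di[of n], of ?c] by simp
      also have "(\<integral>x. (\<phi> n x - \<phi> n (x - ?c))\<^sup>2 \<partial>lborel) \<le> C0 * \<delta>\<^sup>2"
        using te(2) mult_left_mono[OF n, of "\<delta>\<^sup>2"] by (simp add: mult.commute)
      finally show ?thesis by simp
    qed
    then have ev: "\<forall>\<^sub>F n in sequentially. (\<integral>x. (f0 x - f0 (x - ?c))\<^sup>2 \<partial>lborel) \<le> 2 * C0 * \<delta>\<^sup>2 + 8 * (\<integral>x. (D n x)\<^sup>2 \<partial>lborel)"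
      using Gb by (rule eventually_mono[rotated])
    have "(\<lambda>n. 2 * C0 * \<delta>\<^sup>2 + 8 * (\<integral>x. (D n x)\<^sup>2 \<partial>lborel)) \<longlonglongrightarrow> 2 * C0 * \<delta>\<^sup>2 + 8 * 0"
      by (intro tendsto_intros D0)
    from tendsto_lowerbound[OF this ev]
    show "(\<integral>x. (f0 x - f0 (x - ?c))\<^sup>2 \<partial>lborel) \<le> 2 * C0 * \<delta>\<^sup>2" by simp
  qed
qed

text \<open>If \<open>f\<close> did not vanish at a boundary point, then its extension by zero would jump across a piece of
  the boundary, and the squared difference between the extension and its translate by \<open>\<delta>\<close> would have
  an integral of order \<open>\<delta>\<close> instead of \<open>\<delta>\<^sup>2\<close>. Indeed, the strip of width \<open>\<delta>\<close> along that piece has measure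
  at least a multiple of \<open>\<delta>\<close>, as \<open>h / \<delta>\<close> of its translates cover a fixed open set of height \<open>h\<close>.\<close>

proposition H1_0_zero_on_frontier:
  fixes f :: "real^2 \<Rightarrow> real"
  assumes op: "open \<Omega>" and C2: "C2_boundary \<Omega>"
    and cf: "continuous_on (closure \<Omega>) f" and H: "f \<in> H1_0 \<Omega>" and x: "x \<in> frontier \<Omega>"
  shows "f x = 0"
proof (rule ccontr)
  assume fx: "f x \<noteq> 0"
  define f0 where "f0 y = indicator \<Omega> y * f y" for y
  obtain C where C: "\<And>e \<delta>. norm e = 1 \<Longrightarrow> \<delta> > 0 \<Longrightarrow> integrable lborel (\<lambda>x. (f0 x - f0 (x - \<delta> *\<^sub>R e))\<^sup>2)"
    "\<And>e \<delta>. norm e = 1 \<Longrightarrow> \<delta> > 0 \<Longrightarrow> (\<integral>x. (f0 x - f0 (x - \<delta> *\<^sub>R e))\<^sup>2 \<partial>lborel) \<le> C * \<delta>\<^sup>2"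
    using H1_0_translation[OF op cf H] unfolding f0_def by blast
  obtain r e1 e2 \<phi> \<phi>' where r: "r > 0" and e: "norm e1 = 1" "norm e2 = 1" "e1 \<bullet> e2 = 0"
    and \<phi>: "\<And>\<tau>::real. (\<phi> has_real_derivative \<phi>' \<tau>) (at \<tau>)"
    and eq: "\<Omega> \<inter> ball x r = {y \<in> ball x r. \<phi> (e1 \<bullet> y) < e2 \<bullet> y}"
    by (rule C2_boundary_coordinates[OF C2 x]) blast
  have c\<phi>: "continuous_on UNIV \<phi>"
    using \<phi> by (meson DERIV_continuous_on has_field_derivative_at_within)
  have e2e2: "e2 \<bullet> e2 = 1" using e by (simp add: dot_square_norm)
  have xc: "x \<in> closure \<Omega>" "x \<notin> \<Omega>"
    using x op by (auto simp: frontier_def interior_open)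
  \<comment> \<open>height above the graph\<close>
  define \<eta> where "\<eta> y = e2 \<bullet> y - \<phi> (e1 \<bullet> y)" for y
  have c\<eta>: "continuous_on UNIV \<eta>"
    unfolding \<eta>_def by (intro continuous_intros continuous_on_compose2[OF c\<phi>]) auto
  have \<Omega>iff: "y \<in> \<Omega> \<longleftrightarrow> \<eta> y > 0" if "y \<in> ball x r" for y
    using eq that unfolding \<eta>_def by (auto simp: set_eq_iff)
  have \<eta>x: "\<eta> x = 0"
    using \<Omega>iff[of x] closure_above_graph[OF eq c\<phi> xc(1)] r xc by (simp add: \<eta>_def)
  have \<eta>shift: "\<eta> (y - t *\<^sub>R e2) = \<eta> y - t" for y t
    using e e2e2 by (simp add: \<eta>_def inner_diff_right)
  define c where "c = \<bar>f x\<bar> / 2"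
  have c: "c > 0" using fx by (simp add: c_def)
  obtain d1 where d1: "d1 > 0" "\<And>y. y \<in> closure \<Omega> \<Longrightarrow> dist y x < d1 \<Longrightarrow> dist (f y) (f x) < c"
    using cf xc(1) c unfolding continuous_on_iff by metis
  define r0 where "r0 = min d1 (r / 2)"
  have r0: "r0 > 0" "r0 \<le> d1" "r0 \<le> r / 2" using d1 r by (auto simp: r0_def)
  have big: "c \<le> \<bar>f y\<bar>" if "y \<in> closure \<Omega>" "y \<in> ball x r0" for y
  proof -
    have "\<bar>f y - f x\<bar> < c"
      using d1(2)[of y] that r0 by (auto simp: dist_real_def dist_commute)
    then show ?thesis unfolding c_def by linarith
  qed
  define h where "h = r0 / 2"
  have h: "h > 0" using r0 by (simp add: h_def)
  obtain d2 where d2: "d2 > 0" "\<And>y. dist y x < d2 \<Longrightarrow> \<bar>\<eta> y\<bar> < h"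
    using c\<eta> h \<eta>x unfolding continuous_on_iff dist_real_def by (metis UNIV_I diff_zero)
  define \<rho> where "\<rho> = min d2 (r0 / 2)"
  have \<rho>: "\<rho> > 0" "\<rho> \<le> d2" "\<rho> \<le> r0 / 2" using d2 r0 by (auto simp: \<rho>_def)
  define A where "A = \<Omega> \<inter> ball x \<rho>"
  have "open A" unfolding A_def using op by auto
  have "A \<noteq> {}" unfolding A_def using xc(1) \<rho>(1) 
    by (meson centre_in_ball closure_iff_nhds_not_empty inf_commute open_ball subset_refl)
  then obtain a s where as: "s > 0" "ball a s \<subseteq> A"
    using \<open>open A\<close> openE by blast
  have A_fin: "emeasure lborel A < \<infinity>"
    by (rule le_less_trans[OF emeasure_mono emeasure_lborel_ball_finite[of x \<rho>]]) (auto simp: A_def)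
  have Apos: "measure lborel A > 0"
  proof -
    have "0 < measure lborel (ball a s)" using as(1) by (rule content_ball_pos)
    also have "\<dots> \<le> measure lborel A"
      using as(2) \<open>open A\<close> A_fin by (intro measure_mono_fmeasurable) (auto simp: fmeasurable_def)
    finally show ?thesis .
  qed
  \<comment> \<open>strip of width \<open>\<delta>\<close> along the boundary\<close>
  define S where "S \<delta> = {y \<in> ball x r0. 0 < \<eta> y \<and> \<eta> y \<le> \<delta>}" for \<delta>
  have S_meas: "S \<delta> \<in> sets borel" for \<delta>
  proof -
    have [measurable]: "\<eta> \<in> borel_measurable borel" using borel_measurable_continuous_onI[OF c\<eta>] .
    have "S \<delta> = ball x r0 \<inter> {y. 0 < \<eta> y \<and> \<eta> y \<le> \<delta>}" by (auto simp: S_def)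
    moreover have "{y. 0 < \<eta> y \<and> \<eta> y \<le> \<delta>} \<in> sets borel" by measurable
    ultimately show ?thesis by simp
  qed
  have S_fin: "emeasure lborel (S \<delta>) < \<infinity>" for \<delta>
    by (rule le_less_trans[OF emeasure_mono emeasure_lborel_ball_finite[of x r0]]) (auto simp: S_def)
  have Sub: "c\<^sup>2 * measure lborel (S \<delta>) \<le> C * \<delta>\<^sup>2" if \<delta>: "0 < \<delta>" "\<delta> \<le> h" for \<delta>
  proof -
    have "c\<^sup>2 * measure lborel (S \<delta>) = (\<integral>y. c\<^sup>2 * indicator (S \<delta>) y \<partial>lborel)"
      by simp
    also have "\<dots> \<le> (\<integral>y. (f0 y - f0 (y - \<delta> *\<^sub>R e2))\<^sup>2 \<partial>lborel)"
    proof (rule integral_mono)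
      show "integrable lborel (\<lambda>y. c\<^sup>2 * indicator (S \<delta>) y)"
        using S_fin S_meas by (intro integrable_mult_right integrable_real_indicator) auto
      show "integrable lborel (\<lambda>y. (f0 y - f0 (y - \<delta> *\<^sub>R e2))\<^sup>2)" by (rule C(1)[OF e(2) \<delta>(1)])
      fix y
      show "c\<^sup>2 * indicator (S \<delta>) y \<le> (f0 y - f0 (y - \<delta> *\<^sub>R e2))\<^sup>2"
      proof (cases "y \<in> S \<delta>")
        case True
        then have y: "y \<in> ball x r0" "0 < \<eta> y" "\<eta> y \<le> \<delta>" by (auto simp: S_def)
        have yr: "y \<in> ball x r" using y(1) r0 r by auto
        have y\<Omega>: "y \<in> \<Omega>" using \<Omega>iff[OF yr] y by simp
        have "dist x (y - \<delta> *\<^sub>R e2) \<le> dist x y + \<delta>"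
          using norm_triangle_ineq[of "x - y" "\<delta> *\<^sub>R e2"] e \<delta> by (simp add: dist_norm algebra_simps)
        then have "y - \<delta> *\<^sub>R e2 \<in> ball x r" using y(1) \<delta> r0 by (auto simp: h_def)
        then have "y - \<delta> *\<^sub>R e2 \<notin> \<Omega>" using \<Omega>iff y by (simp add: \<eta>shift)
        then have "f0 y - f0 (y - \<delta> *\<^sub>R e2) = f y" using y\<Omega> by (simp add: f0_def)
        moreover have "c \<le> \<bar>f y\<bar>" using y\<Omega> y(1) closure_subset by (intro big) auto
        then have "c\<^sup>2 \<le> (f y)\<^sup>2" using c by (simp add: abs_le_square_iff[symmetric])
        ultimately show ?thesis using True by simp
      qed simp
    qed
    also have "\<dots> \<le> C * \<delta>\<^sup>2" by (rule C(2)[OF e(2) \<delta>(1)])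
    finally show ?thesis .
  qed
  have cover: "measure lborel A \<le> real m * measure lborel (S (h / real m))" if "m > 0" for m :: nat
  proof -
    define \<delta> where "\<delta> = h / real m"
    have \<delta>: "\<delta> > 0" "real m * \<delta> = h" using h that by (auto simp: \<delta>_def)
    define T where "T j = (+) ((real j * \<delta>) *\<^sub>R e2) ` S \<delta>" for j :: nat
    have T_vim: "T j = (\<lambda>y. y - (real j * \<delta>) *\<^sub>R e2) -` S \<delta>" for j
      unfolding T_def by (auto simp: image_iff) (metis add_diff_cancel_left' add.commute diff_add_cancel)
    have T_meas: "T j \<in> sets borel" for j
    proof -
      have "(\<lambda>y. y - (real j * \<delta>) *\<^sub>R e2) \<in> borel \<rightarrow>\<^sub>M borel" by simp
      from measurable_sets[OF this S_meas] show ?thesis by (simp add: T_vim)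
    qed
    have T_em: "emeasure lborel (T j) = emeasure lborel (S \<delta>)" for j
    proof -
      have "emeasure lborel (S \<delta>) = emeasure (distr lborel borel ((+) (- ((real j * \<delta>) *\<^sub>R e2)))) (S \<delta>)"
        by (simp add: lborel_distr_plus)
      also have "\<dots> = emeasure lborel (T j)"
        using S_meas by (subst emeasure_distr) (auto simp: T_vim vimage_def)
      finally show ?thesis by simp
    qed
    have "A \<subseteq> (\<Union>j<m. T j)"
    proof
      fix y assume "y \<in> A"
      then have y: "y \<in> \<Omega>" "dist x y < \<rho>" by (auto simp: A_def)
      have yr: "y \<in> ball x r" using y(2) \<rho> r0 r by auto
      have \<eta>y: "0 < \<eta> y" "\<eta> y < h" using \<Omega>iff[OF yr] y d2(2)[of y] \<rho> by (auto simp: dist_commute)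
      \<comment> \<open>the translate whose heights lie in the interval from \<open>j \<delta>\<close> (excluded) to \<open>(j + 1) \<delta>\<close>\<close>
      define j where "j = nat (\<lceil>\<eta> y / \<delta>\<rceil> - 1)"
      have "0 < \<eta> y / \<delta>" using \<eta>y \<delta> by simp
      then have j: "real j = of_int \<lceil>\<eta> y / \<delta>\<rceil> - 1"
        unfolding j_def by (subst of_nat_nat) auto
      then have j1: "real j < \<eta> y / \<delta>" "\<eta> y / \<delta> \<le> real j + 1"
        by linarith+
      then have j2: "real j * \<delta> < \<eta> y" "\<eta> y \<le> real j * \<delta> + \<delta>"
        using \<delta> by (auto simp: field_simps)
      have "real j * \<delta> < real m * \<delta>" using j2 \<eta>y \<delta> by linarith
      then have "real j < real m" using \<delta>(1) by (simp only: mult_less_cancel_right_pos)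
      then have "j < m" by simp
      moreover have "y - (real j * \<delta>) *\<^sub>R e2 \<in> S \<delta>"
      proof -
        have "dist x (y - (real j * \<delta>) *\<^sub>R e2) \<le> dist x y + real j * \<delta>"
          using norm_triangle_ineq[of "x - y" "(real j * \<delta>) *\<^sub>R e2"] e \<delta> by (simp add: dist_norm algebra_simps)
        then have "dist x (y - (real j * \<delta>) *\<^sub>R e2) < r0"
          using j2 \<eta>y y(2) \<rho> by (simp add: h_def)
        then show ?thesis using j2 by (simp add: S_def \<eta>shift)
      qed
      ultimately show "y \<in> (\<Union>j<m. T j)" by (auto simp: T_vim)
    qed
    then have "emeasure lborel A \<le> emeasure lborel (\<Union>j<m. T j)"
      using T_meas by (intro emeasure_mono) auto
    also have "\<dots> \<le> (\<Sum>j<m. emeasure lborel (T j))"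
      using T_meas by (intro emeasure_subadditive_finite) auto
    also have "\<dots> = of_nat m * emeasure lborel (S \<delta>)" by (simp add: T_em)
    finally have "emeasure lborel A \<le> ennreal (real m * measure lborel (S \<delta>))"
      using S_fin[of \<delta>] by (simp add: emeasure_eq_ennreal_measure ennreal_mult ennreal_of_nat_eq_real_of_nat)
    then show ?thesis
      using A_fin by (simp add: emeasure_eq_ennreal_measure \<delta>_def)
  qed
  obtain m :: nat where m: "real m > C * h\<^sup>2 / (c\<^sup>2 * measure lborel A)" "m > 0"
    using reals_Archimedean2[of "max 0 (C * h\<^sup>2 / (c\<^sup>2 * measure lborel A))"] by (auto simp: max_def split: if_splits)
  have m0: "real m > 0" using m by simp
  have "c\<^sup>2 * measure lborel A \<le> c\<^sup>2 * (real m * measure lborel (S (h / real m)))"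
    using cover[OF m(2)] by (intro mult_left_mono) auto
  also have "\<dots> = real m * (c\<^sup>2 * measure lborel (S (h / real m)))" by simp
  also have "\<dots> \<le> real m * (C * (h / real m)\<^sup>2)"
    using h m0 m(2) by (intro mult_left_mono Sub) (auto simp: divide_le_eq mult_le_cancel_left1)
  also have "\<dots> = C * h\<^sup>2 / real m" using m0 by (simp add: power_divide power2_eq_square)
  finally have "real m * (c\<^sup>2 * measure lborel A) \<le> C * h\<^sup>2" using m0 by (simp add: field_simps)
  moreover have "C * h\<^sup>2 < real m * (c\<^sup>2 * measure lborel A)"
    using m(1) c Apos by (simp add: pos_divide_less_eq)
  ultimately show False by simp
qed

section \<open>Caratheodory equations driven by an integrable control\<close>

lemma integrable_control_times_continuous:
  fixes u :: "real \<Rightarrow> real^'n" and g :: "'n \<Rightarrow> real \<Rightarrow> 'b::euclidean_space"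
  assumes u: "integrable (lebesgue_on {0..T}) u" and g: "\<And>k. continuous_on {0..T} (g k)"
  shows "integrable (lebesgue_on {0..T}) (\<lambda>\<tau>. \<Sum>k\<in>UNIV. u \<tau> $ k *\<^sub>R g k \<tau>)"
proof (intro Bochner_Integration.integrable_sum)
  fix k
  have "bounded (g k ` {0..T})"
    by (intro compact_imp_bounded compact_continuous_image g) auto
  then obtain C where C: "\<And>t. t \<in> {0..T} \<Longrightarrow> norm (g k t) \<le> C"
    unfolding bounded_iff by (metis imageI)
  show "integrable (lebesgue_on {0..T}) (\<lambda>\<tau>. u \<tau> $ k *\<^sub>R g k \<tau>)"
  proof (rule measurable_bounded_by_integrable_imp_lebesgue_integrable)
    have um: "(\<lambda>\<tau>. u \<tau> $ k) \<in> borel_measurable (lebesgue_on {0..T})"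
      using borel_measurable_integrable[OF integrable_bounded_linear[OF bounded_linear_vec_nth u]] .
    show "(\<lambda>\<tau>. u \<tau> $ k *\<^sub>R g k \<tau>) \<in> borel_measurable (lebesgue_on {0..T})"
      using um continuous_imp_measurable_on_sets_lebesgue[OF g[of k]] by simp
    show "integrable (lebesgue_on {0..T}) (\<lambda>\<tau>. norm (u \<tau>) * C)" using u by simp
    show "norm (u \<tau> $ k *\<^sub>R g k \<tau>) \<le> norm (u \<tau>) * C" if "\<tau> \<in> {0..T}" for \<tau>
      using mult_mono[OF component_le_norm_cart[of "u \<tau>" k] C[OF that]] by simp
  qed auto
qed

lemma norm_control_sum_le:
  fixes u :: "real^'n" and g :: "'n \<Rightarrow> 'b::real_normed_vector"
  assumes "\<And>k. norm (g k) \<le> B"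
  shows "norm (\<Sum>k\<in>UNIV. u $ k *\<^sub>R g k) \<le> real CARD('n) * norm u * B"
proof -
  have "norm (\<Sum>k\<in>UNIV. u $ k *\<^sub>R g k) \<le> (\<Sum>k\<in>(UNIV::'n set). norm u * B)"
  proof (rule sum_norm_le)
    fix k show "norm (u $ k *\<^sub>R g k) \<le> norm u * B"
      using mult_mono[OF component_le_norm_cart[of u k] assms[of k]] by simp
  qed
  then show ?thesis by simp
qed

lemma continuous_on_slices:
  assumes "continuous_on (A \<times> B) (\<lambda>(t, s). g t s)"
  shows "s \<in> B \<Longrightarrow> continuous_on A (\<lambda>t. g t s)" "t \<in> A \<Longrightarrow> continuous_on B (\<lambda>s. g t s)"
proof -
  assume "s \<in> B"
  have "continuous_on A (\<lambda>t. case (t, s) of (t, s) \<Rightarrow> g t s)"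
    by (rule continuous_on_compose2[OF assms]) (use \<open>s \<in> B\<close> in \<open>auto intro!: continuous_intros\<close>)
  then show "continuous_on A (\<lambda>t. g t s)" by simp
next
  assume "t \<in> A"
  have "continuous_on B (\<lambda>s. case (t, s) of (t, s) \<Rightarrow> g t s)"
    by (rule continuous_on_compose2[OF assms]) (use \<open>t \<in> A\<close> in \<open>auto intro!: continuous_intros\<close>)
  then show "continuous_on B (\<lambda>s. g t s)" by simp
qed

lemma continuous_on_parametric_primitive:
  fixes u :: "real \<Rightarrow> real^'n" and g :: "'n \<Rightarrow> real \<Rightarrow> real \<Rightarrow> 'b::euclidean_space"
  assumes u: "integrable (lebesgue_on {0..T}) u"
    and g: "\<And>k. continuous_on ({0..T} \<times> {0..1}) (\<lambda>(t, s). g k t s)"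
  shows "continuous_on ({0..T} \<times> {0..1})
    (\<lambda>(t, s). \<integral>\<tau>. (\<Sum>k\<in>UNIV. u \<tau> $ k *\<^sub>R g k \<tau> s) \<partial>lebesgue_on {0..t})"
proof -
  define F where "F \<tau> s = (\<Sum>k\<in>UNIV. u \<tau> $ k *\<^sub>R g k \<tau> s)" for \<tau> s
  have gt: "continuous_on {0..T} (\<lambda>t. g k t s)" if "s \<in> {0..1}" for k s
    by (rule continuous_on_slices(1)[OF g that])
  have gs: "continuous_on {0..1} (\<lambda>s. g k t s)" if "t \<in> {0..T}" for k t
    by (rule continuous_on_slices(2)[OF g that])
  have Fi: "integrable (lebesgue_on {0..T}) (\<lambda>\<tau>. F \<tau> s)" if "s \<in> {0..1}" for s
    unfolding F_def by (rule integrable_control_times_continuous[OF u gt[OF that]])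
  have Fs: "continuous_on {0..1} (F \<tau>)" if "\<tau> \<in> {0..T}" for \<tau>
    unfolding F_def by (intro continuous_intros gs that)
  have "\<exists>B. \<forall>k. \<forall>p\<in>{0..T} \<times> {0..1}. norm (case p of (t, s) \<Rightarrow> g k t s) \<le> B"
  proof -
    have "bounded (\<Union>k. (\<lambda>(t, s). g k t s) ` ({0..T} \<times> {0..1}))"
      by (intro bounded_UN finite ballI compact_imp_bounded compact_continuous_image g compact_Times) auto
    then obtain B where "\<forall>x\<in>(\<Union>k. (\<lambda>(t, s). g k t s) ` ({0..T} \<times> {0..1})). norm x \<le> B"
      unfolding bounded_iff by metis
    then show ?thesis by (intro exI[of _ B]) auto
  qed
  then obtain B where B: "\<And>k t s. t \<in> {0..T} \<Longrightarrow> s \<in> {0..1} \<Longrightarrow> norm (g k t s) \<le> B"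
    by fastforce
  define w where "w \<tau> = real CARD('n) * norm (u \<tau>) * B" for \<tau>
  have wi: "integrable (lebesgue_on {0..T}) w" unfolding w_def using u by simp
  have Fw: "norm (F \<tau> s) \<le> w \<tau>" if "\<tau> \<in> {0..T}" "s \<in> {0..1}" for \<tau> s
    unfolding F_def w_def by (rule norm_control_sum_le) (rule B[OF that])
  have ind: "(\<integral>\<tau>. F \<tau> s \<partial>lebesgue_on {0..t}) = (\<integral>\<tau>. indicator {0..t} \<tau> *\<^sub>R F \<tau> s \<partial>lebesgue_on {0..T})"
    if "t \<in> {0..T}" for t s
  proof -
    have eq: "indicat_real {0..T} \<tau> * indicat_real {0..t} \<tau> = indicat_real {0..t} \<tau>" for \<tau>
      using that by (auto simp: indicator_def)
    show ?thesis
      by (simp add: integral_restrict_space eq)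
  qed
  show ?thesis
    unfolding continuous_on_sequentially F_def[symmetric] o_def
  proof (intro allI impI ballI, elim conjE)
    fix p and x assume p: "p \<in> {0..T} \<times> {0..(1::real)}" and xin: "\<forall>n. x n \<in> {0..T} \<times> {0..(1::real)}" and lim: "x \<longlonglongrightarrow> p"
    obtain t s where ts: "p = (t, s)" "t \<in> {0..T}" "s \<in> {0..1}" using p by auto
    define a where "a n = fst (x n)" for n
    define b where "b n = snd (x n)" for n
    have x: "x n = (a n, b n)" "a n \<in> {0..T}" "b n \<in> {0..1}" for n
      using xin[rule_format, of n] by (auto simp: a_def b_def)
    have a: "a \<longlonglongrightarrow> t" and b: "b \<longlonglongrightarrow> s"
      using tendsto_fst[OF lim] tendsto_snd[OF lim] by (auto simp: a_def[abs_def] b_def[abs_def] ts)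
    have "(\<lambda>n. \<integral>\<tau>. indicator {0..a n} \<tau> *\<^sub>R F \<tau> (b n) \<partial>lebesgue_on {0..T})
        \<longlonglongrightarrow> (\<integral>\<tau>. indicator {0..t} \<tau> *\<^sub>R F \<tau> s \<partial>lebesgue_on {0..T})"
    proof (rule integral_dominated_convergence[OF _ _ wi])
      have m: "(\<lambda>\<tau>. indicat_real {0..t} \<tau> *\<^sub>R F \<tau> s) \<in> borel_measurable (lebesgue_on {0..T})" if "s \<in> {0..1}" for t s
      proof (rule borel_measurable_scaleR)
        show "indicat_real {0..t} \<in> borel_measurable (lebesgue_on {0..T})"
          by (rule measurable_restrict_space1, rule borel_measurable_indicator) simp
        show "(\<lambda>\<tau>. F \<tau> s) \<in> borel_measurable (lebesgue_on {0..T})"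
          using Fi[OF that] by auto
      qed
      show "(\<lambda>\<tau>. indicat_real {0..t} \<tau> *\<^sub>R F \<tau> s) \<in> borel_measurable (lebesgue_on {0..T})" by (rule m[OF ts(3)])
      show "(\<lambda>\<tau>. indicat_real {0..a n} \<tau> *\<^sub>R F \<tau> (b n)) \<in> borel_measurable (lebesgue_on {0..T})" for n by (rule m[OF x(3)])
      show "AE \<tau> in lebesgue_on {0..T}. norm (indicat_real {0..a n} \<tau> *\<^sub>R F \<tau> (b n)) \<le> w \<tau>" for n
      proof (rule AE_I2)
        fix \<tau> assume "\<tau> \<in> space (lebesgue_on {0..T})"
        then have "\<tau> \<in> {0..T}" by simp
        from Fw[OF this x(3), of n] show "norm (indicat_real {0..a n} \<tau> *\<^sub>R F \<tau> (b n)) \<le> w \<tau>"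
          using order_trans[OF norm_ge_zero Fw[OF \<open>\<tau> \<in> {0..T}\<close> x(3), of n]] by (auto simp: indicator_def)
      qed
      show "AE \<tau> in lebesgue_on {0..T}. (\<lambda>n. indicat_real {0..a n} \<tau> *\<^sub>R F \<tau> (b n)) \<longlonglongrightarrow> indicat_real {0..t} \<tau> *\<^sub>R F \<tau> s"
      proof (rule AE_I')
        show "{t} \<in> null_sets (lebesgue_on {0..T})"
          using ts by (subst null_sets_restrict_space) auto
        show "{\<tau> \<in> space (lebesgue_on {0..T}). \<not> (\<lambda>n. indicat_real {0..a n} \<tau> *\<^sub>R F \<tau> (b n)) \<longlonglongrightarrow> indicat_real {0..t} \<tau> *\<^sub>R F \<tau> s} \<subseteq> {t}"
        proof (rule subsetI, rule ccontr)
          fix \<tau> assume "\<tau> \<in> {\<tau> \<in> space (lebesgue_on {0..T}). \<not> (\<lambda>n. indicat_real {0..a n} \<tau> *\<^sub>R F \<tau> (b n)) \<longlonglongrightarrow> indicat_real {0..t} \<tau> *\<^sub>R F \<tau> s}"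
            and "\<tau> \<notin> {t}"
          then have \<tau>: "\<tau> \<in> {0..T}" "\<tau> \<noteq> t"
            and nc: "\<not> (\<lambda>n. indicat_real {0..a n} \<tau> *\<^sub>R F \<tau> (b n)) \<longlonglongrightarrow> indicat_real {0..t} \<tau> *\<^sub>R F \<tau> s" by auto
          have "\<forall>\<^sub>F n in sequentially. indicat_real {0..t} \<tau> = indicat_real {0..a n} \<tau>"
          proof (cases "\<tau> < t")
            case True
            then have "\<forall>\<^sub>F n in sequentially. \<tau> < a n" using a by (rule order_tendstoD(1)[rotated])
            then show ?thesis by eventually_elim (use True \<tau> in auto)
          next
            case False
            then have "t < \<tau>" using \<tau> by simp
            then have "\<forall>\<^sub>F n in sequentially. a n < \<tau>" using a by (rule order_tendstoD(2)[rotated])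
            then show ?thesis by eventually_elim (use \<open>t < \<tau>\<close> \<tau> in auto)
          qed
          then have 1: "(\<lambda>n. indicat_real {0..a n} \<tau>) \<longlonglongrightarrow> indicat_real {0..t} \<tau>"
            by (rule Lim_transform_eventually[OF tendsto_const])
          have "(\<lambda>n. F \<tau> (b n)) \<longlonglongrightarrow> F \<tau> s"
            using Fs[OF \<tau>(1)] ts(3) b x(3) unfolding continuous_on_sequentially o_def by blast
          from tendsto_scaleR[OF 1 this] nc show False by simp
        qed
      qed
    qed
    then show "(\<lambda>n. case x n of (t, s) \<Rightarrow> \<integral>\<tau>. F \<tau> s \<partial>lebesgue_on {0..t}) \<longlonglongrightarrow> (case p of (t, s) \<Rightarrow> \<integral>\<tau>. F \<tau> s \<partial>lebesgue_on {0..t})"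
      using ts x by (simp add: ind)
  qed
qed

text \<open>Without differentiating \<open>exp (4 U)\<close>, one gets \<open>1/2\<close> instead of the optimal factor \<open>1/4\<close>. Any factor
  below \<open>1\<close> makes the Picard iteration below a contraction.\<close>

lemma weighted_primitive_le:
  fixes w :: "real \<Rightarrow> real"
  assumes w: "integrable (lebesgue_on {0..T}) w" and w0: "\<And>t. t \<in> {0..T} \<Longrightarrow> w t \<ge> 0"
  defines "U \<equiv> \<lambda>t. \<integral>\<tau>. w \<tau> \<partial>lebesgue_on {0..t}"
  shows "integrable (lebesgue_on {0..T}) (\<lambda>\<tau>. w \<tau> * exp (4 * U \<tau>))"
    and "t \<in> {0..T} \<Longrightarrow> (\<integral>\<tau>. w \<tau> * exp (4 * U \<tau>) \<partial>lebesgue_on {0..t}) \<le> exp (4 * U t) / 2"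
proof -
  have cU: "continuous_on {0..T} U"
    unfolding U_def by (rule indefinite_lebesgue_integral_continuous[OF w])
  have Udiff: "U t - U s = (\<integral>\<tau>. w \<tau> \<partial>lebesgue_on {s..t})" if "0 \<le> s" "s \<le> t" "t \<le> T" for s t
    unfolding U_def using integral_lebesgue_on_Icc_diff[OF w that] by simp
  have Umono: "U s \<le> U t" if "0 \<le> s" "s \<le> t" "t \<le> T" for s t
  proof -
    have "0 \<le> (\<integral>\<tau>. w \<tau> \<partial>lebesgue_on {s..t})"
      using that w0 by (auto intro!: Bochner_Integration.integral_nonneg)
    then show ?thesis using Udiff[OF that] by linarith
  qed
  show i: "integrable (lebesgue_on {0..T}) (\<lambda>\<tau>. w \<tau> * exp (4 * U \<tau>))"
  proof (rule measurable_bounded_by_integrable_imp_lebesgue_integrable)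
    have "(\<lambda>\<tau>. exp (4 * U \<tau>)) \<in> borel_measurable (lebesgue_on {0..T})"
      by (intro continuous_imp_measurable_on_sets_lebesgue continuous_intros cU) auto
    then show "(\<lambda>\<tau>. w \<tau> * exp (4 * U \<tau>)) \<in> borel_measurable (lebesgue_on {0..T})"
      using w by (intro borel_measurable_times) auto
    show "integrable (lebesgue_on {0..T}) (\<lambda>\<tau>. w \<tau> * exp (4 * U T))" using w by simp
    show "norm (w \<tau> * exp (4 * U \<tau>)) \<le> w \<tau> * exp (4 * U T)" if "\<tau> \<in> {0..T}" for \<tau>
      using w0[OF that] Umono[of \<tau> T] that by (auto simp: abs_mult intro!: mult_left_mono)
  qed auto
  assume t: "t \<in> {0..T}"
  define P where "P t = (\<integral>\<tau>. w \<tau> * exp (4 * U \<tau>) \<partial>lebesgue_on {0..t})" for t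
  obtain \<delta> where \<delta>: "\<delta> > 0"
    and sm: "\<And>s t. 0 \<le> s \<Longrightarrow> s \<le> t \<Longrightarrow> t \<le> T \<Longrightarrow> t - s \<le> \<delta> \<Longrightarrow> (\<integral>\<tau>. w \<tau> \<partial>lebesgue_on {s..t}) \<le> 1/4"
    using integral_short_interval_small[OF w, of "1/4"] by auto
  have "P t - exp (4 * U t) / 2 \<le> P 0 - exp (4 * U 0) / 2"
  proof (rule locally_nonincreasing_imp_le[OF \<delta>, where b = T and f = "\<lambda>t. P t - exp (4 * U t) / 2"])
    fix s t assume st: "0 \<le> s" "s \<le> t" "t \<le> T" "t - s \<le> \<delta>"
    define D where "D = U t - U s"
    have D: "0 \<le> D" "D \<le> 1/4"
      using Umono[OF st(1-3)] sm[OF st] Udiff[OF st(1-3)] by (auto simp: D_def)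
    have int: "integrable (lebesgue_on {s..t}) w" "integrable (lebesgue_on {s..t}) (\<lambda>\<tau>. w \<tau> * exp (4 * U \<tau>))"
      using w i st by (auto intro: integrable_lebesgue_on_Icc_subset)
    have "P t - P s = (\<integral>\<tau>. w \<tau> * exp (4 * U \<tau>) \<partial>lebesgue_on {s..t})"
      unfolding P_def using integral_lebesgue_on_Icc_diff[OF i st(1-3)] .
    also have "\<dots> \<le> (\<integral>\<tau>. w \<tau> * exp (4 * U t) \<partial>lebesgue_on {s..t})"
    proof (rule integral_mono)
      fix \<tau> assume "\<tau> \<in> space (lebesgue_on {s..t})"
      then have \<tau>: "\<tau> \<in> {s..t}" by simp
      show "w \<tau> * exp (4 * U \<tau>) \<le> w \<tau> * exp (4 * U t)"
        using w0[of \<tau>] Umono[of \<tau> t] \<tau> st by (intro mult_left_mono) auto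
    qed (use int in auto)
    also have "\<dots> = D * exp (4 * U t)"
      using int by (simp add: D_def Udiff[OF st(1-3)])
    finally have 1: "P t - P s \<le> D * exp (4 * U t)" .
    have "exp (- 4 * D) \<le> 1 - 2 * D"
    proof -
      have "1 \<le> (1 - 2 * D) * (1 + 4 * D)"
        using D mult_nonneg_nonneg[of D "1 - 4 * D"] by (simp add: algebra_simps)
      also have "\<dots> \<le> (1 - 2 * D) * exp (4 * D)"
        using D exp_ge_add_one_self[of "4 * D"] by (intro mult_left_mono) auto
      finally show ?thesis
        by (simp add: exp_minus field_simps)
    qed
    then have "exp (4 * U t) * exp (- 4 * D) \<le> exp (4 * U t) * (1 - 2 * D)"
      by (intro mult_left_mono) auto
    moreover have "exp (4 * U t) * exp (- 4 * D) = exp (4 * U s)"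
      by (simp add: D_def flip: exp_add)
    ultimately show "P t - exp (4 * U t) / 2 \<le> P s - exp (4 * U s) / 2"
      using 1 by (simp add: algebra_simps)
  qed (use t in auto)
  moreover have "P 0 = 0"
    by (simp add: P_def integral_eq_zero_null_sets)
  ultimately show "(\<integral>\<tau>. w \<tau> * exp (4 * U \<tau>) \<partial>lebesgue_on {0..t}) \<le> exp (4 * U t) / 2"
    unfolding P_def[symmetric] using exp_gt_zero[of "4 * U 0"] by linarith
qed

text \<open>Picard iteration in the norm weighted by \<open>exp (- 4 U t)\<close>, where \<open>U\<close> is the primitive of the
  Lipschitz constant \<open>w\<close> of the right-hand side; the weight makes the iteration a contraction on
  the whole interval.\<close>

proposition caratheodory_existence:
  fixes u :: "real \<Rightarrow> real^'n" and f :: "'n \<Rightarrow> real \<Rightarrow> real \<Rightarrow> 'b::euclidean_space \<Rightarrow> 'b"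
  assumes T: "T \<ge> 0" and u: "integrable (lebesgue_on {0..T}) u"
    and f: "\<And>k. continuous_on ({0..T} \<times> {0..1} \<times> UNIV) (\<lambda>(t, s, x). f k t s x)"
    and lip: "\<And>k t s x y. t \<in> {0..T} \<Longrightarrow> s \<in> {0..1} \<Longrightarrow> norm (f k t s x - f k t s y) \<le> L * norm (x - y)"
    and x0: "continuous_on {0..1} x0"
  obtains x where "continuous_on ({0..T} \<times> {0..1}) (\<lambda>(t, s). x t s)"
    "\<And>s. s \<in> {0..1} \<Longrightarrow> has_ac_derivative_on (\<lambda>t. x t s) (\<lambda>t. \<Sum>k\<in>UNIV. u t $ k *\<^sub>R f k t s (x t s)) 0 T"
    "\<And>s. s \<in> {0..1} \<Longrightarrow> x 0 s = x0 s"
proof -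
  define L' where "L' = max 0 L"
  have L': "L' \<ge> 0" by (simp add: L'_def)
  have lip': "norm (f k t s x - f k t s y) \<le> L' * norm (x - y)" if "t \<in> {0..T}" "s \<in> {0..1}" for k t s x y
    using lip[OF that, of k x y] mult_right_mono[of L L' "norm (x - y)"] by (simp add: L'_def)
  define w where "w \<tau> = real CARD('n) * norm (u \<tau>) * L'" for \<tau>
  have wi: "integrable (lebesgue_on {0..T}) w" unfolding w_def using u by simp
  have w0: "w \<tau> \<ge> 0" for \<tau> using L' by (simp add: w_def)
  define U where "U t = (\<integral>\<tau>. w \<tau> \<partial>lebesgue_on {0..t})" for t
  have cU: "continuous_on {0..T} U"
    unfolding U_def by (rule indefinite_lebesgue_integral_continuous[OF wi])
  note wp = weighted_primitive_le[OF wi w0, folded U_def]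
  let ?box = "{0..T} \<times> {0..(1::real)}"
  define g where "g z k \<tau> s = f k \<tau> s (exp (4 * U \<tau>) *\<^sub>R apply_bcontfun z (\<tau>, s))" for z :: "(real \<times> real) \<Rightarrow>\<^sub>C 'b" and k \<tau> s
  define F where "F z \<tau> s = (\<Sum>k\<in>UNIV. u \<tau> $ k *\<^sub>R g z k \<tau> s)" for z \<tau> s
  define \<Phi> where "\<Phi> z t s = exp (- 4 * U t) *\<^sub>R (x0 s + (\<integral>\<tau>. F z \<tau> s \<partial>lebesgue_on {0..t}))" for z t s
  have cg: "continuous_on ?box (\<lambda>(t, s). g z k t s)" for z k
  proof -
    have "continuous_on ?box (\<lambda>p. (fst p, snd p, exp (4 * U (fst p)) *\<^sub>R apply_bcontfun z p))"
      by (intro continuous_intros continuous_on_compose2[OF cU]) auto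
    then have "continuous_on ?box (\<lambda>p. case (fst p, snd p, exp (4 * U (fst p)) *\<^sub>R apply_bcontfun z p) of (t, s, x) \<Rightarrow> f k t s x)"
      by (rule continuous_on_compose2[OF f]) auto
    then show ?thesis by (simp add: g_def case_prod_beta)
  qed
  have cgt: "continuous_on {0..T} (\<lambda>t. g z k t s)" if "s \<in> {0..1}" for z k s
    by (rule continuous_on_slices(1)[OF cg that])
  have Fi: "integrable (lebesgue_on {0..T}) (\<lambda>\<tau>. F z \<tau> s)" if "s \<in> {0..1}" for z s
    unfolding F_def by (rule integrable_control_times_continuous[OF u cgt[OF that]])
  have c\<Phi>: "continuous_on ?box (\<lambda>(t, s). \<Phi> z t s)" for z
  proof -
    have "continuous_on ?box (\<lambda>p. exp (- 4 * U (fst p)) *\<^sub>R (x0 (snd p) + (case p of (t, s) \<Rightarrow> \<integral>\<tau>. F z \<tau> s \<partial>lebesgue_on {0..t})))"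
      unfolding F_def
      by (intro continuous_intros continuous_on_compose2[OF cU] continuous_on_compose2[OF x0]
          continuous_on_parametric_primitive[OF u cg]) auto
    then show ?thesis by (simp add: \<Phi>_def case_prod_beta)
  qed
  \<comment> \<open>nearest-point projection to the box, to obtain functions on the whole plane\<close>
  define c where "c p = (max 0 (min T (fst p)), max 0 (min 1 (snd p)))" for p :: "real \<times> real"
  have c_in: "c p \<in> ?box" for p using T by (auto simp: c_def)
  have c_id: "c p = p" if "p \<in> ?box" for p using that by (auto simp: c_def)
  have cc: "continuous_on UNIV c" unfolding c_def by (intro continuous_intros)
  define \<Psi> where "\<Psi> z = Bcontfun (\<lambda>p. case c p of (t, s) \<Rightarrow> \<Phi> z t s)" for z
  have \<Psi>: "apply_bcontfun (\<Psi> z) p = (case c p of (t, s) \<Rightarrow> \<Phi> z t s)" for z p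
  proof -
    have "(\<lambda>p. case c p of (t, s) \<Rightarrow> \<Phi> z t s) \<in> bcontfun"
    proof -
      have "bounded ((\<lambda>(t, s). \<Phi> z t s) ` ?box)"
        by (intro compact_imp_bounded compact_continuous_image c\<Phi> compact_Times) auto
      then have "bounded (range (\<lambda>p. case c p of (t, s) \<Rightarrow> \<Phi> z t s))"
        by (rule bounded_subset) (use c_in in blast)
      moreover have "continuous_on UNIV (\<lambda>p. case c p of (t, s) \<Rightarrow> \<Phi> z t s)"
        by (rule continuous_on_compose2[OF c\<Phi> cc]) (use c_in in blast)
      ultimately show ?thesis by (simp add: bcontfun_def)
    qed
    then show ?thesis unfolding \<Psi>_def by (simp add: Bcontfun_inverse)
  qed
  have "\<exists>!z. \<Psi> z = z"
  proof (rule banach_fix_type[of "1/2"])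
    show "\<forall>y z. dist (\<Psi> y) (\<Psi> z) \<le> 1/2 * dist y z"
    proof (intro allI dist_bound)
      fix y z p
      obtain t s where ts: "c p = (t, s)" "t \<in> {0..T}" "s \<in> {0..1}" using c_in[of p] by (cases "c p") auto
      have int: "integrable (lebesgue_on {0..t}) (\<lambda>\<tau>. F y \<tau> s)" "integrable (lebesgue_on {0..t}) (\<lambda>\<tau>. F z \<tau> s)"
        "integrable (lebesgue_on {0..t}) (\<lambda>\<tau>. w \<tau> * exp (4 * U \<tau>))"
        using Fi[OF ts(3)] wp(1) ts by (auto intro: integrable_lebesgue_on_Icc_subset)
      have "dist (\<Psi> y p) (\<Psi> z p) = exp (- 4 * U t) * norm ((\<integral>\<tau>. F y \<tau> s \<partial>lebesgue_on {0..t}) - (\<integral>\<tau>. F z \<tau> s \<partial>lebesgue_on {0..t}))"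
        by (simp add: \<Psi> ts \<Phi>_def dist_norm flip: scaleR_diff_right)
      also have "(\<integral>\<tau>. F y \<tau> s \<partial>lebesgue_on {0..t}) - (\<integral>\<tau>. F z \<tau> s \<partial>lebesgue_on {0..t}) = (\<integral>\<tau>. F y \<tau> s - F z \<tau> s \<partial>lebesgue_on {0..t})"
        using int by simp
      also have "norm \<dots> \<le> (\<integral>\<tau>. norm (F y \<tau> s - F z \<tau> s) \<partial>lebesgue_on {0..t})"
        by (rule integral_norm_bound)
      also have "\<dots> \<le> (\<integral>\<tau>. w \<tau> * exp (4 * U \<tau>) * dist y z \<partial>lebesgue_on {0..t})"
      proof (rule integral_mono)
        fix \<tau> assume "\<tau> \<in> space (lebesgue_on {0..t})"
        then have \<tau>: "\<tau> \<in> {0..T}" using ts by simp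
        have "norm (g y k \<tau> s - g z k \<tau> s) \<le> L' * (exp (4 * U \<tau>) * dist y z)" for k
        proof -
          have "norm (g y k \<tau> s - g z k \<tau> s) \<le> L' * norm (exp (4 * U \<tau>) *\<^sub>R y (\<tau>, s) - exp (4 * U \<tau>) *\<^sub>R z (\<tau>, s))"
            unfolding g_def by (rule lip'[OF \<tau> ts(3)])
          also have "\<dots> = L' * (exp (4 * U \<tau>) * dist (y (\<tau>, s)) (z (\<tau>, s)))"
            by (simp add: dist_norm flip: scaleR_diff_right)
          also have "\<dots> \<le> L' * (exp (4 * U \<tau>) * dist y z)"
            using L' by (intro mult_left_mono dist_bounded) auto
          finally show ?thesis .
        qed
        from norm_control_sum_le[OF this, of "u \<tau>"]
        show "norm (F y \<tau> s - F z \<tau> s) \<le> w \<tau> * exp (4 * U \<tau>) * dist y z"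
          by (simp add: F_def w_def scaleR_diff_right sum_subtractf mult_ac)
      qed (use int in auto)
      also have "\<dots> = (\<integral>\<tau>. w \<tau> * exp (4 * U \<tau>) \<partial>lebesgue_on {0..t}) * dist y z"
        using int by simp
      also have "\<dots> \<le> exp (4 * U t) / 2 * dist y z"
        by (intro mult_right_mono wp(2) ts) auto
      finally have "dist (\<Psi> y p) (\<Psi> z p) \<le> exp (- 4 * U t) * (exp (4 * U t) / 2 * dist y z)"
        by simp
      also have "\<dots> = 1/2 * dist y z"
        by (simp add: exp_minus)
      finally show "dist (\<Psi> y p) (\<Psi> z p) \<le> 1/2 * dist y z" .
    qed
  qed auto
  then obtain z where z: "\<Psi> z = z" by auto
  define x where "x t s = exp (4 * U t) *\<^sub>R apply_bcontfun z (t, s)" for t s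
  have x_eq: "x t s = x0 s + (\<integral>\<tau>. F z \<tau> s \<partial>lebesgue_on {0..t})" if "t \<in> {0..T}" "s \<in> {0..1}" for t s
  proof -
    have "z (t, s) = \<Phi> z t s"
      using \<Psi>[of z "(t, s)"] z c_id[of "(t, s)"] that by simp
    then show ?thesis by (simp add: x_def \<Phi>_def flip: exp_add)
  qed
  have Fx: "F z \<tau> s = (\<Sum>k\<in>UNIV. u \<tau> $ k *\<^sub>R f k \<tau> s (x \<tau> s))" for \<tau> s
    by (simp add: F_def g_def x_def)
  show thesis
  proof (rule that[of x])
    have "continuous_on ?box (\<lambda>p. exp (4 * U (fst p)) *\<^sub>R apply_bcontfun z p)"
      by (intro continuous_intros continuous_on_compose2[OF cU]) auto
    then show "continuous_on ?box (\<lambda>(t, s). x t s)" by (simp add: x_def case_prod_beta)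
    fix s :: real assume s: "s \<in> {0..1}"
    show x0s: "x 0 s = x0 s"
      using x_eq[of 0 s] s T by (simp add: integral_eq_zero_null_sets)
    show "has_ac_derivative_on (\<lambda>t. x t s) (\<lambda>t. \<Sum>k\<in>UNIV. u t $ k *\<^sub>R f k t s (x t s)) 0 T"
      unfolding has_ac_derivative_on_def Fx[symmetric] x0s using Fi[OF s] x_eq[OF _ s] by blast
  qed
qed

text \<open>Time reversal turns the terminal value into an initial value.\<close>

lemma caratheodory_existence_backward:
  fixes u :: "real \<Rightarrow> real^'n" and f :: "'n \<Rightarrow> real \<Rightarrow> real \<Rightarrow> 'b::euclidean_space \<Rightarrow> 'b"
  assumes T: "T \<ge> 0" and u: "integrable (lebesgue_on {0..T}) u"
    and f: "\<And>k. continuous_on ({0..T} \<times> {0..1} \<times> UNIV) (\<lambda>(t, s, x). f k t s x)"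
    and lip: "\<And>k t s x y. t \<in> {0..T} \<Longrightarrow> s \<in> {0..1} \<Longrightarrow> norm (f k t s x - f k t s y) \<le> L * norm (x - y)"
    and x1: "continuous_on {0..1} x1"
  obtains x where "continuous_on ({0..T} \<times> {0..1}) (\<lambda>(t, s). x t s)"
    "\<And>s. s \<in> {0..1} \<Longrightarrow> has_ac_derivative_on (\<lambda>t. x t s) (\<lambda>t. - (\<Sum>k\<in>UNIV. u t $ k *\<^sub>R f k t s (x t s))) 0 T"
    "\<And>s. s \<in> {0..1} \<Longrightarrow> x T s = x1 s"
proof -
  have "has_ac_derivative_on (\<lambda>t. \<integral>\<tau>. u \<tau> \<partial>lebesgue_on {0..t}) u 0 T"
    using u unfolding has_ac_derivative_on_def by (simp add: integral_eq_zero_null_sets)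
  from ac_derivative_reflect[OF this] have ur: "integrable (lebesgue_on {0..T}) (\<lambda>t. u (T - t))"
    unfolding has_ac_derivative_on_def by auto
  have fr: "continuous_on ({0..T} \<times> {0..1} \<times> UNIV) (\<lambda>(t, s, x). f k (T - t) s x)" for k
  proof -
    have "continuous_on ({0..T} \<times> {0..1} \<times> UNIV) (\<lambda>p. (T - fst p, fst (snd p), snd (snd p)) :: real \<times> real \<times> 'b)"
      by (intro continuous_intros)
    then have "continuous_on ({0..T} \<times> {0..1} \<times> UNIV) (\<lambda>p. case (T - fst p, fst (snd p), snd (snd p)) of (t, s, x) \<Rightarrow> f k t s x)"
      by (rule continuous_on_compose2[OF f]) auto
    then show ?thesis by (simp add: case_prod_beta)
  qed
  obtain y where y: "continuous_on ({0..T} \<times> {0..1}) (\<lambda>(t, s). y t s)"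
    "\<And>s. s \<in> {0..1} \<Longrightarrow> has_ac_derivative_on (\<lambda>t. y t s) (\<lambda>t. \<Sum>k\<in>UNIV. u (T - t) $ k *\<^sub>R f k (T - t) s (y t s)) 0 T"
    "\<And>s. s \<in> {0..1} \<Longrightarrow> y 0 s = x1 s"
  proof (rule caratheodory_existence[where f = "\<lambda>k t s x. f k (T - t) s x", OF T ur fr _ x1])
    show "norm (f k (T - t) s x - f k (T - t) s y) \<le> L * norm (x - y)" if "t \<in> {0..T}" "s \<in> {0..1}" for k t s x y
      using that by (intro lip) auto
  qed (rule that; assumption)
  show thesis
  proof (rule that[of "\<lambda>t s. y (T - t) s"])
    have "continuous_on ({0..T} \<times> {0..1}) (\<lambda>p. (T - fst p, snd p) :: real \<times> real)"
      by (intro continuous_intros)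
    then have "continuous_on ({0..T} \<times> {0..1}) (\<lambda>p. case (T - fst p, snd p) of (t, s) \<Rightarrow> y t s)"
      by (rule continuous_on_compose2[OF y(1)]) auto
    then show "continuous_on ({0..T} \<times> {0..1}) (\<lambda>(t, s). y (T - t) s)"
      by (simp add: case_prod_beta)
    fix s :: real assume s: "s \<in> {0..1}"
    show "y (T - T) s = x1 s" using y(3)[OF s] by simp
    show "has_ac_derivative_on (\<lambda>t. y (T - t) s) (\<lambda>t. - (\<Sum>k\<in>UNIV. u t $ k *\<^sub>R f k t s (y (T - t) s))) 0 T"
      using ac_derivative_reflect[OF y(2)[OF s]] by simp
  qed
qed

section \<open>Duality between the perturbed state and the adjoint state\<close>

text \<open>The bound is linear in the \<open>L\<^sup>1\<close> norm of \<open>v\<close>, up to a factor that is bounded for bounded \<open>v\<close>.\<close>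

lemma perturbed_state_bound:
  fixes u v :: "real \<Rightarrow> real^'n" and F :: "'n \<Rightarrow> 'b::euclidean_space \<Rightarrow> 'b"
  assumes u: "integrable (lebesgue_on {0..T}) u" and v: "integrable (lebesgue_on {0..T}) v"
    and z: "has_ac_derivative_on z (\<lambda>t. \<Sum>k\<in>UNIV. u t $ k *\<^sub>R F k (z t)) 0 T"
    and zv: "has_ac_derivative_on zv (\<lambda>t. \<Sum>k\<in>UNIV. (u t + v t) $ k *\<^sub>R F k (zv t)) 0 T"
    and init: "zv 0 = z 0"
    and S: "\<And>t. t \<in> {0..T} \<Longrightarrow> z t \<in> S" "\<And>t. t \<in> {0..T} \<Longrightarrow> zv t \<in> S"
    and C: "C \<ge> 0" and bound: "\<And>k x. x \<in> S \<Longrightarrow> norm (F k x) \<le> C"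
    and lip: "\<And>k x y. x \<in> S \<Longrightarrow> y \<in> S \<Longrightarrow> norm (F k y - F k x) \<le> C * norm (y - x)"
    and t: "t \<in> {0..T}"
  defines "NC \<equiv> real CARD('n) * C"
  shows "norm (zv t - z t) \<le> NC * (\<integral>t. norm (v t) \<partial>lebesgue_on {0..T}) *
    exp (2 * NC * ((\<integral>t. norm (u t) \<partial>lebesgue_on {0..T}) + (\<integral>t. norm (v t) \<partial>lebesgue_on {0..T})))"
proof -
  define y where "y t = norm (zv t - z t)" for t
  define w where "w t = NC * (norm (u t) + norm (v t))" for t
  have NC: "NC \<ge> 0" using C by (simp add: NC_def)
  have wi: "integrable (lebesgue_on {0..T}) w" unfolding w_def using u v by simp
  have d: "has_ac_derivative_on (\<lambda>t. zv t - z t)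
      (\<lambda>t. (\<Sum>k\<in>UNIV. (u t + v t) $ k *\<^sub>R F k (zv t)) - (\<Sum>k\<in>UNIV. u t $ k *\<^sub>R F k (z t))) 0 T" (is "has_ac_derivative_on _ ?h 0 T")
    by (rule ac_derivative_diff_fun[OF zv z])
  have cy: "continuous_on {0..T} y"
    unfolding y_def by (intro continuous_intros ac_derivative_continuous[OF zv] ac_derivative_continuous[OF z])
  have wy: "integrable (lebesgue_on {0..T}) (\<lambda>t. w t * y t)"
  proof -
    have "bounded (y ` {0..T})" by (intro compact_imp_bounded compact_continuous_image cy) auto
    then obtain B where B: "\<And>t. t \<in> {0..T} \<Longrightarrow> \<bar>y t\<bar> \<le> B"
      unfolding bounded_iff by (metis imageI real_norm_def)
    show ?thesis
    proof (rule measurable_bounded_by_integrable_imp_lebesgue_integrable)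
      show "(\<lambda>t. w t * y t) \<in> borel_measurable (lebesgue_on {0..T})"
        using borel_measurable_integrable[OF wi] continuous_imp_measurable_on_sets_lebesgue[OF cy]
        by (intro borel_measurable_times) auto
      show "integrable (lebesgue_on {0..T}) (\<lambda>t. \<bar>w t\<bar> * B)" using wi by simp
      show "norm (w t * y t) \<le> \<bar>w t\<bar> * B" if "t \<in> {0..T}" for t
        using B[OF that] by (simp add: abs_mult mult_left_mono)
    qed auto
  qed
  have hb: "norm (?h t) \<le> w t * y t + NC * norm (v t)" if t: "t \<in> {0..T}" for t
  proof -
    have "?h t = (\<Sum>k\<in>UNIV. u t $ k *\<^sub>R (F k (zv t) - F k (z t))) + (\<Sum>k\<in>UNIV. v t $ k *\<^sub>R (F k (zv t) - F k (z t))) + (\<Sum>k\<in>UNIV. v t $ k *\<^sub>R F k (z t))"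
      by (simp add: scaleR_diff_right scaleR_add_left sum_subtractf sum.distrib)
    also have "norm \<dots> \<le> real CARD('n) * norm (u t) * (C * y t) + real CARD('n) * norm (v t) * (C * y t) + real CARD('n) * norm (v t) * C"
      unfolding y_def
      by (intro norm_triangle_mono norm_control_sum_le lip bound S t)
    finally show ?thesis by (simp add: w_def NC_def algebra_simps)
  qed
  have "y t \<le> (NC * (\<integral>t. norm (v t) \<partial>lebesgue_on {0..T})) * exp (2 * (\<integral>\<tau>. w \<tau> \<partial>lebesgue_on {0..T}))"
  proof (rule gronwall[OF wi _ wy _ _ _ t])
    show "w t \<ge> 0" for t using NC by (simp add: w_def)
    show "y t \<ge> 0" for t by (simp add: y_def)
    show "0 \<le> NC * (\<integral>t. norm (v t) \<partial>lebesgue_on {0..T})"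
      using NC by (intro mult_nonneg_nonneg Bochner_Integration.integral_nonneg) auto
    fix t assume t: "t \<in> {0..T}"
    have vi: "integrable (lebesgue_on {0..t}) (\<lambda>t. norm (v t))" and wyi: "integrable (lebesgue_on {0..t}) (\<lambda>t. w t * y t)"
      using t integrable_lebesgue_on_Icc_subset[OF integrable_norm[OF v], of 0 t]
        integrable_lebesgue_on_Icc_subset[OF wy, of 0 t] by auto
    have hi: "integrable (lebesgue_on {0..t}) ?h"
      using t by (intro ac_derivative_integrable[OF d]) auto
    have "zv t - z t = (\<integral>\<tau>. ?h \<tau> \<partial>lebesgue_on {0..t})"
      using ac_derivative_diff[OF d, of 0 t] t init by simp
    then have "y t = norm (\<integral>\<tau>. ?h \<tau> \<partial>lebesgue_on {0..t})"
      by (simp only: y_def)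
    also have "\<dots> \<le> (\<integral>\<tau>. norm (?h \<tau>) \<partial>lebesgue_on {0..t})"
      by (rule integral_norm_bound)
    also have "\<dots> \<le> (\<integral>\<tau>. w \<tau> * y \<tau> + NC * norm (v \<tau>) \<partial>lebesgue_on {0..t})"
    proof (rule integral_mono)
      show "norm (?h \<tau>) \<le> w \<tau> * y \<tau> + NC * norm (v \<tau>)" if "\<tau> \<in> space (lebesgue_on {0..t})" for \<tau>
        using that t by (intro hb) auto
    qed (use hi vi wyi in auto)
    also have "\<dots> = (\<integral>\<tau>. w \<tau> * y \<tau> \<partial>lebesgue_on {0..t}) + NC * (\<integral>\<tau>. norm (v \<tau>) \<partial>lebesgue_on {0..t})"
      using vi wyi by simp
    also have "(\<integral>\<tau>. norm (v \<tau>) \<partial>lebesgue_on {0..t}) \<le> (\<integral>\<tau>. norm (v \<tau>) \<partial>lebesgue_on {0..T})"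
    proof -
      have "(\<integral>\<tau>. norm (v \<tau>) \<partial>lebesgue_on {0..T}) - (\<integral>\<tau>. norm (v \<tau>) \<partial>lebesgue_on {0..t}) = (\<integral>\<tau>. norm (v \<tau>) \<partial>lebesgue_on {t..T})"
        using t v by (intro integral_lebesgue_on_Icc_diff) auto
      also have "\<dots> \<ge> 0" by (intro Bochner_Integration.integral_nonneg) auto
      finally show ?thesis by simp
    qed
    finally show "y t \<le> NC * (\<integral>t. norm (v t) \<partial>lebesgue_on {0..T}) + (\<integral>\<tau>. w \<tau> * y \<tau> \<partial>lebesgue_on {0..t})"
      using NC by (simp add: mult_left_mono)
  qed
  moreover have "(\<integral>\<tau>. w \<tau> \<partial>lebesgue_on {0..T}) = NC * ((\<integral>t. norm (u t) \<partial>lebesgue_on {0..T}) + (\<integral>t. norm (v t) \<partial>lebesgue_on {0..T}))"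
    unfolding w_def using u v by simp
  ultimately show ?thesis by (simp add: y_def mult_ac)
qed

text \<open>The adjoint equation cancels the first-order terms in \<open>zv - z\<close>, which leaves the Taylor
  remainders and the product of the control increment with \<open>zv - z\<close>.\<close>

proposition adjoint_duality:
  fixes u v :: "real \<Rightarrow> real^'n" and F :: "'n \<Rightarrow> 'b::euclidean_space \<Rightarrow> 'b"
  assumes T: "T \<ge> 0" and u: "integrable (lebesgue_on {0..T}) u" and v: "integrable (lebesgue_on {0..T}) v"
    and z: "has_ac_derivative_on z (\<lambda>t. \<Sum>k\<in>UNIV. u t $ k *\<^sub>R F k (z t)) 0 T"
    and zv: "has_ac_derivative_on zv (\<lambda>t. \<Sum>k\<in>UNIV. (u t + v t) $ k *\<^sub>R F k (zv t)) 0 T"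
    and init: "zv 0 = z 0"
    and r: "has_ac_derivative_on r (\<lambda>t. - (\<Sum>k\<in>UNIV. u t $ k *\<^sub>R A k (z t) (r t))) 0 T"
    and adj: "\<And>k x a y. A k x a \<bullet> y = a \<bullet> DF k x y"
    and S: "\<And>t. t \<in> {0..T} \<Longrightarrow> z t \<in> S" "\<And>t. t \<in> {0..T} \<Longrightarrow> zv t \<in> S"
    and C: "C \<ge> 0" and bound: "\<And>k x. x \<in> S \<Longrightarrow> norm (F k x) \<le> C"
    and lip: "\<And>k x y. x \<in> S \<Longrightarrow> y \<in> S \<Longrightarrow> norm (F k y - F k x) \<le> C * norm (y - x)"
    and taylor: "\<And>k x y. x \<in> S \<Longrightarrow> y \<in> S \<Longrightarrow> norm (F k y - F k x - DF k x (y - x)) \<le> C * (norm (y - x))\<^sup>2"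
    and R: "\<And>t. t \<in> {0..T} \<Longrightarrow> norm (r t) \<le> R"
    and Y: "\<And>t. t \<in> {0..T} \<Longrightarrow> norm (zv t - z t) \<le> Y"
  shows "integrable (lebesgue_on {0..T}) (\<lambda>t. \<Sum>k\<in>UNIV. v t $ k *\<^sub>R (r t \<bullet> F k (z t)))"
    and "\<bar>r T \<bullet> (zv T - z T) - (\<integral>t. (\<Sum>k\<in>UNIV. v t $ k *\<^sub>R (r t \<bullet> F k (z t))) \<partial>lebesgue_on {0..T})\<bar>
      \<le> real CARD('n) * R * C * ((\<integral>t. norm (u t) \<partial>lebesgue_on {0..T}) * Y\<^sup>2 + (\<integral>t. norm (v t) \<partial>lebesgue_on {0..T}) * Y)"
proof -
  have R0: "R \<ge> 0" using R[of 0] T norm_ge_zero[of "r 0"] by (meson atLeastAtMost_iff order.refl order.trans)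
  have Y0: "Y \<ge> 0" using Y[of 0] T norm_ge_zero[of "zv 0 - z 0"] by (meson atLeastAtMost_iff order.refl order.trans)
  have cz: "continuous_on {0..T} z" and cr: "continuous_on {0..T} r"
    using z r by (auto intro: ac_derivative_continuous)
  have cF: "continuous_on S (F k)" for k
    using C lip by (intro lipschitz_on_continuous_on[where L = C]) (auto simp: lipschitz_on_def dist_norm norm_minus_commute)
  have cFz: "continuous_on {0..T} (\<lambda>t. F k (z t))" for k
    by (rule continuous_on_compose2[OF cF cz]) (use S in auto)
  show vi: "integrable (lebesgue_on {0..T}) (\<lambda>t. \<Sum>k\<in>UNIV. v t $ k *\<^sub>R (r t \<bullet> F k (z t)))"
    by (intro integrable_control_times_continuous v continuous_intros cr cFz)
  define y where "y t = zv t - z t" for t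
  define h where "h t = (\<Sum>k\<in>UNIV. (u t + v t) $ k *\<^sub>R F k (zv t)) - (\<Sum>k\<in>UNIV. u t $ k *\<^sub>R F k (z t))" for t
  have d: "has_ac_derivative_on y h 0 T"
    unfolding y_def h_def by (rule ac_derivative_diff_fun[OF zv z])
  note ibp = ac_derivative_integration_by_parts[OF r d T]
  have "r T \<bullet> y T = (\<integral>t. - (\<Sum>k\<in>UNIV. u t $ k *\<^sub>R A k (z t) (r t)) \<bullet> y t + r t \<bullet> h t \<partial>lebesgue_on {0..T})"
    using ibp(2) init by (simp add: y_def)
  then have eq: "r T \<bullet> y T - (\<integral>t. (\<Sum>k\<in>UNIV. v t $ k *\<^sub>R (r t \<bullet> F k (z t))) \<partial>lebesgue_on {0..T}) =
    (\<integral>t. (- (\<Sum>k\<in>UNIV. u t $ k *\<^sub>R A k (z t) (r t)) \<bullet> y t + r t \<bullet> h t) - (\<Sum>k\<in>UNIV. v t $ k *\<^sub>R (r t \<bullet> F k (z t))) \<partial>lebesgue_on {0..T})"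
    (is "_ = (\<integral>t. ?m t \<partial>_)")
    using Bochner_Integration.integral_diff[OF ibp(1) vi] by simp
  have "\<bar>\<integral>t. ?m t \<partial>lebesgue_on {0..T}\<bar> \<le> (\<integral>t. \<bar>?m t\<bar> \<partial>lebesgue_on {0..T})"
    using integral_norm_bound[of "lebesgue_on {0..T}" ?m] by simp
  also have "\<dots> \<le> (\<integral>t. real CARD('n) * R * C * (norm (u t) * Y\<^sup>2 + norm (v t) * Y) \<partial>lebesgue_on {0..T})"
  proof (rule integral_mono)
    show "integrable (lebesgue_on {0..T}) (\<lambda>t. \<bar>?m t\<bar>)"
      using Bochner_Integration.integrable_diff[OF ibp(1) vi] by (rule integrable_abs)
    show "integrable (lebesgue_on {0..T}) (\<lambda>t. real CARD('n) * R * C * (norm (u t) * Y\<^sup>2 + norm (v t) * Y))"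
      using u v by simp
    fix t assume "t \<in> space (lebesgue_on {0..T})"
    then have t: "t \<in> {0..T}" by simp
    have yt: "norm (y t) \<le> Y" using Y[OF t] by (simp add: y_def)
    have yz: "y t = zv t - z t" by (simp add: y_def)
    have 1: "- (\<Sum>k\<in>UNIV. u t $ k *\<^sub>R A k (z t) (r t)) \<bullet> y t = - (\<Sum>k\<in>UNIV. u t $ k * (r t \<bullet> DF k (z t) (y t)))"
      by (simp add: inner_sum_left adj)
    have 2: "r t \<bullet> h t = (\<Sum>k\<in>UNIV. u t $ k * (r t \<bullet> F k (zv t))) + (\<Sum>k\<in>UNIV. v t $ k * (r t \<bullet> F k (zv t)))
        - (\<Sum>k\<in>UNIV. u t $ k * (r t \<bullet> F k (z t)))"
      by (simp add: h_def inner_diff_right inner_sum_right distrib_right sum.distrib)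
    have "?m t = (\<Sum>k\<in>UNIV. u t $ k *\<^sub>R (r t \<bullet> (F k (zv t) - F k (z t) - DF k (z t) (y t))))
        + (\<Sum>k\<in>UNIV. v t $ k *\<^sub>R (r t \<bullet> (F k (zv t) - F k (z t))))"
      unfolding 1 2 by (simp add: inner_diff_right right_diff_distrib sum_subtractf)
    also have "norm \<dots> \<le> real CARD('n) * norm (u t) * (R * (C * Y\<^sup>2)) + real CARD('n) * norm (v t) * (R * (C * Y))"
    proof (intro norm_triangle_mono norm_control_sum_le)
      fix k
      have "norm (F k (zv t) - F k (z t) - DF k (z t) (y t)) \<le> C * (norm (y t))\<^sup>2"
        unfolding yz by (intro taylor S t)
      also have "\<dots> \<le> C * Y\<^sup>2" using yt C by (intro mult_left_mono power_mono) auto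
      finally show "norm (r t \<bullet> (F k (zv t) - F k (z t) - DF k (z t) (y t))) \<le> R * (C * Y\<^sup>2)"
        using Cauchy_Schwarz_ineq2[of "r t"] mult_mono[OF R[OF t]] R0 by (metis norm_ge_zero order_trans real_norm_def)
      have "norm (F k (zv t) - F k (z t)) \<le> C * norm (y t)"
        unfolding yz by (intro lip S t)
      also have "\<dots> \<le> C * Y" using yt C by (intro mult_left_mono) auto
      finally show "norm (r t \<bullet> (F k (zv t) - F k (z t))) \<le> R * (C * Y)"
        using Cauchy_Schwarz_ineq2[of "r t"] mult_mono[OF R[OF t]] R0 by (metis norm_ge_zero order_trans real_norm_def)
    qed
    finally show "\<bar>?m t\<bar> \<le> real CARD('n) * R * C * (norm (u t) * Y\<^sup>2 + norm (v t) * Y)"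
      by (simp add: algebra_simps)
  qed
  also have "\<dots> = real CARD('n) * R * C * ((\<integral>t. norm (u t) \<partial>lebesgue_on {0..T}) * Y\<^sup>2 + (\<integral>t. norm (v t) \<partial>lebesgue_on {0..T}) * Y)"
    using u v by simp
  finally show "\<bar>r T \<bullet> (zv T - z T) - (\<integral>t. (\<Sum>k\<in>UNIV. v t $ k *\<^sub>R (r t \<bullet> F k (z t))) \<partial>lebesgue_on {0..T})\<bar>
      \<le> real CARD('n) * R * C * ((\<integral>t. norm (u t) \<partial>lebesgue_on {0..T}) * Y\<^sup>2 + (\<integral>t. norm (v t) \<partial>lebesgue_on {0..T}) * Y)"
    unfolding y_def[symmetric] eq .
qed

section \<open>Invariance of the closed domain under tangential fields\<close>

text \<open>McShane's extension \<open>x \<mapsto> inf {f y + L d(x, y) | y \<in> K}\<close>.\<close>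

lemma lipschitz_extension_real:
  fixes f :: "'a::metric_space \<Rightarrow> real"
  assumes "K \<noteq> {}" "L \<ge> 0" and lip: "\<And>x y. x \<in> K \<Longrightarrow> y \<in> K \<Longrightarrow> \<bar>f y - f x\<bar> \<le> L * dist x y"
  obtains g where "\<And>x. x \<in> K \<Longrightarrow> g x = f x" "\<And>x y. \<bar>g y - g x\<bar> \<le> L * dist x y"
proof -
  define g where "g x = (INF y\<in>K. f y + L * dist x y)" for x
  obtain k where k: "k \<in> K" using assms(1) by blast
  have bdd: "bdd_below ((\<lambda>y. f y + L * dist x y) ` K)" for x
  proof (rule bdd_belowI2)
    fix y assume y: "y \<in> K"
    have "f k - f y \<le> L * dist y k" using lip[OF y k] by linarith
    also have "\<dots> \<le> L * (dist x y + dist x k)"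
      using assms(2) dist_triangle[of y k x] by (intro mult_left_mono) (simp_all add: dist_commute)
    finally show "f k - L * dist x k \<le> f y + L * dist x y" by (simp add: algebra_simps)
  qed
  have up: "g x \<le> f y + L * dist x y" if "y \<in> K" for x y
    unfolding g_def by (rule cINF_lower[OF bdd that])
  have half: "g y \<le> g x + L * dist x y" for x y
  proof -
    have "g y - L * dist x y \<le> (INF z\<in>K. f z + L * dist x z)"
    proof (rule cINF_greatest[OF assms(1)])
      fix z assume "z \<in> K"
      then have "g y \<le> f z + L * dist y z" by (rule up)
      also have "L * dist y z \<le> L * (dist x y + dist x z)"
        using assms(2) dist_triangle[of y z x] by (intro mult_left_mono) (simp_all add: dist_commute)
      finally show "g y - L * dist x y \<le> f z + L * dist x z" by (simp add: algebra_simps)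
    qed
    then show ?thesis by (simp add: g_def)
  qed
  show thesis
  proof (rule that[of g])
    fix x y
    show "\<bar>g y - g x\<bar> \<le> L * dist x y"
      using half[of x y] half[of y x] by (simp add: dist_commute abs_le_iff)
  next
    fix x assume x: "x \<in> K"
    have "f x \<le> g x"
      unfolding g_def
    proof (rule cINF_greatest[OF assms(1)])
      fix y assume "y \<in> K"
      then show "f x \<le> f y + L * dist x y" using lip[of x y] x by (simp add: abs_le_iff)
    qed
    then show "g x = f x" using up[OF x, of x] by simp
  qed
qed

lemma lipschitz_extension_vec:
  fixes f :: "'a::metric_space \<Rightarrow> real^'m"
  assumes "K \<noteq> {}" "L \<ge> 0" and lip: "\<And>x y. x \<in> K \<Longrightarrow> y \<in> K \<Longrightarrow> norm (f y - f x) \<le> L * dist x y"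
  obtains g where "\<And>x. x \<in> K \<Longrightarrow> g x = f x" "\<And>x y. norm (g y - g x) \<le> real CARD('m) * L * dist x y"
proof -
  have "\<exists>g. (\<forall>x\<in>K. g x = f x $ i) \<and> (\<forall>x y. \<bar>g y - g x\<bar> \<le> L * dist x y)" for i
  proof -
    have "\<bar>f y $ i - f x $ i\<bar> \<le> L * dist x y" if "x \<in> K" "y \<in> K" for x y
      using component_le_norm_cart[of "f y - f x" i] lip[OF that] by simp
    from lipschitz_extension_real[OF assms(1,2) this] show ?thesis by metis
  qed
  then obtain g where g: "\<And>i x. x \<in> K \<Longrightarrow> g i x = f x $ i" "\<And>i x y. \<bar>g i y - g i x\<bar> \<le> L * dist x y"
    by metis
  show thesis
  proof (rule that[of "\<lambda>x. \<chi> i. g i x"])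
    show "(\<chi> i. g i x) = f x" if "x \<in> K" for x using g(1)[OF that] by (simp add: vec_eq_iff)
    fix x y
    have "norm ((\<chi> i. g i y) - (\<chi> i. g i x)) \<le> (\<Sum>i\<in>(UNIV::'m set). L * dist x y)"
      by (rule order_trans[OF norm_le_l1_cart])
        (use sum_mono[of UNIV "\<lambda>i. \<bar>g i y - g i x\<bar>" "\<lambda>_. L * dist x y"] g(2) in simp)
    then show "norm ((\<chi> i. g i y) - (\<chi> i. g i x)) \<le> real CARD('m) * L * dist x y" by simp
  qed
qed

text \<open>Since the fields at a nearest point are orthogonal to the displacement, the squared
  distance to \<open>K\<close> grows at most exponentially along a solution, so it remains zero. The estimate
  compares two times directly, with an error quadratic in the integral of the control.\<close>

proposition invariant_set:
  fixes u :: "real \<Rightarrow> real^'n" and b :: "'n \<Rightarrow> 'b::euclidean_space \<Rightarrow> 'b"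
  assumes K: "closed K" and X: "has_ac_derivative_on X (\<lambda>t. \<Sum>k\<in>UNIV. u t $ k *\<^sub>R b k (X t)) 0 T"
    and u: "integrable (lebesgue_on {0..T}) u" and X0: "X 0 \<in> K"
    and L: "L \<ge> 0" and lip: "\<And>k x y. norm (b k y - b k x) \<le> L * dist x y"
    and tangent: "\<And>x \<pi> k. \<pi> \<in> K \<Longrightarrow> (\<And>y. y \<in> K \<Longrightarrow> dist x \<pi> \<le> dist x y) \<Longrightarrow> (x - \<pi>) \<bullet> b k \<pi> = 0"
    and t: "t \<in> {0..T}"
  shows "X t \<in> K"
proof -
  have Kne: "K \<noteq> {}" using X0 by blast
  have cX: "continuous_on {0..T} X" by (rule ac_derivative_continuous[OF X])
  have cb: "continuous_on UNIV (b k)" for k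
    using L lip by (intro lipschitz_on_continuous_on[where L = L]) (auto simp: lipschitz_on_def dist_norm norm_minus_commute)
  obtain B where B: "\<And>k t. t \<in> {0..T} \<Longrightarrow> norm (b k (X t)) \<le> B" "B \<ge> 0"
  proof -
    have "continuous_on {0..T} (\<lambda>t. b k (X t))" for k
      by (rule continuous_on_compose2[OF cb cX]) auto
    then have "bounded (\<Union>k. (\<lambda>t. b k (X t)) ` {0..T})"
      by (intro bounded_UN finite ballI compact_imp_bounded compact_continuous_image) auto
    then obtain B where "\<forall>x\<in>(\<Union>k. (\<lambda>t. b k (X t)) ` {0..T}). norm x \<le> B"
      unfolding bounded_iff by metis
    then show thesis by (intro that[of "max 0 B"]) (auto simp: le_max_iff_disj)
  qed
  define D where "D t = infdist (X t) K" for t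
  have D0: "D t \<ge> 0" for t by (simp add: D_def infdist_nonneg)
  obtain M where M: "\<And>t. t \<in> {0..T} \<Longrightarrow> D t \<le> M" "M \<ge> 0"
  proof -
    have "continuous_on {0..T} D" unfolding D_def by (intro continuous_on_infdist cX)
    then have "bounded (D ` {0..T})" by (intro compact_imp_bounded compact_continuous_image) auto
    then obtain M where "\<forall>x\<in>D ` {0..T}. \<bar>x\<bar> \<le> M" unfolding bounded_iff by auto
    then show thesis by (intro that[of "max 0 M"]) (auto simp: le_max_iff_disj abs_le_iff)
  qed
  define w where "w t = real CARD('n) * norm (u t)" for t
  have wi: "integrable (lebesgue_on {0..T}) w" unfolding w_def using u by simp
  have w0: "w t \<ge> 0" for t by (simp add: w_def)
  define U where "U t = (\<integral>\<tau>. w \<tau> \<partial>lebesgue_on {0..t})" for t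
  have Udiff: "U t - U s = (\<integral>\<tau>. w \<tau> \<partial>lebesgue_on {s..t})" if "0 \<le> s" "s \<le> t" "t \<le> T" for s t
    unfolding U_def using integral_lebesgue_on_Icc_diff[OF wi that] by simp
  have Umono: "U s \<le> U t" if "0 \<le> s" "s \<le> t" "t \<le> T" for s t
  proof -
    have "0 \<le> (\<integral>\<tau>. w \<tau> \<partial>lebesgue_on {s..t})"
      using w0 by (auto intro!: Bochner_Integration.integral_nonneg)
    then show ?thesis using Udiff[OF that] by linarith
  qed
  let ?h = "\<lambda>t. \<Sum>k\<in>UNIV. u t $ k *\<^sub>R b k (X t)"
  have Xdiff: "norm (X t - X s) \<le> B * (U t - U s)" if st: "0 \<le> s" "s \<le> t" "t \<le> T" for s t
  proof -
    have i: "integrable (lebesgue_on {s..t}) ?h" "integrable (lebesgue_on {s..t}) w"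
      using st wi by (auto intro: ac_derivative_integrable[OF X] integrable_lebesgue_on_Icc_subset)
    have "norm (X t - X s) \<le> (\<integral>\<tau>. norm (?h \<tau>) \<partial>lebesgue_on {s..t})"
      unfolding ac_derivative_diff[OF X st] by (rule integral_norm_bound)
    also have "\<dots> \<le> (\<integral>\<tau>. w \<tau> * B \<partial>lebesgue_on {s..t})"
    proof (rule integral_mono)
      show "norm (?h \<tau>) \<le> w \<tau> * B" if "\<tau> \<in> space (lebesgue_on {s..t})" for \<tau>
        unfolding w_def using that st by (intro norm_control_sum_le B) auto
    qed (use i in auto)
    finally show ?thesis using i by (simp add: Udiff[OF st] mult.commute)
  qed
  define C where "C = 2 * M * L * B + B\<^sup>2"
  have C: "C \<ge> 0" using M B L by (simp add: C_def)
  have step: "(D t)\<^sup>2 \<le> (D s)\<^sup>2 * (1 + 2 * L * (U t - U s)) + C * (U t - U s)\<^sup>2"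
    if st: "0 \<le> s" "s \<le> t" "t \<le> T" for s t
  proof -
    define V where "V = U t - U s"
    have V: "V \<ge> 0" using Umono[OF st] by (simp add: V_def)
    \<comment> \<open>the distance at time \<open>t\<close> is estimated with the nearest point at time \<open>s\<close>\<close>
    obtain \<pi> where \<pi>: "\<pi> \<in> K" "dist (X s) \<pi> = infdist (X s) K"
      using infdist_attains_inf[OF K Kne, of "X s"] by metis
    have Ds: "norm (X s - \<pi>) = D s" using \<pi> by (simp add: D_def dist_norm)
    have perp: "(X s - \<pi>) \<bullet> b k \<pi> = 0" for k
      using \<pi> by (intro tangent) (auto intro: infdist_le)
    have i: "integrable (lebesgue_on {s..t}) ?h" "integrable (lebesgue_on {s..t}) w"
      using st wi by (auto intro: ac_derivative_integrable[OF X] integrable_lebesgue_on_Icc_subset)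
    have "\<bar>(X s - \<pi>) \<bullet> (X t - X s)\<bar> = \<bar>\<integral>\<tau>. (X s - \<pi>) \<bullet> ?h \<tau> \<partial>lebesgue_on {s..t}\<bar>"
      unfolding ac_derivative_diff[OF X st] using i by simp
    also have "\<dots> \<le> (\<integral>\<tau>. \<bar>(X s - \<pi>) \<bullet> ?h \<tau>\<bar> \<partial>lebesgue_on {s..t})"
      using integral_norm_bound[of "lebesgue_on {s..t}" "\<lambda>\<tau>. (X s - \<pi>) \<bullet> ?h \<tau>"] by simp
    also have "\<dots> \<le> (\<integral>\<tau>. w \<tau> * (D s * (L * (B * V + D s))) \<partial>lebesgue_on {s..t})"
    proof (rule integral_mono)
      fix \<tau> assume "\<tau> \<in> space (lebesgue_on {s..t})"
      then have \<tau>: "s \<le> \<tau>" "\<tau> \<le> t" by auto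
      have eq: "(X s - \<pi>) \<bullet> ?h \<tau> = (\<Sum>k\<in>UNIV. u \<tau> $ k *\<^sub>R ((X s - \<pi>) \<bullet> (b k (X \<tau>) - b k \<pi>)))"
        by (simp add: inner_sum_right inner_diff_right perp)
      have "norm ((X s - \<pi>) \<bullet> (b k (X \<tau>) - b k \<pi>)) \<le> D s * (L * (B * V + D s))" for k
      proof -
        have "norm (X \<tau> - X s) \<le> B * (U \<tau> - U s)" using \<tau> st by (intro Xdiff) auto
        also have "\<dots> \<le> B * V" unfolding V_def using Umono[of \<tau> t] \<tau> st B by (intro mult_left_mono) auto
        finally have "dist \<pi> (X \<tau>) \<le> B * V + D s"
          using Ds dist_triangle[of \<pi> "X \<tau>" "X s"] by (simp add: dist_norm norm_minus_commute)
        then have "norm (b k (X \<tau>) - b k \<pi>) \<le> L * (B * V + D s)"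
          using lip[where k = k and x = \<pi> and y = "X \<tau>"] L by (meson mult_left_mono order_trans)
        then have "norm (X s - \<pi>) * norm (b k (X \<tau>) - b k \<pi>) \<le> D s * (L * (B * V + D s))"
          using Ds D0[of s] by (simp add: mult_left_mono)
        then show ?thesis
          using Cauchy_Schwarz_ineq2[of "X s - \<pi>" "b k (X \<tau>) - b k \<pi>"] by simp
      qed
      from norm_control_sum_le[OF this, of "u \<tau>"]
      show "\<bar>(X s - \<pi>) \<bullet> ?h \<tau>\<bar> \<le> w \<tau> * (D s * (L * (B * V + D s)))"
        unfolding eq w_def by simp
    qed (use i in auto)
    also have "\<dots> = V * (D s * (L * (B * V + D s)))"
      using i by (simp add: V_def Udiff[OF st])
    finally have cross: "\<bar>(X s - \<pi>) \<bullet> (X t - X s)\<bar> \<le> V * (D s * (L * (B * V + D s)))" .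
    have "D t \<le> norm (X t - \<pi>)"
      using infdist_le[OF \<pi>(1), of "X t"] by (simp add: D_def dist_norm)
    then have "(D t)\<^sup>2 \<le> (norm ((X s - \<pi>) + (X t - X s)))\<^sup>2"
      using D0[of t] by (simp add: power_mono)
    also have "\<dots> = (D s)\<^sup>2 + 2 * ((X s - \<pi>) \<bullet> (X t - X s)) + (norm (X t - X s))\<^sup>2"
    proof -
      have "(norm (a + b))\<^sup>2 = (norm a)\<^sup>2 + 2 * (a \<bullet> b) + (norm b)\<^sup>2" for a b :: 'b
        by (simp add: power2_norm_eq_inner inner_add_left inner_add_right inner_commute)
      then show ?thesis unfolding Ds[symmetric] .
    qed
    also have "\<dots> \<le> (D s)\<^sup>2 + 2 * (V * (D s * (L * (B * V + D s)))) + (B * V)\<^sup>2"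
      using cross Xdiff[OF st] D0 by (intro add_mono power_mono) (auto simp: V_def abs_le_iff)
    also have "\<dots> = (D s)\<^sup>2 * (1 + 2 * L * V) + (2 * (D s * (L * B)) + B\<^sup>2) * V\<^sup>2"
      by (simp add: power2_eq_square algebra_simps)
    also have "\<dots> \<le> (D s)\<^sup>2 * (1 + 2 * L * V) + C * V\<^sup>2"
    proof -
      have "D s * (L * B) \<le> M * (L * B)" using M(1)[of s] st L B by (intro mult_right_mono) auto
      then have "2 * (D s * (L * B)) + B\<^sup>2 \<le> C" unfolding C_def by (simp add: mult_ac)
      from mult_right_mono[OF this, of "V\<^sup>2"] show ?thesis by simp
    qed
    finally show ?thesis by (simp add: V_def)
  qed
  have small: "(D t)\<^sup>2 * exp (- 2 * L * U t) \<le> C * e * U t" if e: "e > 0" for e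
  proof -
    obtain \<delta> where \<delta>: "\<delta> > 0"
      and sm: "\<And>s t. 0 \<le> s \<Longrightarrow> s \<le> t \<Longrightarrow> t \<le> T \<Longrightarrow> t - s \<le> \<delta> \<Longrightarrow> (\<integral>\<tau>. w \<tau> \<partial>lebesgue_on {s..t}) \<le> e"
      using integral_short_interval_small[OF wi e] by auto
    have "(D t)\<^sup>2 * exp (- 2 * L * U t) - C * e * U t \<le> (D 0)\<^sup>2 * exp (- 2 * L * U 0) - C * e * U 0"
    proof (rule locally_nonincreasing_imp_le[OF \<delta>, where b = T and f = "\<lambda>t. (D t)\<^sup>2 * exp (- 2 * L * U t) - C * e * U t"])
      fix s t assume st: "0 \<le> s" "s \<le> t" "t \<le> T" "t - s \<le> \<delta>"
      define V where "V = U t - U s"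
      have V: "V \<ge> 0" "V \<le> e"
        using Umono[OF st(1-3)] sm[OF st] Udiff[OF st(1-3)] by (auto simp: V_def)
      have Us: "U s \<ge> 0" "U t \<ge> 0" using Umono[of 0 s] Umono[of 0 t] st by (auto simp: U_def integral_eq_zero_null_sets)
      have ex: "exp (- 2 * L * U t) = exp (- 2 * L * V) * exp (- 2 * L * U s)"
        unfolding V_def exp_add[symmetric] by (rule arg_cong[where f = exp]) (simp add: algebra_simps)
      have "(D t)\<^sup>2 * exp (- 2 * L * U t) \<le> ((D s)\<^sup>2 * (1 + 2 * L * V) + C * V\<^sup>2) * exp (- 2 * L * U t)"
        unfolding V_def by (intro mult_right_mono step st) auto
      also have "\<dots> = (D s)\<^sup>2 * exp (- 2 * L * U s) * ((1 + 2 * L * V) * exp (- 2 * L * V)) + C * V\<^sup>2 * exp (- 2 * L * U t)"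
        unfolding ex by (simp add: algebra_simps)
      also have "\<dots> \<le> (D s)\<^sup>2 * exp (- 2 * L * U s) * 1 + C * (e * V) * 1"
      proof (intro add_mono mult_left_mono mult_mono)
        have "(1 + 2 * L * V) * exp (- 2 * L * V) \<le> exp (2 * L * V) * exp (- 2 * L * V)"
          using exp_ge_add_one_self[of "2 * L * V"] by (intro mult_right_mono) auto
        then show "(1 + 2 * L * V) * exp (- 2 * L * V) \<le> 1" by (simp flip: exp_add)
        show "V\<^sup>2 \<le> e * V" using V by (simp add: power2_eq_square mult_right_mono)
        show "exp (- 2 * L * U t) \<le> 1" using L Us by simp
      qed (use C V in auto)
      finally show "(D t)\<^sup>2 * exp (- 2 * L * U t) - C * e * U t \<le> (D s)\<^sup>2 * exp (- 2 * L * U s) - C * e * U s"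
        by (simp add: V_def algebra_simps)
    qed (use t in auto)
    moreover have "D 0 = 0" "U 0 = 0"
      using X0 by (simp_all add: D_def U_def integral_eq_zero_null_sets)
    ultimately show ?thesis by simp
  qed
  have "(D t)\<^sup>2 * exp (- 2 * L * U t) \<le> 0"
  proof (rule field_le_epsilon)
    fix e :: real assume e: "e > 0"
    have U0: "U t \<ge> 0" using Umono[of 0 t] t by (auto simp: U_def integral_eq_zero_null_sets)
    have pos: "C * U t + 1 > 0" using C U0 by (simp add: add_nonneg_pos)
    have "(D t)\<^sup>2 * exp (- 2 * L * U t) \<le> C * (e / (C * U t + 1)) * U t"
      using e pos by (intro small) simp
    also have "\<dots> = e * ((C * U t) / (C * U t + 1))" by simp
    also have "\<dots> \<le> e * 1" using e C U0 pos by (intro mult_left_mono) (auto simp: divide_le_eq)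
    finally show "(D t)\<^sup>2 * exp (- 2 * L * U t) \<le> 0 + e" by simp
  qed
  then have "D t = 0" by (simp add: mult_le_0_iff)
  then show ?thesis
    using K Kne by (simp add: D_def in_closed_iff_infdist_zero)
qed

lemma J_mult_vec: "J *v w = vector [- w $ 2, w $ 1]"
  by (simp add: J_def vec_eq_iff matrix_vector_mult_def forall_2 sum_2)

lemma norm_J_mult: "norm (J *v w) = norm w"
  by (simp add: J_mult_vec norm_vec_def L2_set_def sum_2 add.commute)

text \<open>In the plane, two vectors orthogonal to \<open>\<tau> \<noteq> 0\<close> are parallel.\<close>

lemma inner_J_zero:
  fixes x w \<tau> :: "real^2"
  assumes "\<tau> \<noteq> 0" "x \<bullet> \<tau> = 0" "w \<bullet> \<tau> = 0"
  shows "x \<bullet> (J *v w) = 0"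
proof -
  have a: "x $ 1 * \<tau> $ 1 + x $ 2 * \<tau> $ 2 = 0" "w $ 1 * \<tau> $ 1 + w $ 2 * \<tau> $ 2 = 0"
    using assms by (simp_all add: inner_vec_def sum_2)
  have "(x \<bullet> (J *v w)) * \<tau> $ 1 = 0" "(x \<bullet> (J *v w)) * \<tau> $ 2 = 0"
    unfolding J_mult_vec inner_vec_def sum_2 using a by (simp; algebra)+
  moreover have "\<tau> $ 1 \<noteq> 0 \<or> \<tau> $ 2 \<noteq> 0" using assms(1) by (auto simp: vec_eq_iff forall_2)
  ultimately show ?thesis by auto
qed

text \<open>The gradient of a function vanishing on the boundary and the displacement to a nearest
  point are both normal to the boundary.\<close>

proposition rotated_gradient_tangent:
  fixes h :: "real^2 \<Rightarrow> real"
  assumes op: "open \<Omega>" and bd: "bounded \<Omega>" and C2: "C2_boundary \<Omega>"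
    and h: "smooth_upto_boundary \<Omega> h" "h \<in> H1_0 \<Omega>"
    and \<pi>: "\<pi> \<in> closure \<Omega>" and near: "\<And>y. y \<in> closure \<Omega> \<Longrightarrow> dist x \<pi> \<le> dist x y"
  shows "(x - \<pi>) \<bullet> (J *v grad \<Omega> h \<pi>) = 0"
proof (cases "\<pi> \<in> \<Omega>")
  case True
  then obtain r where r: "r > 0" "ball \<pi> r \<subseteq> \<Omega>" using op openE by blast
  have "x = \<pi>"
  proof (rule ccontr)
    assume "x \<noteq> \<pi>"
    define d where "d = dist x \<pi>"
    have d: "d > 0" using \<open>x \<noteq> \<pi>\<close> by (simp add: d_def)
    define s where "s = min (1/2) (r / (2 * d))"
    have s: "0 < s" "s < 1" "s * d < r"
    proof -
      show "0 < s" "s < 1" using r d by (auto simp: s_def)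
      have "s * d \<le> r / (2 * d) * d" unfolding s_def using d by (intro mult_right_mono) auto
      then show "s * d < r" using r d by simp
    qed
    define y where "y = \<pi> + s *\<^sub>R (x - \<pi>)"
    have "y \<in> ball \<pi> r" using s by (simp add: y_def dist_norm d_def norm_minus_commute)
    then have "y \<in> closure \<Omega>" using r closure_subset by blast
    then have "d \<le> dist x y" using near by (simp add: d_def)
    moreover have "x - y = (1 - s) *\<^sub>R (x - \<pi>)" by (simp add: y_def algebra_simps)
    then have "dist x y = (1 - s) * d" using s by (simp add: dist_norm d_def)
    ultimately show False using mult_pos_pos[OF s(1) d] by (simp add: left_diff_distrib)
  qed
  then show ?thesis by simp
next
  case False
  interpret smooth_closure \<Omega> h using op h(1) by unfold_locales
  have fr: "\<pi> \<in> frontier \<Omega>" using False \<pi> op by (simp add: frontier_def interior_open)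
  have ch: "continuous_on (closure \<Omega>) h" using h(1) by (simp add: smooth_upto_boundary_def)
  have zero: "h y = 0" if "y \<in> frontier \<Omega>" for y
    by (rule H1_0_zero_on_frontier[OF op C2 ch h(2) that])
  obtain r e1 e2 \<phi> \<phi>' where r: "r > 0" and e: "norm e1 = 1" "norm e2 = 1" "e1 \<bullet> e2 = 0"
    and \<phi>: "\<And>\<tau>::real. (\<phi> has_real_derivative \<phi>' \<tau>) (at \<tau>)"
    and eq: "\<Omega> \<inter> ball \<pi> r = {y \<in> ball \<pi> r. \<phi> (e1 \<bullet> y) < e2 \<bullet> y}"
    by (rule C2_boundary_coordinates[OF C2 fr]) blast
  have c\<phi>: "continuous_on UNIV \<phi>"
    using \<phi> by (meson DERIV_continuous_on has_field_derivative_at_within)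
  have ee: "e1 \<bullet> e1 = 1" "e2 \<bullet> e2 = 1" "e2 \<bullet> e1 = 0" using e by (simp_all add: dot_square_norm inner_commute)
  have \<Omega>iff: "y \<in> \<Omega> \<longleftrightarrow> \<phi> (e1 \<bullet> y) < e2 \<bullet> y" if "y \<in> ball \<pi> r" for y
    using eq that by (auto simp: set_eq_iff)
  define p where "p = e1 \<bullet> \<pi>"
  have \<pi>2: "e2 \<bullet> \<pi> = \<phi> p"
    using \<Omega>iff[of \<pi>] closure_above_graph[OF eq c\<phi> \<pi>] r False by (simp add: p_def)
  \<comment> \<open>parametrization of the boundary near \<open>\<pi>\<close>\<close>
  define c where "c \<tau> = \<pi> + \<tau> *\<^sub>R e1 + (\<phi> (p + \<tau>) - \<phi> p) *\<^sub>R e2" for \<tau>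
  have c0: "c 0 = \<pi>" by (simp add: c_def)
  have ec: "e1 \<bullet> c \<tau> = p + \<tau>" "e2 \<bullet> c \<tau> = \<phi> (p + \<tau>)" for \<tau>
    using e ee \<pi>2 by (simp_all add: c_def inner_add_right p_def)
  define v where "v = e1 + \<phi>' p *\<^sub>R e2"
  have "v \<bullet> e1 = 1" using e ee by (simp add: v_def inner_add_left)
  then have v0: "v \<noteq> 0" by auto
  have dc: "(c has_vector_derivative v) (at 0)"
  proof -
    have "((\<lambda>\<tau>. \<phi> (p + \<tau>)) has_real_derivative \<phi>' p) (at 0)"
      using DERIV_shift[of \<phi> "\<phi>' p" 0 p] \<phi>[of p] by (simp add: add.commute)
    then show ?thesis
      unfolding c_def v_def by (auto intro!: derivative_eq_intros)
  qed
  have cc: "continuous (at 0) c" using dc has_vector_derivative_continuous by blast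
  obtain d where d: "d > 0" "\<And>\<tau>. \<bar>\<tau>\<bar> < d \<Longrightarrow> c \<tau> \<in> ball \<pi> r"
  proof -
    from cc r obtain d where "d > 0" "\<And>\<tau>. dist \<tau> 0 < d \<Longrightarrow> dist (c \<tau>) (c 0) < r"
      unfolding continuous_at_eps_delta by metis
    then show thesis by (intro that[of d]) (auto simp: c0 dist_commute)
  qed
  have cfr: "c \<tau> \<in> frontier \<Omega>" if "\<bar>\<tau>\<bar> < d" for \<tau>
  proof -
    have b: "c \<tau> \<in> ball \<pi> r" by (rule d(2)[OF that])
    have "c \<tau> \<notin> \<Omega>" using \<Omega>iff[OF b] by (simp add: ec)
    moreover have "c \<tau> \<in> closure \<Omega>"
      unfolding closure_approachable
    proof (intro allI impI)
      fix \<epsilon> :: real assume \<epsilon>: "\<epsilon> > 0"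
      define s where "s = min \<epsilon> (r - dist \<pi> (c \<tau>)) / 2"
      have s: "s > 0" "s < \<epsilon>" "s < r - dist \<pi> (c \<tau>)" using \<epsilon> b by (auto simp: s_def)
      have "dist \<pi> (c \<tau> + s *\<^sub>R e2) \<le> dist \<pi> (c \<tau>) + s"
        using dist_triangle[of \<pi> "c \<tau> + s *\<^sub>R e2" "c \<tau>"] s e by (simp add: dist_norm)
      then have "c \<tau> + s *\<^sub>R e2 \<in> ball \<pi> r" using s by simp
      then have "c \<tau> + s *\<^sub>R e2 \<in> \<Omega>" using \<Omega>iff s e ee by (simp add: inner_add_right ec)
      moreover have "dist (c \<tau> + s *\<^sub>R e2) (c \<tau>) < \<epsilon>" using s e by (simp add: dist_norm)
      ultimately show "\<exists>y\<in>\<Omega>. dist y (c \<tau>) < \<epsilon>" by blast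
    qed
    ultimately show ?thesis using op by (simp add: frontier_def interior_open)
  qed
  have fc: "y \<in> closure \<Omega>" if "y \<in> frontier \<Omega>" for y using that by (simp add: frontier_def)
  have dsq: "((\<lambda>\<tau>. (y - c \<tau>) \<bullet> (y - c \<tau>)) has_real_derivative - 2 * ((y - \<pi>) \<bullet> v)) (at 0)" for y
  proof -
    have "((\<lambda>\<tau>. (y - c \<tau>) \<bullet> (y - c \<tau>)) has_vector_derivative ((y - c 0) \<bullet> (0 - v) + (0 - v) \<bullet> (y - c 0))) (at 0)"
      using bounded_bilinear.has_vector_derivative[OF bounded_bilinear_inner
          has_vector_derivative_diff[OF has_vector_derivative_const dc, of y]
          has_vector_derivative_diff[OF has_vector_derivative_const dc, of y]] .
    then show ?thesis
      by (simp add: has_real_derivative_iff_has_vector_derivative c0 inner_commute[of v] )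
  qed
  have "- 2 * ((x - \<pi>) \<bullet> v) = 0"
  proof (rule DERIV_local_min[OF dsq d(1)], intro allI impI)
    fix \<tau> assume "\<bar>0 - \<tau>\<bar> < d"
    then have "dist x \<pi> \<le> dist x (c \<tau>)" by (intro near fc cfr) simp
    then have "(norm (x - \<pi>))\<^sup>2 \<le> (norm (x - c \<tau>))\<^sup>2" by (simp add: dist_norm power_mono)
    then show "(x - c 0) \<bullet> (x - c 0) \<le> (x - c \<tau>) \<bullet> (x - c \<tau>)"
      by (simp add: c0 power2_norm_eq_inner)
  qed
  then have 1: "(x - \<pi>) \<bullet> v = 0" by simp
  define G where "G = grad \<Omega> h \<pi>"
  obtain C where C: "C \<ge> 0" and tay: "\<And>y z. y \<in> closure \<Omega> \<Longrightarrow> z \<in> closure \<Omega> \<Longrightarrow>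
    \<bar>P [] z - P [] y - (\<Sum>i\<in>UNIV. P [i] y * (z - y) $ i)\<bar> \<le> C * (dist y z)\<^sup>2"
    by (rule P_taylor[OF bd C2, of "[]"]) (rule that; assumption)
  have Gb: "\<bar>G \<bullet> (c \<tau> - \<pi>)\<bar> \<le> C * ((\<pi> - c \<tau>) \<bullet> (\<pi> - c \<tau>))" if "\<bar>\<tau>\<bar> < d" for \<tau>
  proof -
    have "P [] (c \<tau>) = 0" "P [] \<pi> = 0"
      using cfr[OF that] fr fc by (simp_all add: P_Nil zero)
    then show ?thesis
      using tay[OF \<pi> fc[OF cfr[OF that]]] 
      by (simp add: G_def grad_def inner_vec_def dist_norm power2_norm_eq_inner)
  qed
  \<comment> \<open>by the Taylor estimate and \<open>h = 0\<close> on the boundary, this function has a local maximum at \<open>0\<close>\<close>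
  have "G \<bullet> v - C * (- 2 * ((\<pi> - \<pi>) \<bullet> v)) = 0"
  proof (rule DERIV_local_max[of "\<lambda>\<tau>. G \<bullet> (c \<tau> - \<pi>) - C * ((\<pi> - c \<tau>) \<bullet> (\<pi> - c \<tau>))" _ 0 d])
    have "((\<lambda>\<tau>. G \<bullet> (c \<tau> - \<pi>)) has_vector_derivative G \<bullet> (v - 0)) (at 0)"
      by (rule bounded_linear.has_vector_derivative[OF bounded_linear_inner_right
          has_vector_derivative_diff[OF dc has_vector_derivative_const]])
    then have "((\<lambda>\<tau>. G \<bullet> (c \<tau> - \<pi>)) has_real_derivative G \<bullet> v) (at 0)"
      by (simp add: has_real_derivative_iff_has_vector_derivative)
    then show "((\<lambda>\<tau>. G \<bullet> (c \<tau> - \<pi>) - C * ((\<pi> - c \<tau>) \<bullet> (\<pi> - c \<tau>))) has_real_derivative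
        G \<bullet> v - C * (- 2 * ((\<pi> - \<pi>) \<bullet> v))) (at 0)"
      by (intro DERIV_diff DERIV_cmult dsq)
    show "0 < d" by (rule d)
    show "\<forall>\<tau>. \<bar>0 - \<tau>\<bar> < d \<longrightarrow> G \<bullet> (c \<tau> - \<pi>) - C * ((\<pi> - c \<tau>) \<bullet> (\<pi> - c \<tau>)) \<le> G \<bullet> (c 0 - \<pi>) - C * ((\<pi> - c 0) \<bullet> (\<pi> - c 0))"
      using Gb by (auto simp: c0 abs_le_iff)
  qed
  then have "G \<bullet> v = 0" by simp
  from inner_J_zero[OF v0 1 this] show ?thesis by (simp add: G_def)
qed

section \<open>The characteristic fields and their derivatives\<close>

lemma norm_vec2_le:
  fixes x :: "real^2"
  assumes "\<And>i. \<bar>x $ i\<bar> \<le> c"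
  shows "norm x \<le> 2 * c"
  using norm_le_l1_cart[of x] assms[of 1] assms[of 2] by (simp add: sum_2)

lemma abs_sum2_le:
  fixes f :: "2 \<Rightarrow> real" and a :: "real^2"
  assumes "\<And>j. \<bar>f j\<bar> \<le> c"
  shows "\<bar>\<Sum>j\<in>UNIV. f j * a $ j\<bar> \<le> 2 * c * norm a"
proof -
  have "\<bar>f j * a $ j\<bar> \<le> c * norm a" for j
    using mult_mono[OF assms[of j] component_le_norm_cart[of a j]] assms[of j] by (simp add: abs_mult)
  from this[of 1] this[of 2] show ?thesis by (simp add: sum_2 abs_le_iff)
qed

context smooth_closure
begin

lemma grad_component: "grad \<Omega> f x $ i = P [i] x"
  by (simp add: grad_def)

lemma hessian_mult_component: "(hessian \<Omega> f x *v a) $ i = (\<Sum>j\<in>UNIV. P [i, j] x * a $ j)"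
  by (simp add: hessian_def matrix_vector_mult_def)

text \<open>The order of differentiation differs between \<open>hessian\<close> and \<open>third_deriv\<close> and the derivatives that
  occur in the Taylor expansions, so the symmetry of mixed derivatives is used here.\<close>

lemma derivative_bounds:
  assumes "bounded \<Omega>" "C2_boundary \<Omega>"
  obtains C where "C \<ge> 0"
    "\<And>y. y \<in> closure \<Omega> \<Longrightarrow> norm (grad \<Omega> f y) \<le> C"
    "\<And>y z. y \<in> closure \<Omega> \<Longrightarrow> z \<in> closure \<Omega> \<Longrightarrow> norm (grad \<Omega> f z - grad \<Omega> f y) \<le> C * norm (z - y)"
    "\<And>y a. y \<in> closure \<Omega> \<Longrightarrow> norm (hessian \<Omega> f y *v a) \<le> C * norm a"
    "\<And>y z a. y \<in> closure \<Omega> \<Longrightarrow> z \<in> closure \<Omega> \<Longrightarrow> norm (hessian \<Omega> f z *v a - hessian \<Omega> f y *v a) \<le> C * norm (z - y) * norm a"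
    "\<And>y z. y \<in> closure \<Omega> \<Longrightarrow> z \<in> closure \<Omega> \<Longrightarrow> norm (grad \<Omega> f z - grad \<Omega> f y - hessian \<Omega> f y *v (z - y)) \<le> C * (norm (z - y))\<^sup>2"
    "\<And>y z a. y \<in> closure \<Omega> \<Longrightarrow> z \<in> closure \<Omega> \<Longrightarrow>
       norm (hessian \<Omega> f z *v a - hessian \<Omega> f y *v a - third_deriv \<Omega> f y (z - y) a) \<le> C * (norm (z - y))\<^sup>2 * norm a"
proof -
  define Q where "Q is c \<longleftrightarrow> c \<ge> 0 \<and> (\<forall>y\<in>closure \<Omega>. \<forall>z\<in>closure \<Omega>. \<bar>P is y\<bar> \<le> c \<and> \<bar>P is z - P is y\<bar> \<le> c * norm (z - y) \<and>
      \<bar>P is z - P is y - (\<Sum>i\<in>UNIV. P (i # is) y * (z - y) $ i)\<bar> \<le> c * (norm (z - y))\<^sup>2)" for "is" c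
  have "\<exists>c. Q is c" for "is"
  proof -
    obtain c1 where c1: "\<And>x. x \<in> closure \<Omega> \<Longrightarrow> \<bar>P is x\<bar> \<le> c1"
      by (rule P_bounded[OF assms(1), of "is"]) (rule that; assumption)
    obtain c2 where c2: "c2 \<ge> 0" "\<And>y z. y \<in> closure \<Omega> \<Longrightarrow> z \<in> closure \<Omega> \<Longrightarrow> \<bar>P is z - P is y\<bar> \<le> c2 * dist y z"
      by (rule P_lipschitz[OF assms, of "is"]) (rule that; assumption)
    obtain c3 where c3: "c3 \<ge> 0" "\<And>y z. y \<in> closure \<Omega> \<Longrightarrow> z \<in> closure \<Omega> \<Longrightarrow>
        \<bar>P is z - P is y - (\<Sum>i\<in>UNIV. P (i # is) y * (z - y) $ i)\<bar> \<le> c3 * (dist y z)\<^sup>2"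
      by (rule P_taylor[OF assms, of "is"]) (rule that; assumption)
    define c where "c = max 0 c1 + c2 + c3"
    have c: "c \<ge> 0" "c1 \<le> c" "c2 \<le> c" "c3 \<le> c" using c2 c3 by (auto simp: c_def)
    have "Q is c"
      unfolding Q_def
    proof (intro conjI ballI)
      fix y z assume yz: "y \<in> closure \<Omega>" "z \<in> closure \<Omega>"
      show "\<bar>P is y\<bar> \<le> c" using c1[OF yz(1)] c by linarith
      have d: "dist y z = norm (z - y)" by (simp add: dist_norm norm_minus_commute)
      show "\<bar>P is z - P is y\<bar> \<le> c * norm (z - y)"
        using c2(2)[OF yz] mult_right_mono[OF c(3), of "norm (z - y)"] by (simp add: d)
      show "\<bar>P is z - P is y - (\<Sum>i\<in>UNIV. P (i # is) y * (z - y) $ i)\<bar> \<le> c * (norm (z - y))\<^sup>2"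
        using c3(2)[OF yz] mult_right_mono[OF c(4), of "(norm (z - y))\<^sup>2"] by (simp add: d)
    qed (use c in auto)
    then show ?thesis by blast
  qed
  then obtain c where "\<And>is. Q is (c is)" by metis
  then have c: "\<And>is. c is \<ge> 0" "\<And>is y. y \<in> closure \<Omega> \<Longrightarrow> \<bar>P is y\<bar> \<le> c is"
    "\<And>is y z. y \<in> closure \<Omega> \<Longrightarrow> z \<in> closure \<Omega> \<Longrightarrow> \<bar>P is z - P is y\<bar> \<le> c is * norm (z - y)"
    "\<And>is y z. y \<in> closure \<Omega> \<Longrightarrow> z \<in> closure \<Omega> \<Longrightarrow>
      \<bar>P is z - P is y - (\<Sum>i\<in>UNIV. P (i # is) y * (z - y) $ i)\<bar> \<le> c is * (norm (z - y))\<^sup>2"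
    unfolding Q_def by blast+
  define C0 where "C0 = (\<Sum>i\<in>UNIV. c [i]) + (\<Sum>i\<in>UNIV. \<Sum>j\<in>UNIV. c [i, j])"
  have C1: "c [i] \<le> C0" and C2: "c [i, j] \<le> C0" for i j
  proof -
    have "c [i] \<le> (\<Sum>i\<in>UNIV. c [i])" using c(1) by (intro member_le_sum) auto
    moreover have "c [i, j] \<le> (\<Sum>j\<in>UNIV. c [i, j])" using c(1) by (intro member_le_sum) auto
    moreover have "(\<Sum>j\<in>UNIV. c [i, j]) \<le> (\<Sum>i\<in>UNIV. \<Sum>j\<in>UNIV. c [i, j])"
      using c(1) by (intro member_le_sum[of i UNIV "\<lambda>i. \<Sum>j\<in>UNIV. c [i, j]"] sum_nonneg) auto
    moreover have "0 \<le> (\<Sum>i\<in>UNIV. c [i])" "0 \<le> (\<Sum>i\<in>UNIV. \<Sum>j\<in>UNIV. c [i, j])"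
      using c(1) by (auto intro!: sum_nonneg)
    ultimately show "c [i] \<le> C0" "c [i, j] \<le> C0" unfolding C0_def by linarith+
  qed
  have C0: "C0 \<ge> 0" using C1[of 1] c(1)[of "[1]"] by linarith
  have le4: "2 * x \<le> 4 * C0 * r" if "x \<le> 2 * C0 * r" for x r :: real using that by linarith
  have le2: "2 * x \<le> 4 * C0 * r" if "x \<le> C0 * r" "r \<ge> 0" for x r :: real
    using that C0 mult_nonneg_nonneg[OF C0 that(2)] by linarith
  show thesis
  proof (rule that[of "4 * C0"])
    show "4 * C0 \<ge> 0" using C0 by simp
    fix y z a assume y: "y \<in> closure \<Omega>"
    show "norm (grad \<Omega> f y) \<le> 4 * C0"
    proof -
      have "\<bar>grad \<Omega> f y $ i\<bar> \<le> C0" for i using c(2)[OF y, of "[i]"] C1[of i] by (simp add: grad_component)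
      from norm_vec2_le[OF this] show ?thesis using C0 by simp
    qed
    show "norm (hessian \<Omega> f y *v a) \<le> 4 * C0 * norm a"
    proof -
      have "\<bar>P [i, j] y\<bar> \<le> C0" for i j using c(2)[OF y, of "[i, j]"] C2[of i j] by simp
      from abs_sum2_le[OF this] have "\<bar>(hessian \<Omega> f y *v a) $ i\<bar> \<le> 2 * C0 * norm a" for i
        by (simp add: hessian_mult_component)
      from norm_vec2_le[OF this] show ?thesis by simp
    qed
    assume z: "z \<in> closure \<Omega>"
    show "norm (grad \<Omega> f z - grad \<Omega> f y) \<le> 4 * C0 * norm (z - y)"
    proof -
      have "\<bar>(grad \<Omega> f z - grad \<Omega> f y) $ i\<bar> \<le> C0 * norm (z - y)" for i
        using c(3)[OF y z, of "[i]"] mult_right_mono[OF C1[of i], of "norm (z - y)"] by (simp add: grad_component)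
      from norm_vec2_le[OF this] le2[OF order_refl, of "norm (z - y)"] show ?thesis by simp
    qed
    show "norm (hessian \<Omega> f z *v a - hessian \<Omega> f y *v a) \<le> 4 * C0 * norm (z - y) * norm a"
    proof -
      have "\<bar>P [i, j] z - P [i, j] y\<bar> \<le> C0 * norm (z - y)" for i j
        using c(3)[OF y z, of "[i, j]"] mult_right_mono[OF C2[of i j], of "norm (z - y)"] by simp
      from abs_sum2_le[OF this] have "\<bar>(hessian \<Omega> f z *v a - hessian \<Omega> f y *v a) $ i\<bar> \<le> 2 * (C0 * norm (z - y)) * norm a" for i
        by (simp add: hessian_mult_component left_diff_distrib sum_subtractf)
      from norm_vec2_le[OF this] show ?thesis by simp
    qed
    show "norm (grad \<Omega> f z - grad \<Omega> f y - hessian \<Omega> f y *v (z - y)) \<le> 4 * C0 * (norm (z - y))\<^sup>2"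
    proof -
      have "\<bar>(grad \<Omega> f z - grad \<Omega> f y - hessian \<Omega> f y *v (z - y)) $ i\<bar> \<le> C0 * (norm (z - y))\<^sup>2" for i
        using c(4)[OF y z, of "[i]"] mult_right_mono[OF C1[of i], of "(norm (z - y))\<^sup>2"]
        by (simp add: grad_component hessian_mult_component P_symmetric[OF y, of i])
      from norm_vec2_le[OF this] le2[OF order_refl, of "(norm (z - y))\<^sup>2"] show ?thesis by simp
    qed
    show "norm (hessian \<Omega> f z *v a - hessian \<Omega> f y *v a - third_deriv \<Omega> f y (z - y) a) \<le> 4 * C0 * (norm (z - y))\<^sup>2 * norm a"
    proof -
      have 1: "\<bar>P [i, k] z - P [i, k] y - (\<Sum>j\<in>UNIV. P [j, i, k] y * (z - y) $ j)\<bar> \<le> C0 * (norm (z - y))\<^sup>2" for i k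
        using c(4)[OF y z, of "[i, k]"] mult_right_mono[OF C2[of i k], of "(norm (z - y))\<^sup>2"] by simp
      have 2: "(hessian \<Omega> f z *v a - hessian \<Omega> f y *v a - third_deriv \<Omega> f y (z - y) a) $ i
         = (\<Sum>k\<in>UNIV. (P [i, k] z - P [i, k] y - (\<Sum>j\<in>UNIV. P [j, i, k] y * (z - y) $ j)) * a $ k)" for i
        by (simp add: hessian_mult_component third_deriv_def sum_2 P_symmetric[OF y, of _ i] algebra_simps)
      have "\<bar>(hessian \<Omega> f z *v a - hessian \<Omega> f y *v a - third_deriv \<Omega> f y (z - y) a) $ i\<bar> \<le> 2 * (C0 * (norm (z - y))\<^sup>2) * norm a" for i
        unfolding 2 by (rule abs_sum2_le[OF 1])
      from norm_vec2_le[OF this] show ?thesis by simp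
    qed
  qed
qed

lemma grad_continuous: "continuous_on (closure \<Omega>) (grad \<Omega> f)"
  unfolding grad_def by (rule gradient_continuous)

lemma hessian_component_continuous: "continuous_on (closure \<Omega>) (\<lambda>x. hessian \<Omega> f x $ i $ j)"
  unfolding hessian_def by (simp add: P_continuous)

end

text \<open>The domain, the basis functions and the final time, which determine the state equation.\<close>

locale stream_basis =
  fixes \<Omega> :: "(real^2) set" and h :: "'n::finite \<Rightarrow> real^2 \<Rightarrow> real" and T :: real
  assumes op: "open \<Omega>" and bd: "bounded \<Omega>" and C2: "C2_boundary \<Omega>" and ne: "\<Omega> \<noteq> {}" and Tpos: "T > 0"
    and smooth: "\<And>k. smooth_upto_boundary \<Omega> (h k)" and h0: "\<And>k. h k \<in> H1_0 \<Omega>"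
begin

sublocale smooth_closure \<Omega> "h k" for k
  using op smooth by unfold_locales

text \<open>The state \<open>z = (X, a)\<close> solves \<open>z' = (\<Sum>k. u\<^sub>k field k z)\<close>.\<close>

definition field :: "'n \<Rightarrow> (real^2) \<times> (real^2) \<Rightarrow> (real^2) \<times> (real^2)" where
  "field k z = (J *v grad \<Omega> (h k) (fst z), (J ** hessian \<Omega> (h k) (fst z)) *v snd z)"

text \<open>The derivative of \<open>field k\<close> at \<open>z\<close> in the direction \<open>w\<close>. It is characterized on the closure of
  \<open>\<Omega>\<close> by the second-order Taylor estimate in \<open>field_bounds\<close>.\<close>

definition field_deriv :: "'n \<Rightarrow> (real^2) \<times> (real^2) \<Rightarrow> (real^2) \<times> (real^2) \<Rightarrow> (real^2) \<times> (real^2)" where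
  "field_deriv k z w = ((J ** hessian \<Omega> (h k) (fst z)) *v fst w,
     (J ** hessian \<Omega> (h k) (fst z)) *v snd w + J *v third_deriv \<Omega> (h k) (fst z) (fst w) (snd z))"

text \<open>The transpose of \<open>field_deriv k z\<close>: the adjoint state \<open>r = (p, q)\<close> solves
  \<open>r' = - (\<Sum>k. u\<^sub>k field_adjoint k z r)\<close>.\<close>

definition field_adjoint :: "'n \<Rightarrow> (real^2) \<times> (real^2) \<Rightarrow> (real^2) \<times> (real^2) \<Rightarrow> (real^2) \<times> (real^2)" where
  "field_adjoint k z r = (transpose (J ** hessian \<Omega> (h k) (fst z)) *v fst r
       + transpose (matrix (\<lambda>b. J *v third_deriv \<Omega> (h k) (fst z) b (snd z))) *v snd r,
     transpose (J ** hessian \<Omega> (h k) (fst z)) *v snd r)"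

lemma third_deriv_linear: "linear (\<lambda>b. J *v third_deriv \<Omega> f x b a)"
proof -
  have "linear (\<lambda>b. third_deriv \<Omega> f x b a)"
    by (rule linearI) (simp_all add: third_deriv_def vec_eq_iff sum_2 algebra_simps)
  from linear_compose[OF this matrix_vector_mul_linear[of J]] show ?thesis by (simp add: o_def)
qed

lemma field_adjoint_inner: "field_adjoint k z r \<bullet> w = r \<bullet> field_deriv k z w"
proof -
  have "matrix (\<lambda>b. J *v third_deriv \<Omega> (h k) (fst z) b (snd z)) *v fst w = J *v third_deriv \<Omega> (h k) (fst z) (fst w) (snd z)"
    using fun_cong[OF matrix_vector_mul(2)[OF third_deriv_linear]] .
  then show ?thesis
    by (simp add: field_adjoint_def field_deriv_def inner_prod_def inner_add_left inner_add_right dot_lmul_matrix)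
qed

text \<open>The fields are linear in the tangent \<open>a\<close>, so uniform estimates require a bound \<open>R\<close> on it.\<close>

lemma field_bounds:
  assumes R: "R \<ge> 0"
  obtains C where "C \<ge> 0"
    "\<And>k z. z \<in> closure \<Omega> \<times> cball 0 R \<Longrightarrow> norm (field k z) \<le> C"
    "\<And>k z w. z \<in> closure \<Omega> \<times> cball 0 R \<Longrightarrow> w \<in> closure \<Omega> \<times> cball 0 R \<Longrightarrow> norm (field k w - field k z) \<le> C * norm (w - z)"
    "\<And>k z w. z \<in> closure \<Omega> \<times> cball 0 R \<Longrightarrow> w \<in> closure \<Omega> \<times> cball 0 R \<Longrightarrow>
       norm (field k w - field k z - field_deriv k z (w - z)) \<le> C * (norm (w - z))\<^sup>2"
    "\<And>k x a. x \<in> closure \<Omega> \<Longrightarrow> norm ((J ** hessian \<Omega> (h k) x) *v a) \<le> C * norm a"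
    "\<And>k x y. x \<in> closure \<Omega> \<Longrightarrow> y \<in> closure \<Omega> \<Longrightarrow> norm (J *v grad \<Omega> (h k) y - J *v grad \<Omega> (h k) x) \<le> C * dist x y"
proof -
  define Q where "Q k C \<longleftrightarrow> C \<ge> 0 \<and> (\<forall>y\<in>closure \<Omega>. norm (grad \<Omega> (h k) y) \<le> C) \<and>
    (\<forall>y\<in>closure \<Omega>. \<forall>z\<in>closure \<Omega>. norm (grad \<Omega> (h k) z - grad \<Omega> (h k) y) \<le> C * norm (z - y)) \<and>
    (\<forall>y\<in>closure \<Omega>. \<forall>a. norm (hessian \<Omega> (h k) y *v a) \<le> C * norm a) \<and>
    (\<forall>y\<in>closure \<Omega>. \<forall>z\<in>closure \<Omega>. \<forall>a. norm (hessian \<Omega> (h k) z *v a - hessian \<Omega> (h k) y *v a) \<le> C * norm (z - y) * norm a) \<and>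
    (\<forall>y\<in>closure \<Omega>. \<forall>z\<in>closure \<Omega>. norm (grad \<Omega> (h k) z - grad \<Omega> (h k) y - hessian \<Omega> (h k) y *v (z - y)) \<le> C * (norm (z - y))\<^sup>2) \<and>
    (\<forall>y\<in>closure \<Omega>. \<forall>z\<in>closure \<Omega>. \<forall>a.
       norm (hessian \<Omega> (h k) z *v a - hessian \<Omega> (h k) y *v a - third_deriv \<Omega> (h k) y (z - y) a) \<le> C * (norm (z - y))\<^sup>2 * norm a)" for k C
  have "\<exists>C. Q k C" for k
  proof (rule derivative_bounds[OF bd C2, of k])
    fix C assume "C \<ge> 0"
      "\<And>y. y \<in> closure \<Omega> \<Longrightarrow> norm (grad \<Omega> (h k) y) \<le> C"
      "\<And>y z. y \<in> closure \<Omega> \<Longrightarrow> z \<in> closure \<Omega> \<Longrightarrow> norm (grad \<Omega> (h k) z - grad \<Omega> (h k) y) \<le> C * norm (z - y)"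
      "\<And>y a. y \<in> closure \<Omega> \<Longrightarrow> norm (hessian \<Omega> (h k) y *v a) \<le> C * norm a"
      "\<And>y z a. y \<in> closure \<Omega> \<Longrightarrow> z \<in> closure \<Omega> \<Longrightarrow> norm (hessian \<Omega> (h k) z *v a - hessian \<Omega> (h k) y *v a) \<le> C * norm (z - y) * norm a"
      "\<And>y z. y \<in> closure \<Omega> \<Longrightarrow> z \<in> closure \<Omega> \<Longrightarrow> norm (grad \<Omega> (h k) z - grad \<Omega> (h k) y - hessian \<Omega> (h k) y *v (z - y)) \<le> C * (norm (z - y))\<^sup>2"
      "\<And>y z a. y \<in> closure \<Omega> \<Longrightarrow> z \<in> closure \<Omega> \<Longrightarrow>
         norm (hessian \<Omega> (h k) z *v a - hessian \<Omega> (h k) y *v a - third_deriv \<Omega> (h k) y (z - y) a) \<le> C * (norm (z - y))\<^sup>2 * norm a"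
    then have "Q k C" unfolding Q_def by simp
    then show ?thesis by blast
  qed
  then obtain c where Q: "\<And>k. Q k (c k)" by metis
  then have c0: "\<And>k. c k \<ge> 0"
    and c: "\<And>k y. y \<in> closure \<Omega> \<Longrightarrow> norm (grad \<Omega> (h k) y) \<le> c k"
    "\<And>k y z. y \<in> closure \<Omega> \<Longrightarrow> z \<in> closure \<Omega> \<Longrightarrow> norm (grad \<Omega> (h k) z - grad \<Omega> (h k) y) \<le> c k * norm (z - y)"
    "\<And>k y a. y \<in> closure \<Omega> \<Longrightarrow> norm (hessian \<Omega> (h k) y *v a) \<le> c k * norm a"
    "\<And>k y z a. y \<in> closure \<Omega> \<Longrightarrow> z \<in> closure \<Omega> \<Longrightarrow> norm (hessian \<Omega> (h k) z *v a - hessian \<Omega> (h k) y *v a) \<le> c k * norm (z - y) * norm a"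
    "\<And>k y z. y \<in> closure \<Omega> \<Longrightarrow> z \<in> closure \<Omega> \<Longrightarrow> norm (grad \<Omega> (h k) z - grad \<Omega> (h k) y - hessian \<Omega> (h k) y *v (z - y)) \<le> c k * (norm (z - y))\<^sup>2"
    "\<And>k y z a. y \<in> closure \<Omega> \<Longrightarrow> z \<in> closure \<Omega> \<Longrightarrow>
       norm (hessian \<Omega> (h k) z *v a - hessian \<Omega> (h k) y *v a - third_deriv \<Omega> (h k) y (z - y) a) \<le> c k * (norm (z - y))\<^sup>2 * norm a"
    using Q unfolding Q_def by blast+
  define C0 where "C0 = (\<Sum>k\<in>UNIV. c k)"
  have cC: "c k \<le> C0" for k unfolding C0_def using c0 by (intro member_le_sum) auto
  have C0: "C0 \<ge> 0" unfolding C0_def using c0 by (intro sum_nonneg)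
  have b: "norm (grad \<Omega> (h k) y) \<le> C0" "norm (hessian \<Omega> (h k) y *v a) \<le> C0 * norm a" if "y \<in> closure \<Omega>" for k y a
    using c(1)[OF that, of k] c(3)[OF that, of k a] cC[of k] mult_right_mono[OF cC[of k], of "norm a"] by auto
  have b2: "norm (grad \<Omega> (h k) z - grad \<Omega> (h k) y) \<le> C0 * norm (z - y)"
    "norm (hessian \<Omega> (h k) z *v a - hessian \<Omega> (h k) y *v a) \<le> C0 * norm (z - y) * norm a"
    "norm (grad \<Omega> (h k) z - grad \<Omega> (h k) y - hessian \<Omega> (h k) y *v (z - y)) \<le> C0 * (norm (z - y))\<^sup>2"
    "norm (hessian \<Omega> (h k) z *v a - hessian \<Omega> (h k) y *v a - third_deriv \<Omega> (h k) y (z - y) a) \<le> C0 * (norm (z - y))\<^sup>2 * norm a"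
    if yz: "y \<in> closure \<Omega>" "z \<in> closure \<Omega>" for k y z a
  proof -
    have m: "c k * r \<le> C0 * r" if "r \<ge> 0" for r using cC[of k] that by (rule mult_right_mono)
    have m': "c k * r * norm a \<le> C0 * r * norm a" if "r \<ge> 0" for r using m[OF that] by (rule mult_right_mono) simp
    show "norm (grad \<Omega> (h k) z - grad \<Omega> (h k) y) \<le> C0 * norm (z - y)"
      by (rule order_trans[OF c(2)[OF yz] m]) simp
    show "norm (hessian \<Omega> (h k) z *v a - hessian \<Omega> (h k) y *v a) \<le> C0 * norm (z - y) * norm a"
      by (rule order_trans[OF c(4)[OF yz] m']) simp
    show "norm (grad \<Omega> (h k) z - grad \<Omega> (h k) y - hessian \<Omega> (h k) y *v (z - y)) \<le> C0 * (norm (z - y))\<^sup>2"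
      by (rule order_trans[OF c(5)[OF yz] m]) simp
    show "norm (hessian \<Omega> (h k) z *v a - hessian \<Omega> (h k) y *v a - third_deriv \<Omega> (h k) y (z - y) a) \<le> C0 * (norm (z - y))\<^sup>2 * norm a"
      by (rule order_trans[OF c(6)[OF yz] m']) simp
  qed
  have Jh: "(J ** hessian \<Omega> (h k) x) *v a = J *v (hessian \<Omega> (h k) x *v a)" for k x a
    by (simp add: matrix_vector_mul_assoc)
  have Jd: "J *v a - J *v b = J *v (a - b)" for a b :: "real^2" by (simp add: matrix_vector_mult_diff_distrib)
  have Ja: "J *v a + J *v b = J *v (a + b)" for a b :: "real^2" by (simp add: matrix_vector_right_distrib)
  define C where "C = C0 * (R + 2)"
  have CC: "C \<ge> C0" "C \<ge> C0 + C0 * R" "C \<ge> C0 + C0 * R + C0"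
    using C0 R mult_nonneg_nonneg[OF C0 R] by (simp_all add: C_def algebra_simps)
  show thesis
  proof (rule that[of C])
    show "C \<ge> 0" using C0 R by (simp add: C_def)
    show "norm (field k z) \<le> C" if z: "z \<in> closure \<Omega> \<times> cball 0 R" for k z
    proof -
      have "norm (field k z) \<le> norm (grad \<Omega> (h k) (fst z)) + norm (hessian \<Omega> (h k) (fst z) *v snd z)"
        unfolding field_def using norm_Pair_le[of "J *v grad \<Omega> (h k) (fst z)" "(J ** hessian \<Omega> (h k) (fst z)) *v snd z"]
        by (simp add: Jh norm_J_mult)
      also have "\<dots> \<le> C0 + C0 * R"
        using z b(1)[of "fst z" k] b(2)[of "fst z" k "snd z"] mult_left_mono[OF _ C0, of "norm (snd z)" R] by auto
      finally show ?thesis using CC by linarith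
    qed
    fix k
    show "norm ((J ** hessian \<Omega> (h k) x) *v a) \<le> C * norm a" if "x \<in> closure \<Omega>" for x a
      using b(2)[OF that, of k a] mult_right_mono[OF CC(1), of "norm a"] by (simp add: Jh norm_J_mult)
    show "norm (J *v grad \<Omega> (h k) y - J *v grad \<Omega> (h k) x) \<le> C * dist x y" if "x \<in> closure \<Omega>" "y \<in> closure \<Omega>" for x y
      using b2(1)[OF that, of k] mult_right_mono[OF CC(1), of "norm (y - x)"]
      by (simp add: Jd norm_J_mult dist_norm norm_minus_commute)
    fix z w :: "(real^2) \<times> (real^2)" assume "z \<in> closure \<Omega> \<times> cball 0 R" "w \<in> closure \<Omega> \<times> cball 0 R"
    then obtain x y a b' :: "real^2" where zw: "z = (x, a)" "w = (y, b')" "x \<in> closure \<Omega>" "y \<in> closure \<Omega>" "norm a \<le> R" "norm b' \<le> R"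
      by auto
    define d where "d = norm (w - z)"
    have d: "norm (y - x) \<le> d" "norm (b' - a) \<le> d" "d \<ge> 0"
      using norm_fst_le[of "y - x" "b' - a"] norm_snd_le[of "b' - a" "y - x"] by (simp_all add: d_def zw)
    let ?g = "grad \<Omega> (h k)" and ?H = "hessian \<Omega> (h k)" and ?D = "third_deriv \<Omega> (h k)"
    have e1: "norm (?g y - ?g x) \<le> C0 * d"
      using b2(1)[OF zw(3,4), of k] mult_left_mono[OF d(1) C0] by linarith
    have e2: "norm (?H y *v b' - ?H x *v a) \<le> C0 * d * R + C0 * d"
    proof -
      have "?H y *v b' - ?H x *v a = (?H y *v b' - ?H x *v b') + ?H x *v (b' - a)"
        by (simp add: matrix_vector_mult_diff_distrib)
      also have "norm \<dots> \<le> C0 * norm (y - x) * norm b' + C0 * norm (b' - a)"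
        by (rule norm_triangle_mono[OF b2(2)[OF zw(3,4)] b(2)[OF zw(3)]])
      also have "\<dots> \<le> C0 * d * R + C0 * d"
        using d zw C0 by (intro add_mono mult_mono mult_left_mono) auto
      finally show ?thesis .
    qed
    have "norm (field k w - field k z) \<le> norm (?g y - ?g x) + norm (?H y *v b' - ?H x *v a)"
      using norm_Pair_le[of "J *v (?g y - ?g x)" "J *v (?H y *v b' - ?H x *v a)"]
      by (simp add: field_def zw Jh Jd norm_J_mult)
    also have "\<dots> \<le> C * d" using e1 e2 by (simp add: C_def algebra_simps)
    finally show "norm (field k w - field k z) \<le> C * norm (w - z)" by (simp add: d_def)
    have d2: "(norm (y - x))\<^sup>2 \<le> d\<^sup>2" using d by (intro power_mono) auto
    have t1: "norm (?g y - ?g x - ?H x *v (y - x)) \<le> C0 * d\<^sup>2"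
      using b2(3)[OF zw(3,4), of k] mult_left_mono[OF d2 C0] by linarith
    have t2: "norm (?H y *v b' - ?H x *v a - (?H x *v (b' - a) + ?D x (y - x) a)) \<le> C0 * d\<^sup>2 + C0 * d\<^sup>2 * R"
    proof -
      have "?H y *v b' - ?H x *v a - (?H x *v (b' - a) + ?D x (y - x) a)
          = (?H y *v (b' - a) - ?H x *v (b' - a)) + (?H y *v a - ?H x *v a - ?D x (y - x) a)"
        by (simp add: matrix_vector_mult_diff_distrib)
      also have "norm \<dots> \<le> C0 * norm (y - x) * norm (b' - a) + C0 * (norm (y - x))\<^sup>2 * norm a"
        by (rule norm_triangle_mono[OF b2(2)[OF zw(3,4)] b2(4)[OF zw(3,4)]])
      also have "\<dots> \<le> C0 * d * d + C0 * d\<^sup>2 * R"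
        using d d2 zw C0 by (intro add_mono mult_mono mult_left_mono) auto
      finally show ?thesis by (simp add: power2_eq_square mult.assoc)
    qed
    have "norm (field k w - field k z - field_deriv k z (w - z)) \<le> norm (?g y - ?g x - ?H x *v (y - x))
        + norm (?H y *v b' - ?H x *v a - (?H x *v (b' - a) + ?D x (y - x) a))"
      using norm_Pair_le[of "J *v (?g y - ?g x - ?H x *v (y - x))" "J *v (?H y *v b' - ?H x *v a - (?H x *v (b' - a) + ?D x (y - x) a))"]
      by (simp only: field_def field_deriv_def zw Jh Jd Ja norm_J_mult fst_conv snd_conv diff_Pair)
    also have "\<dots> \<le> C * d\<^sup>2" using t1 t2 by (simp add: C_def algebra_simps)
    finally show "norm (field k w - field k z - field_deriv k z (w - z)) \<le> C * (norm (w - z))\<^sup>2" by (simp add: d_def)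
  qed
qed

section \<open>State and adjoint state for a given control\<close>

lemma grad_stream: "x \<in> closure \<Omega> \<Longrightarrow> grad \<Omega> (stream h u t) x = (\<Sum>k\<in>UNIV. u t $ k *\<^sub>R grad \<Omega> (h k) x)"
  by (simp add: vec_eq_iff grad_def partial_closure_stream[OF op smooth])

lemma hessian_stream: "x \<in> closure \<Omega> \<Longrightarrow> hessian \<Omega> (stream h u t) x = (\<Sum>k\<in>UNIV. u t $ k *\<^sub>R hessian \<Omega> (h k) x)"
  by (simp add: vec_eq_iff hessian_def partial_closure_stream[OF op smooth])

lemma third_deriv_stream: "x \<in> closure \<Omega> \<Longrightarrow>
    third_deriv \<Omega> (stream h u t) x b a = (\<Sum>k\<in>UNIV. u t $ k *\<^sub>R third_deriv \<Omega> (h k) x b a)"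
  by (simp add: vec_eq_iff third_deriv_def partial_closure_stream[OF op smooth] sum_2
      sum_distrib_left sum_distrib_right sum.distrib algebra_simps)

lemma matrix_vector_sum: "A *v (\<Sum>k\<in>I. f k) = (\<Sum>k\<in>I. A *v f k)" for A :: "real^2^2"
  by (induction I rule: infinite_finite_induct) (simp_all add: matrix_vector_right_distrib)

lemma sum_matrix_vector: "(\<Sum>k\<in>I. c k *\<^sub>R (A k :: real^2^2)) *v x = (\<Sum>k\<in>I. c k *\<^sub>R (A k *v x))"
  by (induction I rule: infinite_finite_induct)
    (simp_all add: matrix_vector_mult_add_rdistrib scaleR_matrix_vector_assoc)

lemma J_hessian_stream: "x \<in> closure \<Omega> \<Longrightarrow>
    (J ** hessian \<Omega> (stream h u t) x) *v a = (\<Sum>k\<in>UNIV. u t $ k *\<^sub>R ((J ** hessian \<Omega> (h k) x) *v a))"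
  by (simp add: hessian_stream sum_matrix_vector matrix_vector_sum matrix_vector_mult_scaleR flip: matrix_vector_mul_assoc)

lemma J_grad_stream: "x \<in> closure \<Omega> \<Longrightarrow>
    J *v grad \<Omega> (stream h u t) x = (\<Sum>k\<in>UNIV. u t $ k *\<^sub>R (J *v grad \<Omega> (h k) x))"
  by (simp add: grad_stream matrix_vector_sum matrix_vector_mult_scaleR)

lemma J_third_deriv_stream: "x \<in> closure \<Omega> \<Longrightarrow>
    J *v third_deriv \<Omega> (stream h u t) x b a = (\<Sum>k\<in>UNIV. u t $ k *\<^sub>R (J *v third_deriv \<Omega> (h k) x b a))"
  by (simp add: third_deriv_stream matrix_vector_sum matrix_vector_mult_scaleR)

lemma field_sum: "x \<in> closure \<Omega> \<Longrightarrow>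
    (J *v grad \<Omega> (stream h u t) x, (J ** hessian \<Omega> (stream h u t) x) *v a) = (\<Sum>k\<in>UNIV. u t $ k *\<^sub>R field k (x, a))"
  by (simp add: J_grad_stream J_hessian_stream field_def sum_prod)

lemma vec_eq_by_inner: "(\<And>y. x \<bullet> y = x' \<bullet> y) \<Longrightarrow> x = (x' :: 'a::real_inner)"
  by (metis inner_eq_zero_iff inner_diff_left right_minus_eq)

lemma field_adjoint_sum:
  assumes x: "x \<in> closure \<Omega>"
  shows "(transpose (J ** hessian \<Omega> (stream h u t) x) *v p
      + transpose (matrix (\<lambda>b. J *v third_deriv \<Omega> (stream h u t) x b a)) *v q,
      transpose (J ** hessian \<Omega> (stream h u t) x) *v q) = (\<Sum>k\<in>UNIV. u t $ k *\<^sub>R field_adjoint k (x, a) (p, q))"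
proof (rule vec_eq_by_inner)
  fix w :: "(real^2) \<times> (real^2)"
  have m: "matrix (\<lambda>b. J *v third_deriv \<Omega> (stream h u t) x b a) *v fst w = J *v third_deriv \<Omega> (stream h u t) x (fst w) a"
    using fun_cong[OF matrix_vector_mul(2)[OF third_deriv_linear]] .
  have "(transpose (J ** hessian \<Omega> (stream h u t) x) *v p
      + transpose (matrix (\<lambda>b. J *v third_deriv \<Omega> (stream h u t) x b a)) *v q,
      transpose (J ** hessian \<Omega> (stream h u t) x) *v q) \<bullet> w
    = p \<bullet> ((J ** hessian \<Omega> (stream h u t) x) *v fst w) + q \<bullet> (J *v third_deriv \<Omega> (stream h u t) x (fst w) a)
      + q \<bullet> ((J ** hessian \<Omega> (stream h u t) x) *v snd w)"
    by (simp add: inner_prod_def inner_add_left dot_lmul_matrix m)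
  also have "\<dots> = (\<Sum>k\<in>UNIV. u t $ k * ((p, q) \<bullet> field_deriv k (x, a) w))"
    by (simp add: J_hessian_stream[OF x] J_third_deriv_stream[OF x] field_deriv_def inner_prod_def
        inner_sum_right inner_add_right sum.distrib distrib_left)
  also have "\<dots> = (\<Sum>k\<in>UNIV. u t $ k *\<^sub>R field_adjoint k (x, a) (p, q)) \<bullet> w"
    unfolding inner_sum_left inner_scaleR_left field_adjoint_inner by simp
  finally show "(transpose (J ** hessian \<Omega> (stream h u t) x) *v p
      + transpose (matrix (\<lambda>b. J *v third_deriv \<Omega> (stream h u t) x b a)) *v q,
      transpose (J ** hessian \<Omega> (stream h u t) x) *v q) \<bullet> w = (\<Sum>k\<in>UNIV. u t $ k *\<^sub>R field_adjoint k (x, a) (p, q)) \<bullet> w" .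
qed

lemma continuous_on_hessian_mult:
  assumes "continuous_on S X" "X ` S \<subseteq> closure \<Omega>" "continuous_on S a"
  shows "continuous_on S (\<lambda>p. (J ** hessian \<Omega> (h k) (X p)) *v a p)"
proof -
  have "continuous_on S (\<lambda>p. \<Sum>j\<in>UNIV. hessian \<Omega> (h k) (X p) $ i $ j * a p $ j)" for i
    by (intro continuous_intros continuous_on_compose2[OF hessian_component_continuous assms(1,2)] assms)
  then have "continuous_on S (\<lambda>p. hessian \<Omega> (h k) (X p) *v a p)"
    by (simp add: matrix_vector_mult_def continuous_on_vec_lambda)
  then have "continuous_on S (\<lambda>p. J *v (hessian \<Omega> (h k) (X p) *v a p))"
    by (rule bounded_linear.continuous_on[OF matrix_vector_mul_bounded_linear])
  then show ?thesis by (simp add: matrix_vector_mul_assoc)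
qed

lemma continuous_on_field:
  assumes "continuous_on S z" "(\<lambda>p. fst (z p)) ` S \<subseteq> closure \<Omega>"
  shows "continuous_on S (\<lambda>p. field k (z p))"
proof -
  have "continuous_on S (\<lambda>p. J *v grad \<Omega> (h k) (fst (z p)))"
    by (intro bounded_linear.continuous_on[OF matrix_vector_mul_bounded_linear]
        continuous_on_compose2[OF grad_continuous _ assms(2)] continuous_on_fst assms(1))
  then show ?thesis
    unfolding field_def by (intro continuous_on_Pair continuous_on_hessian_mult continuous_intros assms)
qed

lemma field_adjoint_linear: "linear (field_adjoint k z)"
  by (rule linearI) (simp_all add: field_adjoint_def matrix_vector_right_distrib matrix_vector_mult_scaleR scaleR_add_right)

lemma continuous_on_field_adjoint:
  assumes z: "continuous_on S z" "(\<lambda>p. fst (z p)) ` S \<subseteq> closure \<Omega>" and r: "continuous_on S r"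
  shows "continuous_on S (\<lambda>p. field_adjoint k (z p) (r p))"
proof -
  have P: "continuous_on S (\<lambda>p. partial_closure \<Omega> is (h k) (fst (z p)))" for "is"
    by (rule continuous_on_compose2[OF P_continuous _ z(2)]) (intro continuous_intros z)
  have "field_adjoint k (z p) (r p) = (\<Sum>w\<in>Basis. (r p \<bullet> field_deriv k (z p) w) *\<^sub>R w)" for p
    using euclidean_representation[of "field_adjoint k (z p) (r p)"] by (simp add: field_adjoint_inner)
  moreover have "continuous_on S (\<lambda>p. field_deriv k (z p) w)" for w
  proof -
    have "continuous_on S (\<lambda>p. third_deriv \<Omega> (h k) (fst (z p)) (fst w) (snd (z p)))"
      unfolding third_deriv_def by (intro continuous_on_vec_lambda continuous_intros P z)
    then have "continuous_on S (\<lambda>p. J *v third_deriv \<Omega> (h k) (fst (z p)) (fst w) (snd (z p)))"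
      by (rule bounded_linear.continuous_on[OF matrix_vector_mul_bounded_linear])
    then show ?thesis
      unfolding field_deriv_def by (intro continuous_on_Pair continuous_on_add continuous_on_hessian_mult continuous_intros z)
  qed
  ultimately show ?thesis by (simp add: continuous_intros r)
qed

text \<open>The position is solved for first, with extended fields, and the tangent second, from a linear
  equation along the position.\<close>

lemma state_existence:
  assumes u: "integrable (lebesgue_on {0..T}) u" and g0: "continuous_on {0..1} \<gamma>0" "\<gamma>0 ` {0..1} \<subseteq> closure \<Omega>"
    and g1: "continuous_on {0..1} (\<lambda>s. vector_derivative \<gamma>0 (at s within {0..1}))"
  shows "\<exists>X a. is_state \<Omega> T \<gamma>0 (stream h u) X a"
proof -
  have T0: "T \<ge> 0" using Tpos by simp
  have cne: "closure \<Omega> \<noteq> {}" using ne by simp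
  obtain C where C: "C \<ge> 0" "\<And>k x a. x \<in> closure \<Omega> \<Longrightarrow> norm ((J ** hessian \<Omega> (h k) x) *v a) \<le> C * norm a"
    "\<And>k x y. x \<in> closure \<Omega> \<Longrightarrow> y \<in> closure \<Omega> \<Longrightarrow> norm (J *v grad \<Omega> (h k) y - J *v grad \<Omega> (h k) x) \<le> C * dist x y"
    by (rule field_bounds[OF order_refl]) (rule that; assumption)
  have "\<exists>g. (\<forall>x\<in>closure \<Omega>. g x = J *v grad \<Omega> (h k) x) \<and> (\<forall>x y. norm (g y - g x) \<le> 2 * C * dist x y)" for k
  proof -
    obtain g where "\<And>x. x \<in> closure \<Omega> \<Longrightarrow> g x = J *v grad \<Omega> (h k) x" "\<And>x y. norm (g y - g x) \<le> real CARD(2) * C * dist x y"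
    proof (rule lipschitz_extension_vec[OF cne C(1)])
      show "norm (J *v grad \<Omega> (h k) y - J *v grad \<Omega> (h k) x) \<le> C * dist x y"
        if "x \<in> closure \<Omega>" "y \<in> closure \<Omega>" for x y using C(3)[OF that] .
    qed (rule that; assumption)
    then show ?thesis by (intro exI[of _ g]) simp
  qed
  then obtain g where g: "\<And>k x. x \<in> closure \<Omega> \<Longrightarrow> g k x = J *v grad \<Omega> (h k) x" "\<And>k x y. norm (g k y - g k x) \<le> 2 * C * dist x y"
    by metis
  have cg: "continuous_on UNIV (g k)" for k
    using C(1) g(2) by (intro lipschitz_on_continuous_on[where L = "2 * C"]) (auto simp: lipschitz_on_def dist_norm norm_minus_commute)
  obtain X where X: "continuous_on ({0..T} \<times> {0..1}) (\<lambda>(t, s). X t s)"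
    "\<And>s. s \<in> {0..1} \<Longrightarrow> has_ac_derivative_on (\<lambda>t. X t s) (\<lambda>t. \<Sum>k\<in>UNIV. u t $ k *\<^sub>R g k (X t s)) 0 T"
    "\<And>s. s \<in> {0..1} \<Longrightarrow> X 0 s = \<gamma>0 s"
  proof (rule caratheodory_existence[where f = "\<lambda>k t s x. g k x", OF T0 u _ _ g0(1)])
    show "continuous_on ({0..T} \<times> {0..1} \<times> UNIV) (\<lambda>(t, s, x). g k x)" for k
      unfolding case_prod_beta by (rule continuous_on_compose2[OF cg]) (auto intro!: continuous_intros)
    show "norm (g k x - g k y) \<le> 2 * C * norm (x - y)" for k x y
      using g(2)[where k = k and x = y and y = x] by (simp add: dist_norm norm_minus_commute)
  qed (rule that; assumption)
  have XK: "X t s \<in> closure \<Omega>" if "t \<in> {0..T}" "s \<in> {0..1}" for t s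
  proof (rule invariant_set[OF closed_closure X(2)[OF that(2)] u _ _ g(2) _ that(1)])
    show "X 0 s \<in> closure \<Omega>" using X(3)[OF that(2)] g0(2) that(2) by auto
    show "0 \<le> 2 * C" using C(1) by simp
    show "(x - \<pi>) \<bullet> g k \<pi> = 0" if "\<pi> \<in> closure \<Omega>" "\<And>y. y \<in> closure \<Omega> \<Longrightarrow> dist x \<pi> \<le> dist x y" for x \<pi> k
      using rotated_gradient_tangent[OF op bd C2 smooth h0 that] g(1)[OF that(1)] by simp
  qed
  obtain a where a: "continuous_on ({0..T} \<times> {0..1}) (\<lambda>(t, s). a t s)"
    "\<And>s. s \<in> {0..1} \<Longrightarrow> has_ac_derivative_on (\<lambda>t. a t s) (\<lambda>t. \<Sum>k\<in>UNIV. u t $ k *\<^sub>R ((J ** hessian \<Omega> (h k) (X t s)) *v a t s)) 0 T"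
    "\<And>s. s \<in> {0..1} \<Longrightarrow> a 0 s = vector_derivative \<gamma>0 (at s within {0..1})"
  proof (rule caratheodory_existence[where f = "\<lambda>k t s x. (J ** hessian \<Omega> (h k) (X t s)) *v x", OF T0 u _ _ g1])
    fix k
    have "continuous_on ({0..T} \<times> {0..1} \<times> UNIV) (\<lambda>p. case (fst p, fst (snd p)) of (t, s) \<Rightarrow> X t s)"
      by (rule continuous_on_compose2[OF X(1)]) (auto intro!: continuous_intros)
    then show "continuous_on ({0..T} \<times> {0..1} \<times> UNIV) (\<lambda>(t, s, x). (J ** hessian \<Omega> (h k) (X t s)) *v x)"
      unfolding case_prod_beta by (intro continuous_on_hessian_mult continuous_intros) (use XK in auto)
    show "norm ((J ** hessian \<Omega> (h k) (X t s)) *v x - (J ** hessian \<Omega> (h k) (X t s)) *v y) \<le> C * norm (x - y)"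
      if "t \<in> {0..T}" "s \<in> {0..1}" for t s x y
      using C(2)[OF XK[OF that], of k "x - y"] by (simp add: matrix_vector_mult_diff_distrib)
  qed (rule that; assumption)
  have "is_state \<Omega> T \<gamma>0 (stream h u) X a"
    unfolding is_state_def
  proof (intro conjI ballI)
    fix s :: real assume s: "s \<in> {0..1}"
    show "has_ac_derivative_on (\<lambda>t. X t s) (\<lambda>t. J *v grad \<Omega> (stream h u t) (X t s)) 0 T"
      by (rule ac_derivative_cong[OF X(2)[OF s]]) (use XK s g(1) in \<open>simp_all add: J_grad_stream\<close>)
    show "has_ac_derivative_on (\<lambda>t. a t s) (\<lambda>t. (J ** hessian \<Omega> (stream h u t) (X t s)) *v a t s) 0 T"
      by (rule ac_derivative_cong[OF a(2)[OF s]]) (use XK s in \<open>simp_all add: J_hessian_stream\<close>)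
  qed (use X a XK in auto)
  then show ?thesis by blast
qed

lemma adjoint_existence:
  assumes u: "integrable (lebesgue_on {0..T}) u" and st: "is_state \<Omega> T \<gamma>0 (stream h u) X a" and \<epsilon>: "\<epsilon> > 0"
  shows "\<exists>p q. is_adjoint \<Omega> T \<epsilon> (stream h u) X a p q"
proof -
  have T0: "T \<ge> 0" using Tpos by simp
  have cX: "continuous_on ({0..T} \<times> {0..1}) (\<lambda>(t, s). X t s)" and ca: "continuous_on ({0..T} \<times> {0..1}) (\<lambda>(t, s). a t s)"
    and XK: "\<And>t s. t \<in> {0..T} \<Longrightarrow> s \<in> {0..1} \<Longrightarrow> X t s \<in> closure \<Omega>"
    using st unfolding is_state_def by auto
  have cz: "continuous_on ({0..T} \<times> {0..1} \<times> UNIV) (\<lambda>p. (X (fst p) (fst (snd p)), a (fst p) (fst (snd p))))"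
  proof (intro continuous_on_Pair)
    have "continuous_on ({0..T} \<times> {0..1} \<times> UNIV) (\<lambda>p. case (fst p, fst (snd p)) of (t, s) \<Rightarrow> X t s)"
      "continuous_on ({0..T} \<times> {0..1} \<times> UNIV) (\<lambda>p. case (fst p, fst (snd p)) of (t, s) \<Rightarrow> a t s)"
      by (rule continuous_on_compose2[OF cX] continuous_on_compose2[OF ca]; auto intro!: continuous_intros)+
    then show "continuous_on ({0..T} \<times> {0..1} \<times> UNIV) (\<lambda>p. X (fst p) (fst (snd p)))"
      "continuous_on ({0..T} \<times> {0..1} \<times> UNIV) (\<lambda>p. a (fst p) (fst (snd p)))" by simp_all
  qed
  define f where "f k t s r = field_adjoint k (X t s, a t s) r" for k t s r
  have cf: "continuous_on ({0..T} \<times> {0..1} \<times> UNIV) (\<lambda>(t, s, r). f k t s r)" for k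
    unfolding f_def case_prod_beta by (intro continuous_on_field_adjoint cz continuous_intros) (use XK in auto)
  have "\<exists>L. \<forall>t\<in>{0..T}. \<forall>s\<in>{0..1}. \<forall>r. norm (f k t s r) \<le> L * norm r" for k
  proof -
    define c where "c p = (\<Sum>w\<in>Basis. norm (f k (fst p) (snd p) w))" for p
    have "continuous_on ({0..T} \<times> {0..1}) (\<lambda>p. case (fst p, snd p, w) of (t, s, r) \<Rightarrow> f k t s r)" for w
      by (rule continuous_on_compose2[OF cf[of k]]) (auto intro!: continuous_intros)
    then have "continuous_on ({0..T} \<times> {0..1}) c"
      unfolding c_def by (intro continuous_intros) simp
    then have "bounded (c ` ({0..T} \<times> {0..1}))"
      by (intro compact_imp_bounded compact_continuous_image compact_Times) auto
    then obtain L where L: "\<And>t s. t \<in> {0..T} \<Longrightarrow> s \<in> {0..1} \<Longrightarrow> c (t, s) \<le> L"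
      unfolding bounded_iff by (metis abs_le_D1 image_eqI mem_Sigma_iff real_norm_def)
    have "norm (f k t s r) \<le> L * norm r" if ts: "t \<in> {0..T}" "s \<in> {0..1}" for t s r
    proof -
      have lin: "linear (f k t s)" unfolding f_def[abs_def] by (rule field_adjoint_linear)
      have "f k t s r = (\<Sum>w\<in>Basis. (r \<bullet> w) *\<^sub>R f k t s w)"
        using linear_sum[OF lin, of "\<lambda>w. (r \<bullet> w) *\<^sub>R w" Basis] by (simp add: euclidean_representation linear_scale[OF lin])
      also have "norm \<dots> \<le> (\<Sum>w\<in>Basis. norm r * norm (f k t s w))"
        by (rule sum_norm_le) (auto intro!: mult_right_mono Basis_le_norm)
      also have "\<dots> = norm r * c (t, s)" by (simp add: c_def sum_distrib_left)
      also have "\<dots> \<le> norm r * L" using L[OF ts] by (intro mult_left_mono) auto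
      finally show ?thesis by (simp add: mult.commute)
    qed
    then show ?thesis by blast
  qed
  then obtain L0 where L0: "\<And>k t s r. t \<in> {0..T} \<Longrightarrow> s \<in> {0..1} \<Longrightarrow> norm (f k t s r) \<le> L0 k * norm r"
    by metis
  define L where "L = (\<Sum>k\<in>UNIV. \<bar>L0 k\<bar>)"
  have L: "L0 k \<le> L" for k
    unfolding L_def using member_le_sum[of k UNIV "\<lambda>k. \<bar>L0 k\<bar>"] by auto
  define r1 where "r1 s = (0 :: real^2, - (a T s /\<^sub>R sqrt ((norm (a T s))\<^sup>2 + \<epsilon>\<^sup>2)))" for s
  have pos: "(norm v)\<^sup>2 + \<epsilon>\<^sup>2 > 0" for v :: "real^2" using \<epsilon> by (intro add_nonneg_pos) auto
  have cr1: "continuous_on {0..1} r1"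
    unfolding r1_def using continuous_on_slices(2)[OF ca, of T] T0 pos
    by (intro continuous_intros) (auto simp: less_imp_neq[THEN not_sym])
  obtain r where r: "continuous_on ({0..T} \<times> {0..1}) (\<lambda>(t, s). r t s)"
    "\<And>s. s \<in> {0..1} \<Longrightarrow> has_ac_derivative_on (\<lambda>t. r t s) (\<lambda>t. - (\<Sum>k\<in>UNIV. u t $ k *\<^sub>R f k t s (r t s))) 0 T"
    "\<And>s. s \<in> {0..1} \<Longrightarrow> r T s = r1 s"
  proof (rule caratheodory_existence_backward[OF T0 u cf _ cr1])
    fix k t s x y assume ts: "t \<in> {0..T}" "s \<in> {0..(1::real)}"
    have "f k t s x - f k t s y = f k t s (x - y)"
      unfolding f_def by (rule linear_diff[OF field_adjoint_linear, symmetric])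
    then show "norm (f k t s x - f k t s y) \<le> L * norm (x - y)"
      using L0[OF ts, of k "x - y"] mult_right_mono[OF L[of k], of "norm (x - y)"] by simp
  qed (rule that; assumption)
  have "is_adjoint \<Omega> T \<epsilon> (stream h u) X a (\<lambda>t s. fst (r t s)) (\<lambda>t s. snd (r t s))"
    unfolding is_adjoint_def
  proof (intro conjI ballI)
    have r': "continuous_on ({0..T} \<times> {0..1}) (\<lambda>x. r (fst x) (snd x))" using r(1) by (simp add: case_prod_beta)
    show "continuous_on ({0..T} \<times> {0..1}) (\<lambda>(t, s). fst (r t s))" "continuous_on ({0..T} \<times> {0..1}) (\<lambda>(t, s). snd (r t s))"
      unfolding case_prod_beta by (intro continuous_intros r')+
    fix s :: real assume s: "s \<in> {0..1}"
    show "fst (r T s) = 0" "snd (r T s) = - (a T s /\<^sub>R sqrt ((norm (a T s))\<^sup>2 + \<epsilon>\<^sup>2))"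
      using r(3)[OF s] by (simp_all add: r1_def)
    have "has_ac_derivative_on (\<lambda>t. (fst (r t s), snd (r t s)))
      (\<lambda>t. (- (transpose (J ** hessian \<Omega> (stream h u t) (X t s)) *v fst (r t s)
        + transpose (matrix (\<lambda>b. J *v third_deriv \<Omega> (stream h u t) (X t s) b (a t s))) *v snd (r t s)),
        - (transpose (J ** hessian \<Omega> (stream h u t) (X t s)) *v snd (r t s)))) 0 T"
    proof (rule ac_derivative_cong[OF r(2)[OF s]])
      fix t assume t: "t \<in> {0..T}"
      show "- (\<Sum>k\<in>UNIV. u t $ k *\<^sub>R f k t s (r t s)) = (- (transpose (J ** hessian \<Omega> (stream h u t) (X t s)) *v fst (r t s)
        + transpose (matrix (\<lambda>b. J *v third_deriv \<Omega> (stream h u t) (X t s) b (a t s))) *v snd (r t s)),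
        - (transpose (J ** hessian \<Omega> (stream h u t) (X t s)) *v snd (r t s)))"
        using arg_cong[OF field_adjoint_sum[OF XK[OF t s], of u t "fst (r t s)" "a t s" "snd (r t s)"], of uminus]
        by (simp only: f_def uminus_Pair prod.collapse)
    qed simp
    from ac_derivative_fst_snd[OF this]
    show "has_ac_derivative_on (\<lambda>t. fst (r t s))
          (\<lambda>t. - (transpose (J ** hessian \<Omega> (stream h u t) (X t s)) *v fst (r t s)
                + transpose (matrix (\<lambda>b. J *v third_deriv \<Omega> (stream h u t) (X t s) b (a t s))) *v snd (r t s))) 0 T"
      "has_ac_derivative_on (\<lambda>t. snd (r t s))
          (\<lambda>t. - (transpose (J ** hessian \<Omega> (stream h u t) (X t s)) *v snd (r t s))) 0 T" .
  qed
  then show ?thesis by blast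
qed

end

section \<open>Square-integrable controls\<close>

lemma L2_norm_nonneg: "L2_norm S f \<ge> 0"
  by (simp add: L2_norm_def Bochner_Integration.integral_nonneg)

lemma L2_norm_sq: "(L2_norm S f)\<^sup>2 = (\<integral>x. (norm (f x))\<^sup>2 \<partial>lebesgue_on S)"
  unfolding L2_norm_def by (intro real_sqrt_pow2 Bochner_Integration.integral_nonneg) simp

lemma L2_product_integrable:
  assumes f: "f \<in> L2 S" and g: "g \<in> L2 S"
  shows "integrable (lebesgue_on S) (\<lambda>x. norm (f x) * norm (g x))"
proof (rule Bochner_Integration.integrable_bound)
  have fm: "f \<in> borel_measurable (lebesgue_on S)" "g \<in> borel_measurable (lebesgue_on S)"
    using f g by (auto simp: L2_def)
  show "integrable (lebesgue_on S) (\<lambda>x. (norm (f x))\<^sup>2 + (norm (g x))\<^sup>2)"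
    using f g by (simp add: L2_def)
  show "(\<lambda>x. norm (f x) * norm (g x)) \<in> borel_measurable (lebesgue_on S)"
    using fm by measurable
  show "AE x in lebesgue_on S. norm (norm (f x) * norm (g x)) \<le> norm ((norm (f x))\<^sup>2 + (norm (g x))\<^sup>2)"
  proof (rule AE_I2)
    fix x
    have "2 * norm (f x) * norm (g x) \<le> (norm (f x))\<^sup>2 + (norm (g x))\<^sup>2" by (rule sum_squares_bound)
    moreover have "0 \<le> norm (f x) * norm (g x)" by simp
    ultimately have "norm (f x) * norm (g x) \<le> (norm (f x))\<^sup>2 + (norm (g x))\<^sup>2" by linarith
    then show "norm (norm (f x) * norm (g x)) \<le> norm ((norm (f x))\<^sup>2 + (norm (g x))\<^sup>2)" by simp
  qed
qed

lemma L2_cauchy_schwarz: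
  assumes f: "f \<in> L2 S" and g: "g \<in> L2 S"
  shows "(\<integral>x. norm (f x) * norm (g x) \<partial>lebesgue_on S) \<le> L2_norm S f * L2_norm S g"
proof -
  define A where "A = (L2_norm S f)\<^sup>2"
  define B where "B = (L2_norm S g)\<^sup>2"
  define I where "I = (\<integral>x. norm (f x) * norm (g x) \<partial>lebesgue_on S)"
  have I0: "I \<ge> 0" by (simp add: I_def Bochner_Integration.integral_nonneg)
  have fi: "integrable (lebesgue_on S) (\<lambda>x. (norm (f x))\<^sup>2)" "integrable (lebesgue_on S) (\<lambda>x. (norm (g x))\<^sup>2)"
    using f g by (auto simp: L2_def)
  note pi = L2_product_integrable[OF f g]
  have q: "2 * t * I \<le> t\<^sup>2 * A + B" for t
  proof -
    have "2 * t * I = (\<integral>x. 2 * t * (norm (f x) * norm (g x)) \<partial>lebesgue_on S)"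
      by (simp add: I_def)
    also have "\<dots> \<le> (\<integral>x. t\<^sup>2 * (norm (f x))\<^sup>2 + (norm (g x))\<^sup>2 \<partial>lebesgue_on S)"
    proof (rule integral_mono)
      show "integrable (lebesgue_on S) (\<lambda>x. 2 * t * (norm (f x) * norm (g x)))"
        by (rule integrable_mult_right[OF pi])
      show "integrable (lebesgue_on S) (\<lambda>x. t\<^sup>2 * (norm (f x))\<^sup>2 + (norm (g x))\<^sup>2)" using fi by simp
      show "2 * t * (norm (f x) * norm (g x)) \<le> t\<^sup>2 * (norm (f x))\<^sup>2 + (norm (g x))\<^sup>2" for x
        using sum_squares_bound[of "t * norm (f x)" "norm (g x)"] by (simp add: power_mult_distrib mult_ac)
    qed
    also have "\<dots> = t\<^sup>2 * A + B" using fi by (simp add: A_def B_def L2_norm_sq)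
    finally show ?thesis .
  qed
  have A0: "A \<ge> 0" "B \<ge> 0" by (simp_all add: A_def B_def)
  have "I\<^sup>2 \<le> A * B"
  proof (cases "A = 0")
    case True
    have "I \<le> 0"
    proof (rule ccontr)
      assume "\<not> I \<le> 0"
      then show False using q[of "(B + 1) / (2 * I)"] True A0 by simp
    qed
    then show ?thesis using I0 True by simp
  next
    case False
    then have "A > 0" using A0 by simp
    have "2 * (I / A) * I \<le> (I / A)\<^sup>2 * A + B" by (rule q)
    then have "I\<^sup>2 / A \<le> B" using \<open>A > 0\<close> by (simp add: power2_eq_square)
    then show ?thesis using \<open>A > 0\<close> by (simp add: pos_divide_le_eq mult.commute)
  qed
  then have "I\<^sup>2 \<le> (L2_norm S f * L2_norm S g)\<^sup>2" by (simp add: A_def B_def power_mult_distrib)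
  then show ?thesis
    unfolding I_def[symmetric] by (rule power2_le_imp_le) (simp add: L2_norm_nonneg)
qed

lemma L2_inner_bound:
  assumes f: "f \<in> L2 S" and g: "g \<in> L2 S"
  shows "integrable (lebesgue_on S) (\<lambda>x. f x \<bullet> g x)" "\<bar>L2_inner S f g\<bar> \<le> L2_norm S f * L2_norm S g"
proof -
  have fm: "f \<in> borel_measurable (lebesgue_on S)" "g \<in> borel_measurable (lebesgue_on S)"
    using f g by (auto simp: L2_def)
  show i: "integrable (lebesgue_on S) (\<lambda>x. f x \<bullet> g x)"
  proof (rule Bochner_Integration.integrable_bound[OF L2_product_integrable[OF f g]])
    show "(\<lambda>x. f x \<bullet> g x) \<in> borel_measurable (lebesgue_on S)" using fm by measurable
    show "AE x in lebesgue_on S. norm (f x \<bullet> g x) \<le> norm (norm (f x) * norm (g x))"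
      using Cauchy_Schwarz_ineq2 by (intro AE_I2) simp
  qed
  have "\<bar>L2_inner S f g\<bar> \<le> (\<integral>x. \<bar>f x \<bullet> g x\<bar> \<partial>lebesgue_on S)"
    unfolding L2_inner_def using integral_norm_bound[of "lebesgue_on S" "\<lambda>x. f x \<bullet> g x"] by simp
  also have "\<dots> \<le> (\<integral>x. norm (f x) * norm (g x) \<partial>lebesgue_on S)"
    using i L2_product_integrable[OF f g] Cauchy_Schwarz_ineq2 by (intro integral_mono) auto
  also have "\<dots> \<le> L2_norm S f * L2_norm S g" by (rule L2_cauchy_schwarz[OF f g])
  finally show "\<bar>L2_inner S f g\<bar> \<le> L2_norm S f * L2_norm S g" .
qed

lemma L2_add:
  assumes f: "f \<in> L2 S" and g: "g \<in> L2 S"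
  shows "(\<lambda>x. f x + g x) \<in> L2 S"
proof -
  have fm: "f \<in> borel_measurable (lebesgue_on S)" "g \<in> borel_measurable (lebesgue_on S)"
    using f g by (auto simp: L2_def)
  have "integrable (lebesgue_on S) (\<lambda>x. (norm (f x + g x))\<^sup>2)"
  proof (rule Bochner_Integration.integrable_bound)
    show "integrable (lebesgue_on S) (\<lambda>x. 2 * (norm (f x))\<^sup>2 + 2 * (norm (g x))\<^sup>2)"
      using f g by (simp add: L2_def)
    show "(\<lambda>x. (norm (f x + g x))\<^sup>2) \<in> borel_measurable (lebesgue_on S)" using fm by measurable
    show "AE x in lebesgue_on S. norm ((norm (f x + g x))\<^sup>2) \<le> norm (2 * (norm (f x))\<^sup>2 + 2 * (norm (g x))\<^sup>2)"
    proof (rule AE_I2)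
      fix x
      have "(norm (f x + g x))\<^sup>2 \<le> (norm (f x) + norm (g x))\<^sup>2" by (intro power_mono norm_triangle_ineq) simp
      then have "(norm (f x + g x))\<^sup>2 \<le> 2 * (norm (f x))\<^sup>2 + 2 * (norm (g x))\<^sup>2"
        using square_add_le[of "norm (f x)" "norm (g x)"] by (rule order_trans)
      then show "norm ((norm (f x + g x))\<^sup>2) \<le> norm (2 * (norm (f x))\<^sup>2 + 2 * (norm (g x))\<^sup>2)"
        by simp
    qed
  qed
  then show ?thesis using fm by (simp add: L2_def)
qed

lemma L2_bounded_linear:
  assumes f: "f \<in> L2 S" and A: "bounded_linear A"
  shows "(\<lambda>x. A (f x)) \<in> L2 S"
proof -
  obtain K where K: "\<And>x. norm (A x) \<le> norm x * K" using bounded_linear.bounded[OF A] by blast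
  have fm: "f \<in> borel_measurable (lebesgue_on S)" using f by (auto simp: L2_def)
  have "A \<in> borel_measurable borel"
    by (intro borel_measurable_continuous_onI linear_continuous_on A)
  then have m: "(\<lambda>x. A (f x)) \<in> borel_measurable (lebesgue_on S)" using fm by measurable
  have "integrable (lebesgue_on S) (\<lambda>x. (norm (A (f x)))\<^sup>2)"
  proof (rule Bochner_Integration.integrable_bound)
    show "integrable (lebesgue_on S) (\<lambda>x. (norm (f x))\<^sup>2 * K\<^sup>2)" using f by (simp add: L2_def)
    show "(\<lambda>x. (norm (A (f x)))\<^sup>2) \<in> borel_measurable (lebesgue_on S)" using m by measurable
    show "AE x in lebesgue_on S. norm ((norm (A (f x)))\<^sup>2) \<le> norm ((norm (f x))\<^sup>2 * K\<^sup>2)"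
    proof (rule AE_I2)
      fix x
      have "(norm (A (f x)))\<^sup>2 \<le> (norm (f x) * K)\<^sup>2" using K[of "f x"] by (intro power_mono) auto
      then show "norm ((norm (A (f x)))\<^sup>2) \<le> norm ((norm (f x))\<^sup>2 * K\<^sup>2)" by (simp add: power_mult_distrib)
    qed
  qed
  then show ?thesis using m by (simp add: L2_def)
qed

lemma L2_continuous:
  fixes f :: "real \<Rightarrow> 'b::euclidean_space"
  assumes "continuous_on {a..b} f"
  shows "f \<in> L2 {a..b}"
proof -
  have "integrable (lebesgue_on {a..b}) (\<lambda>x. (norm (f x))\<^sup>2)"
    by (rule continuous_imp_integrable_real) (intro continuous_intros assms)
  then show ?thesis
    using continuous_imp_measurable_on_sets_lebesgue[OF assms] by (simp add: L2_def)
qed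

text \<open>The second part bounds the \<open>L\<^sup>1\<close> norm that occurs in the estimates for the state equation.\<close>

lemma L2_imp_integrable:
  fixes f :: "real \<Rightarrow> 'b::euclidean_space"
  assumes f: "f \<in> L2 {0..T}" and T: "T \<ge> 0"
  shows "integrable (lebesgue_on {0..T}) f" "(\<integral>t. norm (f t) \<partial>lebesgue_on {0..T}) \<le> sqrt T * L2_norm {0..T} f"
proof -
  have one: "(\<lambda>t. 1::real) \<in> L2 {0..T}" by (intro L2_continuous continuous_intros)
  have "L2_norm {0..T} (\<lambda>t. 1::real) = sqrt T"
    using T by (simp add: L2_norm_def measure_restrict_space)
  then show "(\<integral>t. norm (f t) \<partial>lebesgue_on {0..T}) \<le> sqrt T * L2_norm {0..T} f"
    using L2_cauchy_schwarz[OF one f] by simp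
  have "integrable (lebesgue_on {0..T}) (\<lambda>t. norm (f t))"
    using L2_product_integrable[OF one f] by simp
  moreover have "f \<in> borel_measurable (lebesgue_on {0..T})" using f by (simp add: L2_def)
  ultimately show "integrable (lebesgue_on {0..T}) f" by (simp add: integrable_norm_iff)
qed

lemma integral_interchange_control:
  fixes w :: "real \<Rightarrow> real" and c :: "real \<Rightarrow> real \<Rightarrow> real"
  assumes w: "integrable (lebesgue_on {0..T}) w" and c: "continuous_on ({0..T} \<times> {0..1}) (\<lambda>(t, s). c t s)" and T: "T \<ge> 0"
  shows "(\<integral>s. (\<integral>t. w t * c t s \<partial>lebesgue_on {0..T}) \<partial>lebesgue_on {0..1})
       = (\<integral>t. w t * (\<integral>s. c t s \<partial>lebesgue_on {0..1}) \<partial>lebesgue_on {0..T})"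
proof -
  let ?M = "lebesgue_on {0..T}" and ?N = "lebesgue_on {0..(1::real)}"
  define k where "k p = (max 0 (min T (fst p)), max 0 (min 1 (snd p)))" for p :: "real \<times> real"
  define C where "C t s = (case k (t, s) of (t, s) \<Rightarrow> c t s)" for t s
  have Cc: "C t s = c t s" if "t \<in> {0..T}" "s \<in> {0..1}" for t s
    using that by (simp add: C_def k_def)
  have k_in: "k p \<in> {0..T} \<times> {0..1}" for p using T by (auto simp: k_def)
  have cC: "continuous_on UNIV (\<lambda>p. C (fst p) (snd p))"
  proof -
    have "continuous_on UNIV (\<lambda>p. case k p of (t, s) \<Rightarrow> c t s)"
      by (rule continuous_on_compose2[OF c]) (use k_in in \<open>auto simp: k_def intro!: continuous_intros\<close>)
    then show ?thesis by (simp add: C_def)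
  qed
  have "bounded ((\<lambda>(t, s). c t s) ` ({0..T} \<times> {0..1}))"
    by (intro compact_imp_bounded compact_continuous_image c compact_Times) auto
  then obtain B where B: "\<And>p. p \<in> {0..T} \<times> {0..1} \<Longrightarrow> norm (case p of (t, s) \<Rightarrow> c t s) \<le> B"
    unfolding bounded_iff by (metis imageI)
  have CB: "\<bar>C t s\<bar> \<le> B" for t s
    using B[OF k_in[of "(t, s)"]] by (simp add: C_def)
  have "finite_measure ?M" "finite_measure ?N" by (auto intro!: finite_measure_lebesgue_on)
  interpret M: finite_measure ?M by fact
  interpret N: finite_measure ?N by fact
  interpret pair_sigma_finite ?M ?N ..
  have Cs: "continuous_on UNIV (\<lambda>s. C t s)" for t
  proof -
    have "continuous_on UNIV (\<lambda>s. C (fst (t, s)) (snd (t, s)))"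
      by (rule continuous_on_compose2[OF cC]) (intro continuous_on_Pair continuous_on_const continuous_on_id, simp)
    then show ?thesis by simp
  qed
  have Csi: "integrable ?N (\<lambda>s. C t s)" for t
    by (rule continuous_imp_integrable_real) (rule continuous_on_subset[OF Cs], simp)
  have "integrable (?M \<Otimes>\<^sub>M ?N) (\<lambda>p. w (fst p) * C (fst p) (snd p))"
  proof (rule Fubini_integrable)
    have id: "(\<lambda>p. (fst p, snd p)) \<in> borel_measurable (?M \<Otimes>\<^sub>M ?N)"
    proof (intro borel_measurable_Pair)
      have "(\<lambda>x. x) \<in> borel_measurable ?M" "(\<lambda>x. x) \<in> borel_measurable ?N"
        by (auto intro!: continuous_imp_measurable_on_sets_lebesgue)
      then show "fst \<in> borel_measurable (?M \<Otimes>\<^sub>M ?N)" "snd \<in> borel_measurable (?M \<Otimes>\<^sub>M ?N)"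
        using measurable_compose[OF measurable_fst, of "\<lambda>x. x" ?M borel ?N]
          measurable_compose[OF measurable_snd, of "\<lambda>x. x" ?N borel ?M] by auto
    qed
    have "(\<lambda>p. C (fst (fst p, snd p)) (snd (fst p, snd p))) \<in> borel_measurable (?M \<Otimes>\<^sub>M ?N)"
      by (rule measurable_compose[OF id borel_measurable_continuous_onI[OF cC]])
    moreover have "(\<lambda>p. w (fst p)) \<in> borel_measurable (?M \<Otimes>\<^sub>M ?N)"
      using w by (intro measurable_compose[OF measurable_fst]) auto
    ultimately show meas: "(\<lambda>p. w (fst p) * C (fst p) (snd p)) \<in> borel_measurable (?M \<Otimes>\<^sub>M ?N)"
      by simp
    show "AE t in ?M. integrable ?N (\<lambda>s. w (fst (t, s)) * C (fst (t, s)) (snd (t, s)))"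
      using Csi by (intro AE_I2) simp
    show "integrable ?M (\<lambda>t. \<integral>s. norm (w (fst (t, s)) * C (fst (t, s)) (snd (t, s))) \<partial>?N)"
    proof (rule Bochner_Integration.integrable_bound)
      show "integrable ?M (\<lambda>t. \<bar>w t\<bar> * (B * measure ?N (space ?N)))" using w by simp
      show "(\<lambda>t. \<integral>s. norm (w (fst (t, s)) * C (fst (t, s)) (snd (t, s))) \<partial>?N) \<in> borel_measurable ?M"
        using meas by (intro N.borel_measurable_lebesgue_integral) simp
      show "AE t in ?M. norm (\<integral>s. norm (w (fst (t, s)) * C (fst (t, s)) (snd (t, s))) \<partial>?N) \<le> norm (\<bar>w t\<bar> * (B * measure ?N (space ?N)))"
      proof (rule AE_I2)
        fix t
        have B0: "B \<ge> 0" using CB[of 0 0] by linarith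
        have "(\<integral>s. \<bar>w t\<bar> * \<bar>C t s\<bar> \<partial>?N) \<le> (\<integral>s. \<bar>w t\<bar> * B \<partial>?N)"
          using Csi[of t] CB by (intro integral_mono) (auto intro!: mult_left_mono)
        then show "norm (\<integral>s. norm (w (fst (t, s)) * C (fst (t, s)) (snd (t, s))) \<partial>?N) \<le> norm (\<bar>w t\<bar> * (B * measure ?N (space ?N)))"
          using B0 by (simp add: abs_mult mult_ac Bochner_Integration.integral_nonneg)
      qed
    qed
  qed
  then have "integrable (?M \<Otimes>\<^sub>M ?N) (\<lambda>(t, s). w t * C t s)"
    by (simp add: case_prod_beta')
  from Fubini_integral[OF this]
  have "(\<integral>s. (\<integral>t. w t * C t s \<partial>?M) \<partial>?N) = (\<integral>t. (\<integral>s. w t * C t s \<partial>?N) \<partial>?M)" .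
  moreover have "(\<integral>s. (\<integral>t. w t * C t s \<partial>?M) \<partial>?N) = (\<integral>s. (\<integral>t. w t * c t s \<partial>?M) \<partial>?N)"
    by (intro Bochner_Integration.integral_cong refl) (use Cc in auto)
  moreover have "(\<integral>t. (\<integral>s. w t * C t s \<partial>?N) \<partial>?M) = (\<integral>t. w t * (\<integral>s. c t s \<partial>?N) \<partial>?M)"
  proof (intro Bochner_Integration.integral_cong refl)
    fix t assume "t \<in> space ?M"
    then have t: "t \<in> {0..T}" by simp
    have "(\<integral>s. w t * C t s \<partial>?N) = (\<integral>s. w t * c t s \<partial>?N)"
      by (intro Bochner_Integration.integral_cong refl) (use Cc[OF t] in auto)
    then show "(\<integral>s. w t * C t s \<partial>?N) = w t * (\<integral>s. c t s \<partial>?N)" by simp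
  qed
  ultimately show ?thesis by simp
qed

lemma W2_infty_continuous:
  assumes "W2_infty_on \<gamma> 0 1"
  shows "continuous_on {0..1} \<gamma>" "continuous_on {0..1} (\<lambda>s. vector_derivative \<gamma> (at s within {0..1}))"
proof -
  obtain \<gamma>1 \<gamma>2 where g: "has_ac_derivative_on \<gamma> \<gamma>1 0 1" "has_ac_derivative_on \<gamma>1 \<gamma>2 0 1"
    using assms unfolding W2_infty_on_def by blast
  show "continuous_on {0..1} \<gamma>" by (rule ac_derivative_continuous[OF g(1)])
  have c1: "continuous_on {0..1} \<gamma>1" by (rule ac_derivative_continuous[OF g(2)])
  have eq: "\<gamma> 0 + integral {0..s} \<gamma>1 = \<gamma> s" if "s \<in> {0..1}" for s
    using ac_derivative_diff[OF g(1), of 0 s] that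
      lebesgue_integral_eq_integral[OF ac_derivative_integrable[OF g(1), of 0 s]] by (simp add: algebra_simps)
  have der: "\<gamma>1 s = vector_derivative \<gamma> (at s within {0..1})" if s: "s \<in> {0..1}" for s
  proof -
    have "((\<lambda>s. \<gamma> 0 + integral {0..s} \<gamma>1) has_vector_derivative (0 + \<gamma>1 s)) (at s within {0..1})"
      by (intro has_vector_derivative_add has_vector_derivative_const integral_has_vector_derivative[OF c1 s])
    from has_vector_derivative_transform[OF s eq[symmetric] this]
    have "(\<gamma> has_vector_derivative \<gamma>1 s) (at s within {0..1})" by simp
    then show ?thesis
      using s by (intro vector_derivative_within_closed_interval[symmetric]) auto
  qed
  show "continuous_on {0..1} (\<lambda>s. vector_derivative \<gamma> (at s within {0..1}))"
    by (rule continuous_on_eq[OF c1 der])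
qed

text \<open>The remainder equals \<open>(|b|\<^sup>2 - (q - p)\<^sup>2) / (2 p)\<close> with \<open>p = ell \<epsilon> z \<ge> \<epsilon>\<close> and \<open>q = ell \<epsilon> (z + b)\<close>.\<close>

lemma ell_taylor:
  assumes "\<epsilon> > 0"
  shows "\<bar>ell \<epsilon> (z + b) - ell \<epsilon> z - (z /\<^sub>R sqrt ((norm z)\<^sup>2 + \<epsilon>\<^sup>2)) \<bullet> b\<bar> \<le> (norm b)\<^sup>2 / (2 * \<epsilon>)"
proof -
  define p where "p = ell \<epsilon> z"
  define q where "q = ell \<epsilon> (z + b)"
  have sq: "(ell \<epsilon> w)\<^sup>2 = (norm w)\<^sup>2 + \<epsilon>\<^sup>2" for w
    unfolding ell_def by (intro real_sqrt_pow2 add_nonneg_nonneg) auto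
  have ell_ge: "ell \<epsilon> w \<ge> \<epsilon>" for w
    unfolding ell_def using assms by (intro real_le_rsqrt) auto
  have pe: "p \<ge> \<epsilon>" "q \<ge> \<epsilon>" using ell_ge by (auto simp: p_def q_def)
  have p0: "p > 0" using pe assms by linarith
  have d: "q\<^sup>2 - p\<^sup>2 = 2 * (z \<bullet> b) + (norm b)\<^sup>2"
    unfolding p_def q_def sq by (simp add: power2_norm_eq_inner inner_add_left inner_add_right inner_commute)
  have eq: "q - p - (z \<bullet> b) / p = ((norm b)\<^sup>2 - (q - p)\<^sup>2) / (2 * p)"
    using d p0 by (simp add: field_simps power2_eq_square)
  have qp: "\<bar>q - p\<bar> \<le> norm b"
  proof -
    have "q - p = norm (z + b, \<epsilon>) - norm (z, \<epsilon>)"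
      by (simp add: p_def q_def ell_def norm_Pair)
    also have "\<bar>\<dots>\<bar> \<le> norm ((z + b, \<epsilon>) - (z, \<epsilon>))" by (rule norm_triangle_ineq3)
    finally show ?thesis by (simp add: norm_Pair)
  qed
  then have "(q - p)\<^sup>2 \<le> (norm b)\<^sup>2" by (metis abs_le_square_iff abs_norm_cancel)
  then have "\<bar>q - p - (z \<bullet> b) / p\<bar> \<le> (norm b)\<^sup>2 / (2 * p)"
    unfolding eq using p0 by (simp add: divide_right_mono)
  also have "\<dots> \<le> (norm b)\<^sup>2 / (2 * \<epsilon>)"
    using pe assms by (intro divide_left_mono) auto
  finally have "\<bar>q - p - (z \<bullet> b) / p\<bar> \<le> (norm b)\<^sup>2 / (2 * \<epsilon>)" .
  moreover have e: "(z /\<^sub>R sqrt ((norm z)\<^sup>2 + \<epsilon>\<^sup>2)) \<bullet> b = (z \<bullet> b) / p"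
    unfolding p_def ell_def inner_scaleR_left divide_inverse by (rule mult.commute)
  ultimately show ?thesis unfolding e p_def[symmetric] q_def[symmetric] by blast
qed

lemma ell_continuous: "continuous_on S a \<Longrightarrow> continuous_on S (\<lambda>s. ell \<epsilon> (a s))"
  unfolding ell_def by (intro continuous_intros)

section \<open>Differentiability of the reduced cost\<close>

lemma is_state_state: "\<exists>X a. is_state \<Omega> T \<gamma>0 \<psi> X a \<Longrightarrow> state \<Omega> T \<gamma>0 \<psi> = (X, a) \<Longrightarrow> is_state \<Omega> T \<gamma>0 \<psi> X a"
  unfolding state_def using someI_ex[of "\<lambda>(X, a). is_state \<Omega> T \<gamma>0 \<psi> X a"] by auto

lemma is_adjoint_adjoint_state: "\<exists>p q. is_adjoint \<Omega> T \<epsilon> \<psi> X a p q \<Longrightarrow> adjoint_state \<Omega> T \<epsilon> \<psi> X a = (p, q) \<Longrightarrow>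
    is_adjoint \<Omega> T \<epsilon> \<psi> X a p q"
  unfolding adjoint_state_def using someI_ex[of "\<lambda>(p, q). is_adjoint \<Omega> T \<epsilon> \<psi> X a p q"] by auto

context stream_basis
begin

lemma state_pair:
  assumes "is_state \<Omega> T \<gamma>0 (stream h u) X a" "s \<in> {0..1}"
  shows "has_ac_derivative_on (\<lambda>t. (X t s, a t s)) (\<lambda>t. \<Sum>k\<in>UNIV. u t $ k *\<^sub>R field k (X t s, a t s)) 0 T"
proof -
  have "has_ac_derivative_on (\<lambda>t. (X t s, a t s))
      (\<lambda>t. (J *v grad \<Omega> (stream h u t) (X t s), (J ** hessian \<Omega> (stream h u t) (X t s)) *v a t s)) 0 T"
    using assms unfolding is_state_def by (intro ac_derivative_Pair) auto
  then show ?thesis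
    by (rule ac_derivative_cong) (use assms in \<open>auto simp: is_state_def field_sum[symmetric]\<close>)
qed

lemma adjoint_pair:
  assumes st: "is_state \<Omega> T \<gamma>0 (stream h u) X a" and ad: "is_adjoint \<Omega> T \<epsilon> (stream h u) X a p q" and s: "s \<in> {0..1}"
  shows "has_ac_derivative_on (\<lambda>t. (p t s, q t s))
    (\<lambda>t. - (\<Sum>k\<in>UNIV. u t $ k *\<^sub>R field_adjoint k (X t s, a t s) (p t s, q t s))) 0 T"
proof -
  have "has_ac_derivative_on (\<lambda>t. (p t s, q t s))
    (\<lambda>t. (- (transpose (J ** hessian \<Omega> (stream h u t) (X t s)) *v p t s
                + transpose (matrix (\<lambda>b. J *v third_deriv \<Omega> (stream h u t) (X t s) b (a t s))) *v q t s),
      - (transpose (J ** hessian \<Omega> (stream h u t) (X t s)) *v q t s))) 0 T"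
    using ad s unfolding is_adjoint_def by (intro ac_derivative_Pair) blast+
  then show ?thesis
  proof (rule ac_derivative_cong)
    fix t assume "t \<in> {0..T}"
    then have "X t s \<in> closure \<Omega>" using st s by (auto simp: is_state_def)
    from arg_cong[OF field_adjoint_sum[OF this, of u t "p t s" "a t s" "q t s"], of uminus]
    show "(- (transpose (J ** hessian \<Omega> (stream h u t) (X t s)) *v p t s
                + transpose (matrix (\<lambda>b. J *v third_deriv \<Omega> (stream h u t) (X t s) b (a t s))) *v q t s),
      - (transpose (J ** hessian \<Omega> (stream h u t) (X t s)) *v q t s)) = - (\<Sum>k\<in>UNIV. u t $ k *\<^sub>R field_adjoint k (X t s, a t s) (p t s, q t s))"
      by (simp only: uminus_Pair)
  qed simp
qed

lemma state_tangent_bound: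
  assumes st: "is_state \<Omega> T \<gamma>0 (stream h u) X a" and u: "integrable (lebesgue_on {0..T}) u"
    and C: "C \<ge> 0" "\<And>k x a. x \<in> closure \<Omega> \<Longrightarrow> norm ((J ** hessian \<Omega> (h k) x) *v a) \<le> C * norm a"
    and t: "t \<in> {0..T}" and s: "s \<in> {0..1}"
  shows "norm (a t s) \<le> norm (vector_derivative \<gamma>0 (at s within {0..1})) *
    exp (2 * (real CARD('n) * C * (\<integral>t. norm (u t) \<partial>lebesgue_on {0..T})))"
proof -
  have ac: "has_ac_derivative_on (\<lambda>t. a t s) (\<lambda>t. (J ** hessian \<Omega> (stream h u t) (X t s)) *v a t s) 0 T"
    and a0: "a 0 s = vector_derivative \<gamma>0 (at s within {0..1})" and XK: "\<And>t. t \<in> {0..T} \<Longrightarrow> X t s \<in> closure \<Omega>"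
    using st s by (auto simp: is_state_def)
  define w where "w t = real CARD('n) * C * norm (u t)" for t
  have wi: "integrable (lebesgue_on {0..T}) w" unfolding w_def using u by simp
  have ca: "continuous_on {0..T} (\<lambda>t. norm (a t s))"
    by (intro continuous_intros ac_derivative_continuous[OF ac])
  have wa: "integrable (lebesgue_on {0..T}) (\<lambda>t. w t * norm (a t s))"
  proof -
    have "bounded ((\<lambda>t. norm (a t s)) ` {0..T})" by (intro compact_imp_bounded compact_continuous_image ca) auto
    then obtain B where B: "\<And>t. t \<in> {0..T} \<Longrightarrow> norm (a t s) \<le> B"
      unfolding bounded_iff by (metis imageI norm_ge_zero abs_of_nonneg real_norm_def)
    show ?thesis
    proof (rule measurable_bounded_by_integrable_imp_lebesgue_integrable)
      show "(\<lambda>t. w t * norm (a t s)) \<in> borel_measurable (lebesgue_on {0..T})"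
        using borel_measurable_integrable[OF wi] continuous_imp_measurable_on_sets_lebesgue[OF ca]
        by (intro borel_measurable_times) auto
      show "integrable (lebesgue_on {0..T}) (\<lambda>t. \<bar>w t\<bar> * B)" using wi by simp
      show "norm (w t * norm (a t s)) \<le> \<bar>w t\<bar> * B" if "t \<in> {0..T}" for t
        using B[OF that] by (simp add: abs_mult mult_left_mono)
    qed auto
  qed
  have "norm (a t s) \<le> norm (a 0 s) * exp (2 * (\<integral>\<tau>. w \<tau> \<partial>lebesgue_on {0..T}))"
  proof (rule gronwall[OF wi _ wa _ _ _ t])
    show "w t \<ge> 0" for t using C(1) by (simp add: w_def)
    fix t assume t: "t \<in> {0..T}"
    let ?g = "\<lambda>t. (J ** hessian \<Omega> (stream h u t) (X t s)) *v a t s"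
    have gi: "integrable (lebesgue_on {0..t}) ?g" using t by (intro ac_derivative_integrable[OF ac]) auto
    have wai: "integrable (lebesgue_on {0..t}) (\<lambda>t. w t * norm (a t s))"
      using t by (intro integrable_lebesgue_on_Icc_subset[OF wa]) auto
    have "a t s - a 0 s = (\<integral>\<tau>. ?g \<tau> \<partial>lebesgue_on {0..t})"
      using t by (intro ac_derivative_diff[OF ac]) auto
    then have "norm (a t s - a 0 s) \<le> (\<integral>\<tau>. norm (?g \<tau>) \<partial>lebesgue_on {0..t})"
      using integral_norm_bound[of "lebesgue_on {0..t}" ?g] by (simp only:)
    also have "\<dots> \<le> (\<integral>\<tau>. w \<tau> * norm (a \<tau> s) \<partial>lebesgue_on {0..t})"
    proof (rule integral_mono)
      fix \<tau> assume "\<tau> \<in> space (lebesgue_on {0..t})"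
      then have x: "X \<tau> s \<in> closure \<Omega>" using t by (intro XK) auto
      show "norm (?g \<tau>) \<le> w \<tau> * norm (a \<tau> s)"
        unfolding J_hessian_stream[OF x] w_def
        using norm_control_sum_le[of "\<lambda>k. (J ** hessian \<Omega> (h k) (X \<tau> s)) *v a \<tau> s", OF C(2)[OF x], of "u \<tau>"] by (simp add: mult_ac)
    qed (use gi wai in auto)
    finally show "norm (a t s) \<le> norm (a 0 s) + (\<integral>\<tau>. w \<tau> * norm (a \<tau> s) \<partial>lebesgue_on {0..t})"
      using norm_triangle_sub[of "a t s" "a 0 s"] by linarith
  qed auto
  moreover have "(\<integral>\<tau>. w \<tau> \<partial>lebesgue_on {0..T}) = real CARD('n) * C * (\<integral>t. norm (u t) \<partial>lebesgue_on {0..T})"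
    unfolding w_def by simp
  ultimately show ?thesis by (simp add: a0)
qed

lemma h_L2: "h k \<in> L2 \<Omega>"
  using h0[of k] by (simp add: H1_0_def)

lemma L2_norm_stream: "(L2_norm \<Omega> (stream h u t))\<^sup>2 = u t \<bullet> (gram \<Omega> h *v u t)"
proof -
  have i: "integrable (lebesgue_on \<Omega>) (\<lambda>x. h k x * h l x)" for k l
    using L2_inner_bound(1)[OF h_L2 h_L2, of k l] by simp
  have "(L2_norm \<Omega> (stream h u t))\<^sup>2 = (\<integral>x. (\<Sum>k\<in>UNIV. \<Sum>l\<in>UNIV. (u t $ k * u t $ l) * (h k x * h l x)) \<partial>lebesgue_on \<Omega>)"
    unfolding L2_norm_sq by (simp add: stream_def power2_eq_square sum_product mult_ac)
  also have "\<dots> = (\<Sum>k\<in>UNIV. \<Sum>l\<in>UNIV. (u t $ k * u t $ l) * L2_inner \<Omega> (h k) (h l))"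
    using i by (simp add: L2_inner_def)
  also have "\<dots> = u t \<bullet> (gram \<Omega> h *v u t)"
    by (simp add: inner_vec_def matrix_vector_mult_def gram_def sum_distrib_left mult_ac)
  finally show ?thesis .
qed

lemma gram_symmetric: "x \<bullet> (gram \<Omega> h *v y) = y \<bullet> (gram \<Omega> h *v x)"
proof -
  have "transpose (gram \<Omega> h) = gram \<Omega> h"
    by (simp add: transpose_def gram_def L2_inner_def vec_eq_iff mult.commute)
  then show ?thesis by (metis dot_lmul_matrix inner_commute transpose_matrix_vector)
qed

text \<open>The integrand \<open>p \<cdot> J \<nabla>h\<^sub>k(X) + q \<cdot> J \<nabla>\<^sup>2h\<^sub>k(X) a\<close> is the pairing of the adjoint state with the
  \<open>k\<close>-th field.\<close>

definition pairing where
  "pairing X a p q k t s = (p t s, q t s) \<bullet> field k (X t s, a t s)"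

lemma pairing_eq:
  "pairing X a p q k t s = p t s \<bullet> (J *v grad \<Omega> (h k) (X t s)) + q t s \<bullet> ((J ** hessian \<Omega> (h k) (X t s)) *v a t s)"
  by (simp add: pairing_def field_def)

lemma pairing_continuous:
  assumes st: "is_state \<Omega> T \<gamma>0 (stream h u) X a" and ad: "is_adjoint \<Omega> T \<epsilon> (stream h u) X a p q"
  shows "continuous_on ({0..T} \<times> {0..1}) (\<lambda>(t, s). pairing X a p q k t s)"
proof -
  have c: "continuous_on ({0..T} \<times> {0..1}) (\<lambda>x. X (fst x) (snd x))" "continuous_on ({0..T} \<times> {0..1}) (\<lambda>x. a (fst x) (snd x))"
    "continuous_on ({0..T} \<times> {0..1}) (\<lambda>x. p (fst x) (snd x))" "continuous_on ({0..T} \<times> {0..1}) (\<lambda>x. q (fst x) (snd x))"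
    and XK: "\<And>t s. t \<in> {0..T} \<Longrightarrow> s \<in> {0..1} \<Longrightarrow> X t s \<in> closure \<Omega>"
    using st ad unfolding is_state_def is_adjoint_def case_prod_beta by auto
  show ?thesis
    unfolding pairing_def case_prod_beta
    by (intro continuous_on_inner continuous_on_Pair c continuous_on_field) (use XK in auto)
qed

lemma pairing_integral_continuous:
  assumes st: "is_state \<Omega> T \<gamma>0 (stream h u) X a" and ad: "is_adjoint \<Omega> T \<epsilon> (stream h u) X a p q"
  shows "continuous_on {0..T} (\<lambda>t. \<chi> k. \<integral>s. pairing X a p q k t s \<partial>lebesgue_on {0..1})"
proof (rule continuous_on_vec_lambda)
  fix k
  note pc = pairing_continuous[OF st ad, of k]
  have c: "continuous_on ({0..T} \<times> cbox 0 1) (\<lambda>(t, s). pairing X a p q k t s)"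
    using pc by simp
  have "continuous_on {0..T} (\<lambda>t. integral (cbox 0 1) (pairing X a p q k t))"
    by (rule integral_continuous_on_param[OF c])
  moreover have "integral (cbox 0 1) (pairing X a p q k t) = (\<integral>s. pairing X a p q k t s \<partial>lebesgue_on {0..1})" if "t \<in> {0..T}" for t
    using lebesgue_integral_eq_integral[OF continuous_imp_integrable_real[OF continuous_on_slices(2)[OF pc that]]] by simp
  ultimately show "continuous_on {0..T} (\<lambda>t. \<integral>s. pairing X a p q k t s \<partial>lebesgue_on {0..1})"
    by (rule continuous_on_eq)
qed

text \<open>The two forms of the derivative agree.\<close>

lemma gradient_pairing:
  assumes u: "u \<in> L2 {0..T}" and v: "v \<in> L2 {0..T}"
    and st: "is_state \<Omega> T \<gamma>0 (stream h u) X a" and ad: "is_adjoint \<Omega> T \<epsilon> (stream h u) X a p q"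
  shows "lam * (\<integral>t. (gram \<Omega> h *v u t) \<bullet> v t \<partial>lebesgue_on {0..T})
      + (\<integral>t. (\<integral>s. p t s \<bullet> (J *v grad \<Omega> (stream h v t) (X t s))
                  + q t s \<bullet> ((J ** hessian \<Omega> (stream h v t) (X t s)) *v a t s)
             \<partial>lebesgue_on {0..1}) \<partial>lebesgue_on {0..T})
    = L2_inner {0..T} (\<lambda>t. \<chi> k. lam * (gram \<Omega> h *v u t) $ k
        + (\<integral>s. pairing X a p q k t s \<partial>lebesgue_on {0..1})) v"
proof -
  define g where "g t = (\<chi> k. \<integral>s. pairing X a p q k t s \<partial>lebesgue_on {0..1})" for t
  have gL: "g \<in> L2 {0..T}"
    unfolding g_def by (rule L2_continuous[OF pairing_integral_continuous[OF st ad]])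
  have uL: "(\<lambda>t. gram \<Omega> h *v u t) \<in> L2 {0..T}"
    by (rule L2_bounded_linear[OF u matrix_vector_mul_bounded_linear])
  have inner: "(\<integral>s. p t s \<bullet> (J *v grad \<Omega> (stream h v t) (X t s))
                  + q t s \<bullet> ((J ** hessian \<Omega> (stream h v t) (X t s)) *v a t s) \<partial>lebesgue_on {0..1}) = g t \<bullet> v t"
    if t: "t \<in> {0..T}" for t
  proof -
    have "(\<integral>s. p t s \<bullet> (J *v grad \<Omega> (stream h v t) (X t s))
                  + q t s \<bullet> ((J ** hessian \<Omega> (stream h v t) (X t s)) *v a t s) \<partial>lebesgue_on {0..1})
      = (\<integral>s. (\<Sum>k\<in>UNIV. v t $ k * pairing X a p q k t s) \<partial>lebesgue_on {0..1})"
    proof (intro Bochner_Integration.integral_cong refl)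
      fix s assume "s \<in> space (lebesgue_on {0..(1::real)})"
      then have x: "X t s \<in> closure \<Omega>" using st t by (auto simp: is_state_def)
      show "p t s \<bullet> (J *v grad \<Omega> (stream h v t) (X t s)) + q t s \<bullet> ((J ** hessian \<Omega> (stream h v t) (X t s)) *v a t s)
          = (\<Sum>k\<in>UNIV. v t $ k * pairing X a p q k t s)"
        unfolding J_grad_stream[OF x] J_hessian_stream[OF x] pairing_eq
        by (simp add: inner_sum_right distrib_left sum.distrib)
    qed
    also have "\<dots> = (\<Sum>k\<in>UNIV. v t $ k * (\<integral>s. pairing X a p q k t s \<partial>lebesgue_on {0..1}))"
      using continuous_imp_integrable_real[OF continuous_on_slices(2)[OF pairing_continuous[OF st ad] t]] by simp
    also have "\<dots> = g t \<bullet> v t" by (simp add: g_def inner_vec_def mult.commute)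
    finally show ?thesis .
  qed
  have "(\<lambda>t. \<chi> k. lam * (gram \<Omega> h *v u t) $ k + (\<integral>s. pairing X a p q k t s \<partial>lebesgue_on {0..1}))
      = (\<lambda>t. lam *\<^sub>R (gram \<Omega> h *v u t) + g t)"
    by (auto simp: g_def vec_eq_iff)
  moreover have "(\<integral>t. (\<integral>s. p t s \<bullet> (J *v grad \<Omega> (stream h v t) (X t s))
                  + q t s \<bullet> ((J ** hessian \<Omega> (stream h v t) (X t s)) *v a t s)
             \<partial>lebesgue_on {0..1}) \<partial>lebesgue_on {0..T}) = (\<integral>t. g t \<bullet> v t \<partial>lebesgue_on {0..T})"
    by (intro Bochner_Integration.integral_cong refl inner) simp
  ultimately show ?thesis
    using L2_inner_bound(1)[OF uL v] L2_inner_bound(1)[OF gL v] by (simp add: L2_inner_def inner_add_left)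
qed

text \<open>The change of the terminal cost at one curve parameter \<open>s\<close>. The constant \<open>K\<close> depends neither on \<open>s\<close>
  nor on the increment \<open>v\<close> in the unit ball.\<close>

lemma terminal_cost_expansion:
  assumes u: "u \<in> L2 {0..T}" and \<epsilon>: "\<epsilon> > 0"
    and g1: "continuous_on {0..1} (\<lambda>s. vector_derivative \<gamma>0 (at s within {0..1}))"
    and st: "is_state \<Omega> T \<gamma>0 (stream h u) X a" and ad: "is_adjoint \<Omega> T \<epsilon> (stream h u) X a p q"
  obtains K where "K \<ge> 0"
    "\<And>v Xv av s. v \<in> L2 {0..T} \<Longrightarrow> L2_norm {0..T} v \<le> 1 \<Longrightarrow> is_state \<Omega> T \<gamma>0 (stream h (\<lambda>t. u t + v t)) Xv av \<Longrightarrow> s \<in> {0..1} \<Longrightarrow>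
      \<bar>- ell \<epsilon> (av T s) + ell \<epsilon> (a T s) - (\<integral>t. (\<Sum>k\<in>UNIV. v t $ k * pairing X a p q k t s) \<partial>lebesgue_on {0..T})\<bar>
        \<le> K * (L2_norm {0..T} v)\<^sup>2"
proof -
  have T0: "T \<ge> 0" using Tpos by simp
  note ui = L2_imp_integrable[OF u T0]
  define Iu where "Iu = (\<integral>t. norm (u t) \<partial>lebesgue_on {0..T})"
  have Iu0: "Iu \<ge> 0" by (simp add: Iu_def Bochner_Integration.integral_nonneg)
  obtain C1 where C1: "C1 \<ge> 0" "\<And>k x a. x \<in> closure \<Omega> \<Longrightarrow> norm ((J ** hessian \<Omega> (h k) x) *v a) \<le> C1 * norm a"
    by (rule field_bounds[OF order_refl]) (rule that; assumption)
  obtain \<Gamma> where \<Gamma>: "\<And>s. s \<in> {0..1} \<Longrightarrow> norm (vector_derivative \<gamma>0 (at s within {0..1})) \<le> \<Gamma>"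
  proof -
    have "bounded ((\<lambda>s. vector_derivative \<gamma>0 (at s within {0..1})) ` {0..1})"
      by (intro compact_imp_bounded compact_continuous_image g1) auto
    then show thesis using that unfolding bounded_iff by (metis imageI)
  qed
  have \<Gamma>0: "\<Gamma> \<ge> 0" by (rule order_trans[OF norm_ge_zero \<Gamma>[of 0]]) simp
  define N where "N = real CARD('n)"
  have N0: "N \<ge> 0" by (simp add: N_def)
  \<comment> \<open>bound on the tangents for all controls \<open>u + v\<close> with \<open>v\<close> in the unit ball, whose \<open>L\<^sup>1\<close> norm is at most \<open>sqrt T\<close>\<close>
  define R where "R = \<Gamma> * exp (2 * (N * C1 * (Iu + sqrt T)))"
  have R0: "R \<ge> 0" using \<Gamma>0 by (simp add: R_def)
  obtain C where C: "C \<ge> 0"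
    and Fb: "\<And>k z. z \<in> closure \<Omega> \<times> cball 0 R \<Longrightarrow> norm (field k z) \<le> C"
    "\<And>k z w. z \<in> closure \<Omega> \<times> cball 0 R \<Longrightarrow> w \<in> closure \<Omega> \<times> cball 0 R \<Longrightarrow> norm (field k w - field k z) \<le> C * norm (w - z)"
    "\<And>k z w. z \<in> closure \<Omega> \<times> cball 0 R \<Longrightarrow> w \<in> closure \<Omega> \<times> cball 0 R \<Longrightarrow>
       norm (field k w - field k z - field_deriv k z (w - z)) \<le> C * (norm (w - z))\<^sup>2"
    by (rule field_bounds[OF R0]) (rule that; assumption)
  obtain B where B: "\<And>t s. t \<in> {0..T} \<Longrightarrow> s \<in> {0..1} \<Longrightarrow> norm (p t s, q t s) \<le> B"
  proof -
    have "continuous_on ({0..T} \<times> {0..1}) (\<lambda>x. p (fst x) (snd x))" "continuous_on ({0..T} \<times> {0..1}) (\<lambda>x. q (fst x) (snd x))"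
      using ad unfolding is_adjoint_def case_prod_beta by blast+
    then have "bounded ((\<lambda>x. (p (fst x) (snd x), q (fst x) (snd x))) ` ({0..T} \<times> {0..1}))"
      by (intro compact_imp_bounded compact_continuous_image continuous_on_Pair compact_Times) auto
    then obtain B where B: "\<forall>y\<in>(\<lambda>x. (p (fst x) (snd x), q (fst x) (snd x))) ` ({0..T} \<times> {0..1}). norm y \<le> B"
      unfolding bounded_iff by (elim exE)
    show thesis
    proof (rule that[of B])
      fix t s assume "t \<in> {0..T}" "s \<in> {0..(1::real)}"
      then show "norm (p t s, q t s) \<le> B"
        using B[rule_format, OF imageI, of "(t, s)"] by simp
    qed
  qed
  have B0: "B \<ge> 0" by (rule order_trans[OF norm_ge_zero B[of 0 0]]) (use T0 in auto)
  define E where "E = N * C * exp (2 * (N * C) * (Iu + sqrt T))"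
  have E0: "E \<ge> 0" using N0 C by (simp add: E_def)
  define K where "K = N * B * C * (Iu * (E * sqrt T)\<^sup>2 + sqrt T * (E * sqrt T)) + (E * sqrt T)\<^sup>2 / (2 * \<epsilon>)"
  have K0: "K \<ge> 0"
    unfolding K_def using N0 B0 C Iu0 E0 T0 \<epsilon> by (intro add_nonneg_nonneg mult_nonneg_nonneg divide_nonneg_nonneg) auto
  show thesis
  proof (rule that[OF K0])
    fix v Xv av s
    assume v: "v \<in> L2 {0..T}" and v1: "L2_norm {0..T} v \<le> 1"
      and stv: "is_state \<Omega> T \<gamma>0 (stream h (\<lambda>t. u t + v t)) Xv av" and s: "s \<in> {0..(1::real)}"
    define V where "V = L2_norm {0..T} v"
    have V: "V \<ge> 0" "V \<le> 1" using v1 by (auto simp: V_def L2_norm_nonneg)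
    note vi = L2_imp_integrable[OF v T0]
    define Iv where "Iv = (\<integral>t. norm (v t) \<partial>lebesgue_on {0..T})"
    have Iv: "Iv \<ge> 0" "Iv \<le> sqrt T * V" using vi(2) by (auto simp: Iv_def V_def Bochner_Integration.integral_nonneg)
    have Iv1: "Iv \<le> sqrt T" using Iv(2) mult_left_mono[OF V(2), of "sqrt T"] T0 by simp
    have uvi: "integrable (lebesgue_on {0..T}) (\<lambda>t. u t + v t)" using ui(1) vi(1) by simp
    have Iuv: "(\<integral>t. norm (u t + v t) \<partial>lebesgue_on {0..T}) \<le> Iu + Iv"
    proof -
      have "(\<integral>t. norm (u t + v t) \<partial>lebesgue_on {0..T}) \<le> (\<integral>t. norm (u t) + norm (v t) \<partial>lebesgue_on {0..T})"
        using ui(1) vi(1) by (intro integral_mono norm_triangle_ineq) auto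
      then show ?thesis using ui(1) vi(1) by (simp add: Iu_def Iv_def)
    qed
    have Rb: "norm (b t s) \<le> R" if "is_state \<Omega> T \<gamma>0 (stream h w) Y b" "integrable (lebesgue_on {0..T}) w"
      "(\<integral>t. norm (w t) \<partial>lebesgue_on {0..T}) \<le> Iu + sqrt T" "t \<in> {0..T}" for w Y b t
    proof -
      have "norm (b t s) \<le> norm (vector_derivative \<gamma>0 (at s within {0..1})) *
          exp (2 * (real CARD('n) * C1 * (\<integral>t. norm (w t) \<partial>lebesgue_on {0..T})))"
        by (rule state_tangent_bound[OF that(1,2) C1 that(4) s])
      also have "\<dots> \<le> R"
        unfolding R_def N_def using \<Gamma>[OF s] \<Gamma>0 that(3) C1(1)
        by (intro mult_mono) (auto intro!: mult_left_mono)
      finally show ?thesis .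
    qed
    let ?S = "closure \<Omega> \<times> cball (0 :: real^2) R"
    define z where "z t = (X t s, a t s)" for t
    define zv where "zv t = (Xv t s, av t s)" for t
    define r where "r t = (p t s, q t s)" for t
    have zS: "z t \<in> ?S" "zv t \<in> ?S" if t: "t \<in> {0..T}" for t
    proof -
      have "X t s \<in> closure \<Omega>" "Xv t s \<in> closure \<Omega>" using st stv t s by (auto simp: is_state_def)
      moreover have "norm (a t s) \<le> R" using st ui(1) T0 t by (intro Rb) (auto simp: Iu_def)
      moreover have "norm (av t s) \<le> R" using stv uvi Iuv Iv1 t by (intro Rb) auto
      ultimately show "z t \<in> ?S" "zv t \<in> ?S" by (auto simp: z_def zv_def)
    qed
    have zac: "has_ac_derivative_on z (\<lambda>t. \<Sum>k\<in>UNIV. u t $ k *\<^sub>R field k (z t)) 0 T"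
      unfolding z_def by (rule state_pair[OF st s])
    have zvac: "has_ac_derivative_on zv (\<lambda>t. \<Sum>k\<in>UNIV. (u t + v t) $ k *\<^sub>R field k (zv t)) 0 T"
      unfolding zv_def by (rule state_pair[OF stv s])
    have rac: "has_ac_derivative_on r (\<lambda>t. - (\<Sum>k\<in>UNIV. u t $ k *\<^sub>R field_adjoint k (z t) (r t))) 0 T"
      unfolding z_def r_def by (rule adjoint_pair[OF st ad s])
    have init: "zv 0 = z 0" using st stv s by (simp add: z_def zv_def is_state_def)
    define Y where "Y = E * sqrt T * V"
    have Yb: "norm (zv t - z t) \<le> Y" if "t \<in> {0..T}" for t
    proof -
      have "norm (zv t - z t) \<le> real CARD('n) * C * Iv * exp (2 * (real CARD('n) * C) * (Iu + Iv))"
        unfolding Iu_def Iv_def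
        by (rule perturbed_state_bound[OF ui(1) vi(1) zac zvac init zS C Fb(1,2) that])
      also have "\<dots> \<le> N * C * (sqrt T * V) * exp (2 * (N * C) * (Iu + sqrt T))"
        unfolding N_def using Iv Iv1 C T0 V by (intro mult_mono) (auto intro!: mult_left_mono)
      also have "\<dots> = Y" by (simp add: Y_def E_def mult_ac)
      finally show ?thesis .
    qed
    have Y0: "Y \<ge> 0" using E0 V T0 by (simp add: Y_def)
    have Bb: "norm (r t) \<le> B" if "t \<in> {0..T}" for t using B[OF that s] by (simp add: r_def)
    have pr: "(\<lambda>t. \<Sum>k\<in>UNIV. v t $ k *\<^sub>R (r t \<bullet> field k (z t))) = (\<lambda>t. \<Sum>k\<in>UNIV. v t $ k * pairing X a p q k t s)"
      by (simp add: pairing_def r_def z_def)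
    have "\<bar>r T \<bullet> (zv T - z T) - (\<integral>t. (\<Sum>k\<in>UNIV. v t $ k * pairing X a p q k t s) \<partial>lebesgue_on {0..T})\<bar>
        \<le> real CARD('n) * B * C * (Iu * Y\<^sup>2 + Iv * Y)"
      unfolding pr[symmetric] Iu_def Iv_def
      by (rule adjoint_duality(2)[OF T0 ui(1) vi(1) zac zvac init rac field_adjoint_inner zS C Fb Bb Yb])
    also have "\<dots> \<le> N * B * C * (Iu * Y\<^sup>2 + sqrt T * V * Y)"
      unfolding N_def using Iv Y0 B0 C by (intro mult_left_mono add_mono mult_right_mono) auto
    finally have 1: "\<bar>r T \<bullet> (zv T - z T) - (\<integral>t. (\<Sum>k\<in>UNIV. v t $ k * pairing X a p q k t s) \<partial>lebesgue_on {0..T})\<bar>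
        \<le> N * B * C * (Iu * Y\<^sup>2 + sqrt T * V * Y)" .
    define b where "b = av T s - a T s"
    have rT: "r T \<bullet> (zv T - z T) = - ((a T s /\<^sub>R sqrt ((norm (a T s))\<^sup>2 + \<epsilon>\<^sup>2)) \<bullet> b)"
      using ad s by (simp add: r_def zv_def z_def b_def is_adjoint_def)
    have bY: "norm b \<le> Y"
      using Yb[of T] T0 norm_snd_le[of "av T s - a T s" "Xv T s - X T s"] by (simp add: zv_def z_def b_def)
    have "\<bar>ell \<epsilon> (av T s) - ell \<epsilon> (a T s) - (a T s /\<^sub>R sqrt ((norm (a T s))\<^sup>2 + \<epsilon>\<^sup>2)) \<bullet> b\<bar> \<le> (norm b)\<^sup>2 / (2 * \<epsilon>)"
      using ell_taylor[OF \<epsilon>, of "a T s" b] by (simp add: b_def)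
    also have "\<dots> \<le> Y\<^sup>2 / (2 * \<epsilon>)" using bY \<epsilon> by (intro divide_right_mono power_mono) auto
    finally have 2: "\<bar>ell \<epsilon> (av T s) - ell \<epsilon> (a T s) + r T \<bullet> (zv T - z T)\<bar> \<le> Y\<^sup>2 / (2 * \<epsilon>)"
      unfolding rT by simp
    have "\<bar>- ell \<epsilon> (av T s) + ell \<epsilon> (a T s) - (\<integral>t. (\<Sum>k\<in>UNIV. v t $ k * pairing X a p q k t s) \<partial>lebesgue_on {0..T})\<bar>
        \<le> N * B * C * (Iu * Y\<^sup>2 + sqrt T * V * Y) + Y\<^sup>2 / (2 * \<epsilon>)"
      using 1 2 by linarith
    also have "\<dots> = K * V\<^sup>2"
      by (simp add: K_def Y_def power_mult_distrib power2_eq_square algebra_simps add_divide_distrib)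
    finally show "\<bar>- ell \<epsilon> (av T s) + ell \<epsilon> (a T s) - (\<integral>t. (\<Sum>k\<in>UNIV. v t $ k * pairing X a p q k t s) \<partial>lebesgue_on {0..T})\<bar>
        \<le> K * (L2_norm {0..T} v)\<^sup>2" by (simp add: V_def)
  qed
qed

proposition reduced_cost_gradient:
  assumes u: "u \<in> L2 {0..T}" and \<epsilon>: "\<epsilon> > 0"
    and g0: "W2_infty_on \<gamma>0 0 1" "\<gamma>0 ` {0..1} \<subseteq> closure \<Omega>"
    and X: "state \<Omega> T \<gamma>0 (stream h u) = (X, a)" and q: "adjoint_state \<Omega> T \<epsilon> (stream h u) X a = (p, q)"
  shows "has_L2_gradient {0..T} (reduced_cost \<Omega> T \<gamma>0 lam \<epsilon> h)
    (\<lambda>t. \<chi> k. lam * (gram \<Omega> h *v u t) $ k + (\<integral>s. pairing X a p q k t s \<partial>lebesgue_on {0..1})) u"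
    and "is_state \<Omega> T \<gamma>0 (stream h u) X a" and "is_adjoint \<Omega> T \<epsilon> (stream h u) X a p q"
proof -
  have T0: "T \<ge> 0" using Tpos by simp
  note gc = W2_infty_continuous[OF g0(1)]
  have ex: "\<exists>X a. is_state \<Omega> T \<gamma>0 (stream h w) X a" if "w \<in> L2 {0..T}" for w
    by (rule state_existence[OF L2_imp_integrable(1)[OF that T0] gc(1) g0(2) gc(2)])
  show st: "is_state \<Omega> T \<gamma>0 (stream h u) X a" by (rule is_state_state[OF ex[OF u] X])
  show ad: "is_adjoint \<Omega> T \<epsilon> (stream h u) X a p q"
    by (rule is_adjoint_adjoint_state[OF adjoint_existence[OF L2_imp_integrable(1)[OF u T0] st \<epsilon>] q])
  note pc = pairing_continuous[OF st ad]
  define M where "M = gram \<Omega> h"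
  define g where "g t = (\<chi> k. \<integral>s. pairing X a p q k t s \<partial>lebesgue_on {0..1})" for t
  define G where "G t = lam *\<^sub>R (M *v u t) + g t" for t
  have G_eq: "(\<lambda>t. \<chi> k. lam * (gram \<Omega> h *v u t) $ k + (\<integral>s. pairing X a p q k t s \<partial>lebesgue_on {0..1})) = G"
    by (auto simp: G_def g_def M_def vec_eq_iff)
  have gcont: "continuous_on {0..T} g"
    unfolding g_def by (rule pairing_integral_continuous[OF st ad])
  have gL: "g \<in> L2 {0..T}" by (rule L2_continuous[OF gcont])
  have Mlin: "(\<lambda>t. M *v w t) \<in> L2 {0..T}" if "w \<in> L2 {0..T}" for w
    by (rule L2_bounded_linear[OF that matrix_vector_mul_bounded_linear])
  have lMlin: "(\<lambda>t. lam *\<^sub>R (M *v w t)) \<in> L2 {0..T}" if "w \<in> L2 {0..T}" for w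
    by (rule L2_bounded_linear[OF Mlin[OF that] bounded_linear_scaleR_right])
  have GL: "G \<in> L2 {0..T}" unfolding G_def by (rule L2_add[OF lMlin[OF u] gL])
  obtain m where m: "m > 0" "\<And>x. norm (M *v x) \<le> norm x * m"
    using bounded_linear.pos_bounded[OF matrix_vector_mul_bounded_linear[of M]] by blast
  define Q where "Q w = (\<integral>t. w t \<bullet> (M *v w t) \<partial>lebesgue_on {0..T})" for w
  have Qi: "integrable (lebesgue_on {0..T}) (\<lambda>t. w t \<bullet> (M *v w' t))" if "w \<in> L2 {0..T}" "w' \<in> L2 {0..T}" for w w'
    by (rule L2_inner_bound(1)[OF that(1) Mlin[OF that(2)]])
  have cost: "reduced_cost \<Omega> T \<gamma>0 lam \<epsilon> h w = - (\<integral>s. ell \<epsilon> (b T s) \<partial>lebesgue_on {0..1}) + lam / 2 * Q w"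
    if "state \<Omega> T \<gamma>0 (stream h w) = (Y, b)" for w Y b
    unfolding reduced_cost_def cost_def that by (simp add: Q_def M_def L2_norm_stream)
  have Qexp: "\<bar>lam / 2 * Q (\<lambda>t. u t + v t) - lam / 2 * Q u - (\<integral>t. (lam *\<^sub>R (M *v u t)) \<bullet> v t \<partial>lebesgue_on {0..T})\<bar> \<le> \<bar>lam\<bar> / 2 * m * (L2_norm {0..T} v)\<^sup>2"
    if v: "v \<in> L2 {0..T}" for v
  proof -
    have "Q (\<lambda>t. u t + v t) = (\<integral>t. u t \<bullet> (M *v u t) + 2 * (v t \<bullet> (M *v u t)) + v t \<bullet> (M *v v t) \<partial>lebesgue_on {0..T})"
      unfolding Q_def
      by (intro Bochner_Integration.integral_cong refl)
        (simp add: matrix_vector_right_distrib inner_add_left inner_add_right gram_symmetric[folded M_def, of "u _" "v _"])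
    also have "\<dots> = Q u + 2 * (\<integral>t. v t \<bullet> (M *v u t) \<partial>lebesgue_on {0..T}) + Q v"
      using Qi[OF u u] Qi[OF v u] Qi[OF v v] by (simp add: Q_def)
    finally have e: "Q (\<lambda>t. u t + v t) = Q u + 2 * (\<integral>t. v t \<bullet> (M *v u t) \<partial>lebesgue_on {0..T}) + Q v" .
    have e2: "(\<integral>t. (lam *\<^sub>R (M *v u t)) \<bullet> v t \<partial>lebesgue_on {0..T}) = lam * (\<integral>t. v t \<bullet> (M *v u t) \<partial>lebesgue_on {0..T})"
      by (simp add: inner_commute)
    have "\<bar>Q v\<bar> \<le> (\<integral>t. \<bar>v t \<bullet> (M *v v t)\<bar> \<partial>lebesgue_on {0..T})"
      unfolding Q_def using integral_norm_bound[of "lebesgue_on {0..T}" "\<lambda>t. v t \<bullet> (M *v v t)"] by simp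
    also have "\<dots> \<le> (\<integral>t. m * (norm (v t))\<^sup>2 \<partial>lebesgue_on {0..T})"
    proof (rule integral_mono)
      show "integrable (lebesgue_on {0..T}) (\<lambda>t. m * (norm (v t))\<^sup>2)" using v by (simp add: L2_def)
      show "\<bar>v t \<bullet> (M *v v t)\<bar> \<le> m * (norm (v t))\<^sup>2" for t
        using Cauchy_Schwarz_ineq2[of "v t" "M *v v t"] mult_left_mono[OF m(2)[of "v t"], of "norm (v t)"]
        by (simp add: power2_eq_square mult_ac)
    qed (use Qi[OF v v] in simp)
    also have "\<dots> = m * (L2_norm {0..T} v)\<^sup>2" by (simp add: L2_norm_sq)
    finally have "\<bar>lam / 2\<bar> * \<bar>Q v\<bar> \<le> \<bar>lam / 2\<bar> * (m * (L2_norm {0..T} v)\<^sup>2)" by (intro mult_left_mono) auto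
    then show ?thesis unfolding e e2 by (simp add: algebra_simps flip: abs_mult)
  qed
  obtain K where K: "K \<ge> 0"
    "\<And>v Xv av s. v \<in> L2 {0..T} \<Longrightarrow> L2_norm {0..T} v \<le> 1 \<Longrightarrow> is_state \<Omega> T \<gamma>0 (stream h (\<lambda>t. u t + v t)) Xv av \<Longrightarrow> s \<in> {0..1} \<Longrightarrow>
      \<bar>- ell \<epsilon> (av T s) + ell \<epsilon> (a T s) - (\<integral>t. (\<Sum>k\<in>UNIV. v t $ k * pairing X a p q k t s) \<partial>lebesgue_on {0..T})\<bar>
        \<le> K * (L2_norm {0..T} v)\<^sup>2"
    by (rule terminal_cost_expansion[OF u \<epsilon> gc(2) st ad]) (rule that; assumption)
  have rem: "\<bar>reduced_cost \<Omega> T \<gamma>0 lam \<epsilon> h (\<lambda>t. u t + v t) - reduced_cost \<Omega> T \<gamma>0 lam \<epsilon> h u - L2_inner {0..T} G v\<bar>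
      \<le> (K + \<bar>lam\<bar> / 2 * m) * (L2_norm {0..T} v)\<^sup>2" if v: "v \<in> L2 {0..T}" and v1: "L2_norm {0..T} v \<le> 1" for v
  proof -
    obtain Xv av where Xv: "state \<Omega> T \<gamma>0 (stream h (\<lambda>t. u t + v t)) = (Xv, av)" by fastforce
    have stv: "is_state \<Omega> T \<gamma>0 (stream h (\<lambda>t. u t + v t)) Xv av"
      by (rule is_state_state[OF ex[OF L2_add[OF u v]] Xv])
    note vi = L2_imp_integrable[OF v T0]
    have c1: "continuous_on {0..1} (\<lambda>s. ell \<epsilon> (a T s))" and c2: "continuous_on {0..1} (\<lambda>s. ell \<epsilon> (av T s))"
    proof -
      have "continuous_on ({0..T} \<times> {0..1}) (\<lambda>(t, s). a t s)" "continuous_on ({0..T} \<times> {0..1}) (\<lambda>(t, s). av t s)"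
        using st stv by (auto simp: is_state_def)
      moreover have "T \<in> {0..T}" using T0 by simp
      ultimately show "continuous_on {0..1} (\<lambda>s. ell \<epsilon> (a T s))" "continuous_on {0..1} (\<lambda>s. ell \<epsilon> (av T s))"
        by (blast intro: ell_continuous continuous_on_slices(2))+
    qed
    define S where "S s = (\<integral>t. (\<Sum>k\<in>UNIV. v t $ k * pairing X a p q k t s) \<partial>lebesgue_on {0..T})" for s
    have c3: "continuous_on {0..1} S"
      using continuous_on_slices(2)[OF continuous_on_parametric_primitive[OF vi(1) pc], of T] T0
      by (simp add: S_def[abs_def])
    have i: "integrable (lebesgue_on {0..1}) (\<lambda>s. ell \<epsilon> (a T s))" "integrable (lebesgue_on {0..1}) (\<lambda>s. ell \<epsilon> (av T s))"
      "integrable (lebesgue_on {0..1}) S"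
      using c1 c2 c3 by (auto intro: continuous_imp_integrable_real)
    have gv: "(\<integral>t. g t \<bullet> v t \<partial>lebesgue_on {0..T}) = (\<integral>s. S s \<partial>lebesgue_on {0..1})"
    proof -
      have vk: "integrable (lebesgue_on {0..T}) (\<lambda>t. v t $ k)" for k
        by (rule integrable_bounded_linear[OF bounded_linear_vec_nth vi(1)])
      have pt: "integrable (lebesgue_on {0..T}) (\<lambda>t. v t $ k * pairing X a p q k t s)" if "s \<in> {0..1}" for k s
      proof -
        have "continuous_on {0..T} (\<lambda>t. if l = k then pairing X a p q k t s else 0)" for l
          using continuous_on_slices(1)[OF pc that, of k] by (cases "l = k") auto
        from integrable_control_times_continuous[OF vi(1), of "\<lambda>l t. if l = k then pairing X a p q k t s else 0", OF this]
        show ?thesis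
          by (simp add: if_distrib if_distribR sum.delta cong: if_cong)
      qed
      have pp: "continuous_on {0..1} (\<lambda>s. \<integral>t. v t $ k * pairing X a p q k t s \<partial>lebesgue_on {0..T})" for k
      proof -
        have "continuous_on ({0..T} \<times> {0..1}) (\<lambda>(t, s). if l = k then pairing X a p q k t s else 0)" for l
          using pc[of k] by (cases "l = k") (auto simp: case_prod_beta)
        from continuous_on_slices(2)[OF continuous_on_parametric_primitive[OF vi(1), of "\<lambda>l t s. if l = k then pairing X a p q k t s else 0", OF this], of T] T0
        show ?thesis by (simp add: if_distrib if_distribR sum.delta cong: if_cong)
      qed
      have gk: "integrable (lebesgue_on {0..T}) (\<lambda>t. v t $ k * g t $ k)" for k
      proof -
        have "continuous_on {0..T} (\<lambda>t. if l = k then g t $ k else 0)" for l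
          using continuous_on_component[OF gcont, of k] by (cases "l = k") auto
        from integrable_control_times_continuous[OF vi(1), of "\<lambda>l t. if l = k then g t $ k else 0", OF this]
        show ?thesis by (simp add: if_distrib if_distribR sum.delta cong: if_cong)
      qed
      have "(\<integral>t. g t \<bullet> v t \<partial>lebesgue_on {0..T}) = (\<Sum>k\<in>UNIV. \<integral>t. v t $ k * g t $ k \<partial>lebesgue_on {0..T})"
        using gk by (simp add: inner_vec_def mult.commute)
      also have "\<dots> = (\<Sum>k\<in>UNIV. \<integral>s. (\<integral>t. v t $ k * pairing X a p q k t s \<partial>lebesgue_on {0..T}) \<partial>lebesgue_on {0..1})"
        by (simp add: g_def integral_interchange_control[OF vk pc T0])
      also have "\<dots> = (\<integral>s. (\<Sum>k\<in>UNIV. \<integral>t. v t $ k * pairing X a p q k t s \<partial>lebesgue_on {0..T}) \<partial>lebesgue_on {0..1})"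
        using pp by (intro Bochner_Integration.integral_sum[symmetric] continuous_imp_integrable_real) auto
      also have "\<dots> = (\<integral>s. S s \<partial>lebesgue_on {0..1})"
        unfolding S_def by (intro Bochner_Integration.integral_cong refl) (use pt in simp)
      finally show ?thesis .
    qed
    have "\<bar>(\<integral>s. - ell \<epsilon> (av T s) + ell \<epsilon> (a T s) - S s \<partial>lebesgue_on {0..1})\<bar>
        \<le> (\<integral>s. \<bar>- ell \<epsilon> (av T s) + ell \<epsilon> (a T s) - S s\<bar> \<partial>lebesgue_on {0..1})"
      using integral_norm_bound[of "lebesgue_on {0..1}" "\<lambda>s. - ell \<epsilon> (av T s) + ell \<epsilon> (a T s) - S s"] by simp
    also have "\<dots> \<le> (\<integral>s. K * (L2_norm {0..T} v)\<^sup>2 \<partial>lebesgue_on {0..(1::real)})"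
    proof (rule integral_mono)
      show "integrable (lebesgue_on {0..1}) (\<lambda>s. \<bar>- ell \<epsilon> (av T s) + ell \<epsilon> (a T s) - S s\<bar>)" using i by auto
      show "integrable (lebesgue_on {0..(1::real)}) (\<lambda>s. K * (L2_norm {0..T} v)\<^sup>2)"
        by (rule continuous_imp_integrable_real) simp
      show "\<bar>- ell \<epsilon> (av T s) + ell \<epsilon> (a T s) - S s\<bar> \<le> K * (L2_norm {0..T} v)\<^sup>2" if "s \<in> space (lebesgue_on {0..1})" for s
        unfolding S_def using that by (intro K(2)[OF v v1 stv]) simp
    qed
    also have "\<dots> = K * (L2_norm {0..T} v)\<^sup>2" by (simp add: measure_restrict_space)
    finally have A: "\<bar>- (\<integral>s. ell \<epsilon> (av T s) \<partial>lebesgue_on {0..1}) + (\<integral>s. ell \<epsilon> (a T s) \<partial>lebesgue_on {0..1}) - (\<integral>t. g t \<bullet> v t \<partial>lebesgue_on {0..T})\<bar>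
        \<le> K * (L2_norm {0..T} v)\<^sup>2"
      using i by (simp add: gv)
    have GG: "L2_inner {0..T} G v = (\<integral>t. (lam *\<^sub>R (M *v u t)) \<bullet> v t \<partial>lebesgue_on {0..T}) + (\<integral>t. g t \<bullet> v t \<partial>lebesgue_on {0..T})"
      unfolding L2_inner_def G_def inner_add_left
      by (rule Bochner_Integration.integral_add[OF L2_inner_bound(1)[OF lMlin[OF u] v] L2_inner_bound(1)[OF gL v]])
    show ?thesis
      unfolding cost[OF Xv] cost[OF X] GG distrib_right using A Qexp[OF v] by linarith
  qed
  have "has_L2_frechet_derivative {0..T} (reduced_cost \<Omega> T \<gamma>0 lam \<epsilon> h) (L2_inner {0..T} G) u"
    unfolding has_L2_frechet_derivative_def
  proof (intro conjI ballI allI impI)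
    show "L2_inner {0..T} G (\<lambda>t. v t + w t) = L2_inner {0..T} G v + L2_inner {0..T} G w"
      if "v \<in> L2 {0..T}" "w \<in> L2 {0..T}" for v w
      unfolding L2_inner_def inner_add_right
      by (rule Bochner_Integration.integral_add[OF L2_inner_bound(1)[OF GL that(1)] L2_inner_bound(1)[OF GL that(2)]])
    show "L2_inner {0..T} G (\<lambda>t. c *\<^sub>R v t) = c * L2_inner {0..T} G v" for c v
      by (simp add: L2_inner_def)
    show "\<exists>C. \<forall>v\<in>L2 {0..T}. \<bar>L2_inner {0..T} G v\<bar> \<le> C * L2_norm {0..T} v"
      using L2_inner_bound(2)[OF GL] by blast
    fix e :: real assume e: "e > 0"
    define k where "k = K + \<bar>lam\<bar> / 2 * m"
    have k: "k \<ge> 0" using K(1) m(1) by (simp add: k_def)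
    show "\<exists>d>0. \<forall>v\<in>L2 {0..T}. L2_norm {0..T} v < d \<longrightarrow>
        \<bar>reduced_cost \<Omega> T \<gamma>0 lam \<epsilon> h (\<lambda>t. u t + v t) - reduced_cost \<Omega> T \<gamma>0 lam \<epsilon> h u - L2_inner {0..T} G v\<bar> \<le> e * L2_norm {0..T} v"
    proof (intro exI[of _ "min 1 (e / (k + 1))"] conjI ballI impI)
      show "min 1 (e / (k + 1)) > 0" using e k by simp
      fix v :: "real \<Rightarrow> real^'n" assume v: "v \<in> L2 {0..T}" "L2_norm {0..T} v < min 1 (e / (k + 1))"
      have "k * L2_norm {0..T} v \<le> (k + 1) * L2_norm {0..T} v"
        using L2_norm_nonneg by (intro mult_right_mono) auto
      also have "\<dots> \<le> e" using v(2) k by (simp add: pos_less_divide_eq mult.commute less_imp_le)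
      finally have "k * L2_norm {0..T} v * L2_norm {0..T} v \<le> e * L2_norm {0..T} v"
        by (intro mult_right_mono L2_norm_nonneg)
      then show "\<bar>reduced_cost \<Omega> T \<gamma>0 lam \<epsilon> h (\<lambda>t. u t + v t) - reduced_cost \<Omega> T \<gamma>0 lam \<epsilon> h u - L2_inner {0..T} G v\<bar> \<le> e * L2_norm {0..T} v"
        using rem[OF v(1)] v(2) by (simp add: k_def power2_eq_square mult.assoc)
    qed
  qed
  then show "has_L2_gradient {0..T} (reduced_cost \<Omega> T \<gamma>0 lam \<epsilon> h)
    (\<lambda>t. \<chi> k. lam * (gram \<Omega> h *v u t) $ k + (\<integral>s. pairing X a p q k t s \<partial>lebesgue_on {0..1})) u"
    unfolding G_eq has_L2_gradient_def using GL by blast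
qed

end

text \<open>Only the values on \<open>L\<^sup>2\<close> functions matter, since these are closed under linear combinations.\<close>

lemma has_L2_frechet_derivative_cong:
  assumes D: "has_L2_frechet_derivative S j D u" and eq: "\<And>v. v \<in> L2 S \<Longrightarrow> D' v = D v"
  shows "has_L2_frechet_derivative S j D' u"
  unfolding has_L2_frechet_derivative_def
proof (intro conjI allI impI ballI)
  show "D' (\<lambda>t. v t + w t) = D' v + D' w" if "v \<in> L2 S" "w \<in> L2 S" for v w
    using D that by (simp add: eq L2_add has_L2_frechet_derivative_def)
  show "D' (\<lambda>t. c *\<^sub>R v t) = c * D' v" if v: "v \<in> L2 S" for c v
    using D v eq[OF L2_bounded_linear[OF v bounded_linear_scaleR_right]]
    by (simp add: eq has_L2_frechet_derivative_def)
  show "\<exists>C. \<forall>v\<in>L2 S. \<bar>D' v\<bar> \<le> C * L2_norm S v"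
    using D by (simp add: eq has_L2_frechet_derivative_def)
  show "\<exists>d>0. \<forall>v\<in>L2 S. L2_norm S v < d \<longrightarrow> \<bar>j (\<lambda>t. u t + v t) - j u - D' v\<bar> \<le> e * L2_norm S v"
    if "e > 0" for e
    using D that by (simp add: eq has_L2_frechet_derivative_def)
qed

theorem proposition3p8:
  fixes \<Omega> :: "(real^2) set" and T \<epsilon> lam :: real
    and h :: "'n::finite \<Rightarrow> real^2 \<Rightarrow> real" and \<gamma>0 :: "real \<Rightarrow> real^2"
  assumes "open \<Omega>" and "connected \<Omega>" and "\<Omega> \<noteq> {}" and "bounded \<Omega>"
    and "simply_connected \<Omega>" and "C2_boundary \<Omega>"
    and "T > 0" and "\<epsilon> > 0" and "lam > 0"
    and "\<And>k. smooth_upto_boundary \<Omega> (h k)" and "\<And>k. h k \<in> H1_0 \<Omega>"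
    and "\<And>c :: 'n \<Rightarrow> real. (\<forall>x\<in>closure \<Omega>. (\<Sum>k\<in>UNIV. c k * h k x) = 0) \<Longrightarrow> (\<forall>k. c k = 0)"
    and "W2_infty_on \<gamma>0 0 1" and "\<gamma>0 ` {0..1} \<subseteq> closure \<Omega>"
  shows "\<forall>u \<in> L2 {0..T}.
    (let (X, a) = state \<Omega> T \<gamma>0 (stream h u);
         (p, q) = adjoint_state \<Omega> T \<epsilon> (stream h u) X a
     in
       has_L2_frechet_derivative {0..T} (reduced_cost \<Omega> T \<gamma>0 lam \<epsilon> h)
         (\<lambda>\<delta>u. let \<eta> = stream h \<delta>u in
            lam * (\<integral>t. (gram \<Omega> h *v u t) \<bullet> \<delta>u t \<partial>lebesgue_on {0..T})
            + (\<integral>t. (\<integral>s. p t s \<bullet> (J *v grad \<Omega> (\<eta> t) (X t s))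
                        + q t s \<bullet> ((J ** hessian \<Omega> (\<eta> t) (X t s)) *v a t s)
                 \<partial>lebesgue_on {0..1}) \<partial>lebesgue_on {0..T})) u
       \<and>
       has_L2_gradient {0..T} (reduced_cost \<Omega> T \<gamma>0 lam \<epsilon> h)
         (\<lambda>t. \<chi> k. lam * (gram \<Omega> h *v u t) $ k
            + (\<integral>s. p t s \<bullet> (J *v grad \<Omega> (h k) (X t s))
                   + q t s \<bullet> ((J ** hessian \<Omega> (h k) (X t s)) *v a t s)
                 \<partial>lebesgue_on {0..1})) u)"
proof
  fix u :: "real \<Rightarrow> real^'n" assume u: "u \<in> L2 {0..T}"
  interpret stream_basis \<Omega> h T
    using assms by unfold_locales auto
  obtain X a where X: "state \<Omega> T \<gamma>0 (stream h u) = (X, a)" by fastforce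
  obtain p q where q: "adjoint_state \<Omega> T \<epsilon> (stream h u) X a = (p, q)" by fastforce
  note r = reduced_cost_gradient[OF u \<open>\<epsilon> > 0\<close> \<open>W2_infty_on \<gamma>0 0 1\<close> \<open>\<gamma>0 ` {0..1} \<subseteq> closure \<Omega>\<close> X q]
  from r(1)[of lam] have "has_L2_frechet_derivative {0..T} (reduced_cost \<Omega> T \<gamma>0 lam \<epsilon> h)
      (L2_inner {0..T} (\<lambda>t. \<chi> k. lam * (gram \<Omega> h *v u t) $ k + (\<integral>s. pairing X a p q k t s \<partial>lebesgue_on {0..1}))) u"
    by (simp add: has_L2_gradient_def)
  then have "has_L2_frechet_derivative {0..T} (reduced_cost \<Omega> T \<gamma>0 lam \<epsilon> h)
      (\<lambda>\<delta>u. lam * (\<integral>t. (gram \<Omega> h *v u t) \<bullet> \<delta>u t \<partial>lebesgue_on {0..T})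
            + (\<integral>t. (\<integral>s. p t s \<bullet> (J *v grad \<Omega> (stream h \<delta>u t) (X t s))
                        + q t s \<bullet> ((J ** hessian \<Omega> (stream h \<delta>u t) (X t s)) *v a t s)
                 \<partial>lebesgue_on {0..1}) \<partial>lebesgue_on {0..T})) u"
    by (rule has_L2_frechet_derivative_cong) (rule gradient_pairing[OF u _ r(2,3)])
  with r(1)[of lam] show "let (X, a) = state \<Omega> T \<gamma>0 (stream h u);
         (p, q) = adjoint_state \<Omega> T \<epsilon> (stream h u) X a
     in
       has_L2_frechet_derivative {0..T} (reduced_cost \<Omega> T \<gamma>0 lam \<epsilon> h)
         (\<lambda>\<delta>u. let \<eta> = stream h \<delta>u in
            lam * (\<integral>t. (gram \<Omega> h *v u t) \<bullet> \<delta>u t \<partial>lebesgue_on {0..T})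
            + (\<integral>t. (\<integral>s. p t s \<bullet> (J *v grad \<Omega> (\<eta> t) (X t s))
                        + q t s \<bullet> ((J ** hessian \<Omega> (\<eta> t) (X t s)) *v a t s)
                 \<partial>lebesgue_on {0..1}) \<partial>lebesgue_on {0..T})) u
       \<and>
       has_L2_gradient {0..T} (reduced_cost \<Omega> T \<gamma>0 lam \<epsilon> h)
         (\<lambda>t. \<chi> k. lam * (gram \<Omega> h *v u t) $ k
            + (\<integral>s. p t s \<bullet> (J *v grad \<Omega> (h k) (X t s))
                   + q t s \<bullet> ((J ** hessian \<Omega> (h k) (X t s)) *v a t s)
                 \<partial>lebesgue_on {0..1})) u"
    by (simp add: X q pairing_eq Let_def)
qed

end
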